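(* For any constant $c$ and any $\gamma\le c^{n^c}$ (where $n$ is the number of input points), unless $\mathsf{NP}=\mathsf{RP}$, there is no polynomial-time algorithm that approximates NUkC restricted to $\gamma$-perturbation-resilient instances within a factor of $\gamma$ (i.e., that outputs a feasible placement whose dilation is at most $\gamma$ times the optimal dilation).
   Context: NUkC with $t$ radii classes: given a finite set $P$ of $n$ points with a metric $d$, distinct radii $r_1>r_2>\dots>r_t\ge 0$ and non-negative integers $k_1,\dots,k_t$ with $\sum_i k_i=k$, find the minimum dilation $\alpha$ such that one can choose, for each $i$, $k_i$ balls $B(p,\alpha r_i)=\{q\in P: d(p,q)\le \alpha r_i\}$ centered at points $p\in P$ whose union is $P$ (a feasible placement with dilation $\alpha$). A clustering is a partition $\{C_1,\dots,C_k\}$ of $P$ such that some feasible placement has each $C_i$ contained in one of its balls; an optimal clustering is one induced by a minimum-dilation placement. A metric $d_1$ on $P$ is a $\psi$-perturbation of $d$ if $d(p,q)/\psi\le d_1(p,q)\le d(p,q)$ for all $p,q$. The instance $(P,d,t)$ is $\psi$-perturbation-resilient ($\psi$-PR) if for every metric $\psi$-perturbation $d_1$ of $d$, the instance $(P,d_1,t)$ has a unique optimal clustering and it is identical to the unique optimal clustering of $(P,d,t)$. *)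

theory Defs
  imports "HOL-Analysis.Analysis" "HOL-Computational_Algebra.Polynomial"
begin

section \<open>Deterministic multi-tape Turing machines and polynomial time\<close>

datatype move = Go_Left | Stay | Go_Right

text \<open>
  The symbols are the numbers below the alphabet size; symbol 0 is the blank, and 1 and 2 are
  the bits False and True. The states are the numbers up to and including the number
  \<open>num_states\<close>; state 0 is initial and the state \<open>num_states\<close> is the halting state. A transition
  maps a state and the list of scanned symbols to the next state and one pair of a written
  symbol and a head move for every tape.
\<close>

record tm =
  num_tapes :: nat
  num_syms :: nat
  num_states :: nat
  trans :: "nat \<Rightarrow> nat list \<Rightarrow> nat \<times> (nat \<times> move) list"

text \<open>The condition on \<open>trans\<close> makes the relevant part of the transition table finite.\<close>

definition wf_tm :: "tm \<Rightarrow> bool" where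
  "wf_tm M \<longleftrightarrow>
     num_tapes M \<ge> 1 \<and> num_syms M \<ge> 3 \<and>
     (\<forall>s < num_states M. \<forall>as. length as = num_tapes M \<and> set as \<subseteq> {..<num_syms M} \<longrightarrow>
        fst (trans M s as) \<le> num_states M \<and>
        length (snd (trans M s as)) = num_tapes M \<and>
        fst ` set (snd (trans M s as)) \<subseteq> {..<num_syms M})"

text \<open>
  A configuration consists of the state, the head position on each tape and the contents of
  each tape. Tapes are infinite to the right only; moving left from cell 0 has no effect.
\<close>

type_synonym config = "nat \<times> (nat \<Rightarrow> nat) \<times> (nat \<Rightarrow> nat \<Rightarrow> nat)"

fun move_head :: "move \<Rightarrow> nat \<Rightarrow> nat" where
  "move_head Go_Left h = h - 1"
| "move_head Stay h = h"
| "move_head Go_Right h = h + 1"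

fun step :: "tm \<Rightarrow> config \<Rightarrow> config" where
  "step M (s, h, T) =
     (if s \<ge> num_states M then (s, h, T)
      else let (s', acts) = trans M s (map (\<lambda>j. T j (h j)) [0..<num_tapes M])
           in (s',
               (\<lambda>j. if j < num_tapes M then move_head (snd (acts ! j)) (h j) else h j),
               (\<lambda>j. if j < num_tapes M then (T j)(h j := fst (acts ! j)) else T j)))"

definition sym_of_bit :: "bool \<Rightarrow> nat" where
  "sym_of_bit b = (if b then 2 else 1)"

definition init_config :: "bool list \<Rightarrow> config" where
  "init_config x =
     (0, (\<lambda>j. 0), (\<lambda>j i. if j = 0 \<and> i < length x then sym_of_bit (x ! i) else 0))"

text \<open>The output is the bit string on tape 0 from cell 0 up to the first blank.\<close>

definition halted_with :: "tm \<Rightarrow> config \<Rightarrow> bool list \<Rightarrow> bool" where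
  "halted_with M cf y \<longleftrightarrow>
     (case cf of (s, h, T) \<Rightarrow>
        s = num_states M \<and>
        (\<forall>i < length y. T 0 i = sym_of_bit (y ! i)) \<and> T 0 (length y) = 0)"

text \<open>
  Halting configurations are fixed points of \<open>step\<close>, so iterating it \<open>poly p (length x)\<close> times
  means running the machine for at most that many steps.
\<close>

definition poly_time :: "(bool list \<Rightarrow> bool list) \<Rightarrow> bool" where
  "poly_time f \<longleftrightarrow>
     (\<exists>M (p :: nat poly). wf_tm M \<and>
        (\<forall>x. halted_with M ((step M ^^ poly p (length x)) (init_config x)) (f x)))"


section \<open>The complexity classes NP and RP\<close>

text \<open>Self-delimiting code of a bit string: every bit is preceded by a continuation flag.\<close>

definition enc_bits :: "bool list \<Rightarrow> bool list" where
  "enc_bits x = concat (map (\<lambda>b. [True, b]) x) @ [False]"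

definition pair_code :: "bool list \<Rightarrow> bool list \<Rightarrow> bool list" where
  "pair_code x w = enc_bits x @ w"

definition NP :: "bool list set set" where
  "NP = {L. \<exists>V (p :: nat poly). poly_time V \<and>
           (\<forall>x. x \<in> L \<longleftrightarrow> (\<exists>w. length w \<le> poly p (length x) \<and> V (pair_code x w) = [True]))}"

text \<open>
  The random bits of the machine are given as a uniformly distributed string \<open>w\<close> of polynomial
  length; members are accepted with probability at least 1/2, non-members never.
\<close>

definition RP :: "bool list set set" where
  "RP = {L. \<exists>V (p :: nat poly). poly_time V \<and>
           (\<forall>x. let W = {w :: bool list. length w = poly p (length x)};
                    A = {w \<in> W. V (pair_code x w) = [True]}
                in (x \<in> L \<longrightarrow> real (card A) / real (card W) \<ge> 1 / 2) \<and>
                   (x \<notin> L \<longrightarrow> A = {}))}"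


section \<open>Non-uniform k-center\<close>

text \<open>
  The i-th entries of \<open>radii\<close> and \<open>counts\<close> are the radius and the number of balls of the i-th
  radius class.
\<close>

record 'a nukc =
  points :: "'a set"
  metr :: "'a \<Rightarrow> 'a \<Rightarrow> real"
  radii :: "real list"
  counts :: "nat list"

definition nukc_instance :: "'a nukc \<Rightarrow> bool" where
  "nukc_instance I \<longleftrightarrow>
     finite (points I) \<and> Metric_space (points I) (metr I) \<and>
     sorted_wrt (>) (radii I) \<and> (\<forall>r \<in> set (radii I). r \<ge> 0) \<and>
     length (counts I) = length (radii I)"

definition nukc_ball :: "'a nukc \<Rightarrow> 'a \<Rightarrow> real \<Rightarrow> 'a set" where
  "nukc_ball I p r = {q \<in> points I. metr I p q \<le> r}"

text \<open>
  A placement lists the chosen centers of each radius class; a point may be chosen more than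
  once.
\<close>

definition placement_balls :: "'a nukc \<Rightarrow> real \<Rightarrow> 'a list list \<Rightarrow> 'a set set" where
  "placement_balls I \<alpha> S =
     {nukc_ball I p (\<alpha> * radii I ! i) | i p. i < length (radii I) \<and> p \<in> set (S ! i)}"

definition feasible_placement :: "'a nukc \<Rightarrow> real \<Rightarrow> 'a list list \<Rightarrow> bool" where
  "feasible_placement I \<alpha> S \<longleftrightarrow>
     \<alpha> \<ge> 0 \<and> length S = length (radii I) \<and>
     (\<forall>i < length (radii I). length (S ! i) = counts I ! i \<and> set (S ! i) \<subseteq> points I) \<and>
     \<Union> (placement_balls I \<alpha> S) = points I"

definition optimal_dilation :: "'a nukc \<Rightarrow> real \<Rightarrow> bool" where
  "optimal_dilation I \<alpha> \<longleftrightarrow>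
     (\<exists>S. feasible_placement I \<alpha> S) \<and> (\<forall>\<beta> S. feasible_placement I \<beta> S \<longrightarrow> \<alpha> \<le> \<beta>)"

definition induced_clustering :: "'a nukc \<Rightarrow> real \<Rightarrow> 'a list list \<Rightarrow> 'a set set \<Rightarrow> bool" where
  "induced_clustering I \<alpha> S \<C> \<longleftrightarrow>
     partition_on (points I) \<C> \<and> card \<C> = sum_list (counts I) \<and>
     (\<forall>C \<in> \<C>. \<exists>B \<in> placement_balls I \<alpha> S. C \<subseteq> B)"

definition optimal_clustering :: "'a nukc \<Rightarrow> 'a set set \<Rightarrow> bool" where
  "optimal_clustering I \<C> \<longleftrightarrow>
     (\<exists>\<alpha> S. optimal_dilation I \<alpha> \<and> feasible_placement I \<alpha> S \<and> induced_clustering I \<alpha> S \<C>)"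

definition metric_perturbation ::
    "real \<Rightarrow> 'a set \<Rightarrow> ('a \<Rightarrow> 'a \<Rightarrow> real) \<Rightarrow> ('a \<Rightarrow> 'a \<Rightarrow> real) \<Rightarrow> bool" where
  "metric_perturbation \<psi> P d d1 \<longleftrightarrow>
     Metric_space P d1 \<and> (\<forall>p \<in> P. \<forall>q \<in> P. d p q / \<psi> \<le> d1 p q \<and> d1 p q \<le> d p q)"

definition perturbation_resilient :: "real \<Rightarrow> 'a nukc \<Rightarrow> bool" where
  "perturbation_resilient \<psi> I \<longleftrightarrow>
     (\<exists>\<C>. {\<C>'. optimal_clustering I \<C>'} = {\<C>} \<and>
          (\<forall>d1. metric_perturbation \<psi> (points I) (metr I) d1 \<longrightarrow>
                {\<C>'. optimal_clustering (I\<lparr>metr := d1\<rparr>) \<C>'} = {\<C>}))"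


section \<open>Algorithms for non-uniform k-center\<close>

text \<open>
  Inputs are finite objects: the points are the numbers below the number of rows of a rational
  distance matrix, and the radii are rational.
\<close>

record nukc_input =
  in_dist :: "rat list list"
  in_radii :: "rat list"
  in_counts :: "nat list"

definition input_size :: "nukc_input \<Rightarrow> nat" where
  "input_size X = length (in_dist X)"

definition instance_of :: "nukc_input \<Rightarrow> nat nukc" where
  "instance_of X =
     (let n = input_size X in
      \<lparr>points = {..<n},
       metr = (\<lambda>i j. if i < n \<and> j < n then real_of_rat (in_dist X ! i ! j) else 0),
       radii = map real_of_rat (in_radii X),
       counts = in_counts X\<rparr>)"

definition valid_input :: "nukc_input \<Rightarrow> bool" where
  "valid_input X \<longleftrightarrow>
     (\<forall>row \<in> set (in_dist X). length row = input_size X) \<and> nukc_instance (instance_of X)"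

fun binary :: "nat \<Rightarrow> bool list" where
  "binary n = (if n = 0 then [] else odd n # binary (n div 2))"

declare binary.simps [simp del]

definition enc_nat :: "nat \<Rightarrow> bool list" where
  "enc_nat n = enc_bits (binary n)"

text \<open>Only nonnegative rationals occur in valid inputs, so no sign is encoded.\<close>

definition enc_rat :: "rat \<Rightarrow> bool list" where
  "enc_rat q = (case quotient_of q of (a, b) \<Rightarrow> enc_nat (nat a) @ enc_nat (nat b))"

definition enc_list :: "('a \<Rightarrow> bool list) \<Rightarrow> 'a list \<Rightarrow> bool list" where
  "enc_list e xs = concat (map (\<lambda>x. True # e x) xs) @ [False]"

definition enc_input :: "nukc_input \<Rightarrow> bool list" where
  "enc_input X =
     enc_list (enc_list enc_rat) (in_dist X) @ enc_list enc_rat (in_radii X) @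
     enc_list enc_nat (in_counts X)"

definition enc_placement :: "nat list list \<Rightarrow> bool list" where
  "enc_placement S = enc_list (enc_list enc_nat) S"

text \<open>
  The approximation factor, which is also the resilience parameter, may depend on the number
  of points. Nothing is required of \<open>f\<close> on inputs that are not resilient.
\<close>

definition approximates_resilient_nukc ::
    "(nat \<Rightarrow> real) \<Rightarrow> (bool list \<Rightarrow> bool list) \<Rightarrow> bool" where
  "approximates_resilient_nukc \<gamma> f \<longleftrightarrow>
     (\<forall>X. valid_input X \<and> perturbation_resilient (\<gamma> (input_size X)) (instance_of X) \<longrightarrow>
        (\<exists>S \<alpha>. f (enc_input X) = enc_placement S \<and>
               feasible_placement (instance_of X) \<alpha> S \<and>
               (\<forall>\<beta>. optimal_dilation (instance_of X) \<beta> \<longrightarrow> \<alpha> \<le> \<gamma> (input_size X) * \<beta>)))"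

end

theory Submission
  imports Defs
begin

text \<open>
  An algorithm as excluded by the theorem puts NP into RP. Membership of \<open>x\<close> in an NP language
  becomes, by Cook's tableau, a hitting set question: the elements are the pairs of a tableau cell
  and a value, a solution contains exactly one value for every cell, and every local rule of the
  machine is the requirement that a certain set of pairs be hit. Random weights, read off the
  random string, make the cheapest hitting set unique with probability at least 1/2, by the
  isolating lemma.

  Hitting set with costs is then encoded as a non-uniform k-center instance whose distances and
  radii are powers of \<open>2 ^ Q\<close>, where \<open>2 ^ Q\<close> exceeds the factor \<open>\<gamma>\<close>: a placement of dilation less
  than \<open>2 ^ (Q * (W + 1))\<close> yields a hitting set of cost at most \<open>W\<close>. A perturbation by \<open>\<gamma>\<close> does
  not bridge the gap between consecutive powers. Hence, if the cheapest hitting set is unique, the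
  instance is \<open>\<gamma>\<close>-resilient and every \<open>\<gamma>\<close>-approximate placement reveals that set, in which the
  witness can be read. The witness is verified in the end, so errors are one-sided. The converse
  inclusion of RP in NP holds without any assumption.
\<close>

section \<open>Programs for multi-tape machines\<close>

text \<open>The dilation is the only objective of a clustering instance, while isolation needs
  weighted costs. A cost therefore has to act as an exponent of the dilation, measured one radius
  class at a time, and only weights that can be counted out in marks are usable. This is why the
  weight of an element is the number of ones among \<open>4 * G ^ 2\<close> random bits: by a bound
  on central binomial coefficients each of its values has probability at most 1/(2G), and the
  isolating lemma uses nothing else about the distribution. Points come in pairs because a ball
  contains its center whatever its radius; only the second point of a pair demands a radius. The
  counting rests on one equality: there are exactly as many balls as intended clusters, so no ball
  can be wasted. Since \<open>Q\<close> and all exponents are polynomially bounded, the distances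
  have codes of polynomial length although the factor is exponential. Polynomial time refers to
  concrete machines, so the reduction has to be programmed; its intermediate numbers are kept in
  unary, and large numbers occur only in its output.\<close>

type_synonym frag = "nat \<times> (nat \<Rightarrow> (nat \<Rightarrow> nat) \<Rightarrow> nat \<times> (nat \<Rightarrow> nat \<times> move))"
type_synonym store = "(nat \<Rightarrow> nat) \<times> (nat \<Rightarrow> nat \<Rightarrow> nat)"

text \<open>Infinitely many tapes are visible to a fragment, so that composition needs no common
  number of tapes; \<open>tm_of\<close> cuts down to \<open>K\<close> of them. The state
  \<open>fst A\<close> is the exit.\<close>

fun frag_step :: "frag \<Rightarrow> config \<Rightarrow> config" where
  "frag_step A (q, h, T) =
     (if q \<ge> fst A then (q, h, T)
      else let (q', g) = snd A q (\<lambda>j. T j (h j))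
           in (q', (\<lambda>j. move_head (snd (g j)) (h j)), (\<lambda>j. (T j)(h j := fst (g j)))))"

datatype cmd =
    Act nat "nat \<Rightarrow> nat \<times> move"
  | Seq cmd cmd (infixr ";;" 60)
  | Ite nat "nat \<Rightarrow> bool" cmd cmd
  | Loop nat "nat \<Rightarrow> bool" cmd
  | Call nat tm

inductive run :: "cmd \<Rightarrow> store \<Rightarrow> nat \<Rightarrow> store \<Rightarrow> bool" where
  run_Act: "f (T j (h j)) = (a, m) \<Longrightarrow>
     run (Act j f) (h, T) 1 (h(j := move_head m (h j)), T(j := (T j)(h j := a)))"
| run_Seq: "run A s t s' \<Longrightarrow> run B s' t' s'' \<Longrightarrow> run (A ;; B) s (t + t') s''"
| run_IteT: "P (T j (h j)) \<Longrightarrow> run A (h, T) t s' \<Longrightarrow> run (Ite j P A B) (h, T) (Suc t) s'"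
| run_IteF: "\<not> P (T j (h j)) \<Longrightarrow> run B (h, T) t s' \<Longrightarrow> run (Ite j P A B) (h, T) (Suc t) s'"
| run_LoopF: "\<not> P (T j (h j)) \<Longrightarrow> run (Loop j P A) (h, T) 1 (h, T)"
| run_LoopT: "P (T j (h j)) \<Longrightarrow> run A (h, T) t s' \<Longrightarrow> run (Loop j P A) s' t' s'' \<Longrightarrow>
     run (Loop j P A) (h, T) (Suc (t + t')) s''"
| run_Call: "wf_tm M \<Longrightarrow> \<forall>j < num_tapes M. \<forall>i. T (off + j) i < num_syms M \<Longrightarrow>
     (step M ^^ t) (0, (\<lambda>j. h (off + j)), (\<lambda>j. T (off + j))) = (num_states M, h', T') \<Longrightarrow>
     run (Call off M) (h, T) (Suc t)
       ((\<lambda>j. if off \<le> j \<and> j < off + num_tapes M then h' (j - off) else h j),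
        (\<lambda>j. if off \<le> j \<and> j < off + num_tapes M then T' (j - off) else T j))"

text \<open>The exit of a component is identified with the entry of what follows; in a loop it
  becomes state 0, the test. \<open>Call\<close> has an entry state of its own so that every
  fragment has at least one state, even if \<open>M\<close> starts in its halting state. On symbols
  foreign to \<open>M\<close> its table is unconstrained, so the fragment makes a harmless move
  instead.\<close>

primrec frag_of :: "cmd \<Rightarrow> frag" where
  "frag_of (Act j f) = (1, \<lambda>q \<sigma>. (1, \<lambda>i. if i = j then f (\<sigma> j) else (\<sigma> i, Stay)))"
| "frag_of (A ;; B) =
    (fst (frag_of A) + fst (frag_of B),
     \<lambda>q \<sigma>. if q < fst (frag_of A) then snd (frag_of A) q \<sigma>
           else apfst (\<lambda>q. q + fst (frag_of A)) (snd (frag_of B) (q - fst (frag_of A)) \<sigma>))"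
| "frag_of (Ite j P A B) =
    (let a = fst (frag_of A); n = Suc (a + fst (frag_of B)) in
     (n, \<lambda>q \<sigma>. if q = 0 then (if P (\<sigma> j) then 1 else Suc a, \<lambda>i. (\<sigma> i, Stay))
               else if q \<le> a then apfst (\<lambda>q. if q = a then n else Suc q) (snd (frag_of A) (q - 1) \<sigma>)
               else apfst (\<lambda>q. q + Suc a) (snd (frag_of B) (q - Suc a) \<sigma>)))"
| "frag_of (Loop j P A) =
    (let a = fst (frag_of A) in
     (Suc a, \<lambda>q \<sigma>. if q = 0 then (if P (\<sigma> j) then 1 else Suc a, \<lambda>i. (\<sigma> i, Stay))
               else apfst (\<lambda>q. if q = a then 0 else Suc q) (snd (frag_of A) (q - 1) \<sigma>)))"
| "frag_of (Call off M) =
    (Suc (num_states M), \<lambda>q \<sigma>.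
       if q = 0 \<or> \<not> (\<forall>j < num_tapes M. \<sigma> (off + j) < num_syms M) then (1, \<lambda>i. (\<sigma> i, Stay))
       else let (q', acts) = trans M (q - 1) (map (\<lambda>j. \<sigma> (off + j)) [0..<num_tapes M])
            in (Suc q', \<lambda>i. if off \<le> i \<and> i < off + num_tapes M then acts ! (i - off) else (\<sigma> i, Stay)))"

primrec cmd_ok :: "nat \<Rightarrow> nat \<Rightarrow> cmd \<Rightarrow> bool" where
  "cmd_ok K S (Act j f) \<longleftrightarrow> j < K \<and> (\<forall>a < S. fst (f a) < S)"
| "cmd_ok K S (A ;; B) \<longleftrightarrow> cmd_ok K S A \<and> cmd_ok K S B"
| "cmd_ok K S (Ite j P A B) \<longleftrightarrow> j < K \<and> cmd_ok K S A \<and> cmd_ok K S B"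
| "cmd_ok K S (Loop j P A) \<longleftrightarrow> j < K \<and> cmd_ok K S A"
| "cmd_ok K S (Call off M) \<longleftrightarrow> off + num_tapes M \<le> K \<and> wf_tm M \<and> num_syms M \<le> S"

section \<open>Correctness of the compilation into machines\<close>

lemma frag_pos: "0 < fst (frag_of A)"
  by (induction A) (auto simp: Let_def)

lemma frag_of_bounds:
  assumes "cmd_ok K S A" "q < fst (frag_of A)" "\<forall>j < K. \<sigma> j < S"
  shows "fst (snd (frag_of A) q \<sigma>) \<le> fst (frag_of A)" "\<forall>j < K. fst (snd (snd (frag_of A) q \<sigma>) j) < S"
proof -
  have "fst (snd (frag_of A) q \<sigma>) \<le> fst (frag_of A) \<and> (\<forall>j < K. fst (snd (snd (frag_of A) q \<sigma>) j) < S)"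
    using assms
  proof (induction A arbitrary: q)
    case (Act j f)
    then show ?case by auto
  next
    case (Seq A B)
    show ?case
    proof (cases "q < fst (frag_of A)")
      case True
      then show ?thesis using Seq.IH(1)[of q] Seq.prems by auto
    next
      case False
      then show ?thesis using Seq.IH(2)[of "q - fst (frag_of A)"] Seq.prems by auto
    qed
  next
    case (Ite j P A B)
    consider "q = 0" | "q \<noteq> 0" "q \<le> fst (frag_of A)" | "q > fst (frag_of A)" by linarith
    then show ?case
    proof cases
      case 1
      then show ?thesis using Ite.prems by (auto simp: Let_def)
    next
      case 2
      then have "q - 1 < fst (frag_of A)" by auto
      with 2 show ?thesis using Ite.IH(1)[of "q - 1"] Ite.prems by (auto simp: Let_def)
    next
      case 3
      then show ?thesis using Ite.IH(2)[of "q - Suc (fst (frag_of A))"] Ite.prems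
        by (auto simp: Let_def)
    qed
  next
    case (Loop j P A)
    then show ?case using Loop.IH[of "q - 1"] by (auto simp: Let_def)
  next
    case (Call off M)
    show ?case
    proof (cases "q = 0 \<or> \<not> (\<forall>j < num_tapes M. \<sigma> (off + j) < num_syms M)")
      case True
      then show ?thesis using Call.prems by auto
    next
      case False
      let ?as = "map (\<lambda>j. \<sigma> (off + j)) [0..<num_tapes M]"
      obtain q' acts where tr: "trans M (q - 1) ?as = (q', acts)" by fastforce
      have "length ?as = num_tapes M" "set ?as \<subseteq> {..<num_syms M}" "q - 1 < num_states M"
        using False Call.prems by auto
      with Call.prems(1) have *: "q' \<le> num_states M" "length acts = num_tapes M"
          "fst ` set acts \<subseteq> {..<num_syms M}"
        unfolding cmd_ok.simps wf_tm_def using tr by (metis fst_conv snd_conv)+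
      have "fst (acts ! i) < S" if "i < num_tapes M" for i
        using * that Call.prems(1) nth_mem[of i acts] by fastforce
      then show ?thesis using False tr * Call.prems by auto
    qed
  qed
  then show "fst (snd (frag_of A) q \<sigma>) \<le> fst (frag_of A)"
    "\<forall>j < K. fst (snd (snd (frag_of A) q \<sigma>) j) < S" by auto
qed

text \<open>This justifies the passage from infinitely many tapes to \<open>K\<close>: the first
  \<open>K\<close> scanned symbols determine the transition, and the other tapes are left
  alone.\<close>

lemma frag_of_cong:
  assumes "cmd_ok K S A" "\<forall>j < K. \<sigma> j = \<tau> j"
  shows "fst (snd (frag_of A) q \<sigma>) = fst (snd (frag_of A) q \<tau>)"
    "\<forall>j < K. snd (snd (frag_of A) q \<sigma>) j = snd (snd (frag_of A) q \<tau>) j"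
    "\<forall>j \<ge> K. snd (snd (frag_of A) q \<sigma>) j = (\<sigma> j, Stay)"
proof -
  have "fst (snd (frag_of A) q \<sigma>) = fst (snd (frag_of A) q \<tau>) \<and>
    (\<forall>j < K. snd (snd (frag_of A) q \<sigma>) j = snd (snd (frag_of A) q \<tau>) j) \<and>
    (\<forall>j \<ge> K. snd (snd (frag_of A) q \<sigma>) j = (\<sigma> j, Stay))"
    using assms
  proof (induction A arbitrary: q)
    case (Call off M)
    have eq: "map (\<lambda>j. \<sigma> (off + j)) [0..<num_tapes M] = map (\<lambda>j. \<tau> (off + j)) [0..<num_tapes M]"
      "(\<forall>j < num_tapes M. \<sigma> (off + j) < num_syms M) = (\<forall>j < num_tapes M. \<tau> (off + j) < num_syms M)"
      using Call.prems by auto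
    show ?case using Call.prems unfolding frag_of.simps snd_conv eq
      by (auto split: prod.split)
  qed (auto simp: Let_def)
  then show "fst (snd (frag_of A) q \<sigma>) = fst (snd (frag_of A) q \<tau>)"
    "\<forall>j < K. snd (snd (frag_of A) q \<sigma>) j = snd (snd (frag_of A) q \<tau>) j"
    "\<forall>j \<ge> K. snd (snd (frag_of A) q \<sigma>) j = (\<sigma> j, Stay)" by auto
qed

lemma frag_step_funpow_halted: "fst A \<le> q \<Longrightarrow> (frag_step A ^^ t) (q, s) = (q, s)"
  by (induction t) (cases s, auto)+

text \<open>A renaming \<mu> of states that commutes with the transitions transports runs up to the
  exit. Only \<open>t' \<le> t\<close> can be claimed, because \<open>A\<close> rests in its exit
  state while the larger fragment may go on from the image of that state.\<close>

lemma frag_embed: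
  assumes "\<And>q \<sigma>. q < fst A \<Longrightarrow> \<mu> q < fst B \<and> snd B (\<mu> q) \<sigma> = apfst \<mu> (snd A q \<sigma>)"
    and "(frag_step A ^^ t) (q, s) = (fst A, s')"
  shows "\<exists>t' \<le> t. (frag_step B ^^ t') (\<mu> q, s) = (\<mu> (fst A), s')"
  using assms(2)
proof (induction t arbitrary: q s)
  case 0
  then show ?case by auto
next
  case (Suc t)
  show ?case
  proof (cases "q < fst A")
    case False
    then have "(q, s) = (fst A, s')" using frag_step_funpow_halted[of A q "Suc t" s] Suc.prems by simp
    then show ?thesis by (intro exI[of _ 0]) auto
  next
    case True
    obtain h T where s: "s = (h, T)" by fastforce
    obtain q1 s1 where 1: "frag_step A (q, s) = (q1, s1)" by (metis surj_pair)
    have 2: "frag_step B (\<mu> q, s) = (\<mu> q1, s1)"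
      using True 1 assms(1)[OF True] unfolding s by (auto split: prod.splits)
    have "(frag_step A ^^ t) (q1, s1) = (fst A, s')" using Suc.prems 1 by (simp add: funpow_swap1)
    from Suc.IH[OF this] obtain t' where "t' \<le> t" "(frag_step B ^^ t') (\<mu> q1, s1) = (\<mu> (fst A), s')"
      by blast
    then show ?thesis using 2 by (intro exI[of _ "Suc t'"]) (simp add: funpow_swap1)
  qed
qed

lemma funpow_comp_apply: "(f ^^ m) x = y \<Longrightarrow> (f ^^ n) y = z \<Longrightarrow> (f ^^ (m + n)) x = z"
  by (metis add.commute comp_apply funpow_add)

lemma step_syms:
  assumes "wf_tm M" "\<forall>j < num_tapes M. \<forall>i. T j i < num_syms M" "step M (q, h, T) = (q', h', T')"
  shows "\<forall>j < num_tapes M. \<forall>i. T' j i < num_syms M"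
proof (cases "q < num_states M")
  case True
  let ?as = "map (\<lambda>j. T j (h j)) [0..<num_tapes M]"
  obtain p acts where tr: "trans M q ?as = (p, acts)" by fastforce
  have "length ?as = num_tapes M" "set ?as \<subseteq> {..<num_syms M}" using assms by auto
  with assms(1) True have *: "length acts = num_tapes M" "fst ` set acts \<subseteq> {..<num_syms M}"
    unfolding wf_tm_def using tr by (metis snd_conv)+
  have "fst (acts ! i) < num_syms M" if "i < num_tapes M" for i
    using * that nth_mem[of i acts] by fastforce
  then show ?thesis using assms True tr by auto
qed (use assms in auto)

lemma call_steps:
  assumes "wf_tm M" "\<forall>j < num_tapes M. \<forall>i. T (off + j) i < num_syms M"
    "(step M ^^ t) (q, (\<lambda>j. h (off + j)), (\<lambda>j. T (off + j))) = (num_states M, h', T')"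
  shows "\<exists>t' \<le> t. (frag_step (frag_of (Call off M)) ^^ t') (Suc q, h, T) =
    (Suc (num_states M),
     (\<lambda>j. if off \<le> j \<and> j < off + num_tapes M then h' (j - off) else h j),
     (\<lambda>j. if off \<le> j \<and> j < off + num_tapes M then T' (j - off) else T j))"
  using assms(2,3)
proof (induction t arbitrary: q h T)
  case 0
  then show ?case by (auto intro!: ext)
next
  case (Suc t)
  show ?case
  proof (cases "q < num_states M")
    case False
    have "(step M ^^ n) (q, s) = (q, s)" for n s using False by (induction n) (cases s, auto)+
    then have "(num_states M, h', T') = (q, (\<lambda>j. h (off + j)), (\<lambda>j. T (off + j)))"
      using Suc.prems(2) by metis
    then show ?thesis by (auto intro!: exI[of _ 0] ext)
  next
    case True
    let ?as = "map (\<lambda>j. T (off + j) (h (off + j))) [0..<num_tapes M]"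
    obtain p acts where tr: "trans M q ?as = (p, acts)" by fastforce
    define h1 where "h1 = (\<lambda>j. if off \<le> j \<and> j < off + num_tapes M
        then move_head (snd (acts ! (j - off))) (h j) else h j)"
    define T1 where "T1 = (\<lambda>j. if off \<le> j \<and> j < off + num_tapes M
        then (T j)(h j := fst (acts ! (j - off))) else T j)"
    have s1: "step M (q, (\<lambda>j. h (off + j)), (\<lambda>j. T (off + j))) =
        (p, (\<lambda>j. h1 (off + j)), (\<lambda>j. T1 (off + j)))"
      using True tr by (auto simp: h1_def T1_def)
    have s2: "frag_step (frag_of (Call off M)) (Suc q, h, T) = (Suc p, h1, T1)"
      using True tr Suc.prems(1) by (auto simp: h1_def T1_def)
    have "\<forall>j < num_tapes M. \<forall>i. T1 (off + j) i < num_syms M"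
      using step_syms[OF assms(1) Suc.prems(1) s1] .
    moreover have "(step M ^^ t) (p, (\<lambda>j. h1 (off + j)), (\<lambda>j. T1 (off + j))) = (num_states M, h', T')"
      using Suc.prems(2) s1 by (simp add: funpow_swap1)
    ultimately obtain t' where t': "t' \<le> t" "(frag_step (frag_of (Call off M)) ^^ t') (Suc p, h1, T1) =
    (Suc (num_states M),
     (\<lambda>j. if off \<le> j \<and> j < off + num_tapes M then h' (j - off) else h1 j),
     (\<lambda>j. if off \<le> j \<and> j < off + num_tapes M then T' (j - off) else T1 j))"
      using Suc.IH by blast
    have "(\<lambda>j. if off \<le> j \<and> j < off + num_tapes M then h' (j - off) else h1 j) =
        (\<lambda>j. if off \<le> j \<and> j < off + num_tapes M then h' (j - off) else h j)"
      "(\<lambda>j. if off \<le> j \<and> j < off + num_tapes M then T' (j - off) else T1 j) =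
        (\<lambda>j. if off \<le> j \<and> j < off + num_tapes M then T' (j - off) else T j)"
      by (auto simp: h1_def T1_def)
    with t' s2 show ?thesis
      by (intro exI[of _ "Suc t'"]) (simp add: funpow_swap1 del: frag_of.simps frag_step.simps)
  qed
qed

text \<open>Induction on the big-step run; each component is transported into the compound fragment
  by \<open>frag_embed\<close>, with the renaming that \<open>frag_of\<close> applies to its
  states.\<close>

lemma frag_run: "run A s t s' \<Longrightarrow> \<exists>t' \<le> t. (frag_step (frag_of A) ^^ t') (0, s) = (fst (frag_of A), s')"
proof (induction rule: run.induct)
  case (run_Act f T j h a m)
  have "(\<lambda>i. move_head (snd (if i = j then f (T j (h j)) else (T i (h i), Stay))) (h i)) =
      h(j := move_head m (h j))"
    "(\<lambda>i. (T i)(h i := fst (if i = j then f (T j (h j)) else (T i (h i), Stay)))) =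
      T(j := (T j)(h j := a))"
    using run_Act by auto
  then show ?case by (intro exI[of _ 1]) simp
next
  case (run_Seq A s t s' B t' s'')
  let ?C = "frag_of (A ;; B)"
  from run_Seq.IH obtain t1 t2 where 1: "t1 \<le> t" "(frag_step (frag_of A) ^^ t1) (0, s) = (fst (frag_of A), s')"
    and 2: "t2 \<le> t'" "(frag_step (frag_of B) ^^ t2) (0, s') = (fst (frag_of B), s'')" by blast
  have "\<exists>t1' \<le> t1. (frag_step ?C ^^ t1') (id 0, s) = (id (fst (frag_of A)), s')"
    using frag_pos[of B] by (intro frag_embed[OF _ 1(2)]) (auto simp: apfst_def map_prod_def split: prod.splits)
  moreover have "\<exists>t2' \<le> t2. (frag_step ?C ^^ t2') (0 + fst (frag_of A), s') =
      (fst (frag_of B) + fst (frag_of A), s'')"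
    by (intro frag_embed[OF _ 2(2)]) auto
  ultimately obtain t1' t2' where "t1' \<le> t1" "t2' \<le> t2"
    "(frag_step ?C ^^ t1') (0, s) = (fst (frag_of A), s')"
    "(frag_step ?C ^^ t2') (fst (frag_of A), s') = (fst ?C, s'')" by (auto simp: add.commute)
  then show ?case using 1 2 funpow_comp_apply[of t1' "frag_step ?C" "(0,s)" _ t2']
    by (intro exI[of _ "t1' + t2'"]) (auto simp del: frag_of.simps)
next
  case (run_IteT P T j h A t s' B)
  let ?C = "frag_of (Ite j P A B)" and ?a = "fst (frag_of A)"
  let ?mu = "\<lambda>q. if q = ?a then fst ?C else Suc q"
  from run_IteT.IH obtain t1 where 1: "t1 \<le> t"
    "(frag_step (frag_of A) ^^ t1) (0, (h, T)) = (fst (frag_of A), s')" by blast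
  have "\<exists>t1' \<le> t1. (frag_step ?C ^^ t1') (?mu 0, (h, T)) = (?mu ?a, s')"
    by (intro frag_embed[OF _ 1(2)]) (auto simp: Let_def)
  then obtain t1' where 2: "t1' \<le> t1" "(frag_step ?C ^^ t1') (1, (h, T)) = (fst ?C, s')"
    using frag_pos[of A] by auto
  have "frag_step ?C (0, (h, T)) = (1, (h, T))" using run_IteT.hyps by (simp add: Let_def)
  with 1 2 show ?case
    by (intro exI[of _ "Suc t1'"]) (simp add: funpow_swap1 del: frag_of.simps frag_step.simps)
next
  case (run_IteF P T j h B t s' A)
  let ?C = "frag_of (Ite j P A B)" and ?a = "fst (frag_of A)"
  let ?mu = "\<lambda>q. q + Suc ?a"
  from run_IteF.IH obtain t1 where 1: "t1 \<le> t"
    "(frag_step (frag_of B) ^^ t1) (0, (h, T)) = (fst (frag_of B), s')" by blast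
  have "\<exists>t1' \<le> t1. (frag_step ?C ^^ t1') (?mu 0, (h, T)) = (?mu (fst (frag_of B)), s')"
    by (intro frag_embed[OF _ 1(2)]) (auto simp: Let_def)
  then obtain t1' where 2: "t1' \<le> t1" "(frag_step ?C ^^ t1') (Suc ?a, (h, T)) = (fst ?C, s')"
    by (auto simp: Let_def add.commute)
  have "frag_step ?C (0, (h, T)) = (Suc ?a, (h, T))" using run_IteF.hyps by (simp add: Let_def)
  with 1 2 show ?case
    by (intro exI[of _ "Suc t1'"]) (simp add: funpow_swap1 del: frag_of.simps frag_step.simps)
next
  case (run_LoopF P T j h A)
  then show ?case by (intro exI[of _ 1]) (simp add: Let_def)
next
  case (run_LoopT P T j h A t s' t' s'')
  let ?C = "frag_of (Loop j P A)" and ?a = "fst (frag_of A)"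
  let ?mu = "\<lambda>q. if q = ?a then 0 else Suc q"
  from run_LoopT.IH obtain t1 t2 where 1: "t1 \<le> t"
    "(frag_step (frag_of A) ^^ t1) (0, (h, T)) = (fst (frag_of A), s')"
    and 3: "t2 \<le> t'" "(frag_step ?C ^^ t2) (0, s') = (fst ?C, s'')" by blast
  have "\<exists>t1' \<le> t1. (frag_step ?C ^^ t1') (?mu 0, (h, T)) = (?mu ?a, s')"
    by (intro frag_embed[OF _ 1(2)]) (auto simp: Let_def)
  then obtain t1' where 2: "t1' \<le> t1" "(frag_step ?C ^^ t1') (1, (h, T)) = (0, s')"
    using frag_pos[of A] by auto
  have "frag_step ?C (0, (h, T)) = (1, (h, T))" using run_LoopT.hyps by (simp add: Let_def)
  then have "(frag_step ?C ^^ Suc t1') (0, (h, T)) = (0, s')"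
    using 2 by (simp add: funpow_swap1 del: frag_of.simps frag_step.simps)
  from funpow_comp_apply[OF this 3(2)] show ?case using 1 2 3
    by (intro exI[of _ "Suc t1' + t2"]) (auto simp del: frag_of.simps)
next
  case (run_Call M T off t h h' T')
  from call_steps[OF this] obtain t' where t': "t' \<le> t"
    "(frag_step (frag_of (Call off M)) ^^ t') (Suc 0, h, T) =
    (Suc (num_states M),
     (\<lambda>j. if off \<le> j \<and> j < off + num_tapes M then h' (j - off) else h j),
     (\<lambda>j. if off \<le> j \<and> j < off + num_tapes M then T' (j - off) else T j))" by blast
  have "frag_step (frag_of (Call off M)) (0, h, T) = (Suc 0, h, T)" by simp
  with t' show ?case
    by (intro exI[of _ "Suc t'"]) (simp add: funpow_swap1 del: frag_step.simps)
qed

definition tm_of :: "nat \<Rightarrow> nat \<Rightarrow> cmd \<Rightarrow> tm" where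
  "tm_of K S A = \<lparr>num_tapes = K, num_syms = S, num_states = fst (frag_of A),
     trans = (\<lambda>q as. let (q', g) = snd (frag_of A) q (\<lambda>j. as ! j) in (q', map g [0..<K]))\<rparr>"

lemma wf_tm_of:
  assumes "cmd_ok K S A" "K \<ge> 1" "S \<ge> 3"
  shows "wf_tm (tm_of K S A)"
  unfolding wf_tm_def
proof (intro conjI allI impI; (elim conjE)?)
  fix q as assume q: "q < num_states (tm_of K S A)" and as: "length as = num_tapes (tm_of K S A)"
    "set as \<subseteq> {..<num_syms (tm_of K S A)}"
  then have as': "\<forall>j < K. as ! j < S" unfolding tm_of_def by (simp, metis lessThan_iff nth_mem subsetD)
  note b = frag_of_bounds[OF assms(1) _ as', of q]
  show "fst (trans (tm_of K S A) q as) \<le> num_states (tm_of K S A)"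
    using b q by (auto simp: tm_of_def split: prod.splits)
  show "length (snd (trans (tm_of K S A) q as)) = num_tapes (tm_of K S A)"
    by (auto simp: tm_of_def split: prod.splits)
  show "fst ` set (snd (trans (tm_of K S A) q as)) \<subseteq> {..<num_syms (tm_of K S A)}"
    using b(2) q by (auto simp: tm_of_def split: prod.splits)
qed (use assms in \<open>auto simp: tm_of_def\<close>)

lemma step_tm_of:
  assumes "cmd_ok K S A"
  shows "step (tm_of K S A) cf = frag_step (frag_of A) cf"
proof -
  obtain q h T where cf: "cf = (q, h, T)" by (metis surj_pair)
  let ?\<sigma> = "\<lambda>j. T j (h j)" and ?\<tau> = "\<lambda>j. map (\<lambda>j. T j (h j)) [0..<K] ! j"
  note c = frag_of_cong[OF assms, of ?\<sigma> ?\<tau> q]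
  obtain q1 g1 where 1: "snd (frag_of A) q ?\<sigma> = (q1, g1)" by fastforce
  obtain q2 g2 where 2: "snd (frag_of A) q ?\<tau> = (q2, g2)" by fastforce
  have "q1 = q2" "\<forall>j < K. g1 j = g2 j" "\<forall>j \<ge> K. g1 j = (?\<sigma> j, Stay)" using c 1 2 by auto
  then show ?thesis
    unfolding cf using 1 2 by (auto simp: tm_of_def fun_eq_iff)
qed

lemma poly_time_cmd:
  assumes "cmd_ok K S A" "K \<ge> 1" "S \<ge> 3"
    and "\<And>x. \<exists>t h T. t \<le> poly p (length x) \<and> run A (snd (init_config x)) t (h, T) \<and>
           (\<forall>i < length (f x). T 0 i = sym_of_bit (f x ! i)) \<and> T 0 (length (f x)) = 0"
  shows "poly_time f"
  unfolding poly_time_def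
proof (intro exI conjI allI)
  show "wf_tm (tm_of K S A)" using assms wf_tm_of by blast
  fix x
  from assms(4) obtain t h T where 1: "t \<le> poly p (length x)" "run A (snd (init_config x)) t (h, T)"
    and 2: "\<forall>i < length (f x). T 0 i = sym_of_bit (f x ! i)" "T 0 (length (f x)) = 0" by blast
  from frag_run[OF 1(2)] obtain t' where 3: "t' \<le> t" "(frag_step (frag_of A) ^^ t') (0, snd (init_config x)) =
     (fst (frag_of A), h, T)" by blast
  obtain k where k: "poly p (length x) = t' + k" using 1 3 by (metis le_iff_add le_trans)
  have i: "init_config x = (0, snd (init_config x))" by (simp add: init_config_def)
  have "(step (tm_of K S A) ^^ poly p (length x)) (init_config x) =
      (frag_step (frag_of A) ^^ (t' + k)) (init_config x)"
    using step_tm_of[OF assms(1)] k by (metis ext)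
  also have "\<dots> = (fst (frag_of A), h, T)"
    using 3(2) i frag_step_funpow_halted[of "frag_of A" "fst (frag_of A)"]
    by (metis funpow_comp_apply order_refl)
  finally show "halted_with (tm_of K S A)
      ((step (tm_of K S A) ^^ poly p (length x)) (init_config x)) (f x)"
    using 2 by (simp add: halted_with_def tm_of_def)
qed

section \<open>Execution within a time bound\<close>

definition runs :: "cmd \<Rightarrow> store \<Rightarrow> nat \<Rightarrow> store \<Rightarrow> bool" where
  "runs A s t s' \<longleftrightarrow> (\<exists>t' \<le> t. run A s t' s')"

lemma runs_mono: "runs A s t s' \<Longrightarrow> t \<le> t' \<Longrightarrow> runs A s t' s'"
  unfolding runs_def by (meson le_trans)

lemma runs_Seq: "runs A s t s' \<Longrightarrow> runs B s' t' s'' \<Longrightarrow> runs (A ;; B) s (t + t') s''"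
  unfolding runs_def by (meson add_mono run_Seq)

lemma runs_IteT: "P (T j (h j)) \<Longrightarrow> runs A (h, T) t s' \<Longrightarrow> runs (Ite j P A B) (h, T) (Suc t) s'"
  unfolding runs_def by (meson Suc_le_mono run_IteT)

lemma runs_IteF: "\<not> P (T j (h j)) \<Longrightarrow> runs B (h, T) t s' \<Longrightarrow> runs (Ite j P A B) (h, T) (Suc t) s'"
  unfolding runs_def by (meson Suc_le_mono run_IteF)

lemma runs_Act:
  "runs (Act j f) (h, T) 1 (h(j := move_head (snd (f (T j (h j)))) (h j)), T(j := (T j)(h j := fst (f (T j (h j))))))"
  unfolding runs_def using run_Act[of f T j h] by (intro exI[of _ 1]) simp

text \<open>The intermediate stores \<sigma> are given in closed form and take the place of an
  invariant; the induction proceeds backwards from the last iteration.\<close>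

lemma runs_Loop:
  assumes "\<And>i. i < n \<Longrightarrow> P (snd (\<sigma> i) j (fst (\<sigma> i) j))"
    and "\<And>i. i < n \<Longrightarrow> runs A (\<sigma> i) t (\<sigma> (Suc i))"
    and "\<not> P (snd (\<sigma> n) j (fst (\<sigma> n) j))"
  shows "runs (Loop j P A) (\<sigma> 0) (Suc (n * Suc t)) (\<sigma> n)"
proof -
  have "runs (Loop j P A) (\<sigma> (n - k)) (Suc (k * Suc t)) (\<sigma> n)" if "k \<le> n" for k
    using that
  proof (induction k)
    case 0
    obtain h T where s: "\<sigma> n = (h, T)" by fastforce
    show ?case unfolding runs_def using assms(3) run_LoopF[of P T j h A]
      by (intro exI[of _ 1]) (auto simp: s)
  next
    case (Suc k)
    have i: "n - Suc k < n" "Suc (n - Suc k) = n - k" using Suc.prems by auto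
    obtain h T where s: "\<sigma> (n - Suc k) = (h, T)" by fastforce
    obtain t1 where 1: "t1 \<le> t" "run A (h, T) t1 (\<sigma> (n - k))"
      using assms(2)[OF i(1)] i(2) s by (auto simp: runs_def)
    obtain t2 where 2: "t2 \<le> Suc (k * Suc t)" "run (Loop j P A) (\<sigma> (n - k)) t2 (\<sigma> n)"
      using Suc by (auto simp: runs_def)
    have "P (T j (h j))" using assms(1)[OF i(1)] s by simp
    from run_LoopT[OF this 1(2) 2(2)] show ?case
      unfolding runs_def s using 1 2 by (intro exI[of _ "Suc (t1 + t2)"]) auto
  qed
  from this[of n] show ?thesis by simp
qed

section \<open>Registers as head positions\<close>

definition go_right :: "nat \<Rightarrow> cmd" where "go_right j = Act j (\<lambda>a. (a, Go_Right))"
definition go_left :: "nat \<Rightarrow> cmd" where "go_left j = Act j (\<lambda>a. (a, Go_Left))"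
definition nop :: cmd where "nop = Act 0 (\<lambda>a. (a, Stay))"

lemma runs_go_right: "runs (go_right j) (h, T) 1 (h(j := Suc (h j)), T)"
  unfolding go_right_def using runs_Act[of j "\<lambda>a. (a, Go_Right)" h T] by simp

lemma runs_go_left: "runs (go_left j) (h, T) 1 (h(j := h j - 1), T)"
  unfolding go_left_def using runs_Act[of j "\<lambda>a. (a, Go_Left)" h T] by simp

lemma runs_nop: "runs nop (h, T) 1 (h, T)"
  unfolding nop_def using runs_Act[of 0 "\<lambda>a. (a, Stay)" h T] by simp

text \<open>
  A register is a tape that is blank except for the symbol 1 in cell 0; the number it holds is
  the position of its head.
\<close>

definition reg_tape :: "nat \<Rightarrow> nat" where "reg_tape = (\<lambda>i. if i = 0 then 1 else 0)"

lemma reg_tape_eq_1 [simp]: "reg_tape i = Suc 0 \<longleftrightarrow> i = 0"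
  by (simp add: reg_tape_def)

definition while_pos :: "nat \<Rightarrow> cmd \<Rightarrow> cmd" where
  "while_pos r A = Loop r (\<lambda>a. a \<noteq> 1) (go_left r ;; A)"

lemma runs_while_pos:
  assumes T: "\<And>i. i \<le> h0 r \<Longrightarrow> snd (\<sigma> i) r = reg_tape"
    and h: "\<And>i. i \<le> h0 r \<Longrightarrow> fst (\<sigma> i) r = h0 r - i"
    and A: "\<And>i. i < h0 r \<Longrightarrow> runs A ((fst (\<sigma> i))(r := h0 r - Suc i), snd (\<sigma> i)) t (\<sigma> (Suc i))"
  shows "runs (while_pos r A) (\<sigma> 0) (Suc (h0 r * (t + 2))) (\<sigma> (h0 r))"
proof -
  have "runs (Loop r (\<lambda>a. a \<noteq> 1) (go_left r ;; A)) (\<sigma> 0) (Suc (h0 r * Suc (1 + t))) (\<sigma> (h0 r))"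
  proof (rule runs_Loop)
    fix i assume i: "i < h0 r"
    obtain h T where s: "\<sigma> i = (h, T)" by fastforce
    show "snd (\<sigma> i) r (fst (\<sigma> i) r) \<noteq> 1" using T[of i] h[of i] i by simp
    have "h(r := h r - 1) = h(r := h0 r - Suc i)" using h[of i] i s by simp
    then show "runs (go_left r ;; A) (\<sigma> i) (1 + t) (\<sigma> (Suc i))"
      using runs_Seq[OF runs_go_left[of r h T]] A[OF i] s by simp
  qed (use T[of "h0 r"] h[of "h0 r"] in simp)
  then show ?thesis by (simp add: while_pos_def)
qed

definition clear_reg :: "nat \<Rightarrow> cmd" where "clear_reg r = while_pos r nop"

lemma runs_clear:
  assumes "T r = reg_tape"
  shows "runs (clear_reg r) (h, T) (Suc (h r * 3)) (h(r := 0), T)"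
proof -
  have "runs nop ((h(r := h r - i))(r := h r - Suc i), T) 1 (h(r := h r - Suc i), T)" for i
    using runs_nop by simp
  then show ?thesis
    using runs_while_pos[of h r "\<lambda>i. (h(r := h r - i), T)" nop 1] assms
    by (simp add: clear_reg_def numeral_3_eq_3)
qed

definition move_reg :: "nat \<Rightarrow> nat \<Rightarrow> cmd" where "move_reg r e = while_pos r (go_right e)"

lemma runs_move_reg:
  assumes "T r = reg_tape" "r \<noteq> e"
  shows "runs (move_reg r e) (h, T) (Suc (h r * 3)) (h(r := 0, e := h e + h r), T)"
proof -
  let ?s = "\<lambda>i. (h(r := h r - i, e := h e + i), T)"
  have "runs (go_right e) ((fst (?s i))(r := h r - Suc i), snd (?s i)) 1 (?s (Suc i))" for i
    using runs_go_right[of e "h(r := h r - Suc i, e := h e + i)" T] assms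
    by (simp add: fun_upd_twist)
  then show ?thesis
    using runs_while_pos[of h r ?s "go_right e" 1] assms
    by (simp add: move_reg_def numeral_3_eq_3)
qed

definition move_reg2 :: "nat \<Rightarrow> nat \<Rightarrow> nat \<Rightarrow> cmd" where
  "move_reg2 r e e' = while_pos r (go_right e ;; go_right e')"

lemma runs_move_reg2:
  assumes "T r = reg_tape" "r \<noteq> e" "r \<noteq> e'" "e \<noteq> e'"
  shows "runs (move_reg2 r e e') (h, T) (Suc (h r * 4)) (h(r := 0, e := h e + h r, e' := h e' + h r), T)"
proof -
  let ?s = "\<lambda>i. (h(r := h r - i, e := h e + i, e' := h e' + i), T)"
  have "runs (go_right e ;; go_right e') ((fst (?s i))(r := h r - Suc i), snd (?s i)) (1 + 1) (?s (Suc i))" for i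
  proof -
    let ?h = "h(r := h r - Suc i, e := h e + i, e' := h e' + i)"
    have "(fst (?s i))(r := h r - Suc i) = ?h"
      "?h(e := Suc (?h e), e' := Suc ((?h(e := Suc (?h e))) e')) = fst (?s (Suc i))"
      using assms by (auto simp: fun_eq_iff)
    then show ?thesis
      using runs_Seq[OF runs_go_right[of e ?h T] runs_go_right[of e' "?h(e := Suc (?h e))" T]] by simp
  qed
  then show ?thesis
    using runs_while_pos[of h r ?s "go_right e ;; go_right e'" "1 + 1"] assms
    by (simp add: move_reg2_def eval_nat_numeral)
qed

text \<open>Reading a register uses it up, hence the detour through the scratch register
  \<open>Suc e\<close>, from which the original is restored.\<close>

definition copy_reg :: "nat \<Rightarrow> nat \<Rightarrow> cmd" where
  "copy_reg r e = move_reg2 r e (Suc e) ;; move_reg (Suc e) r"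

lemma runs_copy_reg:
  assumes "T r = reg_tape" "T (Suc e) = reg_tape" "r < e" "h (Suc e) = 0" "h e = 0"
  shows "runs (copy_reg r e) (h, T) (2 + h r * 7) (h(e := h r), T)"
proof -
  let ?h = "h(r := 0, e := h e + h r, Suc e := h (Suc e) + h r)"
  have "?h(Suc e := 0, r := ?h r + ?h (Suc e)) = h(e := h r)" using assms by (auto simp: fun_eq_iff)
  then show ?thesis
    using runs_Seq[OF runs_move_reg2[of T r e "Suc e" h] runs_move_reg[of T "Suc e" r ?h]] assms
    by (simp add: copy_reg_def algebra_simps)
qed

definition str_tape :: "bool list \<Rightarrow> nat \<Rightarrow> nat" where
  "str_tape x = (\<lambda>i. if i < length x then sym_of_bit (x ! i) else 0)"

lemma str_tape_eq_0 [simp]: "str_tape x i = 0 \<longleftrightarrow> length x \<le> i"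
  by (simp add: str_tape_def sym_of_bit_def)

lemma str_tape_le: "str_tape x i \<le> 2"
  by (simp add: str_tape_def sym_of_bit_def)

text \<open>A string tape carries no mark at its left end, so \<open>Suc e\<close> counts the moves
  to the right and is used up on the way back.\<close>

definition len_tape :: "nat \<Rightarrow> nat \<Rightarrow> cmd" where
  "len_tape j e = Loop j (\<lambda>a. a \<noteq> 0) (go_right j ;; go_right e ;; go_right (Suc e)) ;;
     while_pos (Suc e) (go_left j)"

lemma runs_len_tape:
  assumes "T j = str_tape x" "T (Suc e) = reg_tape" "j < e" "h (Suc e) = 0" "h e = 0" "h j = 0"
  shows "runs (len_tape j e) (h, T) (2 + length x * 7) (h(e := length x), T)"
proof -
  let ?s = "\<lambda>i. (h(j := i, e := i, Suc e := i), T)"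
  let ?A = "go_right j ;; go_right e ;; go_right (Suc e)"
  have "runs ?A (?s i) (1 + (1 + 1)) (?s (Suc i))" for i
  proof -
    let ?h = "h(j := i, e := i, Suc e := i)"
    let ?h1 = "?h(j := Suc (?h j))"
    let ?h2 = "?h1(e := Suc (?h1 e))"
    have "?h2(Suc e := Suc (?h2 (Suc e))) = fst (?s (Suc i))" using assms by (auto simp: fun_eq_iff)
    then show ?thesis
      using runs_Seq[OF runs_go_right[of j ?h T] runs_Seq[OF runs_go_right[of e ?h1 T]
         runs_go_right[of "Suc e" ?h2 T]]] by (metis fst_conv)
  qed
  note A = this
  have 1: "runs (Loop j (\<lambda>a. a \<noteq> 0) ?A) (?s 0) (Suc (length x * Suc (1 + (1 + 1)))) (?s (length x))"
    by (rule runs_Loop[where \<sigma> = ?s and P = "\<lambda>a. a \<noteq> 0" and n = "length x" and j = j, OF _ A])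
      (use assms in simp_all)
  have s0: "?s 0 = (h, T)" using assms by (auto simp: fun_eq_iff)
  let ?h = "h(j := length x, e := length x, Suc e := length x)"
  let ?u = "\<lambda>i. (?h(j := length x - i, Suc e := length x - i), T)"
  have "runs (go_left j) ((fst (?u i))(Suc e := ?h (Suc e) - Suc i), snd (?u i)) 1 (?u (Suc i))" for i
  proof -
    let ?g = "(fst (?u i))(Suc e := ?h (Suc e) - Suc i)"
    have "?g(j := ?g j - 1) = fst (?u (Suc i))" using assms by (auto simp: fun_eq_iff)
    then show ?thesis using runs_go_left[of j ?g T] by (metis fst_conv snd_conv)
  qed
  note B = this
  have "runs (while_pos (Suc e) (go_left j)) (?u 0) (Suc (?h (Suc e) * (1 + 2))) (?u (?h (Suc e)))"
    by (rule runs_while_pos[where \<sigma> = ?u and ?h0.0 = ?h and r = "Suc e", OF _ _ B]) (use assms in simp_all)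
  moreover have "?u 0 = ?s (length x)" "?u (?h (Suc e)) = (h(e := length x), T)" "?h (Suc e) = length x"
    using assms by (auto simp: fun_eq_iff)
  ultimately have "runs (while_pos (Suc e) (go_left j)) (?s (length x)) (Suc (length x * (1 + 2)))
      (h(e := length x), T)" by (simp only:)
  from runs_Seq[OF 1 this] show ?thesis unfolding s0 len_tape_def
    by (rule runs_mono) simp
qed

text \<open>The position in \<open>e\<close> is used up on the way to the cell, which frees
  \<open>e\<close> for the symbol found there, a number at most 2. The way back is counted in
  \<open>Suc e\<close>.\<close>

definition read_tape :: "nat \<Rightarrow> nat \<Rightarrow> cmd" where
  "read_tape j e = while_pos e (go_right j ;; go_right (Suc e)) ;;
     Ite j (\<lambda>a. a = 0) nop (Ite j (\<lambda>a. a = 1) (go_right e) (go_right e ;; go_right e)) ;;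
     while_pos (Suc e) (go_left j)"

lemma runs_read_tape:
  assumes "T j = str_tape x" "T (Suc e) = reg_tape" "T e = reg_tape" "j < e" "h (Suc e) = 0" "h j = 0"
  shows "runs (read_tape j e) (h, T) (10 + h e * 7) (h(e := str_tape x (h e)), T)"
proof -
  let ?n = "h e"
  let ?s = "\<lambda>i. (h(j := i, e := ?n - i, Suc e := i), T)"
  let ?A = "go_right j ;; go_right (Suc e)"
  have "runs ?A ((fst (?s i))(e := ?n - Suc i), snd (?s i)) (1 + 1) (?s (Suc i))" for i
  proof -
    let ?h = "(fst (?s i))(e := ?n - Suc i)"
    let ?h1 = "?h(j := Suc (?h j))"
    have "?h1(Suc e := Suc (?h1 (Suc e))) = fst (?s (Suc i))" using assms by (auto simp: fun_eq_iff)
    then show ?thesis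
      using runs_Seq[OF runs_go_right[of j ?h T] runs_go_right[of "Suc e" ?h1 T]]
      by (metis fst_conv snd_conv)
  qed
  note A = this
  have 1: "runs (while_pos e ?A) (?s 0) (Suc (?n * (1 + 1 + 2))) (?s ?n)"
    by (rule runs_while_pos[where \<sigma> = ?s and ?h0.0 = h and r = e, OF _ _ A]) (use assms in simp_all)
  have s0: "?s 0 = (h, T)" using assms by (auto simp: fun_eq_iff)
  let ?v = "str_tape x ?n"
  let ?h = "h(j := ?n, e := 0, Suc e := ?n)" and ?k = "h(j := ?n, e := ?v, Suc e := ?n)"
  have rd: "T j (?h j) = ?v" using assms by simp
  have "runs (Ite j (\<lambda>a. a = 0) nop (Ite j (\<lambda>a. a = 1) (go_right e) (go_right e ;; go_right e)))
      (?h, T) (Suc (Suc (1 + 1))) (?k, T)"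
  proof -
    consider "?v = 0" | "?v = 1" | "?v = 2" using str_tape_le[of x ?n] by linarith
    then show ?thesis
    proof cases
      case 1
      have "?k = ?h" using 1 by (auto simp: fun_eq_iff)
      moreover have "runs (Ite j (\<lambda>a. a = 0) nop (Ite j (\<lambda>a. a = 1) (go_right e) (go_right e ;; go_right e)))
         (?h, T) (Suc 1) (?h, T)"
        by (rule runs_IteT[OF _ runs_nop]) (use 1 rd in simp)
      ultimately show ?thesis by (simp only:) (erule runs_mono, simp)
    next
      case 2
      have "?k = ?h(e := Suc (?h e))" using 2 assms by (auto simp: fun_eq_iff)
      moreover have "runs (Ite j (\<lambda>a. a = 0) nop (Ite j (\<lambda>a. a = 1) (go_right e) (go_right e ;; go_right e)))
         (?h, T) (Suc (Suc 1)) (?h(e := Suc (?h e)), T)"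
        by (rule runs_IteF[OF _ runs_IteT[OF _ runs_go_right]]) (use 2 rd in simp)+
      ultimately show ?thesis by (simp only:) (erule runs_mono, simp)
    next
      case 3
      have "?k = ?h(e := Suc (?h e), e := Suc ((?h(e := Suc (?h e))) e))" using 3 assms by (auto simp: fun_eq_iff)
      moreover have "runs (Ite j (\<lambda>a. a = 0) nop (Ite j (\<lambda>a. a = 1) (go_right e) (go_right e ;; go_right e)))
         (?h, T) (Suc (Suc (1 + 1))) (?h(e := Suc (?h e), e := Suc ((?h(e := Suc (?h e))) e)), T)"
        by (rule runs_IteF[OF _ runs_IteF[OF _ runs_Seq[OF runs_go_right runs_go_right]]]) (use 3 rd in simp)+
      ultimately show ?thesis by (simp only:)
    qed
  qed
  moreover have "?s ?n = (?h, T)" by simp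
  ultimately have 2: "runs (Ite j (\<lambda>a. a = 0) nop (Ite j (\<lambda>a. a = 1) (go_right e) (go_right e ;; go_right e)))
      (?s ?n) (Suc (Suc (1 + 1))) (?k, T)" by simp
  let ?u = "\<lambda>i. (?k(j := ?n - i, Suc e := ?n - i), T)"
  have "runs (go_left j) ((fst (?u i))(Suc e := ?k (Suc e) - Suc i), snd (?u i)) 1 (?u (Suc i))" for i
  proof -
    let ?g = "(fst (?u i))(Suc e := ?k (Suc e) - Suc i)"
    have "?g(j := ?g j - 1) = fst (?u (Suc i))" using assms by (auto simp: fun_eq_iff)
    then show ?thesis using runs_go_left[of j ?g T] by (metis fst_conv snd_conv)
  qed
  note B = this
  have "runs (while_pos (Suc e) (go_left j)) (?u 0) (Suc (?k (Suc e) * (1 + 2))) (?u (?k (Suc e)))"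
    by (rule runs_while_pos[where \<sigma> = ?u and ?h0.0 = ?k and r = "Suc e", OF _ _ B]) (use assms in simp_all)
  moreover have "?u 0 = (?k, T)" "?u (?k (Suc e)) = (h(e := ?v), T)" "?k (Suc e) = ?n"
    using assms by (auto simp: fun_eq_iff)
  ultimately have 3: "runs (while_pos (Suc e) (go_left j)) (?k, T) (Suc (?n * (1 + 2)))
      (h(e := ?v), T)" by (simp only:)
  from runs_Seq[OF 1 runs_Seq[OF 2 3]] show ?thesis unfolding s0 read_tape_def
    by (rule runs_mono) simp
qed

section \<open>Numbers and strings computed in polynomial time\<close>

lemma poly_mono_nat: "x \<le> y \<Longrightarrow> poly p x \<le> poly p (y :: nat)"
  by (induction p) (auto intro!: add_mono mult_mono)

text \<open>
  A context names the data \<open>c :: 'c\<close> available to a program: the strings on the read-only tapes 0 and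
  1 and the contents of some registers. The output is appended on tape 2, the registers in use
  lie below \<open>e\<close>, and all registers from \<open>e\<close> on are zero.
\<close>

type_synonym 'c ctx = "('c \<Rightarrow> bool list) \<times> ('c \<Rightarrow> bool list) \<times> ('c \<Rightarrow> nat) list"

definition csize :: "'c ctx \<Rightarrow> 'c \<Rightarrow> nat" where
  "csize \<Gamma> c = (case \<Gamma> of (Z, Y, vs) \<Rightarrow> length (Z c) + length (Y c) + (\<Sum>v\<leftarrow>vs. v c))"

definition ready :: "nat \<Rightarrow> 'c ctx \<Rightarrow> nat list \<Rightarrow> nat \<Rightarrow> 'c \<Rightarrow> store \<Rightarrow> bool" where
  "ready R \<Gamma> m e c s \<longleftrightarrow> (case (\<Gamma>, s) of ((Z, Y, vs), (h, T)) \<Rightarrow>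
     T 0 = str_tape (Z c) \<and> T 1 = str_tape (Y c) \<and> h 0 = 0 \<and> h 1 = 0 \<and>
     (\<forall>r. 3 \<le> r \<and> r < R \<longrightarrow> T r = reg_tape) \<and> (\<forall>r. e \<le> r \<and> r < R \<longrightarrow> h r = 0) \<and>
     list_all2 (\<lambda>r v. h r = v c) m vs)"

definition layout :: "'c ctx \<Rightarrow> nat list \<Rightarrow> nat \<Rightarrow> bool" where
  "layout \<Gamma> m e \<longleftrightarrow> 3 \<le> e \<and> length m = length (snd (snd \<Gamma>)) \<and> set m \<subseteq> {3..<e}"

text \<open>As values are unary, both the value and the time have to be polynomial in
  \<open>csize\<close>. The program may depend on the register layout but not on \<open>c\<close>;
  it uses the registers from \<open>e\<close> on as scratch space and returns all of them to zero,
  apart from the result. The alphabet size stays open because machines with further symbols are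
  called later.\<close>

definition pf :: "'c ctx \<Rightarrow> ('c \<Rightarrow> nat) \<Rightarrow> bool" where
  "pf \<Gamma> f \<longleftrightarrow> (\<exists>p. \<forall>c. f c \<le> poly p (csize \<Gamma> c)) \<and>
     (\<forall>m e. layout \<Gamma> m e \<longrightarrow> (\<exists>A R p. e < R \<and> (\<forall>S\<ge>4. cmd_ok R S A) \<and>
        (\<forall>c h T. ready R \<Gamma> m e c (h, T) \<longrightarrow> runs A (h, T) (poly p (csize \<Gamma> c)) (h(e := f c), T))))"

text \<open>The new variable is the one bound by a sum, a quantifier, a loop or a recursion; nested
  binding iterates \<open>ext\<close>.\<close>

definition ext :: "'c ctx \<Rightarrow> ('c \<times> nat) ctx" where
  "ext \<Gamma> = (fst \<Gamma> \<circ> fst, fst (snd \<Gamma>) \<circ> fst, snd # map (\<lambda>v. v \<circ> fst) (snd (snd \<Gamma>)))"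

lemma pf_bound: "pf \<Gamma> f \<Longrightarrow> \<exists>p. \<forall>c. f c \<le> poly p (csize \<Gamma> c)"
  by (simp add: pf_def)

lemma pf_cmd:
  assumes "pf \<Gamma> f" "layout \<Gamma> m e"
  obtains A R p where "e < R" "\<And>S. S \<ge> 4 \<Longrightarrow> cmd_ok R S A"
    "\<And>c h T. ready R \<Gamma> m e c (h, T) \<Longrightarrow> runs A (h, T) (poly p (csize \<Gamma> c)) (h(e := f c), T)"
  using assms unfolding pf_def by metis

lemma pfI:
  assumes "\<And>c. f c \<le> poly p (csize \<Gamma> c)"
    and "\<And>m e. layout \<Gamma> m e \<Longrightarrow> \<exists>A R p. e < R \<and> (\<forall>S\<ge>4. cmd_ok R S A) \<and>
        (\<forall>c h T. ready R \<Gamma> m e c (h, T) \<longrightarrow> runs A (h, T) (poly p (csize \<Gamma> c)) (h(e := f c), T))"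
  shows "pf \<Gamma> f"
  unfolding pf_def using assms by blast

lemma cmd_ok_mono: "cmd_ok K S A \<Longrightarrow> K \<le> K' \<Longrightarrow> cmd_ok K' S A"
  by (induction A) auto

lemma layout_mono: "layout \<Gamma> m e \<Longrightarrow> e \<le> e' \<Longrightarrow> layout \<Gamma> m e'"
  unfolding layout_def by auto

lemma layout_ext: "layout \<Gamma> m e \<Longrightarrow> r < e \<Longrightarrow> 3 \<le> r \<Longrightarrow> layout (ext \<Gamma>) (r # m) e"
  unfolding layout_def ext_def by auto

lemma ready_upd:
  assumes "ready R \<Gamma> m e c (h, T)" "layout \<Gamma> m e" "R' \<le> R" "\<And>r. r < e \<Longrightarrow> h' r = h r"
    "\<And>r. e' \<le> r \<Longrightarrow> r < R' \<Longrightarrow> h' r = 0"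
  shows "ready R' \<Gamma> m e' c (h', T)"
proof -
  have "list_all2 (\<lambda>r v. h r = v c) m (snd (snd \<Gamma>))" using assms(1) by (auto simp: ready_def split: prod.splits)
  then have "list_all2 (\<lambda>r v. h' r = v c) m (snd (snd \<Gamma>))"
    using assms(2,4) by (auto simp: list_all2_conv_all_nth layout_def) (metis atLeastLessThan_iff nth_mem subsetD)
  then show ?thesis using assms by (auto simp: ready_def layout_def split: prod.splits)
qed

lemma ready_ext: "ready R \<Gamma> m e c (h, T) \<Longrightarrow> h r = i \<Longrightarrow> ready R (ext \<Gamma>) (r # m) e (c, i) (h, T)"
  by (auto simp: ready_def ext_def list.rel_map split: prod.splits)

lemma csize_ext [simp]: "csize (ext \<Gamma>) (c, i) = csize \<Gamma> c + i"
  by (auto simp: csize_def ext_def comp_def split: prod.splits)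

lemma ready_head: "ready R \<Gamma> m e c (h, T) \<Longrightarrow> e \<le> r \<Longrightarrow> r < R \<Longrightarrow> h r = 0"
  by (auto simp: ready_def split: prod.splits)

lemma ready_reg: "ready R \<Gamma> m e c (h, T) \<Longrightarrow> 3 \<le> r \<Longrightarrow> r < R \<Longrightarrow> T r = reg_tape"
  by (auto simp: ready_def split: prod.splits)

lemma cmd_ok_basic [simp]:
  "cmd_ok R S (go_right j) \<longleftrightarrow> j < R" "cmd_ok R S (go_left j) \<longleftrightarrow> j < R" "cmd_ok R S nop \<longleftrightarrow> 0 < R"
  "cmd_ok R S (while_pos r A) \<longleftrightarrow> r < R \<and> cmd_ok R S A"
  "cmd_ok R S (clear_reg r) \<longleftrightarrow> r < R"
  "cmd_ok R S (move_reg r e) \<longleftrightarrow> r < R \<and> e < R"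
  "cmd_ok R S (move_reg2 r e e') \<longleftrightarrow> r < R \<and> e < R \<and> e' < R"
  "cmd_ok R S (copy_reg r e) \<longleftrightarrow> r < R \<and> Suc e < R"
  "cmd_ok R S (len_tape j e) \<longleftrightarrow> j < R \<and> Suc e < R"
  "cmd_ok R S (read_tape j e) \<longleftrightarrow> j < R \<and> Suc e < R"
  by (auto simp: go_right_def go_left_def nop_def while_pos_def clear_reg_def move_reg_def
      move_reg2_def copy_reg_def len_tape_def read_tape_def)

section \<open>Closure properties of the computable numbers\<close>

lemma pf_zero: "pf \<Gamma> (\<lambda>c. 0)"
proof (rule pfI[where p = 0])
  fix m e assume "layout \<Gamma> m e"
  show "\<exists>A R p. e < R \<and> (\<forall>S\<ge>4. cmd_ok R S A) \<and>
        (\<forall>c h T. ready R \<Gamma> m e c (h, T) \<longrightarrow> runs A (h, T) (poly p (csize \<Gamma> c)) (h(e := 0), T))"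
  proof (intro exI[of _ nop] exI[of _ "Suc e"] exI[of _ 1] conjI allI impI)
    fix c h T assume r: "ready (Suc e) \<Gamma> m e c (h, T)"
    have "h(e := 0) = h" using ready_head[OF r, of e] by (auto simp: fun_eq_iff)
    then show "runs nop (h, T) (poly 1 (csize \<Gamma> c)) (h(e := 0), T)" using runs_nop by simp
  qed auto
qed auto

lemma pf_Suc:
  assumes "pf \<Gamma> f" shows "pf \<Gamma> (\<lambda>c. Suc (f c))"
proof -
  obtain p where p: "\<And>c. f c \<le> poly p (csize \<Gamma> c)" using pf_bound[OF assms] by blast
  show ?thesis
  proof (rule pfI[where p = "p + 1"])
    fix m e assume l: "layout \<Gamma> m e"
    obtain A R q where A: "e < R" "\<And>S. S \<ge> 4 \<Longrightarrow> cmd_ok R S A"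
      "\<And>c h T. ready R \<Gamma> m e c (h, T) \<Longrightarrow> runs A (h, T) (poly q (csize \<Gamma> c)) (h(e := f c), T)"
      by (rule pf_cmd[OF assms l]) (rule that)
    show "\<exists>A R p. e < R \<and> (\<forall>S\<ge>4. cmd_ok R S A) \<and>
        (\<forall>c h T. ready R \<Gamma> m e c (h, T) \<longrightarrow> runs A (h, T) (poly p (csize \<Gamma> c)) (h(e := Suc (f c)), T))"
    proof (intro exI[of _ "A ;; go_right e"] exI[of _ R] exI[of _ "q + 1"] conjI allI impI)
      fix c h T assume r: "ready R \<Gamma> m e c (h, T)"
      from runs_Seq[OF A(3)[OF r] runs_go_right[of e]]
      show "runs (A ;; go_right e) (h, T) (poly (q + 1) (csize \<Gamma> c)) (h(e := Suc (f c)), T)" by simp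
    qed (use A in auto)
  qed (use p in auto)
qed

lemma pf_pred:
  assumes "pf \<Gamma> f" shows "pf \<Gamma> (\<lambda>c. f c - 1)"
proof -
  obtain p where p: "\<And>c. f c \<le> poly p (csize \<Gamma> c)" using pf_bound[OF assms] by blast
  show ?thesis
  proof (rule pfI[where p = p])
    fix m e assume l: "layout \<Gamma> m e"
    obtain A R q where A: "e < R" "\<And>S. S \<ge> 4 \<Longrightarrow> cmd_ok R S A"
      "\<And>c h T. ready R \<Gamma> m e c (h, T) \<Longrightarrow> runs A (h, T) (poly q (csize \<Gamma> c)) (h(e := f c), T)"
      by (rule pf_cmd[OF assms l]) (rule that)
    show "\<exists>A R p. e < R \<and> (\<forall>S\<ge>4. cmd_ok R S A) \<and>
        (\<forall>c h T. ready R \<Gamma> m e c (h, T) \<longrightarrow> runs A (h, T) (poly p (csize \<Gamma> c)) (h(e := f c - 1), T))"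
    proof (intro exI[of _ "A ;; go_left e"] exI[of _ R] exI[of _ "q + 1"] conjI allI impI)
      fix c h T assume r: "ready R \<Gamma> m e c (h, T)"
      from runs_Seq[OF A(3)[OF r] runs_go_left[of e]]
      show "runs (A ;; go_left e) (h, T) (poly (q + 1) (csize \<Gamma> c)) (h(e := f c - 1), T)" by simp
    qed (use A in auto)
  qed (use le_trans[OF diff_le_self p] in blast)
qed

lemma pf_const: "pf \<Gamma> (\<lambda>c. k)"
  by (induction k) (auto intro: pf_zero pf_Suc)

lemma pf_var:
  assumes "v \<in> set (snd (snd \<Gamma>))" shows "pf \<Gamma> v"
proof (rule pfI[where p = "[:0, 1:]"])
  obtain Z Y vs where G: "\<Gamma> = (Z, Y, vs)" by (metis surj_pair)
  have v: "v c \<le> csize \<Gamma> c" for c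
    using assms member_le_sum_list[of "v c" "map (\<lambda>v. v c) vs"] by (auto simp: G csize_def trans_le_add2)
  then show "v c \<le> poly [:0, 1:] (csize \<Gamma> c)" for c by simp
  fix m e assume l: "layout \<Gamma> m e"
  obtain i where i: "i < length vs" "vs ! i = v" using assms G by (auto simp: in_set_conv_nth)
  have "m ! i \<in> set m" using i l by (auto simp: layout_def G)
  then have mi: "3 \<le> m ! i" "m ! i < e" "3 \<le> e" using l by (auto simp: layout_def)
  show "\<exists>A R p. e < R \<and> (\<forall>S\<ge>4. cmd_ok R S A) \<and>
        (\<forall>c h T. ready R \<Gamma> m e c (h, T) \<longrightarrow> runs A (h, T) (poly p (csize \<Gamma> c)) (h(e := v c), T))"
  proof (intro exI[of _ "copy_reg (m ! i) e"] exI[of _ "e + 2"] exI[of _ "[:2, 7:]"] conjI allI impI)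
    fix c h T assume r: "ready (e + 2) \<Gamma> m e c (h, T)"
    have hv: "h (m ! i) = v c" using r i by (auto simp: ready_def G list_all2_conv_all_nth)
    have "runs (copy_reg (m ! i) e) (h, T) (2 + h (m ! i) * 7) (h(e := h (m ! i)), T)"
      using mi ready_head[OF r] ready_reg[OF r] by (intro runs_copy_reg) auto
    then show "runs (copy_reg (m ! i) e) (h, T) (poly [:2, 7:] (csize \<Gamma> c)) (h(e := v c), T)"
      unfolding hv by (rule runs_mono) (use v[of c] in simp)
  qed (use mi in auto)
qed

lemma pf_len:
  fixes j :: nat
  assumes "\<And>c. Z c = (if j = 0 then fst \<Gamma> c else fst (snd \<Gamma>) c)" "j < 2"
  shows "pf \<Gamma> (\<lambda>c. length (Z c))"
proof (rule pfI[where p = "[:0, 1:]"])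
  have v: "length (Z c) \<le> csize \<Gamma> c" for c using assms by (auto simp: csize_def split: prod.splits)
  then show "length (Z c) \<le> poly [:0, 1:] (csize \<Gamma> c)" for c by simp
  fix m e assume l: "layout \<Gamma> m e"
  show "\<exists>A R p. e < R \<and> (\<forall>S\<ge>4. cmd_ok R S A) \<and>
        (\<forall>c h T. ready R \<Gamma> m e c (h, T) \<longrightarrow> runs A (h, T) (poly p (csize \<Gamma> c)) (h(e := length (Z c)), T))"
  proof (intro exI[of _ "len_tape j e"] exI[of _ "e + 2"] exI[of _ "[:2, 7:]"] conjI allI impI)
    fix c h T assume r: "ready (e + 2) \<Gamma> m e c (h, T)"
    have "T j = str_tape (Z c)" "h j = 0" using r assms by (auto simp: ready_def less_2_cases_iff split: prod.splits)
    then have "runs (len_tape j e) (h, T) (2 + length (Z c) * 7) (h(e := length (Z c)), T)"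
      using assms l ready_head[OF r] ready_reg[OF r] by (intro runs_len_tape) (auto simp: layout_def)
    then show "runs (len_tape j e) (h, T) (poly [:2, 7:] (csize \<Gamma> c)) (h(e := length (Z c)), T)"
      by (rule runs_mono) (use v[of c] in simp)
  qed (use assms l in \<open>auto simp: layout_def\<close>)
qed

lemma pf_read:
  fixes j :: nat
  assumes "\<And>c. Z c = (if j = 0 then fst \<Gamma> c else fst (snd \<Gamma>) c)" "j < 2" "pf \<Gamma> f"
  shows "pf \<Gamma> (\<lambda>c. str_tape (Z c) (f c))"
proof -
  obtain p where p: "\<And>c. f c \<le> poly p (csize \<Gamma> c)" using pf_bound[OF assms(3)] by blast
  show ?thesis
  proof (rule pfI[where p = "[:2:]"])
    show "str_tape (Z c) (f c) \<le> poly [:2:] (csize \<Gamma> c)" for c by (simp add: str_tape_le)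
    fix m e assume l: "layout \<Gamma> m e"
    obtain A R q where A: "e < R" "\<And>S. S \<ge> 4 \<Longrightarrow> cmd_ok R S A"
      "\<And>c h T. ready R \<Gamma> m e c (h, T) \<Longrightarrow> runs A (h, T) (poly q (csize \<Gamma> c)) (h(e := f c), T)"
      by (rule pf_cmd[OF assms(3) l]) (rule that)
    show "\<exists>A R p. e < R \<and> (\<forall>S\<ge>4. cmd_ok R S A) \<and>
        (\<forall>c h T. ready R \<Gamma> m e c (h, T) \<longrightarrow>
          runs A (h, T) (poly p (csize \<Gamma> c)) (h(e := str_tape (Z c) (f c)), T))"
    proof (intro exI[of _ "A ;; read_tape j e"] exI[of _ "R + 2"] exI[of _ "q + (10 + 7 * p)"] conjI allI impI)
      fix c h T assume r: "ready (R + 2) \<Gamma> m e c (h, T)"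
      have r': "ready R \<Gamma> m e c (h, T)" using ready_upd[OF r l, of R h e] ready_head[OF r] by auto
      let ?h = "h(e := f c)"
      have "T j = str_tape (Z c)" "h j = 0" using r assms by (auto simp: ready_def less_2_cases_iff split: prod.splits)
      then have "runs (read_tape j e) (?h, T) (10 + ?h e * 7) (?h(e := str_tape (Z c) (?h e)), T)"
        using assms l ready_head[OF r] ready_reg[OF r] A(1) by (intro runs_read_tape) (auto simp: layout_def)
      from runs_Seq[OF A(3)[OF r'] this]
      show "runs (A ;; read_tape j e) (h, T) (poly (q + (10 + 7 * p)) (csize \<Gamma> c)) (h(e := str_tape (Z c) (f c)), T)"
        unfolding fun_upd_upd fun_upd_same by (rule runs_mono) (use p[of c] in simp)
    qed (use A l assms(2) in \<open>auto simp: layout_def intro: cmd_ok_mono[OF A(2)]\<close>)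
  qed
qed

lemma pf_if:
  assumes "pf \<Gamma> f" "pf \<Gamma> a" "pf \<Gamma> b"
  shows "pf \<Gamma> (\<lambda>c. if f c \<noteq> 0 then a c else b c)"
proof -
  obtain pf' where pf': "\<And>c. f c \<le> poly pf' (csize \<Gamma> c)" using pf_bound[OF assms(1)] by blast
  obtain pa where pa: "\<And>c. a c \<le> poly pa (csize \<Gamma> c)" using pf_bound[OF assms(2)] by blast
  obtain pb where pb: "\<And>c. b c \<le> poly pb (csize \<Gamma> c)" using pf_bound[OF assms(3)] by blast
  show ?thesis
  proof (rule pfI[where p = "pa + pb"])
    show "(if f c \<noteq> 0 then a c else b c) \<le> poly (pa + pb) (csize \<Gamma> c)" for c
      using pa[of c] pb[of c] by simp
    fix m e assume l: "layout \<Gamma> m e"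
    obtain F R1 q1 where F: "e < R1" "\<And>S. S \<ge> 4 \<Longrightarrow> cmd_ok R1 S F"
      "\<And>c h T. ready R1 \<Gamma> m e c (h, T) \<Longrightarrow> runs F (h, T) (poly q1 (csize \<Gamma> c)) (h(e := f c), T)"
      by (rule pf_cmd[OF assms(1) l]) (rule that)
    obtain A R2 q2 where A: "e < R2" "\<And>S. S \<ge> 4 \<Longrightarrow> cmd_ok R2 S A"
      "\<And>c h T. ready R2 \<Gamma> m e c (h, T) \<Longrightarrow> runs A (h, T) (poly q2 (csize \<Gamma> c)) (h(e := a c), T)"
      by (rule pf_cmd[OF assms(2) l]) (rule that)
    obtain B R3 q3 where B: "e < R3" "\<And>S. S \<ge> 4 \<Longrightarrow> cmd_ok R3 S B"
      "\<And>c h T. ready R3 \<Gamma> m e c (h, T) \<Longrightarrow> runs B (h, T) (poly q3 (csize \<Gamma> c)) (h(e := b c), T)"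
      by (rule pf_cmd[OF assms(3) l]) (rule that)
    let ?R = "R1 + R2 + R3"
    show "\<exists>A R p. e < R \<and> (\<forall>S\<ge>4. cmd_ok R S A) \<and>
        (\<forall>c h T. ready R \<Gamma> m e c (h, T) \<longrightarrow>
          runs A (h, T) (poly p (csize \<Gamma> c)) (h(e := if f c \<noteq> 0 then a c else b c), T))"
    proof (intro exI[of _ "F ;; Ite e (\<lambda>a. a \<noteq> 1) (clear_reg e ;; A) B"] exI[of _ ?R]
        exI[of _ "q1 + (2 + 3 * pf' + q2 + q3)"] conjI allI impI)
      fix c h T assume r: "ready ?R \<Gamma> m e c (h, T)"
      have r1: "ready R1 \<Gamma> m e c (h, T)" and r2: "ready R2 \<Gamma> m e c (h, T)" and r3: "ready R3 \<Gamma> m e c (h, T)"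
        using ready_upd[OF r l, of _ h e] ready_head[OF r] by auto
      have e: "T e = reg_tape" using ready_reg[OF r, of e] l F(1) by (auto simp: layout_def)
      let ?h = "h(e := f c)"
      have e0: "h(e := 0) = h" using ready_head[OF r, of e] F(1) by (auto simp: fun_eq_iff)
      have "runs (Ite e (\<lambda>a. a \<noteq> 1) (clear_reg e ;; A) B) (?h, T)
        (poly (2 + 3 * pf' + q2 + q3) (csize \<Gamma> c)) (h(e := if f c \<noteq> 0 then a c else b c), T)"
      proof (cases "f c = 0")
        case False
        have "runs (clear_reg e) (?h, T) (Suc (f c * 3)) (h, T)"
          using runs_clear[of T e ?h, OF e] e0 by simp
        from runs_Seq[OF this A(3)[OF r2]]
        have "runs (Ite e (\<lambda>a. a \<noteq> 1) (clear_reg e ;; A) B) (?h, T)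
          (Suc (Suc (f c * 3) + poly q2 (csize \<Gamma> c))) (h(e := a c), T)"
          by (intro runs_IteT) (use False e in auto)
        then show ?thesis using False pf'[of c] by (auto elim!: runs_mono)
      next
        case True
        have "runs (Ite e (\<lambda>a. a \<noteq> 1) (clear_reg e ;; A) B) (?h, T)
          (Suc (poly q3 (csize \<Gamma> c))) (h(e := b c), T)"
          using B(3)[OF r3] True e e0 ready_head[OF r, of e] F(1)
          by (intro runs_IteF) (auto simp: trans_less_add1)
        then show ?thesis using True by (auto elim!: runs_mono)
      qed
      from runs_Seq[OF F(3)[OF r1] this]
      show "runs (F ;; Ite e (\<lambda>a. a \<noteq> 1) (clear_reg e ;; A) B) (h, T)
        (poly (q1 + (2 + 3 * pf' + q2 + q3)) (csize \<Gamma> c)) (h(e := if f c \<noteq> 0 then a c else b c), T)"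
        by simp
    qed (use F A B l in \<open>auto simp: layout_def intro: cmd_ok_mono[OF F(2)] cmd_ok_mono[OF A(2)] cmd_ok_mono[OF B(2)]\<close>)
  qed
qed

text \<open>The hypothesis \<open>bd\<close> bounds all intermediate values by one polynomial;
  without such a bound, iterated doubling would leave the class.\<close>

lemma pf_rec:
  assumes n: "pf \<Gamma> n" and a: "pf \<Gamma> a" and b: "pf (ext (ext \<Gamma>)) (\<lambda>p. b (fst (fst p)) (snd (fst p)) (snd p))"
    and bd: "\<And>c i. i \<le> n c \<Longrightarrow> rec_nat (a c) (b c) i \<le> poly q (csize \<Gamma> c)"
  shows "pf \<Gamma> (\<lambda>c. rec_nat (a c) (b c) (n c))"
proof -
  obtain pn where pn: "\<And>c. n c \<le> poly pn (csize \<Gamma> c)" using pf_bound[OF n] by blast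
  show ?thesis
  proof (rule pfI[where p = q])
    show "rec_nat (a c) (b c) (n c) \<le> poly q (csize \<Gamma> c)" for c by (rule bd) simp
    fix m e assume l: "layout \<Gamma> m e"
    have l1: "layout \<Gamma> m (e + 1)" "layout \<Gamma> m (e + 3)" using layout_mono[OF l] by auto
    have le: "3 \<le> e" using l by (simp add: layout_def)
    have l3: "layout (ext (ext \<Gamma>)) (e # (e + 2) # m) (e + 3)"
      using le by (intro layout_ext l1) auto
    obtain A R1 q1 where A: "e < R1" "\<And>S. S \<ge> 4 \<Longrightarrow> cmd_ok R1 S A"
      "\<And>c h T. ready R1 \<Gamma> m e c (h, T) \<Longrightarrow> runs A (h, T) (poly q1 (csize \<Gamma> c)) (h(e := a c), T)"
      by (rule pf_cmd[OF a l]) (rule that)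
    obtain N R2 q2 where N: "e + 1 < R2" "\<And>S. S \<ge> 4 \<Longrightarrow> cmd_ok R2 S N"
      "\<And>c h T. ready R2 \<Gamma> m (e + 1) c (h, T) \<Longrightarrow>
         runs N (h, T) (poly q2 (csize \<Gamma> c)) (h(e + 1 := n c), T)"
      by (rule pf_cmd[OF n l1(1)]) (rule that)
    obtain B R3 q3 where B: "e + 3 < R3" "\<And>S. S \<ge> 4 \<Longrightarrow> cmd_ok R3 S B"
      "\<And>p h T. ready R3 (ext (ext \<Gamma>)) (e # (e + 2) # m) (e + 3) p (h, T) \<Longrightarrow>
         runs B (h, T) (poly q3 (csize (ext (ext \<Gamma>)) p))
           (h(e + 3 := b (fst (fst p)) (snd (fst p)) (snd p)), T)"
      by (rule pf_cmd[OF b l3]) (rule that)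
    let ?R = "R1 + R2 + R3 + (e + 4)"
    \<comment> \<open>Register \<open>e\<close> holds the accumulator, \<open>e + 1\<close> counts
      down and \<open>e + 2\<close> is the recursion index; the next value is computed in
      \<open>e + 3\<close> and then replaces the accumulator.\<close>
    let ?D = "B ;; clear_reg e ;; move_reg (e + 3) e ;; go_right (e + 2)"
    let ?P = "A ;; N ;; while_pos (e + 1) ?D ;; clear_reg (e + 2)"
    let ?tb = "pcompose q3 ([:0, 1:] + pn + q) + (3 + 6 * q)"
    let ?p = "q1 + (q2 + ((1 + pn * (?tb + 2)) + (1 + 3 * pn)))"
    show "\<exists>A R p. e < R \<and> (\<forall>S\<ge>4. cmd_ok R S A) \<and>
        (\<forall>c h T. ready R \<Gamma> m e c (h, T) \<longrightarrow>
          runs A (h, T) (poly p (csize \<Gamma> c)) (h(e := rec_nat (a c) (b c) (n c)), T))"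
    proof (intro exI[of _ ?P] exI[of _ ?R] exI[of _ ?p] conjI allI impI)
      fix c h T assume r: "ready ?R \<Gamma> m e c (h, T)"
      define acc where "acc = rec_nat (a c) (b c)"
      let ?cs = "csize \<Gamma> c"
      have r1: "ready R1 \<Gamma> m e c (h, T)"
        using ready_upd[OF r l, of _ h e] ready_head[OF r] by auto
      have r2: "ready R2 \<Gamma> m (e + 1) c (h(e := a c), T)"
        using ready_head[OF r] by (intro ready_upd[OF r l]) auto
      have reg: "T e = reg_tape" "T (e + 1) = reg_tape" "T (e + 2) = reg_tape" "T (e + 3) = reg_tape"
        using le by (auto intro!: ready_reg[OF r])
      have h0: "h e = 0" "h (e + 1) = 0" "h (e + 2) = 0" "h (e + 3) = 0"
        by (auto intro!: ready_head[OF r])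
      let ?s = "\<lambda>i. (h(e := acc i, e + 1 := n c - i, e + 2 := i), T)"
      have D: "runs ?D ((fst (?s i))(e + 1 := n c - Suc i), snd (?s i)) (poly ?tb ?cs) (?s (Suc i))"
        if i: "i < n c" for i
      proof -
        let ?h = "h(e := acc i, e + 1 := n c - Suc i, e + 2 := i)"
        have "ready R3 \<Gamma> m (e + 3) c (?h, T)"
          using ready_head[OF r] by (intro ready_upd[OF r l]) auto
        then have "ready R3 (ext (ext \<Gamma>)) (e # (e + 2) # m) (e + 3) ((c, i), acc i) (?h, T)"
          by (intro ready_ext) auto
        from B(3)[OF this]
        have 1: "runs B (?h, T) (poly q3 (?cs + i + acc i)) (?h(e + 3 := acc (Suc i)), T)"
          by (simp add: acc_def)
        let ?h1 = "?h(e + 3 := acc (Suc i))"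
        let ?h2 = "?h1(e := 0)"
        let ?h3 = "?h2(e + 3 := 0, e := ?h2 e + ?h2 (e + 3))"
        have 2: "runs (clear_reg e) (?h1, T) (Suc (acc i * 3)) (?h2, T)"
          using runs_clear[of T e ?h1, OF reg(1)] by simp
        have 3: "runs (move_reg (e + 3) e) (?h2, T) (Suc (acc (Suc i) * 3)) (?h3, T)"
          using runs_move_reg[of T "e + 3" e ?h2, OF reg(4)] by simp
        have 4: "?h3(e + 2 := Suc (?h3 (e + 2))) = fst (?s (Suc i))"
          using h0 by (auto simp: fun_eq_iff)
        have 5: "(fst (?s i))(e + 1 := n c - Suc i) = ?h" by (auto simp: fun_eq_iff)
        have ac: "acc i \<le> poly q ?cs" "acc (Suc i) \<le> poly q ?cs" "i \<le> poly pn ?cs"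
          using bd[of i c] bd[of "Suc i" c] i pn[of c] by (auto simp: acc_def)
        then have "poly q3 (?cs + i + acc i) \<le> poly q3 (?cs + poly pn ?cs + poly q ?cs)"
          by (intro poly_mono_nat) simp
        then have t: "poly q3 (?cs + i + acc i) + (Suc (acc i * 3) + (Suc (acc (Suc i) * 3) + 1)) \<le> poly ?tb ?cs"
          using ac by (simp add: poly_pcompose)
        from runs_Seq[OF 1 runs_Seq[OF 2 runs_Seq[OF 3 runs_go_right[of "e + 2" ?h3 T]]]]
        show ?thesis unfolding 4 5 snd_conv using t by (auto elim!: runs_mono)
      qed
      have W: "runs (while_pos (e + 1) ?D) (?s 0) (Suc ((fst (?s 0)) (e + 1) * (poly ?tb ?cs + 2)))
          (?s ((fst (?s 0)) (e + 1)))"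
        by (rule runs_while_pos[where \<sigma> = ?s and ?h0.0 = "fst (?s 0)" and r = "e + 1"])
          (use reg D in auto)
      have s0: "h(e := a c, e + 1 := n c) = fst (?s 0)"
        using h0 by (auto simp: fun_eq_iff acc_def)
      have sn: "(fst (?s (n c)))(e + 2 := 0) = h(e := acc (n c))"
        using h0 by (auto simp: fun_eq_iff)
      have s0n: "(fst (?s 0)) (e + 1) = n c" by simp
      have W': "runs (while_pos (e + 1) ?D) (h(e := a c, e + 1 := n c), T)
          (Suc (n c * (poly ?tb ?cs + 2))) (fst (?s (n c)), T)"
        using W unfolding s0n s0 by simp
      have C: "runs (clear_reg (e + 2)) (fst (?s (n c)), T) (Suc (n c * 3)) (h(e := acc (n c)), T)"
        using runs_clear[of T "e + 2" "fst (?s (n c))", OF reg(3)] unfolding sn by simp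
      from runs_Seq[OF A(3)[OF r1] runs_Seq[OF N(3)[OF r2] runs_Seq[OF W' C]]]
      have "runs ?P (h, T) (poly q1 ?cs + (poly q2 ?cs +
          (Suc (n c * (poly ?tb ?cs + 2)) + Suc (n c * 3)))) (h(e := acc (n c)), T)" .
      moreover have "poly q1 ?cs + (poly q2 ?cs + (Suc (n c * (poly ?tb ?cs + 2)) + Suc (n c * 3)))
          \<le> poly ?p ?cs"
      proof -
        have "n c * (poly ?tb ?cs + 2) \<le> poly pn ?cs * (poly ?tb ?cs + 2)" using pn[of c] by (rule mult_le_mono1)
        moreover have "poly (?tb + 2) ?cs = poly ?tb ?cs + 2" by simp
        ultimately show ?thesis using pn[of c] by (simp only: poly_add poly_mult poly_1 poly_numeral)
      qed
      ultimately show "runs ?P (h, T) (poly ?p ?cs) (h(e := rec_nat (a c) (b c) (n c)), T)"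
        unfolding acc_def by (rule runs_mono)
    qed (use A N B le in \<open>auto intro: cmd_ok_mono[OF A(2)] cmd_ok_mono[OF N(2)] cmd_ok_mono[OF B(2)]\<close>)
  qed
qed

lemma pf_weak:
  assumes "pf \<Gamma> f" shows "pf (ext \<Gamma>) (\<lambda>p. f (fst p))"
proof -
  obtain p where p: "\<And>c. f c \<le> poly p (csize \<Gamma> c)" using pf_bound[OF assms] by blast
  have le: "poly q (csize \<Gamma> c) \<le> poly q (csize (ext \<Gamma>) (c, i))" for q c i by (rule poly_mono_nat) simp
  show ?thesis
  proof (rule pfI[where p = p])
    show "f (fst c) \<le> poly p (csize (ext \<Gamma>) c)" for c
      using p[of "fst c"] le[of p "fst c" "snd c"] by simp
    fix m e assume l: "layout (ext \<Gamma>) m e"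
    then obtain r m' where m: "m = r # m'" by (cases m) (auto simp: layout_def ext_def)
    have l': "layout \<Gamma> m' e" using l m by (auto simp: layout_def ext_def)
    obtain A R q where A: "e < R" "\<And>S. S \<ge> 4 \<Longrightarrow> cmd_ok R S A"
      "\<And>c h T. ready R \<Gamma> m' e c (h, T) \<Longrightarrow> runs A (h, T) (poly q (csize \<Gamma> c)) (h(e := f c), T)"
      by (rule pf_cmd[OF assms l']) (rule that)
    show "\<exists>A R p. e < R \<and> (\<forall>S\<ge>4. cmd_ok R S A) \<and>
        (\<forall>c h T. ready R (ext \<Gamma>) m e c (h, T) \<longrightarrow>
          runs A (h, T) (poly p (csize (ext \<Gamma>) c)) (h(e := f (fst c)), T))"
    proof (intro exI[of _ A] exI[of _ R] exI[of _ q] conjI allI impI)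
      fix c h T assume "ready R (ext \<Gamma>) m e c (h, T)"
      then have "ready R \<Gamma> m' e (fst c) (h, T)"
        by (auto simp: ready_def ext_def m list.rel_map comp_def split: prod.splits)
      from A(3)[OF this] show "runs A (h, T) (poly q (csize (ext \<Gamma>) c)) (h(e := f (fst c)), T)"
        by (rule runs_mono) (use le[of q "fst c" "snd c"] in simp)
    qed (use A in auto)
  qed
qed

lemma pf_snd: "pf (ext \<Gamma>) (\<lambda>p. snd p)"
  by (rule pf_var) (simp add: ext_def)

lemma pf_cong: "pf \<Gamma> f \<Longrightarrow> (\<And>c. f c = g c) \<Longrightarrow> pf \<Gamma> g"
  by (metis ext)

section \<open>Arithmetic on bounded numbers\<close>

lemma pf_add:
  assumes "pf \<Gamma> a" "pf \<Gamma> b" shows "pf \<Gamma> (\<lambda>c. a c + b c)"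
proof -
  obtain pa where pa: "\<And>c. a c \<le> poly pa (csize \<Gamma> c)" using pf_bound[OF assms(1)] by blast
  obtain pb where pb: "\<And>c. b c \<le> poly pb (csize \<Gamma> c)" using pf_bound[OF assms(2)] by blast
  have r: "rec_nat x (\<lambda>i. Suc) n = x + n" for x n by (induction n) auto
  have "pf \<Gamma> (\<lambda>c. rec_nat (a c) ((\<lambda>c i. Suc) c) (b c))"
    by (rule pf_rec[OF assms(2,1), where q = "pa + pb"])
      (auto intro: pf_Suc pf_snd simp: r pa pb intro!: add_mono le_trans[OF _ pb])
  then show ?thesis by (rule pf_cong) (simp add: r)
qed

lemma pf_mult:
  assumes "pf \<Gamma> a" "pf \<Gamma> b" shows "pf \<Gamma> (\<lambda>c. a c * b c)"
proof -
  obtain pa where pa: "\<And>c. a c \<le> poly pa (csize \<Gamma> c)" using pf_bound[OF assms(1)] by blast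
  obtain pb where pb: "\<And>c. b c \<le> poly pb (csize \<Gamma> c)" using pf_bound[OF assms(2)] by blast
  have r: "rec_nat 0 (\<lambda>i acc. acc + x) n = x * n" for x n :: nat by (induction n) auto
  have "pf \<Gamma> (\<lambda>c. rec_nat 0 ((\<lambda>c i acc. acc + a c) c) (b c))"
  proof (rule pf_rec[OF assms(2) pf_zero, where q = "pa * pb"])
    show "pf (ext (ext \<Gamma>)) (\<lambda>p. snd p + a (fst (fst p)))"
      by (rule pf_add[OF pf_snd pf_weak[OF pf_weak[OF assms(1)]]])
    show "rec_nat 0 (\<lambda>i acc. acc + a c) i \<le> poly (pa * pb) (csize \<Gamma> c)" if "i \<le> b c" for c i
      unfolding r poly_mult using that by (intro mult_mono pa le_trans[OF _ pb]) auto
  qed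
  then show ?thesis by (rule pf_cong) (simp add: r)
qed

lemma pf_sub:
  assumes "pf \<Gamma> a" "pf \<Gamma> b" shows "pf \<Gamma> (\<lambda>c. a c - b c)"
proof -
  obtain pa where pa: "\<And>c. a c \<le> poly pa (csize \<Gamma> c)" using pf_bound[OF assms(1)] by blast
  have r: "rec_nat x (\<lambda>i acc. acc - 1) n = x - n" for x n :: nat by (induction n) auto
  have "pf \<Gamma> (\<lambda>c. rec_nat (a c) ((\<lambda>c i acc. acc - 1) c) (b c))"
  proof (rule pf_rec[OF assms(2,1), where q = "pa"])
    show "pf (ext (ext \<Gamma>)) (\<lambda>p. snd p - 1)" by (rule pf_pred[OF pf_snd])
    show "rec_nat (a c) (\<lambda>i acc. acc - 1) i \<le> poly pa (csize \<Gamma> c)" for c i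
      unfolding r by (rule le_trans[OF diff_le_self pa])
  qed
  then show ?thesis by (rule pf_cong) (use r in simp)
qed

section \<open>Predicates, bounded sums and bounded quantifiers\<close>

definition pfb :: "'c ctx \<Rightarrow> ('c \<Rightarrow> bool) \<Rightarrow> bool" where
  "pfb \<Gamma> P \<longleftrightarrow> pf \<Gamma> (\<lambda>c. if P c then 1 else 0)"

lemma pfb_cong: "pfb \<Gamma> f \<Longrightarrow> (\<And>c. f c = g c) \<Longrightarrow> pfb \<Gamma> g"
  unfolding pfb_def by (erule pf_cong) simp

lemma pf_ifb: "pfb \<Gamma> P \<Longrightarrow> pf \<Gamma> a \<Longrightarrow> pf \<Gamma> b \<Longrightarrow> pf \<Gamma> (\<lambda>c. if P c then a c else b c)"
  unfolding pfb_def by (rule pf_cong[OF pf_if[of \<Gamma> "\<lambda>c. if P c then 1 else 0" a b]]) auto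

lemma pfb_const: "pfb \<Gamma> (\<lambda>c. B)"
  unfolding pfb_def by (rule pf_const)

lemma pfb_nonzero: "pf \<Gamma> a \<Longrightarrow> pfb \<Gamma> (\<lambda>c. a c \<noteq> 0)"
  unfolding pfb_def by (rule pf_if) (auto intro: pf_const)

lemma pfb_ifb: "pfb \<Gamma> P \<Longrightarrow> pfb \<Gamma> a \<Longrightarrow> pfb \<Gamma> b \<Longrightarrow> pfb \<Gamma> (\<lambda>c. if P c then a c else b c)"
  unfolding pfb_def[of _ a] pfb_def[of _ b] pfb_def[of _ "\<lambda>c. if P c then a c else b c"]
  by (rule pf_cong[OF pf_ifb[of \<Gamma> P "\<lambda>c. if a c then 1 else 0" "\<lambda>c. if b c then 1 else 0"]]) auto

lemma pfb_not: "pfb \<Gamma> P \<Longrightarrow> pfb \<Gamma> (\<lambda>c. \<not> P c)"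
  by (rule pfb_cong[OF pfb_ifb[OF _ pfb_const[of _ False] pfb_const[of _ True]]]) auto

lemma pfb_conj: "pfb \<Gamma> P \<Longrightarrow> pfb \<Gamma> Q \<Longrightarrow> pfb \<Gamma> (\<lambda>c. P c \<and> Q c)"
  by (rule pfb_cong[OF pfb_ifb[of \<Gamma> P Q, OF _ _ pfb_const[of _ False]]]) auto

lemma pfb_disj: "pfb \<Gamma> P \<Longrightarrow> pfb \<Gamma> Q \<Longrightarrow> pfb \<Gamma> (\<lambda>c. P c \<or> Q c)"
  by (rule pfb_cong[OF pfb_ifb[of \<Gamma> P _ Q, OF _ pfb_const[of _ True]]]) auto

lemma pfb_imp: "pfb \<Gamma> P \<Longrightarrow> pfb \<Gamma> Q \<Longrightarrow> pfb \<Gamma> (\<lambda>c. P c \<longrightarrow> Q c)"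
  by (rule pfb_cong[OF pfb_ifb[of \<Gamma> P Q, OF _ _ pfb_const[of _ True]]]) auto

lemma pfb_le: "pf \<Gamma> a \<Longrightarrow> pf \<Gamma> b \<Longrightarrow> pfb \<Gamma> (\<lambda>c. a c \<le> b c)"
  by (rule pfb_cong[OF pfb_not[OF pfb_nonzero[OF pf_sub[of \<Gamma> a b]]]]) auto

lemma pfb_less: "pf \<Gamma> a \<Longrightarrow> pf \<Gamma> b \<Longrightarrow> pfb \<Gamma> (\<lambda>c. a c < b c)"
  by (rule pfb_cong[OF pfb_not[OF pfb_le[of \<Gamma> b a]]]) auto

lemma pfb_eq: "pf \<Gamma> a \<Longrightarrow> pf \<Gamma> b \<Longrightarrow> pfb \<Gamma> (\<lambda>c. a c = b c)"
  by (rule pfb_cong[OF pfb_conj[OF pfb_le[of \<Gamma> a b] pfb_le[of \<Gamma> b a]]]) auto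

lemma pf_sum:
  assumes n: "pf \<Gamma> n" and g: "pf (ext \<Gamma>) (\<lambda>p. g (fst p) (snd p))"
  shows "pf \<Gamma> (\<lambda>c. \<Sum>i<n c. g c i)"
proof -
  obtain pn where pn: "\<And>c. n c \<le> poly pn (csize \<Gamma> c)" using pf_bound[OF n] by blast
  obtain pg where "\<And>p. g (fst p) (snd p) \<le> poly pg (csize (ext \<Gamma>) p)" using pf_bound[OF g] by blast
  then have pg: "g c i \<le> poly pg (csize \<Gamma> c + i)" for c i by (metis csize_ext fst_conv snd_conv)
  have r: "rec_nat 0 (\<lambda>i acc. acc + f i) k = (\<Sum>i<k. f i)" for f :: "nat \<Rightarrow> nat" and k
    by (induction k) auto
  have "pf \<Gamma> (\<lambda>c. rec_nat 0 ((\<lambda>c i acc. acc + g c i) c) (n c))"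
  proof (rule pf_rec[OF n pf_zero, where q = "pn * pcompose pg ([:0, 1:] + pn)"])
    show "pf (ext (ext \<Gamma>)) (\<lambda>p. snd p + g (fst (fst p)) (snd (fst p)))"
      by (rule pf_add[OF pf_snd pf_weak[OF g]])
    fix c k assume k: "k \<le> n c"
    have "(\<Sum>i<k. g c i) \<le> of_nat (card {..<k}) * poly pg (csize \<Gamma> c + poly pn (csize \<Gamma> c))"
      using k pn[of c] by (intro sum_bounded_above le_trans[OF pg] poly_mono_nat) auto
    also have "\<dots> \<le> poly pn (csize \<Gamma> c) * poly pg (csize \<Gamma> c + poly pn (csize \<Gamma> c))"
      using k pn[of c] by (intro mult_le_mono1) simp
    finally show "rec_nat 0 (\<lambda>i acc. acc + g c i) k \<le> poly (pn * pcompose pg ([:0, 1:] + pn)) (csize \<Gamma> c)"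
      by (simp add: r poly_pcompose)
  qed
  then show ?thesis by (rule pf_cong) (simp add: r)
qed

lemma pfb_ex:
  assumes "pf \<Gamma> n" "pfb (ext \<Gamma>) (\<lambda>p. P (fst p) (snd p))"
  shows "pfb \<Gamma> (\<lambda>c. \<exists>i<n c. P c i)"
proof -
  have "pf \<Gamma> (\<lambda>c. \<Sum>i<n c. if P c i then 1 else 0)"
    by (rule pf_sum[OF assms(1)]) (use assms(2) in \<open>simp add: pfb_def\<close>)
  from pfb_nonzero[OF this] show ?thesis by (rule pfb_cong) auto
qed

lemma pfb_all:
  assumes "pf \<Gamma> n" "pfb (ext \<Gamma>) (\<lambda>p. P (fst p) (snd p))"
  shows "pfb \<Gamma> (\<lambda>c. \<forall>i<n c. P c i)"
  by (rule pfb_cong[OF pfb_not[OF pfb_ex[OF assms(1) pfb_not[OF assms(2)]]]]) auto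

lemma pf_div:
  assumes "pf \<Gamma> a" "pf \<Gamma> b" shows "pf \<Gamma> (\<lambda>c. a c div b c)"
proof -
  \<comment> \<open>The quotient is the number of positive multiples of \<open>y\<close> up to
    \<open>x\<close>; the case distinction reproduces the value 0 of a division by 0.\<close>
  have d: "x div y = (if y \<noteq> 0 then \<Sum>i<x. if Suc i * y \<le> x then 1 else 0 else 0)" for x y :: nat
  proof (cases "y = 0")
    case False
    then have "(Suc i * y \<le> x) = (i < x div y)" for i
      by (metis Suc_le_eq less_eq_div_iff_mult_less_eq neq0_conv)
    moreover have "x div y \<le> x" by simp
    moreover have "(\<Sum>i<x. if i < k then 1 else 0) = k" if "k \<le> x" for k
    proof -
      have "(\<Sum>i<x. if i < k then 1 else 0) = (\<Sum>i<k. 1 :: nat)"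
        using that by (intro sum.mono_neutral_cong_right) auto
      then show ?thesis by simp
    qed
    ultimately show ?thesis using False by simp
  qed simp
  note w = pf_weak[OF assms(1)] pf_weak[OF assms(2)]
  have "pf \<Gamma> (\<lambda>c. if b c \<noteq> 0 then \<Sum>i<a c. if Suc i * b c \<le> a c then 1 else 0 else 0)"
    by (intro pf_if assms pf_zero pf_sum pf_ifb pfb_le pf_mult pf_Suc pf_snd w pf_const)
  then show ?thesis by (rule pf_cong) (metis d)
qed

lemma pf_mod:
  assumes "pf \<Gamma> a" "pf \<Gamma> b" shows "pf \<Gamma> (\<lambda>c. a c mod b c)"
proof -
  have "pf \<Gamma> (\<lambda>c. a c - a c div b c * b c)" by (intro pf_sub pf_mult pf_div assms)
  then show ?thesis by (rule pf_cong) (simp add: minus_div_mult_eq_mod)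
qed

lemma pf_poly:
  assumes "pf \<Gamma> a" shows "pf \<Gamma> (\<lambda>c. poly p (a c))"
  by (induction p) (auto intro!: pf_add pf_mult pf_const assms)

lemma pf_power_const:
  assumes "pf \<Gamma> a" shows "pf \<Gamma> (\<lambda>c. a c ^ k)"
  by (induction k) (auto intro!: pf_mult pf_const[of _ 1, simplified] assms)

text \<open>The power \<open>2 ^ b c\<close> may be too large for a register, so halving is iterated
  instead.\<close>

lemma pf_halve:
  assumes "pf \<Gamma> a" "pf \<Gamma> b" shows "pf \<Gamma> (\<lambda>c. a c div 2 ^ b c)"
proof -
  obtain pa where pa: "\<And>c. a c \<le> poly pa (csize \<Gamma> c)" using pf_bound[OF assms(1)] by blast
  have r: "rec_nat x (\<lambda>i acc. acc div 2) n = x div 2 ^ n" for x n :: nat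
    by (induction n) (auto simp: div_mult2_eq power_Suc2 simp del: power_Suc)
  have "pf \<Gamma> (\<lambda>c. rec_nat (a c) ((\<lambda>c i acc. acc div 2) c) (b c))"
    by (rule pf_rec[OF assms(2,1), where q = "pa"])
      (auto simp: r intro!: pf_div pf_snd pf_const le_trans[OF div_le_dividend pa])
  then show ?thesis by (rule pf_cong) (simp add: r)
qed

text \<open>The bound \<open>k\<close> is a constant, so an arbitrary \<open>f\<close> amounts to a
  finite case distinction. In this way the table of a fixed machine enters the programs, even
  through a noncomputably chosen enumeration.\<close>

lemma pf_table:
  assumes "pf \<Gamma> a" shows "pf \<Gamma> (\<lambda>c. if a c < k then f (a c) else 0)"
proof (induction k)
  case (Suc k)
  have "pf \<Gamma> (\<lambda>c. if a c = k then f k else if a c < k then f (a c) else 0)"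
    by (intro pf_ifb pfb_eq assms pf_const Suc)
  then show ?case by (rule pf_cong) auto
qed (simp add: pf_zero)

lemma pfb_table2:
  assumes "pf \<Gamma> a" "pf \<Gamma> b" shows "pfb \<Gamma> (\<lambda>c. a c < k \<and> b c < l \<and> P (a c) (b c))"
proof -
  have "pfb \<Gamma> (\<lambda>c. a c < k \<and> b c < l \<and>
     (if a c * l + b c < k * l then (\<lambda>x. if P (x div l) (x mod l) then 1 else 0) (a c * l + b c) else 0) \<noteq> (0::nat))"
    by (intro pfb_conj pfb_less pfb_nonzero pf_table pf_add pf_mult pf_const assms)
  then show ?thesis
  proof (rule pfb_cong, goal_cases)
    case (1 c)
    have "a c < k \<Longrightarrow> b c < l \<Longrightarrow> a c * l + b c < k * l"
    proof -
      assume "a c < k" "b c < l"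
      then have "a c * l + b c < Suc (a c) * l" by simp
      also have "\<dots> \<le> k * l" using \<open>a c < k\<close> by (intro mult_le_mono1) simp
      finally show ?thesis .
    qed
    then show ?case by auto
  qed
qed

section \<open>Programs that write strings\<close>

definition out_app :: "bool list \<Rightarrow> store \<Rightarrow> store" where
  "out_app bs s = (case s of (h, T) \<Rightarrow> (h(2 := h 2 + length bs),
     T(2 := (\<lambda>i. if h 2 \<le> i \<and> i < h 2 + length bs then sym_of_bit (bs ! (i - h 2)) else T 2 i))))"

lemma out_app_Nil [simp]: "out_app [] s = s"
  by (auto simp: out_app_def fun_eq_iff split: prod.splits)

lemma out_app_append: "out_app (xs @ ys) s = out_app ys (out_app xs s)"
  by (auto simp: out_app_def fun_eq_iff nth_append split: prod.splits)

definition tr :: "'c ctx \<Rightarrow> ('c \<Rightarrow> bool list) \<Rightarrow> bool" where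
  "tr \<Gamma> F \<longleftrightarrow> (\<exists>p. \<forall>c. length (F c) \<le> poly p (csize \<Gamma> c)) \<and>
     (\<forall>m e. layout \<Gamma> m e \<longrightarrow> (\<exists>A R p. e < R \<and> (\<forall>S\<ge>4. cmd_ok R S A) \<and>
        (\<forall>c h T. ready R \<Gamma> m e c (h, T) \<longrightarrow> runs A (h, T) (poly p (csize \<Gamma> c)) (out_app (F c) (h, T)))))"

lemma tr_bound: "tr \<Gamma> F \<Longrightarrow> \<exists>p. \<forall>c. length (F c) \<le> poly p (csize \<Gamma> c)"
  by (simp add: tr_def)

lemma tr_cmd:
  assumes "tr \<Gamma> F" "layout \<Gamma> m e"
  obtains A R p where "e < R" "\<And>S. S \<ge> 4 \<Longrightarrow> cmd_ok R S A"
    "\<And>c h T. ready R \<Gamma> m e c (h, T) \<Longrightarrow> runs A (h, T) (poly p (csize \<Gamma> c)) (out_app (F c) (h, T))"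
  using assms unfolding tr_def by metis

lemma trI:
  assumes "\<And>c. length (F c) \<le> poly p (csize \<Gamma> c)"
    and "\<And>m e. layout \<Gamma> m e \<Longrightarrow> \<exists>A R p. e < R \<and> (\<forall>S\<ge>4. cmd_ok R S A) \<and>
        (\<forall>c h T. ready R \<Gamma> m e c (h, T) \<longrightarrow> runs A (h, T) (poly p (csize \<Gamma> c)) (out_app (F c) (h, T)))"
  shows "tr \<Gamma> F"
  unfolding tr_def using assms by blast

lemma tr_cong: "tr \<Gamma> f \<Longrightarrow> (\<And>c. f c = g c) \<Longrightarrow> tr \<Gamma> g"
  by (metis ext)

lemma ready_out_app:
  assumes "ready R \<Gamma> m e c (h, T)" "layout \<Gamma> m e"
  shows "ready R \<Gamma> m e c (out_app bs (h, T))"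
proof -
  have "list_all2 (\<lambda>r v. h r = v c) m (snd (snd \<Gamma>))" using assms(1) by (auto simp: ready_def split: prod.splits)
  moreover have "r \<noteq> 2" if "r \<in> set m" for r using that assms(2) by (auto simp: layout_def)
  ultimately have "list_all2 (\<lambda>r v. (h(2 := k)) r = v c) m (snd (snd \<Gamma>))" for k
    by (auto simp: list_all2_conv_all_nth)
  then show ?thesis using assms by (auto simp: ready_def layout_def out_app_def split: prod.splits)
qed

lemma tr_nil: "tr \<Gamma> (\<lambda>c. [])"
proof (rule trI[where p = 0])
  fix m e show "\<exists>A R p. e < R \<and> (\<forall>S\<ge>4. cmd_ok R S A) \<and>
        (\<forall>c h T. ready R \<Gamma> m e c (h, T) \<longrightarrow> runs A (h, T) (poly p (csize \<Gamma> c)) (out_app [] (h, T)))"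
    by (intro exI[of _ nop] exI[of _ "Suc e"] exI[of _ 1]) (use runs_nop in auto)
qed auto

lemma tr_emit: "tr \<Gamma> (\<lambda>c. [b])"
proof (rule trI[where p = 1])
  fix m e assume l: "layout \<Gamma> m e"
  let ?A = "Act 2 (\<lambda>a. (sym_of_bit b, Go_Right))"
  show "\<exists>A R p. e < R \<and> (\<forall>S\<ge>4. cmd_ok R S A) \<and>
        (\<forall>c h T. ready R \<Gamma> m e c (h, T) \<longrightarrow> runs A (h, T) (poly p (csize \<Gamma> c)) (out_app [b] (h, T)))"
  proof (intro exI[of _ ?A] exI[of _ "Suc e"] exI[of _ 1] conjI allI impI)
    fix c h T
    have "(h(2 := Suc (h 2)), T(2 := (T 2)(h 2 := sym_of_bit b))) = out_app [b] (h, T)"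
      by (auto simp: out_app_def fun_eq_iff)
    then show "runs ?A (h, T) (poly 1 (csize \<Gamma> c)) (out_app [b] (h, T))"
      using runs_Act[of 2 "\<lambda>a. (sym_of_bit b, Go_Right)" h T] by simp
  qed (use l in \<open>auto simp: layout_def sym_of_bit_def\<close>)
qed auto

lemma tr_append:
  assumes "tr \<Gamma> F" "tr \<Gamma> G" shows "tr \<Gamma> (\<lambda>c. F c @ G c)"
proof -
  obtain p where p: "\<And>c. length (F c) \<le> poly p (csize \<Gamma> c)" using tr_bound[OF assms(1)] by blast
  obtain q where q: "\<And>c. length (G c) \<le> poly q (csize \<Gamma> c)" using tr_bound[OF assms(2)] by blast
  show ?thesis
  proof (rule trI[where p = "p + q"])
    fix m e assume l: "layout \<Gamma> m e"
    obtain A R1 q1 where A: "e < R1" "\<And>S. S \<ge> 4 \<Longrightarrow> cmd_ok R1 S A"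
      "\<And>c h T. ready R1 \<Gamma> m e c (h, T) \<Longrightarrow> runs A (h, T) (poly q1 (csize \<Gamma> c)) (out_app (F c) (h, T))"
      by (rule tr_cmd[OF assms(1) l]) (rule that)
    obtain B R2 q2 where B: "e < R2" "\<And>S. S \<ge> 4 \<Longrightarrow> cmd_ok R2 S B"
      "\<And>c h T. ready R2 \<Gamma> m e c (h, T) \<Longrightarrow> runs B (h, T) (poly q2 (csize \<Gamma> c)) (out_app (G c) (h, T))"
      by (rule tr_cmd[OF assms(2) l]) (rule that)
    show "\<exists>A R p. e < R \<and> (\<forall>S\<ge>4. cmd_ok R S A) \<and>
        (\<forall>c h T. ready R \<Gamma> m e c (h, T) \<longrightarrow> runs A (h, T) (poly p (csize \<Gamma> c)) (out_app (F c @ G c) (h, T)))"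
    proof (intro exI[of _ "A ;; B"] exI[of _ "R1 + R2"] exI[of _ "q1 + q2"] conjI allI impI)
      fix c h T assume r: "ready (R1 + R2) \<Gamma> m e c (h, T)"
      have r1: "ready R1 \<Gamma> m e c (h, T)" and r2: "ready R2 \<Gamma> m e c (h, T)"
        using ready_upd[OF r l, of _ h e] ready_head[OF r] by auto
      obtain h' T' where s: "out_app (F c) (h, T) = (h', T')" by fastforce
      show "runs (A ;; B) (h, T) (poly (q1 + q2) (csize \<Gamma> c)) (out_app (F c @ G c) (h, T))"
        using runs_Seq[OF A(3)[OF r1]] B(3) ready_out_app[OF r2 l, of "F c"]
        unfolding s out_app_append by simp
    qed (use A B in \<open>auto intro: cmd_ok_mono[OF A(2)] cmd_ok_mono[OF B(2)]\<close>)
  qed (use add_mono[OF p q] in auto)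
qed

lemma tr_if:
  assumes "pf \<Gamma> f" "tr \<Gamma> F" "tr \<Gamma> G"
  shows "tr \<Gamma> (\<lambda>c. if f c \<noteq> 0 then F c else G c)"
proof -
  obtain pf' where pf': "\<And>c. f c \<le> poly pf' (csize \<Gamma> c)" using pf_bound[OF assms(1)] by blast
  obtain p where p: "\<And>c. length (F c) \<le> poly p (csize \<Gamma> c)" using tr_bound[OF assms(2)] by blast
  obtain q where q: "\<And>c. length (G c) \<le> poly q (csize \<Gamma> c)" using tr_bound[OF assms(3)] by blast
  show ?thesis
  proof (rule trI[where p = "p + q"])
    show "length (if f c \<noteq> 0 then F c else G c) \<le> poly (p + q) (csize \<Gamma> c)" for c
      using p[of c] q[of c] by simp
    fix m e assume l: "layout \<Gamma> m e"
    obtain N R1 q1 where N: "e < R1" "\<And>S. S \<ge> 4 \<Longrightarrow> cmd_ok R1 S N"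
      "\<And>c h T. ready R1 \<Gamma> m e c (h, T) \<Longrightarrow> runs N (h, T) (poly q1 (csize \<Gamma> c)) (h(e := f c), T)"
      by (rule pf_cmd[OF assms(1) l]) (rule that)
    obtain A R2 q2 where A: "e < R2" "\<And>S. S \<ge> 4 \<Longrightarrow> cmd_ok R2 S A"
      "\<And>c h T. ready R2 \<Gamma> m e c (h, T) \<Longrightarrow> runs A (h, T) (poly q2 (csize \<Gamma> c)) (out_app (F c) (h, T))"
      by (rule tr_cmd[OF assms(2) l]) (rule that)
    obtain B R3 q3 where B: "e < R3" "\<And>S. S \<ge> 4 \<Longrightarrow> cmd_ok R3 S B"
      "\<And>c h T. ready R3 \<Gamma> m e c (h, T) \<Longrightarrow> runs B (h, T) (poly q3 (csize \<Gamma> c)) (out_app (G c) (h, T))"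
      by (rule tr_cmd[OF assms(3) l]) (rule that)
    let ?R = "R1 + R2 + R3" and ?I = "Ite e (\<lambda>a. a \<noteq> 1) (clear_reg e ;; A) B"
    show "\<exists>A R p. e < R \<and> (\<forall>S\<ge>4. cmd_ok R S A) \<and>
        (\<forall>c h T. ready R \<Gamma> m e c (h, T) \<longrightarrow>
          runs A (h, T) (poly p (csize \<Gamma> c)) (out_app (if f c \<noteq> 0 then F c else G c) (h, T)))"
    proof (intro exI[of _ "N ;; ?I"] exI[of _ ?R]
        exI[of _ "q1 + (2 + 3 * pf' + q2 + q3)"] conjI allI impI)
      fix c h T assume r: "ready ?R \<Gamma> m e c (h, T)"
      have r1: "ready R1 \<Gamma> m e c (h, T)" and r2: "ready R2 \<Gamma> m e c (h, T)" and r3: "ready R3 \<Gamma> m e c (h, T)"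
        using ready_upd[OF r l, of _ h e] ready_head[OF r] by auto
      have e: "T e = reg_tape" using ready_reg[OF r, of e] l N(1) by (auto simp: layout_def)
      let ?h = "h(e := f c)"
      have e0: "h(e := 0) = h" using ready_head[OF r, of e] N(1) by (auto simp: fun_eq_iff)
      have "runs ?I (?h, T)
        (poly (2 + 3 * pf' + q2 + q3) (csize \<Gamma> c)) (out_app (if f c \<noteq> 0 then F c else G c) (h, T))"
      proof (cases "f c = 0")
        case False
        have "runs (clear_reg e) (?h, T) (Suc (f c * 3)) (h, T)"
          using runs_clear[of T e ?h, OF e] e0 by simp
        from runs_Seq[OF this A(3)[OF r2]]
        have "runs ?I (?h, T)
          (Suc (Suc (f c * 3) + poly q2 (csize \<Gamma> c))) (out_app (F c) (h, T))"
          by (intro runs_IteT) (use False e in auto)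
        then show ?thesis using False pf'[of c] by (auto elim!: runs_mono)
      next
        case True
        have "runs ?I (?h, T) (Suc (poly q3 (csize \<Gamma> c))) (out_app (G c) (h, T))"
          using B(3)[OF r3] True e e0 ready_head[OF r, of e] N(1)
          by (intro runs_IteF) (auto simp: trans_less_add1)
        then show ?thesis using True by (auto elim!: runs_mono)
      qed
      from runs_Seq[OF N(3)[OF r1] this]
      show "runs (N ;; ?I) (h, T)
        (poly (q1 + (2 + 3 * pf' + q2 + q3)) (csize \<Gamma> c)) (out_app (if f c \<noteq> 0 then F c else G c) (h, T))"
        by simp
    qed (use N A B l in \<open>auto simp: layout_def intro: cmd_ok_mono[OF N(2)] cmd_ok_mono[OF A(2)] cmd_ok_mono[OF B(2)]\<close>)
  qed
qed

lemma out_app_upd: "r \<noteq> 2 \<Longrightarrow> out_app bs (h(r := v), T) = ((fst (out_app bs (h, T)))(r := v), snd (out_app bs (h, T)))"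
  by (auto simp: out_app_def fun_eq_iff)

lemma out_app_other [simp]:
  "r \<noteq> 2 \<Longrightarrow> fst (out_app bs s) r = fst s r" "r \<noteq> 2 \<Longrightarrow> snd (out_app bs s) r = snd s r"
  by (auto simp: out_app_def split: prod.splits)

lemma tr_for:
  assumes n: "pf \<Gamma> n" and F: "tr (ext \<Gamma>) (\<lambda>p. F (fst p) (snd p))"
  shows "tr \<Gamma> (\<lambda>c. concat (map (F c) [0..<n c]))"
proof -
  obtain pn where pn: "\<And>c. n c \<le> poly pn (csize \<Gamma> c)" using pf_bound[OF n] by blast
  obtain pg where "\<And>p. length (F (fst p) (snd p)) \<le> poly pg (csize (ext \<Gamma>) p)" using tr_bound[OF F] by blast
  then have pg: "length (F c i) \<le> poly pg (csize \<Gamma> c + i)" for c i by (metis csize_ext fst_conv snd_conv)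
  show ?thesis
  proof (rule trI[where p = "pn * pcompose pg ([:0, 1:] + pn)"])
    fix c
    have "(\<Sum>i<n c. length (F c i)) \<le> of_nat (card {..<n c}) * poly pg (csize \<Gamma> c + poly pn (csize \<Gamma> c))"
      using pn[of c] by (intro sum_bounded_above le_trans[OF pg] poly_mono_nat) auto
    also have "\<dots> \<le> poly pn (csize \<Gamma> c) * poly pg (csize \<Gamma> c + poly pn (csize \<Gamma> c))"
      using pn[of c] by (intro mult_le_mono1) simp
    finally show "length (concat (map (F c) [0..<n c])) \<le> poly (pn * pcompose pg ([:0, 1:] + pn)) (csize \<Gamma> c)"
      by (simp add: poly_pcompose length_concat comp_def interv_sum_list_conv_sum_set_nat atLeast0LessThan)
  next
    fix m e assume l: "layout \<Gamma> m e"
    have l1: "layout \<Gamma> m (e + 2)" using layout_mono[OF l] by auto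
    have le: "3 \<le> e" using l by (simp add: layout_def)
    have l3: "layout (ext \<Gamma>) ((e + 1) # m) (e + 2)"
      using le by (intro layout_ext l1) auto
    obtain N R2 q2 where N: "e < R2" "\<And>S. S \<ge> 4 \<Longrightarrow> cmd_ok R2 S N"
      "\<And>c h T. ready R2 \<Gamma> m e c (h, T) \<Longrightarrow> runs N (h, T) (poly q2 (csize \<Gamma> c)) (h(e := n c), T)"
      by (rule pf_cmd[OF n l]) (rule that)
    obtain B R3 q3 where B: "e + 2 < R3" "\<And>S. S \<ge> 4 \<Longrightarrow> cmd_ok R3 S B"
      "\<And>p h T. ready R3 (ext \<Gamma>) ((e + 1) # m) (e + 2) p (h, T) \<Longrightarrow>
         runs B (h, T) (poly q3 (csize (ext \<Gamma>) p)) (out_app (F (fst p) (snd p)) (h, T))"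
      by (rule tr_cmd[OF F l3]) (rule that)
    let ?R = "R2 + R3"
    \<comment> \<open>Register \<open>e\<close> counts the remaining rounds, while
      \<open>e + 1\<close> is the loop index that the body sees as its new variable.\<close>
    let ?D = "B ;; go_right (e + 1)"
    let ?P = "N ;; while_pos e ?D ;; clear_reg (e + 1)"
    let ?tb = "pcompose q3 ([:0, 1:] + pn) + 1"
    let ?p = "q2 + ((1 + pn * (?tb + 2)) + (1 + 3 * pn))"
    show "\<exists>A R p. e < R \<and> (\<forall>S\<ge>4. cmd_ok R S A) \<and>
        (\<forall>c h T. ready R \<Gamma> m e c (h, T) \<longrightarrow>
          runs A (h, T) (poly p (csize \<Gamma> c)) (out_app (concat (map (F c) [0..<n c])) (h, T)))"
    proof (intro exI[of _ ?P] exI[of _ ?R] exI[of _ ?p] conjI allI impI)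
      fix c h T assume r: "ready ?R \<Gamma> m e c (h, T)"
      let ?cs = "csize \<Gamma> c"
      have r2: "ready R2 \<Gamma> m e c (h, T)"
        using ready_upd[OF r l, of _ h e] ready_head[OF r] by auto
      have reg: "T e = reg_tape" "T (e + 1) = reg_tape"
        using le B(1) by (auto intro!: ready_reg[OF r])
      have h0: "h e = 0" "h (e + 1) = 0"
        using B(1) by (auto intro!: ready_head[OF r])
      define w where "w = (\<lambda>i. concat (map (F c) [0..<i]))"
      let ?s = "\<lambda>i. out_app (w i) (h(e := n c - i, e + 1 := i), T)"
      have D: "runs ?D ((fst (?s i))(e := n c - Suc i), snd (?s i)) (poly ?tb ?cs) (?s (Suc i))"
        if i: "i < n c" for i
      proof -
        let ?h = "h(e := n c - Suc i, e + 1 := i)"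
        let ?t = "out_app (w i) (?h, T)"
        have "ready R3 \<Gamma> m (e + 2) c (?h, T)"
          using ready_head[OF r] by (intro ready_upd[OF r l]) auto
        then have "ready R3 (ext \<Gamma>) ((e + 1) # m) (e + 2) (c, i) (?h, T)"
          by (intro ready_ext) auto
        from ready_out_app[OF this l3, of "w i"]
        have "ready R3 (ext \<Gamma>) ((e + 1) # m) (e + 2) (c, i) (fst ?t, snd ?t)" by simp
        from B(3)[OF this]
        have 1: "runs B ?t (poly q3 (?cs + i)) (out_app (w (Suc i)) (?h, T))"
          by (simp add: w_def out_app_append)
        let ?u = "out_app (w (Suc i)) (?h, T)"
        have "?h(e + 1 := Suc i) = h(e := n c - Suc i, e + 1 := Suc i)" by simp
        then have 4: "((fst ?u)(e + 1 := Suc (fst ?u (e + 1))), snd ?u) = ?s (Suc i)"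
          using le out_app_upd[of "e + 1" "w (Suc i)" ?h "Suc i" T] by simp
        have "(h(e := n c - i, e + 1 := i))(e := n c - Suc i) = ?h" by auto
        then have 5: "((fst (?s i))(e := n c - Suc i), snd (?s i)) = ?t"
          using le out_app_upd[of e "w i" "h(e := n c - i, e + 1 := i)" "n c - Suc i" T] by simp
        have "poly q3 (?cs + i) \<le> poly q3 (?cs + poly pn ?cs)"
          using i pn[of c] by (intro poly_mono_nat) simp
        then have t: "poly q3 (?cs + i) + 1 \<le> poly ?tb ?cs" by (simp add: poly_pcompose)
        have "runs (go_right (e + 1)) ?u 1 (?s (Suc i))"
          using runs_go_right[of "e + 1" "fst ?u" "snd ?u"] unfolding 4 by simp
        from runs_Seq[OF 1 this] show ?thesis unfolding 5 using t by (rule runs_mono)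
      qed
      have W: "runs (while_pos e ?D) (?s 0) (Suc ((fst (?s 0)) e * (poly ?tb ?cs + 2)))
          (?s ((fst (?s 0)) e))"
        by (rule runs_while_pos[where \<sigma> = ?s and ?h0.0 = "fst (?s 0)" and r = e])
          (use reg D le in auto)
      have s0: "?s 0 = (h(e := n c), T)"
        using h0 by (auto simp: fun_eq_iff w_def)
      have s0n: "(fst (?s 0)) e = n c" using le by simp
      have W': "runs (while_pos e ?D) (h(e := n c), T)
          (Suc (n c * (poly ?tb ?cs + 2))) (?s (n c))"
        using W unfolding s0n unfolding s0 .
      have "(h(e := n c - n c, e + 1 := n c))(e + 1 := 0) = h" using h0 by (auto simp: fun_eq_iff)
      then have sn: "((fst (?s (n c)))(e + 1 := 0), snd (?s (n c))) = out_app (w (n c)) (h, T)"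
        using le out_app_upd[of "e + 1" "w (n c)" "h(e := n c - n c, e + 1 := n c)" 0 T] by simp
      have C: "runs (clear_reg (e + 1)) (?s (n c)) (Suc (n c * 3)) (out_app (w (n c)) (h, T))"
        using runs_clear[of "snd (?s (n c))" "e + 1" "fst (?s (n c))"] reg le unfolding sn by simp
      from runs_Seq[OF N(3)[OF r2] runs_Seq[OF W' C]]
      have "runs ?P (h, T) (poly q2 ?cs +
          (Suc (n c * (poly ?tb ?cs + 2)) + Suc (n c * 3))) (out_app (w (n c)) (h, T))" .
      moreover have "poly q2 ?cs + (Suc (n c * (poly ?tb ?cs + 2)) + Suc (n c * 3)) \<le> poly ?p ?cs"
      proof -
        have "n c * (poly ?tb ?cs + 2) \<le> poly pn ?cs * (poly ?tb ?cs + 2)" using pn[of c] by (rule mult_le_mono1)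
        moreover have "poly (?tb + 2) ?cs = poly ?tb ?cs + 2" by simp
        ultimately show ?thesis using pn[of c] by (simp only: poly_add poly_mult poly_1 poly_numeral)
      qed
      ultimately show "runs ?P (h, T) (poly ?p ?cs) (out_app (concat (map (F c) [0..<n c])) (h, T))"
        unfolding w_def by (rule runs_mono)
    qed (use N B le in \<open>auto intro: cmd_ok_mono[OF N(2)] cmd_ok_mono[OF B(2)]\<close>)
  qed
qed

lemma tr_bit: "pfb \<Gamma> P \<Longrightarrow> tr \<Gamma> (\<lambda>c. [P c])"
  unfolding pfb_def by (rule tr_cong[OF tr_if[of \<Gamma> "\<lambda>c. if P c then 1 else 0", OF _ tr_emit[of _ True] tr_emit[of _ False]]]) auto

lemma tr_ifb: "pfb \<Gamma> P \<Longrightarrow> tr \<Gamma> F \<Longrightarrow> tr \<Gamma> G \<Longrightarrow> tr \<Gamma> (\<lambda>c. if P c then F c else G c)"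
  unfolding pfb_def by (rule tr_cong[OF tr_if[of \<Gamma> "\<lambda>c. if P c then 1 else 0" F G]]) auto

section \<open>Machines as subroutines\<close>

lemma step_agree:
  assumes "\<forall>j < num_tapes M. h j = h' j \<and> T j = T' j"
  shows "fst ((step M ^^ t) (q, h, T)) = fst ((step M ^^ t) (q, h', T'))"
    "\<forall>j < num_tapes M. fst (snd ((step M ^^ t) (q, h, T))) j = fst (snd ((step M ^^ t) (q, h', T'))) j \<and>
       snd (snd ((step M ^^ t) (q, h, T))) j = snd (snd ((step M ^^ t) (q, h', T'))) j"
proof -
  have "fst ((step M ^^ t) (q, h, T)) = fst ((step M ^^ t) (q, h', T')) \<and>
    (\<forall>j < num_tapes M. fst (snd ((step M ^^ t) (q, h, T))) j = fst (snd ((step M ^^ t) (q, h', T'))) j \<and>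
       snd (snd ((step M ^^ t) (q, h, T))) j = snd (snd ((step M ^^ t) (q, h', T'))) j)"
  proof (induction t)
    case (Suc t)
    obtain q1 h1 T1 where 1: "(step M ^^ t) (q, h, T) = (q1, h1, T1)" by (metis surj_pair)
    obtain q2 h2 T2 where 2: "(step M ^^ t) (q, h', T') = (q2, h2, T2)" by (metis surj_pair)
    have *: "q1 = q2" "\<forall>j < num_tapes M. h1 j = h2 j \<and> T1 j = T2 j" using Suc 1 2 by auto
    then have m: "map (\<lambda>j. T1 j (h1 j)) [0..<num_tapes M] = map (\<lambda>j. T2 j (h2 j)) [0..<num_tapes M]" by simp
    show ?case using 1 2 * by (simp add: m Let_def split: prod.splits)
  qed (use assms in auto)
  then show "fst ((step M ^^ t) (q, h, T)) = fst ((step M ^^ t) (q, h', T'))"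
    "\<forall>j < num_tapes M. fst (snd ((step M ^^ t) (q, h, T))) j = fst (snd ((step M ^^ t) (q, h', T'))) j \<and>
       snd (snd ((step M ^^ t) (q, h, T))) j = snd (snd ((step M ^^ t) (q, h', T'))) j"
    by blast+
qed

text \<open>A head moves at most one cell per step. This bounds the length of an output, the way
  back of a head after a call and, later, the width of a tableau.\<close>

lemma steps_reach:
  assumes "(step M ^^ t) (init_config x) = (q, h, T)"
  shows "\<forall>j. h j \<le> t" "\<forall>i \<ge> max (length x) t. T 0 i = 0"
proof -
  have "(\<forall>j. h j \<le> t) \<and> (\<forall>i \<ge> max (length x) t. T 0 i = 0)"
    using assms
  proof (induction t arbitrary: q h T)
    case 0
    then show ?case by (auto simp: init_config_def)
  next
    case (Suc t)
    obtain q1 h1 T1 where 1: "(step M ^^ t) (init_config x) = (q1, h1, T1)" by (metis surj_pair)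
    have IH: "\<forall>j. h1 j \<le> t" "\<forall>i \<ge> max (length x) t. T1 0 i = 0" using Suc.IH[OF 1] by auto
    have s: "step M (q1, h1, T1) = (q, h, T)" using Suc.prems 1 by simp
    have mh: "move_head m i \<le> Suc t" if "i \<le> t" for m i using that by (cases m) auto
    show ?case
    proof (cases "q1 < num_states M")
      case False
      then show ?thesis using s IH by (auto intro: le_SucI)
    next
      case True
      obtain acts where a: "h = (\<lambda>j. if j < num_tapes M then move_head (snd (acts ! j)) (h1 j) else h1 j)"
        "T = (\<lambda>j. if j < num_tapes M then (T1 j)(h1 j := fst (acts ! j)) else T1 j)"
        using s True by (auto split: prod.splits)
      have "h1 0 \<noteq> i" if "i \<ge> max (length x) (Suc t)" for i using IH(1) that by (auto dest: spec[of _ 0])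
      then show ?thesis using a IH mh by (auto intro: le_SucI)
    qed
  qed
  then show "\<forall>j. h j \<le> t" "\<forall>i \<ge> max (length x) t. T 0 i = 0" by auto
qed

lemma halted_with_init_length:
  assumes "halted_with M ((step M ^^ t) (init_config x)) y"
  shows "length y \<le> length x + t"
proof -
  obtain q h T where 1: "(step M ^^ t) (init_config x) = (q, h, T)" by (metis surj_pair)
  show ?thesis
  proof (rule ccontr)
    assume "\<not> length y \<le> length x + t"
    then have "length y - 1 < length y" "max (length x) t \<le> length y - 1" by auto
    with steps_reach(2)[OF 1] assms 1 show False by (auto simp: halted_with_def sym_of_bit_def split: if_splits)
  qed
qed

lemma poly_time_length:
  assumes "poly_time f" shows "\<exists>p. \<forall>x. length (f x) \<le> poly p (length x)"
proof -
  obtain M p where "\<forall>x. halted_with M ((step M ^^ poly p (length x)) (init_config x)) (f x)"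
    using assms by (auto simp: poly_time_def)
  then have "length (f x) \<le> length x + poly p (length x)" for x using halted_with_init_length by blast
  then show ?thesis by (intro exI[of _ "[:0, 1:] + p"]) simp
qed

lemma init_config_str: "init_config x = (0, \<lambda>j. 0, \<lambda>j. if j = 0 then str_tape x else (\<lambda>i. 0))"
  by (auto simp: init_config_def str_tape_def fun_eq_iff)

text \<open>A machine is started on fresh tapes of the larger one. About these tapes nothing is
  known afterwards except the output and a bound for the position of the head on the first of them,
  which suffices to bring that head back.\<close>

lemma runs_Call:
  assumes M: "wf_tm M" "\<And>x. halted_with M ((step M ^^ poly p (length x)) (init_config x)) (f x)"
    and T: "\<And>j. j < num_tapes M \<Longrightarrow> h (off + j) = 0"
      "\<And>j. j < num_tapes M \<Longrightarrow> T (off + j) = (if j = 0 then str_tape x else (\<lambda>i. 0))"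
  obtains h' T' where "runs (Call off M) (h, T) (Suc (poly p (length x))) (h', T')"
    "\<And>r. r < off \<or> off + num_tapes M \<le> r \<Longrightarrow> h' r = h r \<and> T' r = T r"
    "h' off \<le> poly p (length x)"
    "\<And>i. i < length (f x) \<Longrightarrow> T' off i = sym_of_bit (f x ! i)" "T' off (length (f x)) = 0"
proof -
  let ?t = "poly p (length x)"
  obtain q1 h1 T1 where 1: "(step M ^^ ?t) (init_config x) = (q1, h1, T1)" by (metis surj_pair)
  obtain q2 h2 T2 where 2: "(step M ^^ ?t) (0, (\<lambda>j. h (off + j)), (\<lambda>j. T (off + j))) = (q2, h2, T2)"
    by (metis surj_pair)
  have "\<forall>j < num_tapes M. (\<lambda>j. h (off + j)) j = (\<lambda>j. 0) j \<and>
      (\<lambda>j. T (off + j)) j = (\<lambda>j. if j = 0 then str_tape x else (\<lambda>i. 0)) j" using T by auto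
  from step_agree[OF this, of ?t 0] have e: "q1 = q2" "\<forall>j < num_tapes M. h1 j = h2 j \<and> T1 j = T2 j"
    using 1 2 unfolding init_config_str by auto
  have k: "0 < num_tapes M" "3 \<le> num_syms M" using M(1) by (auto simp: wf_tm_def)
  have q: "q2 = num_states M" and o: "\<And>i. i < length (f x) \<Longrightarrow> T2 0 i = sym_of_bit (f x ! i)"
    "T2 0 (length (f x)) = 0"
    using M(2)[of x] 1 e k by (auto simp: halted_with_def)
  have s: "\<forall>j < num_tapes M. \<forall>i. T (off + j) i < num_syms M"
    using T(2) k le_less_trans[OF str_tape_le[of x], of "num_syms M"] by auto
  have "runs (Call off M) (h, T) (Suc ?t)
       ((\<lambda>j. if off \<le> j \<and> j < off + num_tapes M then h2 (j - off) else h j),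
        (\<lambda>j. if off \<le> j \<and> j < off + num_tapes M then T2 (j - off) else T j))"
    unfolding runs_def using run_Call[OF M(1) s] 2 q by blast
  note r = this
  have h2: "h2 0 \<le> ?t" using steps_reach(1)[OF 1] e k by metis
  show ?thesis by (rule that[OF r]) (use o k h2 in auto)
qed

lemma runs_Loop_left_to_3:
  assumes "T j 0 = 3" "\<And>i. 0 < i \<Longrightarrow> i \<le> h j \<Longrightarrow> T j i \<noteq> 3"
  shows "runs (Loop j (\<lambda>a. a \<noteq> 3) (go_left j)) (h, T) (Suc (h j * 2)) (h(j := 0), T)"
proof -
  let ?s = "\<lambda>i. (h(j := h j - i), T)"
  have A: "runs (go_left j) (?s i) 1 (?s (Suc i))" for i
    using runs_go_left[of j "h(j := h j - i)" T] by simp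
  have "runs (Loop j (\<lambda>a. a \<noteq> 3) (go_left j)) (?s 0) (Suc (h j * Suc 1)) (?s (h j))"
    by (rule runs_Loop[where \<sigma> = ?s, OF _ A]) (use assms in auto)
  then show ?thesis by (simp add: numeral_2_eq_2)
qed

text \<open>The symbol 3 in cell 0 of the output tape marks its left end; the code of a bit is never
  3.\<close>

definition rewind_out :: cmd where "rewind_out = Loop 2 (\<lambda>a. a \<noteq> 3) (go_left 2) ;; go_right 2"

lemma runs_rewind_out:
  assumes "T 2 0 = 3" "\<And>i. 0 < i \<Longrightarrow> i \<le> h 2 \<Longrightarrow> T 2 i \<noteq> 3"
  shows "runs rewind_out (h, T) (2 + h 2 * 2) (h(2 := 1), T)"
  using runs_Seq[OF runs_Loop_left_to_3[of T 2 h, OF assms] runs_go_right[of 2 "h(2 := 0)" T]]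
  by (simp add: rewind_out_def)

text \<open>Moving left from cell 0 has no effect, so any upper bound for the head position may
  serve as the count in register 3.\<close>

definition lefts :: "nat \<Rightarrow> cmd" where "lefts j = while_pos 3 (go_left j)"

lemma runs_lefts:
  assumes "T 3 = reg_tape" "j \<noteq> 3"
  shows "runs (lefts j) (h, T) (Suc (h 3 * 3)) (h(3 := 0, j := h j - h 3), T)"
proof -
  let ?s = "\<lambda>i. (h(3 := h 3 - i, j := h j - i), T)"
  have A: "runs (go_left j) ((fst (?s i))(3 := h 3 - Suc i), snd (?s i)) 1 (?s (Suc i))" for i
  proof -
    let ?g = "(fst (?s i))(3 := h 3 - Suc i)"
    have "?g(j := ?g j - 1) = fst (?s (Suc i))" using assms by (auto simp: fun_eq_iff)
    then show ?thesis using runs_go_left[of j ?g T] by (metis fst_conv snd_conv)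
  qed
  have "runs (while_pos 3 (go_left j)) (?s 0) (Suc (h 3 * (1 + 2))) (?s (h 3))"
    by (rule runs_while_pos[where \<sigma> = ?s and ?h0.0 = h and r = 3, OF _ _ A]) (use assms in auto)
  then show ?thesis by (simp add: lefts_def numeral_3_eq_3)
qed

text \<open>Register 3 counts the copied symbols, which allows the head of the target to return.\<close>

definition move_str :: "nat \<Rightarrow> nat \<Rightarrow> cmd" where
  "move_str src dst = Loop src (\<lambda>a. a \<noteq> 0)
      (Ite src (\<lambda>a. a = 1) (Act dst (\<lambda>_. (1, Go_Right))) (Act dst (\<lambda>_. (2, Go_Right))) ;;
       Act src (\<lambda>_. (0, Go_Right)) ;; go_right 3) ;;
     Act dst (\<lambda>_. (0, Stay)) ;; lefts dst"

text \<open>The source is erased behind the head, which makes the output tape reusable; the blank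
  written after the copy ends it, whatever the target held before.\<close>

lemma runs_move_str:
  assumes T: "T 3 = reg_tape" "h 3 = 0" "h dst = 0" "src \<noteq> dst" "src \<noteq> 3" "dst \<noteq> 3"
    and w: "\<And>i. i < length w \<Longrightarrow> T src (h src + i) = sym_of_bit (w ! i)" "T src (h src + length w) = 0"
  shows "runs (move_str src dst) (h, T) (5 + length w * 9)
    (h(src := h src + length w),
     T(src := (\<lambda>i. if h src \<le> i \<and> i < h src + length w then 0 else T src i),
       dst := (\<lambda>i. if i < length w then sym_of_bit (w ! i) else if i = length w then 0 else T dst i)))"
proof -
  let ?L = "length w"
  let ?h = "\<lambda>i. h(src := h src + i, dst := i, 3 := i)"
  let ?T = "\<lambda>k. T(src := (\<lambda>i. if h src \<le> i \<and> i < h src + k then 0 else T src i),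
       dst := (\<lambda>i. if i < k then sym_of_bit (w ! i) else T dst i))"
  let ?B = "Ite src (\<lambda>a. a = 1) (Act dst (\<lambda>_. (1, Go_Right))) (Act dst (\<lambda>_. (2, Go_Right))) ;;
       Act src (\<lambda>_. (0, Go_Right)) ;; go_right 3"
  have A: "runs ?B (?h k, ?T k) (2 + (1 + 1)) (?h (Suc k), ?T (Suc k))" if k: "k < ?L" for k
  proof -
    let ?h1 = "(?h k)(dst := Suc k)"
    let ?T1 = "(?T k)(dst := (?T k dst)(k := sym_of_bit (w ! k)))"
    have rd: "?T k src (?h k src) = sym_of_bit (w ! k)" using w(1)[OF k] assms by auto
    have "runs (Ite src (\<lambda>a. a = 1) (Act dst (\<lambda>_. (1, Go_Right))) (Act dst (\<lambda>_. (2, Go_Right))))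
        (?h k, ?T k) 2 (?h1, ?T1)"
    proof (cases "w ! k")
      case True
      then show ?thesis using runs_IteF[of "\<lambda>a. a = 1" "?T k" src "?h k",
          OF _ runs_Act[of dst "\<lambda>_. (2, Go_Right)" "?h k" "?T k"]] rd assms
        by (simp add: sym_of_bit_def numeral_2_eq_2)
    next
      case False
      then show ?thesis using runs_IteT[of "\<lambda>a. a = 1" "?T k" src "?h k",
          OF _ runs_Act[of dst "\<lambda>_. (1, Go_Right)" "?h k" "?T k"]] rd assms
        by (simp add: sym_of_bit_def numeral_2_eq_2)
    qed
    note 1 = this
    let ?h2 = "?h1(src := Suc (?h1 src))" and ?T2 = "?T1(src := (?T1 src)(?h1 src := 0))"
    have 2: "runs (Act src (\<lambda>_. (0, Go_Right))) (?h1, ?T1) 1 (?h2, ?T2)"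
      using runs_Act[of src "\<lambda>_. (0, Go_Right)" ?h1 ?T1] by simp
    have 3: "runs (go_right 3) (?h2, ?T2) 1 (?h2(3 := Suc (?h2 3)), ?T2)" by (rule runs_go_right)
    have "?h2(3 := Suc (?h2 3)) = ?h (Suc k)" using assms by (auto simp: fun_eq_iff)
    moreover have "?T2 = ?T (Suc k)" using assms by (auto simp: fun_eq_iff)
    ultimately show ?thesis using runs_Seq[OF 1 runs_Seq[OF 2 3]] by simp
  qed
  have L: "runs (Loop src (\<lambda>a. a \<noteq> 0) ?B) (?h 0, ?T 0) (Suc (?L * Suc (2 + (1 + 1)))) (?h ?L, ?T ?L)"
    by (rule runs_Loop[where \<sigma> = "\<lambda>k. (?h k, ?T k)", OF _ A]) (use assms in \<open>auto simp: sym_of_bit_def\<close>)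
  have h0: "?h 0 = h" "?T 0 = T" using assms by (auto simp: fun_eq_iff)
  let ?T' = "(?T ?L)(dst := (?T ?L dst)(?L := 0))"
  have B: "runs (Act dst (\<lambda>_. (0, Stay))) (?h ?L, ?T ?L) 1 (?h ?L, ?T')"
  proof -
    have "(?h ?L) dst = ?L" "(?h ?L)(dst := ?L) = ?h ?L" using assms by (auto simp: fun_eq_iff)
    then show ?thesis
      using runs_Act[of dst "\<lambda>_. (0, Stay)" "?h ?L" "?T ?L"] by (simp only: fst_conv snd_conv move_head.simps)
  qed
  have "?T' 3 = reg_tape" using assms by simp
  from runs_lefts[of ?T' dst "?h ?L", OF this]
  have C: "runs (lefts dst) (?h ?L, ?T') (Suc (?L * 3)) ((?h ?L)(3 := 0, dst := 0), ?T')" using assms by simp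
  have f: "(?h ?L)(3 := 0, dst := 0) = h(src := h src + ?L)" using assms by (auto simp: fun_eq_iff)
  have g: "?T' = T(src := (\<lambda>i. if h src \<le> i \<and> i < h src + ?L then 0 else T src i),
       dst := (\<lambda>i. if i < ?L then sym_of_bit (w ! i) else if i = ?L then 0 else T dst i))"
    by (auto simp: fun_eq_iff)
  from runs_Seq[OF L runs_Seq[OF B C]] show ?thesis
    unfolding f g unfolding h0 move_str_def by (rule runs_mono) simp
qed

lemma cmd_ok_basic2 [simp]:
  "cmd_ok R S rewind_out \<longleftrightarrow> 2 < R" "cmd_ok R S (lefts j) \<longleftrightarrow> 3 < R \<and> j < R"
  "4 \<le> S \<Longrightarrow> cmd_ok R S (move_str j j') \<longleftrightarrow> 3 < R \<and> j < R \<and> j' < R"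
  by (auto simp: rewind_out_def lefts_def move_str_def)

section \<open>Composition of polynomial-time functions\<close>

definition zy_ctx :: "(bool list \<times> bool list) ctx" where "zy_ctx = (fst, snd, [])"

definition out_empty :: "nat \<Rightarrow> nat" where "out_empty = (\<lambda>i. if i = 0 then 3 else 0)"

definition idle :: "nat \<Rightarrow> bool list \<times> bool list \<Rightarrow> store \<Rightarrow> bool" where
  "idle R c s \<longleftrightarrow> ready R zy_ctx [] 3 c s \<and> fst s 2 = 1 \<and> snd s 2 = out_empty"

lemma csize_zy [simp]: "csize zy_ctx c = length (fst c) + length (snd c)"
  by (simp add: csize_def zy_ctx_def split: prod.splits)

lemma idle_iff: "idle R c (h, T) \<longleftrightarrow> T 0 = str_tape (fst c) \<and> T 1 = str_tape (snd c) \<and> T 2 = out_empty \<and>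
   h 0 = 0 \<and> h 1 = 0 \<and> h 2 = 1 \<and> (\<forall>r. 3 \<le> r \<and> r < R \<longrightarrow> T r = reg_tape \<and> h r = 0)"
  by (auto simp: idle_def ready_def zy_ctx_def)

definition flush :: "nat \<Rightarrow> cmd" where "flush dst = rewind_out ;; move_str 2 dst ;; rewind_out"

lemma runs_flush:
  assumes "idle R c (h, T)" "3 < R" "R \<le> dst" "h dst = 0" "T dst = (\<lambda>i. 0)"
  shows "runs (flush dst) (out_app w (h, T)) (13 + 13 * length w) (h, T(dst := str_tape w))"
proof -
  let ?s = "out_app w (h, T)"
  let ?L = "length w"
  let ?T = "T(2 := (\<lambda>i. if i = 0 then 3 else if i < Suc ?L then sym_of_bit (w ! (i - 1)) else 0))"
  have i: "T 2 = out_empty" "h 2 = 1" "T 3 = reg_tape" "h 3 = 0" using assms by (auto simp: idle_iff)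
  have s: "?s = (h(2 := Suc ?L), ?T)" using i by (auto simp: out_app_def out_empty_def fun_eq_iff)
  have 1: "runs rewind_out ?s (2 + Suc ?L * 2) (h, ?T)"
    using runs_rewind_out[of ?T "h(2 := Suc ?L)"] i(2) unfolding s
    by (auto simp: sym_of_bit_def fun_upd_idem)
  let ?T2 = "?T(2 := (\<lambda>i. if h 2 \<le> i \<and> i < h 2 + ?L then 0 else ?T 2 i),
       dst := (\<lambda>i. if i < ?L then sym_of_bit (w ! i) else if i = ?L then 0 else ?T dst i))"
  have 2: "runs (move_str 2 dst) (h, ?T) (5 + ?L * 9) (h(2 := h 2 + ?L), ?T2)"
    by (rule runs_move_str) (use assms i in auto)
  have e: "?T2 = T(dst := str_tape w)"
    using assms i by (auto simp: fun_eq_iff str_tape_def out_empty_def)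
  have "(h(2 := h 2 + ?L))(2 := 1) = h" using i by (auto simp: fun_eq_iff)
  then have 3: "runs rewind_out (h(2 := h 2 + ?L), T(dst := str_tape w)) (2 + (1 + ?L) * 2) (h, T(dst := str_tape w))"
    using runs_rewind_out[of "T(dst := str_tape w)" "h(2 := h 2 + ?L)"] i assms
    by (auto simp: out_empty_def)
  from runs_Seq[OF 1 runs_Seq[OF 2[unfolded e] 3]] show ?thesis
    unfolding flush_def by (rule runs_mono) simp
qed

text \<open>The command \<open>C off\<close> uses the tapes from \<open>off\<close> on as work tapes and leaves its result on the first of them.\<close>

definition stage ::
    "(bool list \<times> bool list \<Rightarrow> bool list) \<Rightarrow> (nat \<Rightarrow> cmd) \<Rightarrow> nat \<Rightarrow> nat poly \<Rightarrow> nat \<Rightarrow> nat \<Rightarrow> bool" where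
  "stage f C R q k S0 \<longleftrightarrow> 3 < R \<and> 1 \<le> k \<and>
    (\<forall>off S. R \<le> off \<longrightarrow> S0 \<le> S \<longrightarrow> cmd_ok (off + k) S (C off)) \<and>
    (\<forall>R' off c h T. R \<le> R' \<longrightarrow> R' \<le> off \<longrightarrow> idle R' c (h, T) \<longrightarrow>
       (\<forall>j < k. h (off + j) = 0 \<and> T (off + j) = (\<lambda>i. 0)) \<longrightarrow>
       (\<exists>h' T'. runs (C off) (h, T) (poly q (csize zy_ctx c)) (h', T') \<and> idle R' c (h', T') \<and> h' off = 0 \<and>
         (\<forall>i < length (f c). T' off i = sym_of_bit (f c ! i)) \<and> T' off (length (f c)) = 0 \<and>
         (\<forall>r. r < off \<or> off + k \<le> r \<longrightarrow> h' r = h r \<and> T' r = T r)))"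

lemma stage_cmd_ok: "stage f C R q k S0 \<Longrightarrow> R \<le> off \<Longrightarrow> S0 \<le> S \<Longrightarrow> cmd_ok (off + k) S (C off)"
  unfolding stage_def by blast

lemma stage_runs:
  assumes "stage f C R q k S0" "R \<le> R'" "R' \<le> off" "idle R' c (h, T)"
    "\<And>j. j < k \<Longrightarrow> h (off + j) = 0 \<and> T (off + j) = (\<lambda>i. 0)"
  shows "\<exists>h' T'. runs (C off) (h, T) (poly q (csize zy_ctx c)) (h', T') \<and> idle R' c (h', T') \<and> h' off = 0 \<and>
         (\<forall>i < length (f c). T' off i = sym_of_bit (f c ! i)) \<and> T' off (length (f c)) = 0 \<and>
         (\<forall>r. r < off \<or> off + k \<le> r \<longrightarrow> h' r = h r \<and> T' r = T r)"
  using assms unfolding stage_def by blast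

lemma poly_time_stage:
  assumes F: "tr zy_ctx F" and f: "poly_time f"
  shows "\<exists>C R q k S0. stage (\<lambda>c. f (F c)) C R q k S0"
proof -
  obtain M p where M: "wf_tm M" "\<And>x. halted_with M ((step M ^^ poly p (length x)) (init_config x)) (f x)"
    using f by (auto simp: poly_time_def)
  obtain b where b: "\<And>c. length (F c) \<le> poly b (csize zy_ctx c)" using tr_bound[OF F] by blast
  have l: "layout zy_ctx [] 3" by (simp add: layout_def zy_ctx_def)
  obtain A R1 q1 where A: "3 < R1" "\<And>S. S \<ge> 4 \<Longrightarrow> cmd_ok R1 S A"
      "\<And>c h T. ready R1 zy_ctx [] 3 c (h, T) \<Longrightarrow> runs A (h, T) (poly q1 (csize zy_ctx c)) (out_app (F c) (h, T))"
    by (rule tr_cmd[OF F l]) (rule that)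
  \<comment> \<open>After the call, the head on tape \<open>off\<close> is only known to lie within
    the running time on \<open>F c\<close>. The number \<open>?N c\<close> bounds this time and is
    computable from the lengths of the two strings.\<close>
  let ?N = "\<lambda>c. poly (pcompose p b) (length (fst c) + length (snd c))"
  have "pf zy_ctx (\<lambda>c :: bool list \<times> bool list. length (fst c) + length (snd c))"
    by (intro pf_add pf_len[where j = 0] pf_len[where j = 1]) (auto simp: zy_ctx_def)
  then have N: "pf zy_ctx ?N" by (rule pf_poly)
  obtain B R2 q2 where B: "3 < R2" "\<And>S. S \<ge> 4 \<Longrightarrow> cmd_ok R2 S B"
      "\<And>c h T. ready R2 zy_ctx [] 3 c (h, T) \<Longrightarrow> runs B (h, T) (poly q2 (csize zy_ctx c)) (h(3 := ?N c), T)"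
    by (rule pf_cmd[OF N l]) (rule that)
  let ?C = "\<lambda>off. A ;; flush off ;; Call off M ;; B ;; lefts off"
  let ?q = "q1 + ((13 + 13 * b) + ((1 + pcompose p b) + (q2 + (1 + 3 * pcompose p b))))"
  let ?k = "num_tapes M"
  show ?thesis
    unfolding stage_def
  proof (rule exI[of _ ?C], rule exI[of _ "R1 + R2"], rule exI[of _ ?q], rule exI[of _ ?k],
      rule exI[of _ "4 + num_syms M"], intro conjI allI impI)
    show "3 < R1 + R2" using A by simp
    have k: "1 \<le> ?k" using M(1) by (simp add: wf_tm_def)
    then show "1 \<le> ?k" .
    show "cmd_ok (off + ?k) S (?C off)" if "R1 + R2 \<le> off" "4 + num_syms M \<le> S" for off S
      using that M(1) k A(1) cmd_ok_mono[OF A(2)[of S], of "off + ?k"] cmd_ok_mono[OF B(2)[of S], of "off + ?k"]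
      by (auto simp: flush_def)
    fix R' off c h T
    assume R: "R1 + R2 \<le> R'" "R' \<le> off" and i: "idle R' c (h, T)"
      and T: "\<forall>j < ?k. h (off + j) = 0 \<and> T (off + j) = (\<lambda>i. 0)"
    let ?cs = "csize zy_ctx c" and ?w = "F c"
    have i0: "h off = 0" "T off = (\<lambda>i. 0)" using spec[OF T, of 0] k by auto
    have r: "ready R1 zy_ctx [] 3 c (h, T)" using i R by (auto simp: idle_def ready_def zy_ctx_def)
    have 1: "runs A (h, T) (poly q1 ?cs) (out_app ?w (h, T))" by (rule A(3)[OF r])
    have 2: "runs (flush off) (out_app ?w (h, T)) (13 + 13 * length ?w) (h, T(off := str_tape ?w))"
      by (rule runs_flush[OF i _ R(2) i0]) (use R A in simp)
    obtain h' T' where 3: "runs (Call off M) (h, T(off := str_tape ?w)) (Suc (poly p (length ?w))) (h', T')"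
      "\<And>r. r < off \<or> off + ?k \<le> r \<Longrightarrow> h' r = h r \<and> T' r = (T(off := str_tape ?w)) r"
      "h' off \<le> poly p (length ?w)"
      "\<And>i. i < length (f ?w) \<Longrightarrow> T' off i = sym_of_bit (f ?w ! i)" "T' off (length (f ?w)) = 0"
      by (rule runs_Call[OF M, of h off "T(off := str_tape ?w)" ?w]) (use T in auto)
    have o: "off \<noteq> 3" "3 < off" using R A by auto
    have i': "idle R' c (h', T')" using i 3(2) R A unfolding idle_iff by auto
    then have r': "ready R2 zy_ctx [] 3 c (h', T')" using R by (auto simp: idle_def ready_def zy_ctx_def)
    have 4: "runs B (h', T') (poly q2 ?cs) (h'(3 := ?N c), T')" by (rule B(3)[OF r'])
    have N: "poly p (length ?w) \<le> ?N c" "?N c = poly (pcompose p b) ?cs"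
      using poly_mono_nat[OF b[of c], of p] by (simp_all add: poly_pcompose)
    have h3: "T' 3 = reg_tape" "h' 3 = 0" using i' R A by (auto simp: idle_iff)
    have "(h'(3 := ?N c))(3 := 0, off := (h'(3 := ?N c)) off - (h'(3 := ?N c)) 3) = h'(off := 0)"
      using N(1) 3(3) o h3 by (auto simp: fun_eq_iff)
    then have 5: "runs (lefts off) (h'(3 := ?N c), T') (Suc (?N c * 3)) (h'(off := 0), T')"
      using runs_lefts[of T' off "h'(3 := ?N c)", OF h3(1) o(1)] by simp
    have t: "poly q1 ?cs + ((13 + 13 * length ?w) + (Suc (poly p (length ?w)) + (poly q2 ?cs + Suc (?N c * 3))))
        \<le> poly ?q ?cs" using N b[of c] by (simp add: poly_pcompose)
    have "runs (?C off) (h, T) (poly ?q ?cs) (h'(off := 0), T')"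
      by (rule runs_mono[OF runs_Seq[OF 1 runs_Seq[OF 2 runs_Seq[OF 3(1) runs_Seq[OF 4 5]]]] t])
    moreover have "idle R' c (h'(off := 0), T')" using i' R A by (auto simp: idle_iff)
    ultimately show "\<exists>h' T'. runs (?C off) (h, T) (poly ?q ?cs) (h', T') \<and> idle R' c (h', T') \<and> h' off = 0 \<and>
         (\<forall>i < length (f ?w). T' off i = sym_of_bit (f ?w ! i)) \<and> T' off (length (f ?w)) = 0 \<and>
         (\<forall>r. r < off \<or> off + ?k \<le> r \<longrightarrow> h' r = h r \<and> T' r = T r)"
      using 3 k by (intro exI[of _ "h'(off := 0)"] exI[of _ T']) auto
  qed
qed

primrec init_regs :: "nat \<Rightarrow> cmd" where
  "init_regs 0 = Act 2 (\<lambda>_. (3, Go_Right))"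
| "init_regs (Suc n) = init_regs n ;; Act (3 + n) (\<lambda>_. (1, Stay))"

lemma cmd_ok_init_regs: "3 + n \<le> R \<Longrightarrow> 4 \<le> S \<Longrightarrow> cmd_ok R S (init_regs n)"
  by (induction n) auto

lemma runs_init_regs:
  "runs (init_regs n) (snd (init_config x)) (Suc n)
     ((\<lambda>j. if j = 2 then 1 else 0), (\<lambda>j. if j = 0 then str_tape x else if j = 2 then out_empty
        else if 3 \<le> j \<and> j < 3 + n then reg_tape else (\<lambda>i. 0)))"
proof (induction n)
  case 0
  have eq: "(\<lambda>j. 0)(2 := 1) = (\<lambda>j :: nat. if j = 2 then 1 else (0::nat))"
    "(\<lambda>j :: nat. if j = 0 then str_tape x else (\<lambda>i. 0))(2 := (\<lambda>i. 0)(0 := 3)) =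
     (\<lambda>j. if j = 0 then str_tape x else if j = 2 then out_empty
        else if 3 \<le> j \<and> j < 3 + 0 then reg_tape else (\<lambda>i. 0))"
    by (auto simp: fun_eq_iff out_empty_def)
  show ?case
    using runs_Act[of 2 "\<lambda>_. (3, Go_Right)" "\<lambda>j. 0" "\<lambda>j. if j = 0 then str_tape x else (\<lambda>i. 0)"]
    unfolding eq[symmetric] by (simp add: init_config_str)
next
  case (Suc n)
  let ?h = "\<lambda>j. if j = 2 then 1 else (0::nat)"
  let ?T = "\<lambda>n j. if j = 0 then str_tape x else if j = 2 then out_empty
        else if 3 \<le> j \<and> j < 3 + n then reg_tape else (\<lambda>i. 0)"
  have eq: "?h(3 + n := 0) = ?h" "(?T n)(3 + n := (\<lambda>i. 0)(0 := 1)) = ?T (Suc n)"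
    by (auto simp: fun_eq_iff reg_tape_def)
  have "runs (Act (3 + n) (\<lambda>_. (1, Stay))) (?h, ?T n) 1 (?h(3 + n := 0), (?T n)(3 + n := (\<lambda>i. 0)(0 := 1)))"
    using runs_Act[of "3 + n" "\<lambda>_. (1, Stay)" ?h "?T n"] by simp
  from runs_Seq[OF Suc this] show ?case unfolding eq by simp
qed

text \<open>The input \<open>z\<close> stays on tape 0 when the value of \<open>f\<close> arrives on
  tape 1, so the second stage can use both. This is the form needed by a procedure that asks
  \<open>f\<close> one question and then evaluates the answer together with
  \<open>z\<close>.\<close>

theorem poly_time_compose:
  assumes f: "poly_time f" and g: "poly_time g" and F: "tr zy_ctx F" and G: "tr zy_ctx G"
  shows "poly_time (\<lambda>z. g (G (z, f (F (z, [])))))"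
proof -
  obtain C1 R1 q1 k1 S1 where s1: "stage (\<lambda>c. f (F c)) C1 R1 q1 k1 S1" using poly_time_stage[OF F f] by blast
  obtain C2 R2 q2 k2 S2 where s2: "stage (\<lambda>c. g (G c)) C2 R2 q2 k2 S2" using poly_time_stage[OF G g] by blast
  have C1: "3 < R1" "1 \<le> k1" and C2: "3 < R2" "1 \<le> k2" using s1 s2 by (auto simp: stage_def)
  obtain bF where bF: "\<And>c. length (F c) \<le> poly bF (csize zy_ctx c)" using tr_bound[OF F] by blast
  obtain bG where bG: "\<And>c. length (G c) \<le> poly bG (csize zy_ctx c)" using tr_bound[OF G] by blast
  obtain bf where bf: "\<And>x. length (f x) \<le> poly bf (length x)" using poly_time_length[OF f] by blast
  obtain bg where bg: "\<And>x. length (g x) \<le> poly bg (length x)" using poly_time_length[OF g] by blast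
  let ?R = "R1 + R2"
  \<comment> \<open>The second stage gets tapes of its own, since the first one leaves garbage on
    those that it used.\<close>
  let ?o = "?R + k1"
  let ?P = "init_regs (?R - 3) ;; C1 ?R ;; move_str ?R 1 ;; C2 ?o ;; move_str ?o 0"
  let ?Y = "pcompose bf bF"
  let ?t = "[:?R:] + (q1 + ((5 + 9 * ?Y) + (pcompose q2 ([:0, 1:] + ?Y) +
      (5 + 9 * pcompose bg (pcompose bG ([:0, 1:] + ?Y))))))"
  show ?thesis
  proof (rule poly_time_cmd[where A = ?P and K = "?o + k2" and S = "S1 + S2 + 4" and p = ?t])
    show "cmd_ok (?o + k2) (S1 + S2 + 4) ?P"
      using C1(1,2) C2(1,2) cmd_ok_mono[OF stage_cmd_ok[OF s1, of ?R "S1 + S2 + 4"], of "?o + k2"] stage_cmd_ok[OF s2, of ?o "S1 + S2 + 4"]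
      by (auto intro: cmd_ok_init_regs)
    fix z
    define y where "y = f (F (z, []))"
    define v where "v = g (G (z, y))"
    define h0 where "h0 = (\<lambda>j :: nat. if j = 2 then 1 else (0::nat))"
    define T0 where "T0 = (\<lambda>j :: nat. if j = 0 then str_tape z else if j = 2 then out_empty
        else if 3 \<le> j \<and> j < 3 + (?R - 3) then reg_tape else (\<lambda>i. 0))"
    have 1: "runs (init_regs (?R - 3)) (snd (init_config z)) (Suc (?R - 3)) (h0, T0)"
      unfolding h0_def T0_def by (rule runs_init_regs)
    have i0: "idle ?R (z, []) (h0, T0)" using C1(1)
      by (auto simp: idle_iff h0_def T0_def str_tape_def)
    have e0: "h0 r = 0 \<and> T0 r = (\<lambda>i. 0)" if "?R \<le> r" for r using that C1(1) by (auto simp: h0_def T0_def)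
    have "\<exists>h' T'. runs (C1 ?R) (h0, T0) (poly q1 (csize zy_ctx (z, []))) (h', T') \<and> idle ?R (z, []) (h', T') \<and> h' ?R = 0 \<and>
         (\<forall>i < length (f (F (z, []))). T' ?R i = sym_of_bit (f (F (z, [])) ! i)) \<and> T' ?R (length (f (F (z, [])))) = 0 \<and>
         (\<forall>r. r < ?R \<or> ?R + k1 \<le> r \<longrightarrow> h' r = h0 r \<and> T' r = T0 r)"
      by (rule stage_runs[OF s1 _ _ i0]) (use e0 in auto)
    then obtain h1 T1 where 2: "runs (C1 ?R) (h0, T0) (poly q1 (length z)) (h1, T1)"
      and i1: "idle ?R (z, []) (h1, T1)" "h1 ?R = 0"
        "\<And>i. i < length y \<Longrightarrow> T1 ?R i = sym_of_bit (y ! i)" "T1 ?R (length y) = 0"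
      and e1: "\<And>r. ?o \<le> r \<Longrightarrow> h1 r = 0 \<and> T1 r = (\<lambda>i. 0)"
      using e0 by (auto simp: y_def)
    define h2 where "h2 = h1(?R := h1 ?R + length y)"
    define T2 where "T2 = T1(?R := (\<lambda>i. if h1 ?R \<le> i \<and> i < h1 ?R + length y then 0 else T1 ?R i),
       1 := (\<lambda>i. if i < length y then sym_of_bit (y ! i) else if i = length y then 0 else T1 1 i))"
    have 3: "runs (move_str ?R 1) (h1, T1) (5 + length y * 9) (h2, T2)"
      unfolding h2_def T2_def
      by (rule runs_move_str) (use i1 C1(1) in \<open>auto simp: idle_iff\<close>)
    have i2: "idle ?R (z, y) (h2, T2)"
      using i1 C1(1) by (auto simp: idle_iff h2_def T2_def str_tape_def fun_eq_iff)
    have e2: "h2 r = 0 \<and> T2 r = (\<lambda>i. 0)" if "?o \<le> r" for r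
      using e1[OF that] that C1(1,2) by (auto simp: h2_def T2_def)
    have "\<exists>h' T'. runs (C2 ?o) (h2, T2) (poly q2 (csize zy_ctx (z, y))) (h', T') \<and> idle ?R (z, y) (h', T') \<and> h' ?o = 0 \<and>
         (\<forall>i < length (g (G (z, y))). T' ?o i = sym_of_bit (g (G (z, y)) ! i)) \<and> T' ?o (length (g (G (z, y)))) = 0 \<and>
         (\<forall>r. r < ?o \<or> ?o + k2 \<le> r \<longrightarrow> h' r = h2 r \<and> T' r = T2 r)"
      by (rule stage_runs[OF s2 _ _ i2]) (use e2 in auto)
    then obtain h3 T3 where 4: "runs (C2 ?o) (h2, T2) (poly q2 (length z + length y)) (h3, T3)"
      and i3: "idle ?R (z, y) (h3, T3)" "h3 ?o = 0"
        "\<And>i. i < length v \<Longrightarrow> T3 ?o i = sym_of_bit (v ! i)" "T3 ?o (length v) = 0"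
      by (auto simp: v_def)
    define h4 where "h4 = h3(?o := h3 ?o + length v)"
    define T4 where "T4 = T3(?o := (\<lambda>i. if h3 ?o \<le> i \<and> i < h3 ?o + length v then 0 else T3 ?o i),
       0 := (\<lambda>i. if i < length v then sym_of_bit (v ! i) else if i = length v then 0 else T3 0 i))"
    have 5: "runs (move_str ?o 0) (h3, T3) (5 + length v * 9) (h4, T4)"
      unfolding h4_def T4_def
      by (rule runs_move_str) (use i3 C1(1) in \<open>auto simp: idle_iff\<close>)
    let ?n = "length z"
    have y: "length y \<le> poly ?Y ?n"
      using le_trans[OF bf[of "F (z, [])"] poly_mono_nat[OF bF[of "(z, [])"], of bf]]
      by (simp add: y_def poly_pcompose)
    have "length (G (z, y)) \<le> poly (pcompose bG ([:0, 1:] + ?Y)) ?n"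
      using le_trans[OF bG[of "(z, y)"] poly_mono_nat] y by (simp add: poly_pcompose)
    then have v: "length v \<le> poly (pcompose bg (pcompose bG ([:0, 1:] + ?Y))) ?n"
      using le_trans[OF bg poly_mono_nat] by (simp add: v_def poly_pcompose[of bg])
    have q: "poly q2 (?n + length y) \<le> poly (pcompose q2 ([:0, 1:] + ?Y)) ?n"
      using poly_mono_nat[of "?n + length y" "?n + poly ?Y ?n" q2] y by (simp add: poly_pcompose)
    have t: "Suc (?R - 3) + (poly q1 ?n + ((5 + length y * 9) + (poly q2 (?n + length y) + (5 + length v * 9))))
        \<le> poly ?t ?n"
    proof -
      have "poly ?t ?n = ?R + (poly q1 ?n + ((5 + 9 * poly ?Y ?n) + (poly (pcompose q2 ([:0, 1:] + ?Y)) ?n +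
         (5 + 9 * poly (pcompose bg (pcompose bG ([:0, 1:] + ?Y))) ?n))))" by simp
      then show ?thesis using y v q C1(1) by linarith
    qed
    have "runs ?P (snd (init_config z)) (poly ?t ?n) (h4, T4)"
      by (rule runs_mono[OF runs_Seq[OF 1 runs_Seq[OF 2 runs_Seq[OF 3 runs_Seq[OF 4 5]]]] t])
    then obtain t where "t \<le> poly ?t ?n" "run ?P (snd (init_config z)) t (h4, T4)"
      unfolding runs_def by blast
    moreover have "(\<forall>i < length v. T4 0 i = sym_of_bit (v ! i)) \<and> T4 0 (length v) = 0" by (simp add: T4_def)
    ultimately show "\<exists>t h T. t \<le> poly ?t (length z) \<and> run ?P (snd (init_config z)) t (h, T) \<and>
           (\<forall>i < length (g (G (z, f (F (z, []))))). T 0 i = sym_of_bit (g (G (z, f (F (z, [])))) ! i)) \<and>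
           T 0 (length (g (G (z, f (F (z, [])))))) = 0"
      unfolding y_def[symmetric] v_def[symmetric] by blast
  qed (use C1 in auto)
qed

section \<open>Computation tableaux\<close>

text \<open>Tuples of indices are coded in mixed radix; this peels off one digit.\<close>

lemma all_div_mod:
  "(\<forall>d < m * n. P (d div n) (d mod n)) \<longleftrightarrow> (\<forall>x < m. \<forall>y < (n::nat). P x y)"
proof (intro iffI allI impI)
  fix x y assume *: "\<forall>d < m * n. P (d div n) (d mod n)" and xy: "x < m" "y < n"
  have "x * n + y < Suc x * n" using xy by simp
  also have "\<dots> \<le> m * n" using xy by (intro mult_le_mono1) simp
  finally have "P ((x * n + y) div n) ((x * n + y) mod n)" using * by blast
  then show "P x y" using xy by simp
next
  fix d assume *: "\<forall>x < m. \<forall>y < n. P x y" and d: "d < m * n"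
  then have "0 < n" by (cases n) auto
  then have "d div n < m" "d mod n < n" using d by (simp_all add: div_less_iff_less_mult)
  then show "P (d div n) (d mod n)" using * by blast
qed

lemma all_less_add: "(\<forall>c < m + n. P c) \<longleftrightarrow> (\<forall>x < m. P x) \<and> (\<forall>d < n. P (m + d :: nat))"
proof (intro iffI allI impI)
  fix c assume *: "(\<forall>x < m. P x) \<and> (\<forall>d < n. P (m + d))" and c: "c < m + n"
  show "P c"
  proof (cases "c < m")
    case False
    then have "P (m + (c - m))" using * c by (intro *[THEN conjunct2, rule_format]) linarith
    then show ?thesis using False by simp
  qed (use * in blast)
qed auto

lemma mult_add_div_mod: "v < q \<Longrightarrow> (x * q + v) div q = (x :: nat)" "v < q \<Longrightarrow> (x * q + v) mod q = v"
  by simp_all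

text \<open>A control is a state together with all scanned symbols. Keeping it in a single cell
  makes the next action a function of one value; any enumeration of the finite set will do.\<close>

definition ctrls :: "tm \<Rightarrow> (nat \<times> nat list) list" where
  "ctrls M = (SOME xs. set xs = {..num_states M} \<times> {as. set as \<subseteq> {..<num_syms M} \<and> length as = num_tapes M})"

lemma set_ctrls: "set (ctrls M) = {..num_states M} \<times> {as. set as \<subseteq> {..<num_syms M} \<and> length as = num_tapes M}"
  unfolding ctrls_def by (rule someI_ex, rule finite_list) (simp add: finite_lists_length_eq)

text \<open>A halting configuration repeats itself, so every row of the tableau has a
  successor.\<close>

definition act :: "tm \<Rightarrow> nat \<times> nat list \<Rightarrow> nat \<times> (nat \<times> move) list" where
  "act M c = (if fst c \<ge> num_states M then (fst c, map (\<lambda>b. (b, Stay)) (snd c)) else trans M (fst c) (snd c))"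

text \<open>Tape 0 holds the known string \<open>s0\<close> followed by an unknown witness of length
  at most \<open>P\<close>; \<open>B\<close> is the number of steps.\<close>

locale tableau =
  fixes M :: tm and B P :: nat and s0 :: "bool list"
begin

abbreviation "k \<equiv> num_tapes M"
abbreviation "S \<equiv> num_syms M"
definition NV where "NV = length (ctrls M)"
text \<open>Within \<open>B\<close> steps no head gets beyond cell \<open>B\<close>; the summand 2
  guarantees the cells 0 and 1, in which the output is checked.\<close>

definition Wd where "Wd = B + length s0 + P + 2"
text \<open>One range of values for all cells: indices of controls, symbols and head positions all
  lie below \<open>q\<close>.\<close>

definition q where "q = NV + S + Wd"
definition Rw where "Rw = 1 + k + k * Wd"
definition Mv where "Mv = (B + 1) * Rw"
text \<open>The first \<open>Mv\<close> requirements demand a value for every cell; each of the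
  others is given by one of 12 rules, a time, a tape, a position and two values.\<close>

definition J where "J = Mv + 12 * (B + 1) * k * Wd * q * q"

definition cst where "cst v = fst (ctrls M ! v)"
definition csc where "csc v j = snd (ctrls M ! v) ! j"
definition nst where "nst v = fst (act M (ctrls M ! v))"
definition cwr where "cwr v j = fst (snd (act M (ctrls M ! v)) ! j)"
definition cdir where "cdir v j = snd (snd (act M (ctrls M ! v)) ! j)"

text \<open>A row consists of one control cell, \<open>k\<close> cells for the head positions and
  \<open>k * Wd\<close> tape cells.\<close>

definition Xc :: "nat \<Rightarrow> nat" where "Xc t = t * Rw"
definition Xh :: "nat \<Rightarrow> nat \<Rightarrow> nat" where "Xh t j = t * Rw + 1 + j"
definition Xs :: "nat \<Rightarrow> nat \<Rightarrow> nat \<Rightarrow> nat" where "Xs t j i = t * Rw + 1 + k + (j * Wd + i)"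

definition una :: "nat \<Rightarrow> (nat \<Rightarrow> bool) \<Rightarrow> nat \<Rightarrow> bool" where
  "una X R g \<longleftrightarrow> g div q = X \<and> R (g mod q)"

text \<open>The implication \<open>val X1 = a \<longrightarrow> val X2 = b \<longrightarrow> R (val
  X3)\<close> as a set of pairs to be hit: since every cell has exactly one value, having a value
  other than \<open>a\<close> means that another pair of that cell is chosen.\<close>

definition imp :: "nat \<Rightarrow> nat \<Rightarrow> nat \<Rightarrow> nat \<Rightarrow> nat \<Rightarrow> (nat \<Rightarrow> bool) \<Rightarrow> nat \<Rightarrow> bool" where
  "imp X1 a X2 b X3 R g \<longleftrightarrow>
     g div q = X1 \<and> g mod q \<noteq> a \<or> g div q = X2 \<and> g mod q \<noteq> b \<or> g div q = X3 \<and> R (g mod q)"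

text \<open>Rules 0 to 4 describe a step: next state, agreement of control and scanned symbols, head
  movement, written symbol, untouched cells. Rules 5 to 8 fix the initial configuration, where 7
  admits only blanks after the first blank of the witness region; 9 to 11 demand halting with output
  True. A rule whose side condition fails contains every pair. The range conditions,
  \<open>0 < Suc 0\<close> among them, give the lookups the form decided by
  \<open>pfb_table2\<close> and \<open>pfb_table3\<close>.\<close>

definition rule :: "nat \<Rightarrow> nat \<Rightarrow> nat \<Rightarrow> nat \<Rightarrow> nat \<Rightarrow> nat \<Rightarrow> nat \<Rightarrow> bool" where
  "rule f t j i a b g \<longleftrightarrow>
    (if f = 0 then t < B \<longrightarrow> imp (Xc t) a (Xc t) a (Xc (t + 1)) (\<lambda>v. a < NV \<and> v < NV \<and> cst v = nst a) g
     else if f = 1 then imp (Xh t j) i (Xs t j i) a (Xc t) (\<lambda>v. v < NV \<and> j < k \<and> a < S \<and> csc v j = a) g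
     else if f = 2 then t < B \<longrightarrow> imp (Xc t) a (Xh t j) i (Xh (t + 1) j)
        (\<lambda>v. a < NV \<and> j < k \<and> cdir a j = Go_Left \<and> v = i - 1 \<or>
             a < NV \<and> j < k \<and> cdir a j = Stay \<and> v = i \<or>
             a < NV \<and> j < k \<and> cdir a j = Go_Right \<and> v = i + 1) g
     else if f = 3 then t < B \<longrightarrow> imp (Xc t) a (Xh t j) i (Xs (t + 1) j i)
        (\<lambda>v. a < NV \<and> j < k \<and> v < S \<and> cwr a j = v) g
     else if f = 4 then t < B \<and> b \<noteq> i \<longrightarrow> imp (Xh t j) b (Xs t j i) a (Xs (t + 1) j i) (\<lambda>v. v = a) g
     else if f = 5 then una (Xh 0 j) (\<lambda>v. v = 0) g
     else if f = 6 then una (Xs 0 j i) (\<lambda>v. if j = 0 \<and> i < length s0 then v = str_tape s0 i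
        else if j = 0 \<and> i < length s0 + P then v < 3 else v = 0) g
     else if f = 7 then length s0 \<le> i \<and> i + 1 < Wd \<longrightarrow>
        imp (Xs 0 0 i) 0 (Xs 0 0 i) 0 (Xs 0 0 (i + 1)) (\<lambda>v. v = 0) g
     else if f = 8 then una (Xc 0) (\<lambda>v. v < NV \<and> 0 < Suc 0 \<and> cst v = 0) g
     else if f = 9 then una (Xc B) (\<lambda>v. v < NV \<and> 0 < Suc 0 \<and> cst v = num_states M) g
     else if f = 10 then una (Xs B 0 0) (\<lambda>v. v = 2) g
     else una (Xs B 0 1) (\<lambda>v. v = 0) g)"

definition E :: "nat \<Rightarrow> nat \<Rightarrow> bool" where
  "E c g \<longleftrightarrow> (if c < Mv then g div q = c else
     rule ((c - Mv) div q div q div Wd div k div (B + 1)) ((c - Mv) div q div q div Wd div k mod (B + 1))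
       ((c - Mv) div q div q div Wd mod k) ((c - Mv) div q div q mod Wd)
       ((c - Mv) div q mod q) ((c - Mv) mod q) g)"

lemma all_E:
  "(\<forall>c<J. \<exists>g\<in>A. E c g) \<longleftrightarrow> (\<forall>x<Mv. \<exists>g\<in>A. g div q = x) \<and>
     (\<forall>f<12. \<forall>t<B + 1. \<forall>j<k. \<forall>i<Wd. \<forall>a<q. \<forall>b<q. \<exists>g\<in>A. rule f t j i a b g)"
proof -
  let ?n = "12 * (B + 1) * k * Wd * q * q"
  have "(\<forall>c<J. \<exists>g\<in>A. E c g) \<longleftrightarrow> (\<forall>x<Mv. \<exists>g\<in>A. E x g) \<and> (\<forall>d<?n. \<exists>g\<in>A. E (Mv + d) g)"
    unfolding J_def by (rule all_less_add)
  also have "(\<forall>x<Mv. \<exists>g\<in>A. E x g) \<longleftrightarrow> (\<forall>x<Mv. \<exists>g\<in>A. g div q = x)" by (simp add: E_def)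
  also have "(\<forall>d<?n. \<exists>g\<in>A. E (Mv + d) g) \<longleftrightarrow>
    (\<forall>d<?n. \<exists>g\<in>A. rule (d div q div q div Wd div k div (B + 1)) (d div q div q div Wd div k mod (B + 1))
       (d div q div q div Wd mod k) (d div q div q mod Wd) (d div q mod q) (d mod q) g)"
    by (simp add: E_def)
  also have "\<dots> \<longleftrightarrow> (\<forall>f<12. \<forall>t<B + 1. \<forall>j<k. \<forall>i<Wd. \<forall>a<q. \<forall>b<q. \<exists>g\<in>A. rule f t j i a b g)"
    unfolding all_div_mod[where P = "\<lambda>d b. \<exists>g\<in>A. rule (d div q div Wd div k div (B + 1)) (d div q div Wd div k mod (B + 1))
       (d div q div Wd mod k) (d div q mod Wd) (d mod q) b g"]
    unfolding all_div_mod[where P = "\<lambda>d a. \<forall>b<q. \<exists>g\<in>A. rule (d div Wd div k div (B + 1)) (d div Wd div k mod (B + 1))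
       (d div Wd mod k) (d mod Wd) a b g"]
    unfolding all_div_mod[where P = "\<lambda>d i. \<forall>a<q. \<forall>b<q. \<exists>g\<in>A. rule (d div k div (B + 1)) (d div k mod (B + 1))
       (d mod k) i a b g"]
    unfolding all_div_mod[where P = "\<lambda>d j. \<forall>i<Wd. \<forall>a<q. \<forall>b<q. \<exists>g\<in>A. rule (d div (B + 1)) (d mod (B + 1)) j i a b g"]
    unfolding all_div_mod[where P = "\<lambda>f t. \<forall>j<k. \<forall>i<Wd. \<forall>a<q. \<forall>b<q. \<exists>g\<in>A. rule f t j i a b g"]
    ..
  finally show ?thesis .
qed

text \<open>The element \<open>x * q + v\<close> stands for the pair of cell \<open>x\<close> and
  value \<open>v\<close>.\<close>

definition graph :: "(nat \<Rightarrow> nat) \<Rightarrow> nat set" where "graph val = (\<lambda>x. x * q + val x) ` {..<Mv}"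

definition proper :: "(nat \<Rightarrow> nat) \<Rightarrow> bool" where "proper val \<longleftrightarrow> (\<forall>x<Mv. val x < q)"

lemma graph_bex: "proper val \<Longrightarrow> (\<exists>g\<in>graph val. Q (g div q) (g mod q)) \<longleftrightarrow> (\<exists>x<Mv. Q x (val x))"
proof -
  assume p: "proper val"
  have "(\<exists>g\<in>graph val. Q (g div q) (g mod q)) \<longleftrightarrow> (\<exists>x<Mv. Q ((x * q + val x) div q) ((x * q + val x) mod q))"
    by (auto simp: graph_def)
  also have "\<dots> \<longleftrightarrow> (\<exists>x<Mv. Q x (val x))"
    using p unfolding proper_def by (metis mult_add_div_mod)
  finally show ?thesis .
qed

lemma una_graph:
  assumes "proper val" "X < Mv" shows "(\<exists>g\<in>graph val. una X R g) \<longleftrightarrow> R (val X)"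
  unfolding una_def graph_bex[OF assms(1), of "\<lambda>x v. x = X \<and> R v"] using assms(2) by blast

lemma imp_graph:
  assumes "proper val" "X1 < Mv" "X2 < Mv" "X3 < Mv"
  shows "(\<exists>g\<in>graph val. imp X1 a X2 b X3 R g) \<longleftrightarrow> (val X1 = a \<longrightarrow> val X2 = b \<longrightarrow> R (val X3))"
  unfolding imp_def graph_bex[OF assms(1), of "\<lambda>x v. x = X1 \<and> v \<noteq> a \<or> x = X2 \<and> v \<noteq> b \<or> x = X3 \<and> R v"]
  using assms(2-4) by blast

lemma graph_props:
  assumes "proper val"
  shows "graph val \<subseteq> {..<Mv * q}" "card (graph val) = Mv" "\<forall>x<Mv. \<exists>g\<in>graph val. g div q = x"
proof -
  show "\<forall>x<Mv. \<exists>g\<in>graph val. g div q = x"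
    using graph_bex[OF assms, of "\<lambda>x v. x = _"] by auto
  show "graph val \<subseteq> {..<Mv * q}"
  proof
    fix g assume "g \<in> graph val"
    then obtain x where x: "x < Mv" "g = x * q + val x" by (auto simp: graph_def)
    then have "g < Suc x * q" using assms by (simp add: proper_def)
    also have "\<dots> \<le> Mv * q" using x by (intro mult_le_mono1) simp
    finally show "g \<in> {..<Mv * q}" by simp
  qed
  have "inj_on (\<lambda>x. x * q + val x) {..<Mv}"
  proof (rule inj_onI)
    fix x y assume *: "x \<in> {..<Mv}" "y \<in> {..<Mv}" and eq: "x * q + val x = y * q + val y"
    have "(x * q + val x) div q = x" "(y * q + val y) div q = y"
      using * assms unfolding proper_def by (simp_all only: mult_add_div_mod lessThan_iff)
    then show "x = y" using eq by metis
  qed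
  then show "card (graph val) = Mv" by (simp add: graph_def card_image)
qed

text \<open>A set of only \<open>Mv\<close> elements that meets all \<open>Mv\<close> cells meets
  each of them once. This is what the fixed cardinality of a solution is for.\<close>

lemma hits_graph:
  assumes A: "A \<subseteq> {..<Mv * q}" "card A = Mv" and at: "\<forall>x<Mv. \<exists>g\<in>A. g div q = x"
  shows "\<exists>val. proper val \<and> A = graph val"
proof -
  have fA: "finite A" using A(1) finite_subset by blast
  have lt: "g div q < Mv" "g mod q < q" if "g \<in> A" for g
  proof -
    have "g < Mv * q" using A(1) that by auto
    moreover from this have "0 < q" by (cases q) auto
    ultimately show "g div q < Mv" "g mod q < q" by (simp_all add: div_less_iff_less_mult)
  qed
  have "(\<lambda>g. g div q) ` A = {..<Mv}" using at lt by (force simp: image_iff)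
  then have inj: "inj_on (\<lambda>g. g div q) A" by (intro eq_card_imp_inj_on[OF fA]) (simp add: A(2))
  obtain s where s: "\<And>x. x < Mv \<Longrightarrow> s x \<in> A \<and> s x div q = x" using at by metis
  let ?val = "\<lambda>x. s x mod q"
  have sx: "x * q + ?val x = s x" if "x < Mv" for x using s[OF that] div_mult_mod_eq[of "s x" q] by simp
  have "graph ?val \<subseteq> A" unfolding graph_def using sx s by auto
  moreover have "g \<in> graph ?val" if g: "g \<in> A" for g
  proof -
    have "s (g div q) = g" using inj s[OF lt(1)[OF g]] g by (meson inj_onD)
    then have "g = (g div q) * q + ?val (g div q)" by simp
    then show ?thesis unfolding graph_def using lt(1)[OF g] by blast
  qed
  moreover have "proper ?val" using s lt by (simp add: proper_def)
  ultimately show ?thesis by blast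
qed

lemma X_less:
  assumes "t \<le> B" shows "Xc t < Mv" "j < k \<Longrightarrow> Xh t j < Mv" "j < k \<Longrightarrow> i < Wd \<Longrightarrow> Xs t j i < Mv"
proof -
  have "(t + 1) * Rw \<le> Mv" unfolding Mv_def using assms by (intro mult_le_mono1) simp
  then have *: "t * Rw + Rw \<le> Mv" by simp
  show "Xc t < Mv" "j < k \<Longrightarrow> Xh t j < Mv" using * by (auto simp: Xc_def Xh_def Rw_def)
  assume "j < k" "i < Wd"
  then have "j * Wd + i < Suc j * Wd" by simp
  also have "\<dots> \<le> k * Wd" using \<open>j < k\<close> by (intro mult_le_mono1) simp
  finally show "Xs t j i < Mv" using * by (simp add: Xs_def Rw_def)
qed

definition row :: "(nat \<Rightarrow> nat) \<Rightarrow> nat \<Rightarrow> config \<Rightarrow> bool" where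
  "row val t cf \<longleftrightarrow> (case cf of (s, h, T) \<Rightarrow> val (Xc t) < NV \<and>
     ctrls M ! val (Xc t) = (s, map (\<lambda>j. T j (h j)) [0..<k]) \<and>
     (\<forall>j<k. val (Xh t j) = h j \<and> (\<forall>i<Wd. val (Xs t j i) = T j i)))"

text \<open>The rules as statements about values, free of pairs and coded indices.\<close>

definition sem :: "(nat \<Rightarrow> nat) \<Rightarrow> bool" where
  "sem val \<longleftrightarrow>
    (\<forall>t<B. \<forall>a<NV. val (Xc t) = a \<longrightarrow> val (Xc (t + 1)) < NV \<and> cst (val (Xc (t + 1))) = nst a) \<and>
    (\<forall>t\<le>B. \<forall>j<k. \<forall>i<Wd. val (Xh t j) = i \<longrightarrow> val (Xc t) < NV \<and> val (Xs t j i) < S \<and> csc (val (Xc t)) j = val (Xs t j i)) \<and>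
    (\<forall>t<B. \<forall>j<k. \<forall>i<Wd. val (Xc t) < NV \<longrightarrow> val (Xh t j) = i \<longrightarrow>
       val (Xh (t + 1) j) = move_head (cdir (val (Xc t)) j) i \<and>
       val (Xs (t + 1) j i) < S \<and> val (Xs (t + 1) j i) = cwr (val (Xc t)) j) \<and>
    (\<forall>t<B. \<forall>j<k. \<forall>i<Wd. val (Xh t j) \<noteq> i \<longrightarrow> val (Xs (t + 1) j i) = val (Xs t j i)) \<and>
    (\<forall>j<k. val (Xh 0 j) = 0) \<and>
    (\<forall>j<k. \<forall>i<Wd. if j = 0 \<and> i < length s0 then val (Xs 0 j i) = str_tape s0 i
        else if j = 0 \<and> i < length s0 + P then val (Xs 0 j i) < 3 else val (Xs 0 j i) = 0) \<and>
    (\<forall>i. length s0 \<le> i \<longrightarrow> i + 1 < Wd \<longrightarrow> val (Xs 0 0 i) = 0 \<longrightarrow> val (Xs 0 0 (i + 1)) = 0) \<and>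
    val (Xc 0) < NV \<and> cst (val (Xc 0)) = 0 \<and>
    val (Xc B) < NV \<and> cst (val (Xc B)) = num_states M \<and>
    val (Xs B 0 0) = 2 \<and> val (Xs B 0 1) = 0"

end

section \<open>Hitting sets as clustering instances\<close>

text \<open>A set lies within one block, so every block needs a set of its own. With no more sets
  than blocks, each block has exactly one, and that one has to cover it alone.\<close>

lemma partition_cover_eq:
  assumes P: "partition_on X P" "finite P" and B: "\<And>B. B \<in> \<B> \<Longrightarrow> \<exists>b\<in>P. B \<subseteq> b"
    and cov: "X \<subseteq> \<Union>\<B>" and card: "finite \<B>" "card \<B> \<le> card P" and b: "b \<in> P"
  shows "\<exists>B\<in>\<B>. b \<subseteq> B"
proof -
  have disj: "b1 = b2" if "b1 \<in> P" "b2 \<in> P" "x \<in> b1" "x \<in> b2" for b1 b2 x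
    using P(1) that by (auto simp: partition_on_def disjoint_def)
  have ne: "\<exists>x. x \<in> b" if "b \<in> P" for b using P(1) that by (metis all_not_in_conv partition_on_def)
  have sub: "b \<subseteq> X" if "b \<in> P" for b using P(1) that by (auto simp: partition_on_def)
  have in_block: "B \<subseteq> b" if "B \<in> \<B>" "x \<in> B" "b \<in> P" "x \<in> b" for B b x
    using B[OF that(1)] disj that by blast
  have "\<exists>B\<in>\<B>. \<exists>x\<in>B. x \<in> b" if "b \<in> P" for b
    using ne[OF that] sub[OF that] cov by blast
  then obtain h where h: "\<And>b. b \<in> P \<Longrightarrow> h b \<in> \<B> \<and> (\<exists>x\<in>h b. x \<in> b)" by metis
  have inj: "inj_on h P"
  proof (rule inj_onI)
    fix b1 b2 assume 1: "b1 \<in> P" "b2 \<in> P" "h b1 = h b2"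
    obtain x where "x \<in> h b1" "x \<in> b1" using h 1 by blast
    moreover have "h b1 \<subseteq> b2" using in_block[of "h b2"] h[of b2] 1 by auto
    ultimately show "b1 = b2" using disj 1 by blast
  qed
  have "h ` P = \<B>"
    using h card card_mono[OF card(1), of "h ` P"]
    by (intro card_subset_eq) (auto simp: card_image[OF inj])
  moreover have "y \<in> h b" if y: "y \<in> b" for y
  proof -
    obtain B where 1: "B \<in> \<B>" "y \<in> B" using cov sub[OF b] y by blast
    then obtain b' where 2: "b' \<in> P" "B = h b'" using \<open>h ` P = \<B>\<close> by blast
    obtain x where "x \<in> h b'" "x \<in> b'" using h 2 by blast
    moreover have "B \<subseteq> b" using in_block 1 b y by blast
    ultimately have "b' = b" using disj 2 b by blast
    then show ?thesis using 1 2 by simp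
  qed
  ultimately show ?thesis using h[OF b] by blast
qed

lemma placement_balls_UN:
  "placement_balls I \<alpha> S =
      (\<Union>i<length (radii I). (\<lambda>p. nukc_ball I p (\<alpha> * radii I ! i)) ` set (S ! i))"
  unfolding placement_balls_def by auto

lemma card_placement_balls:
  assumes "length S = length (radii I)" "\<And>i. i < length (radii I) \<Longrightarrow> length (S ! i) = counts I ! i"
    "length (counts I) = length (radii I)"
  shows "finite (placement_balls I \<alpha> S)" "card (placement_balls I \<alpha> S) \<le> sum_list (counts I)"
proof -
  have eq: "placement_balls I \<alpha> S =
      (\<Union>i<length (radii I). (\<lambda>p. nukc_ball I p (\<alpha> * radii I ! i)) ` set (S ! i))"
    by (rule placement_balls_UN)
  show "finite (placement_balls I \<alpha> S)" unfolding eq by auto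
  have "card (placement_balls I \<alpha> S) \<le>
      (\<Sum>i<length (radii I). card ((\<lambda>p. nukc_ball I p (\<alpha> * radii I ! i)) ` set (S ! i)))"
    unfolding eq by (rule card_UN_le) simp
  also have "\<dots> \<le> (\<Sum>i<length (radii I). counts I ! i)"
    using assms by (intro sum_mono) (metis card_image_le card_length finite_set le_trans lessThan_iff)
  also have "\<dots> = sum_list (counts I)"
    using assms(3) by (simp add: sum_list_sum_nth atLeast0LessThan)
  finally show "card (placement_balls I \<alpha> S) \<le> sum_list (counts I)" .
qed

text \<open>
  For a fixed placement only the finitely many dilations at which a ball acquires a point matter.
\<close>

lemma optimal_dilation_exists:
  assumes I: "finite (points I)" "\<And>r. r \<in> set (radii I) \<Longrightarrow> r > 0"
    and f: "feasible_placement I \<alpha> S"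
  shows "\<exists>\<beta>. optimal_dilation I \<beta>"
proof -
  define V where "V = insert 0 ((\<lambda>(p, q, r). metr I p q / r) ` (points I \<times> points I \<times> set (radii I)))"
  have fin: "finite V" unfolding V_def using I(1) by auto
  have down: "\<exists>\<beta>'\<in>V. \<beta>' \<le> \<beta> \<and> feasible_placement I \<beta>' S'" if f: "feasible_placement I \<beta> S'" for \<beta> S'
  proof -
    \<comment> \<open>The largest threshold not above \<beta>; no ball changes between it and
      \<beta>. The threshold 0 ensures that one exists.\<close>
    let ?\<beta> = "Max {v \<in> V. v \<le> \<beta>}"
    have b0: "0 \<le> \<beta>" using f by (simp add: feasible_placement_def)
    have ne: "{v \<in> V. v \<le> \<beta>} \<noteq> {}" using b0 by (auto simp: V_def)
    have m: "?\<beta> \<in> V" "?\<beta> \<le> \<beta>" using Max_in[OF _ ne] fin by auto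
    have "0 \<le> ?\<beta>" using fin b0 by (intro Max_ge) (auto simp: V_def)
    have "nukc_ball I p (?\<beta> * radii I ! i) = nukc_ball I p (\<beta> * radii I ! i)"
      if "i < length (radii I)" "p \<in> points I" for i p
    proof -
      have r: "radii I ! i > 0" "radii I ! i \<in> set (radii I)" using I(2) that by auto
      have "metr I p q \<le> ?\<beta> * radii I ! i \<longleftrightarrow> metr I p q \<le> \<beta> * radii I ! i" if "q \<in> points I" for q
      proof
        assume "metr I p q \<le> ?\<beta> * radii I ! i"
        also have "\<dots> \<le> \<beta> * radii I ! i" using m r by (intro mult_right_mono) auto
        finally show "metr I p q \<le> \<beta> * radii I ! i" .
      next
        assume "metr I p q \<le> \<beta> * radii I ! i"
        then have "metr I p q / radii I ! i \<le> \<beta>" using r by (simp add: divide_simps)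
        moreover have "metr I p q / radii I ! i \<in> V"
          unfolding V_def using that r \<open>p \<in> points I\<close> by (intro insertI2 image_eqI[of _ _ "(p, q, radii I ! i)"]) auto
        ultimately have "metr I p q / radii I ! i \<le> ?\<beta>" using fin by (intro Max_ge) auto
        then show "metr I p q \<le> ?\<beta> * radii I ! i" using r by (simp add: divide_simps)
      qed
      then show ?thesis by (auto simp: nukc_ball_def)
    qed
    then have "placement_balls I ?\<beta> S' = placement_balls I \<beta> S'"
      using f unfolding placement_balls_UN feasible_placement_def
      by (intro SUP_cong image_cong) auto
    then have "feasible_placement I ?\<beta> S'" using f \<open>0 \<le> ?\<beta>\<close> by (simp add: feasible_placement_def)
    then show ?thesis using m by blast
  qed
  let ?W = "{v \<in> V. \<exists>S. feasible_placement I v S}"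
  have "?W \<noteq> {}" using down[OF f] by blast
  then have m: "Min ?W \<in> ?W" using fin by (intro Min_in) auto
  have "Min ?W \<le> \<beta>" if "feasible_placement I \<beta> S'" for \<beta> S'
  proof -
    obtain v where "v \<in> ?W" "v \<le> \<beta>" using down[OF \<open>feasible_placement I \<beta> S'\<close>] by blast
    moreover have "finite ?W" using fin by simp
    ultimately show ?thesis using Min_le[of ?W v] by linarith
  qed
  then show ?thesis using m unfolding optimal_dilation_def by blast
qed

text \<open>
  Choose \<open>K\<close> of \<open>G\<close> groups such that for every \<open>c < J\<close> some chosen group \<open>g\<close> satisfies \<open>E c g\<close>; a
  group that is not chosen costs the number of its marks \<open>w g u\<close>, \<open>u < U\<close>. Each group consists of
  \<open>J + U\<close> pairs of points. The \<open>K\<close> balls of radius class 0 cover whole groups, all others at most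
  one pair. Pair \<open>c < J\<close> of group \<open>g\<close> fits into the classes up to \<open>1 + 2 * c\<close> if \<open>E c g\<close>, and up to
  \<open>2 + 2 * c\<close> otherwise; as class \<open>1 + 2 * c\<close> has fewer balls than there are groups with \<open>E c g\<close>,
  one of these must be chosen. The classes above \<open>2 * J\<close> have one ball each, with
  exponents \<open>T, \<dots>, 1\<close>, and covering the pairs with marks by them forces the dilation to grow with
  the number of marks.
\<close>

locale hitting =
  fixes G K J U :: nat and E :: "nat \<Rightarrow> nat \<Rightarrow> bool" and w :: "nat \<Rightarrow> nat \<Rightarrow> bool"
begin

definition N where "N = J + U"
text \<open>An upper bound for the cost of every admissible set, and therefore the number of classes
  needed to measure costs.\<close>

definition T where "T = (G - K) * U"
text \<open>The spacing of the large exponents: it exceeds a shift by \<open>W \<le> T\<close> even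
  when added to an exponent up to \<open>T\<close> of the last classes.\<close>

definition L where "L = 2 * T + 2"
definition n where "n = 2 * N * G"

definition item_exp :: "nat \<Rightarrow> nat" where
  "item_exp i = (let g = i div N; c = i mod N in
     if c < J then L * (2 * J + 1 - (if E c g then 1 + 2 * c else 2 + 2 * c))
     else if w g (c - J) then T + 1 else 0)"

text \<open>The distances of a tree with the levels group, pair and point, hence
  ultrametric.\<close>

definition dist_exp :: "nat \<Rightarrow> nat \<Rightarrow> nat" where
  "dist_exp p q = (if p div 2 div N \<noteq> q div 2 div N then L * (2 * J + 2)
     else if p div 2 \<noteq> q div 2 then L * (2 * J + 1) else item_exp (p div 2))"

definition rad_exp :: "nat \<Rightarrow> nat" where
  "rad_exp \<kappa> = (if \<kappa> \<le> 2 * J then L * (2 * J + 1 - \<kappa>) else T + 1 + 2 * J - \<kappa>)"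

text \<open>One ball fewer than there are groups satisfying \<open>c\<close>, so they cannot all
  remain unchosen. The minimum makes the subtraction in \<open>cnt\<close> exact: the two classes of
  \<open>c\<close> together have \<open>G - K\<close> balls.\<close>

definition bound :: "nat \<Rightarrow> nat" where
  "bound c = min (card {g. g < G \<and> E c g} - 1) (G - K)"

definition cnt :: "nat \<Rightarrow> nat" where
  "cnt \<kappa> = (if \<kappa> = 0 then K else if \<kappa> \<le> 2 * J then
     (if odd \<kappa> then bound ((\<kappa> - 1) div 2) else G - K - bound ((\<kappa> - 1) div 2)) else 1)"

definition hits :: "nat set \<Rightarrow> bool" where
  "hits A \<longleftrightarrow> A \<subseteq> {..<G} \<and> card A = K \<and> (\<forall>c<J. \<exists>g\<in>A. E c g)"

definition cost :: "nat set \<Rightarrow> nat" where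
  "cost A = card {(g, u). g < G \<and> g \<notin> A \<and> u < U \<and> w g u}"

text \<open>The most that a ball of radius exponent \<open>e\<close> can contain as long as the
  dilation, multiplied by the perturbation factor, stays below \<open>2 ^ (Q * (W + 1))\<close>. The
  center belongs to the ball regardless of its exponent.\<close>

definition nball :: "nat \<Rightarrow> nat \<Rightarrow> nat \<Rightarrow> nat set" where
  "nball W p e = {q. q < n \<and> (q = p \<or> dist_exp p q \<le> e + W)}"

definition blocks :: "nat set \<Rightarrow> nat set set" where
  "blocks A = (\<lambda>g. {p. p < n \<and> p div 2 div N = g}) ` A \<union>
     (\<lambda>i. {2 * i, 2 * i + 1}) ` {i. i < G * N \<and> i div N \<notin> A}"

definition groups :: "nat list list \<Rightarrow> nat set" where
  "groups S = (\<lambda>p. p div 2 div N) ` set (S ! 0)"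

text \<open>Feasibility in terms of exponents alone, so that the counting argument is free of reals,
  of \<open>Q\<close> and of the perturbation.\<close>

definition covers :: "nat \<Rightarrow> nat list list \<Rightarrow> bool" where
  "covers W S \<longleftrightarrow> length S = 1 + 2 * J + T \<and>
     (\<forall>\<kappa> < 1 + 2 * J + T. length (S ! \<kappa>) = cnt \<kappa> \<and> set (S ! \<kappa>) \<subseteq> {..<n}) \<and>
     (\<forall>q<n. \<exists>\<kappa> < 1 + 2 * J + T. \<exists>p\<in>set (S ! \<kappa>). q \<in> nball W p (rad_exp \<kappa>))"

section \<open>The number of balls per class and the pairs that fit into them\<close>

lemma bound_le: "bound c \<le> G - K" by (simp add: bound_def)

lemma cnt_sum:
  assumes "j \<le> J" shows "(\<Sum>\<kappa>=1..<1+2*j. cnt \<kappa>) = j * (G - K)"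
  using assms
proof (induction j)
  case (Suc j)
  have "{1..<1+2*Suc j} = {1..<1+2*j} \<union> {1+2*j, 2+2*j}" by auto
  moreover have "(\<Sum>\<kappa>\<in>{1..<1+2*j} \<union> {1+2*j, 2+2*j}. cnt \<kappa>) = (\<Sum>\<kappa>=1..<1+2*j. cnt \<kappa>) + (cnt (1+2*j) + cnt (2+2*j))"
    by (subst sum.union_disjoint) auto
  moreover have "cnt (1+2*j) + cnt (2+2*j) = G - K"
    using bound_le[of j] Suc.prems by (simp add: cnt_def)
  ultimately show ?case using Suc by simp
qed simp

text \<open>The classes from 1 to \<open>2 * J\<close> have as many balls as \<open>G - K\<close>
  unchosen groups have requirement pairs; every further class adds one ball.\<close>

lemma cnt_sum_iso:
  assumes "W \<le> T" shows "(\<Sum>\<kappa>=1..<1+2*J+W. cnt \<kappa>) = J * (G - K) + W"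
proof -
  have "{1..<1+2*J+W} = {1..<1+2*J} \<union> {1+2*J..<1+2*J+W}" by auto
  then have "(\<Sum>\<kappa>=1..<1+2*J+W. cnt \<kappa>) = (\<Sum>\<kappa>=1..<1+2*J. cnt \<kappa>) + (\<Sum>\<kappa>=1+2*J..<1+2*J+W. cnt \<kappa>)"
    by (simp add: sum.union_disjoint)
  moreover have "(\<Sum>\<kappa>=1+2*J..<1+2*J+W. cnt \<kappa>) = (\<Sum>\<kappa>=1+2*J..<1+2*J+W. 1)"
    by (intro sum.cong) (auto simp: cnt_def)
  ultimately show ?thesis using cnt_sum[of J] by simp
qed

text \<open>Up to class \<open>1 + 2 * c\<close> there is room for the earlier requirement pairs of
  all unchosen groups and for \<open>bound c\<close> pairs more.\<close>

lemma cnt_sum_early: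
  assumes "c < J" shows "(\<Sum>\<kappa>=1..<2+2*c. cnt \<kappa>) = c * (G - K) + bound c"
proof -
  have "{1..<2+2*c} = insert (1+2*c) {1..<1+2*c}" by auto
  then have "(\<Sum>\<kappa>=1..<2+2*c. cnt \<kappa>) = cnt (1+2*c) + (\<Sum>\<kappa>=1..<1+2*c. cnt \<kappa>)" by simp
  then show ?thesis using cnt_sum[of c] assms by (simp add: cnt_def)
qed

lemma T_lt_L: "W \<le> T \<Longrightarrow> W < L" "W \<le> T \<Longrightarrow> T + W < L" by (auto simp: L_def)

lemma rad_exp_small:
  assumes "1 \<le> \<kappa>" "\<kappa> < 1 + 2 * J + T" "W \<le> T" shows "rad_exp \<kappa> + W < L * (2 * J + 1)"
proof (cases "\<kappa> \<le> 2 * J")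
  case True
  have "2 * J + 1 - \<kappa> \<le> 2 * J" using assms(1) by linarith
  then have "rad_exp \<kappa> \<le> L * (2 * J)" using True unfolding rad_exp_def by simp
  then have "rad_exp \<kappa> + W < L * (2 * J) + L" using T_lt_L(1)[OF assms(3)] by linarith
  then show ?thesis by simp
next
  case False
  then have "rad_exp \<kappa> + W \<le> T + W" by (auto simp: rad_exp_def)
  also have "\<dots> < L" by (rule T_lt_L(2)[OF assms(3)])
  finally show ?thesis by (rule less_le_trans) simp
qed

lemma nball_big:
  assumes "W \<le> T" "q \<in> nball W p (rad_exp 0)" shows "q div 2 div N = p div 2 div N"
proof (rule ccontr)
  assume ne: "q div 2 div N \<noteq> p div 2 div N"
  then have "L * (2 * J + 2) \<le> L * (2 * J + 1) + W"
    using assms by (auto simp: nball_def dist_exp_def rad_exp_def split: if_splits)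
  then show False using T_lt_L[OF assms(1)] by (simp add: algebra_simps)
qed

lemma nball_small:
  assumes "W \<le> T" "1 \<le> \<kappa>" "\<kappa> < 1 + 2 * J + T" "q \<in> nball W p (rad_exp \<kappa>)"
  shows "q div 2 = p div 2" "q = p \<or> item_exp (p div 2) \<le> rad_exp \<kappa> + W"
proof -
  note s = rad_exp_small[OF assms(2,3,1)]
  have "L * (2 * J + 1) \<le> L * (2 * J + 2)" by simp
  then have "\<not> L * (2 * J + 2) \<le> rad_exp \<kappa> + W" "\<not> L * (2 * J + 1) \<le> rad_exp \<kappa> + W" using s by linarith+
  then show "q div 2 = p div 2" "q = p \<or> item_exp (p div 2) \<le> rad_exp \<kappa> + W"
    using assms(4) by (auto simp: nball_def dist_exp_def split: if_splits)
qed

text \<open>Dilation does not help a requirement pair, because the gaps of size \<open>L\<close>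
  exceed the shift \<open>W\<close>; for a marked pair each unit of \<open>W\<close> opens one more
  class.\<close>

lemma rad_exp_item_exp:
  assumes W: "W \<le> T" and \<kappa>: "1 \<le> \<kappa>" "\<kappa> < 1 + 2 * J + T" and le: "item_exp i \<le> rad_exp \<kappa> + W"
  shows "i mod N < J \<Longrightarrow> \<kappa> \<le> (if E (i mod N) (i div N) then 1 + 2 * (i mod N) else 2 + 2 * (i mod N))"
    "\<not> i mod N < J \<Longrightarrow> w (i div N) (i mod N - J) \<Longrightarrow> \<kappa> \<le> 2 * J + W"
proof -
  assume c: "i mod N < J"
  define l where "l = (if E (i mod N) (i div N) then 1 + 2 * (i mod N) else 2 + 2 * (i mod N))"
  have l: "l \<le> 2 * J" using c by (auto simp: l_def)
  have ie: "item_exp i = L * (2 * J + 1 - l)" using c by (simp add: item_exp_def l_def Let_def)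
  show "\<kappa> \<le> l"
  proof (rule ccontr)
    assume k: "\<not> \<kappa> \<le> l"
    show False
    proof (cases "\<kappa> \<le> 2 * J")
      case True
      have "L * (2 * J + 1 - \<kappa>) + L * 1 \<le> L * (2 * J + 1 - l)"
        unfolding add_mult_distrib2[symmetric] using k True by (intro mult_le_mono2) linarith
      then show False using le True T_lt_L(1)[OF W] unfolding ie by (simp add: rad_exp_def)
    next
      case False
      have "L * 1 \<le> L * (2 * J + 1 - l)" using l by (intro mult_le_mono2) linarith
      moreover have "rad_exp \<kappa> \<le> T" using False by (simp add: rad_exp_def)
      ultimately show False using le T_lt_L(2)[OF W] unfolding ie by linarith
    qed
  qed
next
  assume c: "\<not> i mod N < J" "w (i div N) (i mod N - J)"
  then have ie: "item_exp i = T + 1" by (simp add: item_exp_def)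
  show "\<kappa> \<le> 2 * J + W"
  proof (cases "\<kappa> \<le> 2 * J")
    case False
    then show ?thesis using le \<kappa> unfolding ie by (simp add: rad_exp_def)
  qed simp
qed

lemma div_mod_less: "i < G * N \<Longrightarrow> i div N < G \<and> i mod N < N"
  by (metis less_mult_imp_div_less mod_less_divisor mult_0_right neq0_conv not_less_zero)

lemma item_card:
  assumes "finite A" "\<And>g c. (g, c) \<in> A \<Longrightarrow> c < N"
  shows "card {i. (i div N, i mod N) \<in> A} = card A"
proof -
  have "bij_betw (\<lambda>i. (i div N, i mod N)) {i. (i div N, i mod N) \<in> A} A"
  proof (rule bij_betw_byWitness[where f' = "\<lambda>(g, c). g * N + c"])
    show "\<forall>a'\<in>A. (\<lambda>i. (i div N, i mod N)) ((\<lambda>(g, c). g * N + c) a') = a'"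
    proof
      fix a assume "a \<in> A"
      then show "(\<lambda>i. (i div N, i mod N)) ((\<lambda>(g, c). g * N + c) a) = a"
        using assms(2)[of "fst a" "snd a"] by (cases a) simp
    qed
    show "(\<lambda>(g, c). g * N + c) ` A \<subseteq> {i. (i div N, i mod N) \<in> A}"
    proof
      fix i assume "i \<in> (\<lambda>(g, c). g * N + c) ` A"
      then obtain g c where "(g, c) \<in> A" "i = g * N + c" by auto
      then show "i \<in> {i. (i div N, i mod N) \<in> A}" using assms(2)[of g c] by simp
    qed
  qed (auto simp: div_mult_mod_eq split: prod.splits)
  then show ?thesis by (rule bij_betw_same_card)
qed

end

section \<open>From placements of small dilation to cheap hitting sets\<close>

context hitting begin
text \<open>A pigeonhole argument. A small ball meets a single pair, and the pairs outside the
  groups of the large balls are at least as many as the small balls. So the large balls occupy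
  \<open>K\<close> different groups, and small balls correspond one to one to the remaining pairs.
  Hence each such pair fits into its ball, and counting the pairs that fit only into an initial
  segment of the classes gives both the hitting property and the cost.\<close>

lemma covers_structure:
  assumes cov: "covers W S" and W: "W \<le> T" and KG: "K \<le> G" and N0: "0 < N"
    and ne: "\<And>c. c < J \<Longrightarrow> \<exists>g<G. E c g"
  shows "hits (groups S)" "cost (groups S) \<le> W"
    "\<And>\<kappa> p. \<kappa> < 1 + 2 * J + T \<Longrightarrow> p \<in> set (S ! \<kappa>) \<Longrightarrow> \<exists>b\<in>blocks (groups S). nball W p (rad_exp \<kappa>) \<subseteq> b"
proof -
  let ?A = "groups S"
  let ?C = "{..<1 + 2 * J + T}"
  have S: "length (S ! \<kappa>) = cnt \<kappa>" "set (S ! \<kappa>) \<subseteq> {..<n}" if "\<kappa> < 1 + 2 * J + T" for \<kappa>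
    using cov that by (auto simp: covers_def)
  have half: "p div 2 < G * N" if "p < n" for p using that by (auto simp: n_def algebra_simps)
  have A: "?A \<subseteq> {..<G}"
  proof
    fix g assume "g \<in> ?A"
    then obtain p where "p \<in> set (S ! 0)" "g = p div 2 div N" by (auto simp: groups_def)
    moreover from this have "p < n" using S(2)[of 0] by auto
    ultimately show "g \<in> {..<G}" using half div_mod_less by blast
  qed
  have fA: "finite ?A" by (simp add: groups_def)
  have "card ?A \<le> card (set (S ! 0))" unfolding groups_def by (rule card_image_le) simp
  also have "\<dots> \<le> K" using S(1)[of 0] card_length[of "S ! 0"] by (simp add: cnt_def)
  finally have AK: "card ?A \<le> K" .
  \<comment> \<open>The small balls by class and position in the list; \<open>It\<close> collects
    the pairs outside the chosen groups, and \<open>\<phi>\<close> sends a ball to the pair of its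
    center.\<close>
  define Sm where "Sm = (SIGMA \<kappa>:{1..<1+2*J+T}. {..<cnt \<kappa>})"
  define It where "It = {i. i < G * N \<and> i div N \<notin> ?A}"
  define \<phi> where "\<phi> = (\<lambda>(\<kappa>, x). S ! \<kappa> ! x div 2)"
  have fSm: "finite Sm" by (simp add: Sm_def)
  have GKN: "(G - K) * N = J * (G - K) + T" by (simp add: N_def T_def algebra_simps)
  have cSm: "card Sm = (G - K) * N"
    using cnt_sum_iso[of T] by (simp add: Sm_def GKN)
  have It_eq: "It = {i. (i div N, i mod N) \<in> ({..<G} - ?A) \<times> {..<N}}"
    unfolding It_def using N0 by (simp add: div_less_iff_less_mult set_eq_iff conj_ac)
  have cIt: "card It = (G - card ?A) * N"
    unfolding It_eq using A fA by (subst item_card) (auto simp: card_Diff_subset)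
  have fIt: "finite It" by (simp add: It_def)
  \<comment> \<open>A point outside the chosen groups is reached only by a small ball centered in
    its own pair, either because it is the center or because the pair fits.\<close>
  have key: "\<exists>s\<in>Sm. \<phi> s = i \<and> (q = S ! fst s ! snd s \<or> item_exp i \<le> rad_exp (fst s) + W)"
    if i: "i \<in> It" and q: "q div 2 = i" for i q
  proof -
    have "q < n" using i q by (auto simp: It_def n_def algebra_simps)
    then obtain \<kappa> p where kp: "\<kappa> < 1 + 2 * J + T" "p \<in> set (S ! \<kappa>)" "q \<in> nball W p (rad_exp \<kappa>)"
      using cov by (auto simp: covers_def)
    have "\<kappa> \<noteq> 0"
    proof
      assume "\<kappa> = 0"
      then have "q div 2 div N = p div 2 div N" "p \<in> set (S ! 0)" using nball_big[OF W] kp by auto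
      then have "i div N \<in> ?A" using q by (auto simp: groups_def)
      then show False using i by (simp add: It_def)
    qed
    then have k1: "1 \<le> \<kappa>" by simp
    obtain x where x: "x < cnt \<kappa>" "S ! \<kappa> ! x = p"
      using kp(2) unfolding in_set_conv_nth S(1)[OF kp(1)] by blast
    then show ?thesis using nball_small[OF W k1 kp(1,3)] kp k1 q
      by (intro bexI[of _ "(\<kappa>, x)"]) (auto simp: \<phi>_def Sm_def)
  qed
  have sub: "It \<subseteq> \<phi> ` Sm"
  proof
    fix i assume "i \<in> It"
    from key[OF this, of "2 * i"] show "i \<in> \<phi> ` Sm" by auto
  qed
  have "card It \<le> card Sm" by (rule surj_card_le[OF fSm sub])
  then have "(G - card ?A) * N \<le> (G - K) * N" by (simp add: cIt cSm)
  then have "G - card ?A \<le> G - K" using N0 by simp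
  then have cA: "card ?A = K" using AK KG by linarith
  have cc: "card It = card Sm" by (simp add: cIt cSm cA)
  have inj: "inj_on \<phi> Sm" and img: "\<phi> ` Sm = It"
  proof -
    have "card (\<phi> ` Sm) \<le> card It" using card_image_le[OF fSm, of \<phi>] cc by simp
    then have "card It = card (\<phi> ` Sm)" using card_mono[OF _ sub] fSm by simp
    then show "\<phi> ` Sm = It" using sub fSm card_subset_eq[of "\<phi> ` Sm" It] by simp
    then show "inj_on \<phi> Sm" using cc fSm by (intro eq_card_imp_inj_on) auto
  qed
  \<comment> \<open>The point of the pair that is not the center is covered too, and by injectivity
    of \<open>\<phi>\<close> only this ball can do it.\<close>
  have fit: "item_exp (\<phi> s) \<le> rad_exp (fst s) + W" if s: "s \<in> Sm" for s
  proof -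
    let ?i = "\<phi> s" and ?p = "S ! fst s ! snd s"
    have i: "?i \<in> It" using img s by blast
    have p: "?p div 2 = ?i" by (simp add: \<phi>_def split: prod.splits)
    let ?q = "if ?p = 2 * ?i then 2 * ?i + 1 else 2 * ?i"
    have "?q div 2 = ?i" "?q \<noteq> ?p" by auto
    from key[OF i this(1)] obtain s' where "s' \<in> Sm" "\<phi> s' = ?i"
        "?q = S ! fst s' ! snd s' \<or> item_exp ?i \<le> rad_exp (fst s') + W" by blast
    moreover from this have "s' = s" using inj s by (meson inj_onD)
    ultimately show ?thesis using \<open>?q \<noteq> ?p\<close> by auto
  qed
  \<comment> \<open>A count in the manner of Hall's condition: pairs that fit only below class
    \<open>m\<close> use different balls of these classes.\<close>
  have count: "card X \<le> (\<Sum>\<kappa>=1..<m. cnt \<kappa>)" if X: "X \<subseteq> It" and m: "m \<le> 1 + 2 * J + T"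
    and *: "\<And>i \<kappa>. i \<in> X \<Longrightarrow> 1 \<le> \<kappa> \<Longrightarrow> \<kappa> < 1 + 2 * J + T \<Longrightarrow> item_exp i \<le> rad_exp \<kappa> + W \<Longrightarrow> \<kappa> < m" for X m
  proof -
    let ?Y = "SIGMA \<kappa>:{1..<m}. {..<cnt \<kappa>}"
    have "X \<subseteq> \<phi> ` ?Y"
    proof
      fix i assume i: "i \<in> X"
      then obtain s where s: "s \<in> Sm" "\<phi> s = i" using X img by blast
      then have "fst s < m" using *[OF i, of "fst s"] fit[OF s(1)] by (auto simp: Sm_def)
      then have "s \<in> ?Y" using s(1) by (auto simp: Sm_def)
      then show "i \<in> \<phi> ` ?Y" using s by blast
    qed
    then have "card X \<le> card ?Y" by (intro surj_card_le) auto
    then show ?thesis by simp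
  qed
  have cD: "card ({..<G} - ?A) = G - K" using A fA cA by (simp add: card_Diff_subset)
  have JN: "J \<le> N" by (simp add: N_def)
  show "hits ?A"
    unfolding hits_def
  proof (intro conjI allI impI A cA)
    fix c assume c: "c < J"
    let ?D = "{..<G} - ?A" and ?Ec = "{g. g < G \<and> E c g}"
    \<comment> \<open>All earlier requirement pairs of unchosen groups compete with the demanding
      pairs of \<open>c\<close> for the classes up to \<open>1 + 2 * c\<close>.\<close>
    let ?P = "?D \<times> {..<c} \<union> (?Ec - ?A) \<times> {c}"
    let ?X = "{i. (i div N, i mod N) \<in> ?P}"
    have "card ?X = card ?P" using c JN by (intro item_card) auto
    also have "\<dots> = card (?D \<times> {..<c}) + card ((?Ec - ?A) \<times> {c})" by (rule card_Un_disjoint) auto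
    finally have 1: "card ?X = c * (G - K) + card (?Ec - ?A)" by (simp add: card_cartesian_product cD)
    have "card ?X \<le> (\<Sum>\<kappa>=1..<2 + 2 * c. cnt \<kappa>)"
    proof (rule count)
      show "?X \<subseteq> It" unfolding It_eq using c JN by auto
      fix i \<kappa> assume i: "i \<in> ?X" and k: "1 \<le> \<kappa>" "\<kappa> < 1 + 2 * J + T" "item_exp i \<le> rad_exp \<kappa> + W"
      then have "i mod N < J" using c by auto
      from rad_exp_item_exp(1)[OF W k this] show "\<kappa> < 2 + 2 * c" using i by (auto split: if_splits)
    qed (use c in simp)
    then have "card (?Ec - ?A) \<le> bound c" using 1 cnt_sum_early[OF c] by simp
    then have "card (?Ec - ?A) < card ?Ec"
    proof -
      have "0 < card ?Ec" using ne[OF c] by (auto simp: card_gt_0_iff)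
      moreover have "card (?Ec - ?A) \<le> card ?Ec - 1"
        using \<open>card (?Ec - ?A) \<le> bound c\<close> unfolding bound_def by simp
      ultimately show ?thesis by linarith
    qed
    then have "?Ec - ?A \<noteq> ?Ec" by (metis less_irrefl)
    then show "\<exists>g\<in>?A. E c g" by blast
  qed
  show "cost ?A \<le> W"
  proof -
    let ?D = "{..<G} - ?A"
    let ?Wt = "{(g, u). g < G \<and> g \<notin> ?A \<and> u < U \<and> w g u}"
    \<comment> \<open>The requirement pairs take up as many balls as the classes up to
      \<open>2 * J\<close> have, which leaves \<open>W\<close> balls for the marked pairs.\<close>
    let ?P = "?D \<times> {..<J} \<union> (\<lambda>(g, u). (g, J + u)) ` ?Wt"
    let ?X = "{i. (i div N, i mod N) \<in> ?P}"
    have fW: "finite ?Wt" by (rule finite_subset[of _ "{..<G} \<times> {..<U}"]) auto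
    have "card ?X = card ?P" using fW by (intro item_card) (auto simp: N_def)
    also have "\<dots> = card (?D \<times> {..<J}) + card ((\<lambda>(g, u). (g, J + u)) ` ?Wt)"
      using fW by (intro card_Un_disjoint) auto
    also have "card ((\<lambda>(g, u). (g, J + u)) ` ?Wt) = cost ?A"
      unfolding cost_def by (rule card_image) (auto simp: inj_on_def)
    finally have 1: "card ?X = J * (G - K) + cost ?A" by (simp add: card_cartesian_product cD)
    have "card ?X \<le> (\<Sum>\<kappa>=1..<1 + 2 * J + W. cnt \<kappa>)"
    proof (rule count)
      show "?X \<subseteq> It" unfolding It_eq by (auto simp: N_def)
      fix i \<kappa> assume i: "i \<in> ?X" and k: "1 \<le> \<kappa>" "\<kappa> < 1 + 2 * J + T" "item_exp i \<le> rad_exp \<kappa> + W"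
      show "\<kappa> < 1 + 2 * J + W"
      proof (cases "i mod N < J")
        case True
        from rad_exp_item_exp(1)[OF W k this] show ?thesis using True by (auto split: if_splits)
      next
        case False
        then have "w (i div N) (i mod N - J)" using i by auto
        from rad_exp_item_exp(2)[OF W k False this] show ?thesis by simp
      qed
    qed (use W in simp)
    then show ?thesis using 1 cnt_sum_iso[OF W] by simp
  qed
  fix \<kappa> p assume k: "\<kappa> < 1 + 2 * J + T" and p: "p \<in> set (S ! \<kappa>)"
  show "\<exists>b\<in>blocks ?A. nball W p (rad_exp \<kappa>) \<subseteq> b"
  proof (cases "\<kappa> = 0")
    case True
    then have "p div 2 div N \<in> ?A" using p by (auto simp: groups_def)
    moreover have "nball W p (rad_exp \<kappa>) \<subseteq> {q. q < n \<and> q div 2 div N = p div 2 div N}"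
      using nball_big[OF W] True by (auto simp: nball_def)
    ultimately show ?thesis unfolding blocks_def by blast
  next
    case False
    obtain x where x: "x < cnt \<kappa>" "S ! \<kappa> ! x = p"
      using p unfolding in_set_conv_nth S(1)[OF k] by blast
    then have "(\<kappa>, x) \<in> Sm" using False k by (auto simp: Sm_def)
    then have "p div 2 \<in> It" using img x by (force simp: \<phi>_def)
    moreover have "nball W p (rad_exp \<kappa>) \<subseteq> {2 * (p div 2), 2 * (p div 2) + 1}"
    proof
      fix q assume "q \<in> nball W p (rad_exp \<kappa>)"
      then have "q div 2 = p div 2" using nball_small(1)[OF W _ k] False by simp
      then show "q \<in> {2 * (p div 2), 2 * (p div 2) + 1}" by auto
    qed
    ultimately show ?thesis unfolding blocks_def It_def by blast
  qed
qed

end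

section \<open>The placement of a hitting set and its clusters\<close>

context hitting begin

lemma item_exp_le: "item_exp i \<le> L * (2 * J + 1)"
proof (cases "i mod N < J")
  case True
  then have *: "item_exp i = L * (2 * J + 1 - (if E (i mod N) (i div N) then 1 + 2 * (i mod N) else 2 + 2 * (i mod N)))"
    by (simp add: item_exp_def Let_def)
  show ?thesis unfolding * by (intro mult_le_mono2 diff_le_self)
next
  case False
  have "T + 1 \<le> L * 1" by (simp add: L_def)
  also have "\<dots> \<le> L * (2 * J + 1)" by (intro mult_le_mono2) simp
  finally have "T + 1 \<le> L * (2 * J + 1)" .
  moreover have "item_exp i \<le> T + 1" using False by (simp add: item_exp_def Let_def)
  ultimately show ?thesis by linarith
qed

text \<open>A greedy assignment: for each requirement the unchosen groups that satisfy it are listed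
  first and receive the balls of the larger class, and the marked pairs receive the largest of the
  single balls.\<close>

lemma covers_exists:
  assumes A: "hits A" and N0: "0 < N" and KG: "K \<le> G"
  shows "\<exists>S. covers (cost A) S"
proof -
  have AG: "A \<subseteq> {..<G}" "card A = K" and fA: "finite A"
    using A by (auto simp: hits_def finite_subset)
  define us where "us = sorted_list_of_set ({..<G} - A)"
  have us: "distinct us" "set us = {..<G} - A" "length us = G - K"
    using AG fA by (simp_all add: us_def card_Diff_subset)
  define gs where "gs = (\<lambda>c. filter (E c) us @ filter (\<lambda>g. \<not> E c g) us)"
  have gs: "length (gs c) = G - K" "set (gs c) = {..<G} - A" for c
    unfolding gs_def length_append sum_length_filter_compl using us by auto
  define al where "al = List.product us [0..<U]"
  have al: "distinct al" "set al = ({..<G} - A) \<times> {..<U}" "length al = T"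
    using us by (simp_all add: al_def distinct_product T_def lessThan_atLeast0)
  define es where "es = filter (\<lambda>(g, u). w g u) al @ filter (\<lambda>x. \<not> (case x of (g, u) \<Rightarrow> w g u)) al"
  have es: "length es = T" "set es = ({..<G} - A) \<times> {..<U}"
    unfolding es_def length_append sum_length_filter_compl using al by auto
  have early: "length (filter (\<lambda>(g, u). w g u) al) = cost A"
  proof -
    have "length (filter (\<lambda>(g, u). w g u) al) = card (set (filter (\<lambda>(g, u). w g u) al))"
      using al by (metis distinct_card distinct_filter)
    also have "set (filter (\<lambda>(g, u). w g u) al) = {(g, u). g < G \<and> g \<notin> A \<and> u < U \<and> w g u}"
      using al by auto
    finally show ?thesis by (simp add: cost_def)
  qed
  have costT: "cost A \<le> T" unfolding early[symmetric] al(3)[symmetric] by (rule length_filter_le)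
  \<comment> \<open>Some chosen group satisfies \<open>c\<close>, so at least one of the satisfying
    groups is missing among the unchosen ones.\<close>
  have few: "length (filter (E c) us) \<le> bound c" if c: "c < J" for c
  proof -
    let ?Ec = "{g. g < G \<and> E c g}"
    have "length (filter (E c) us) = card (?Ec - A)"
      using us by (subst distinct_card[symmetric]) (auto intro!: arg_cong[of _ _ card])
    moreover have "length (filter (E c) us) \<le> G - K" using us length_filter_le by metis
    moreover have "card (?Ec - A) < card ?Ec"
      using A c AG by (intro psubset_card_mono) (auto simp: hits_def)
    ultimately show ?thesis by (simp add: bound_def)
  qed
  define Sf where "Sf = (\<lambda>\<kappa>. if \<kappa> = 0 then map (\<lambda>g. 2 * (g * N)) (sorted_list_of_set A)
     else if \<kappa> \<le> 2 * J then map (\<lambda>g. 2 * (g * N + (\<kappa> - 1) div 2))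
        (if odd \<kappa> then take (bound ((\<kappa> - 1) div 2)) (gs ((\<kappa> - 1) div 2))
         else drop (bound ((\<kappa> - 1) div 2)) (gs ((\<kappa> - 1) div 2)))
     else [case es ! (\<kappa> - 2 * J - 1) of (g, u) \<Rightarrow> 2 * (g * N + (J + u))])"
  have lt: "2 * (g * N + c) < n" if "g < G" "c < N" for g c
  proof -
    have "g * N + c < Suc g * N" using that by simp
    also have "\<dots> \<le> G * N" using that by (intro mult_le_mono1) simp
    finally show ?thesis by (simp add: n_def algebra_simps)
  qed
  have len: "length (Sf \<kappa>) = cnt \<kappa>" if "\<kappa> < 1 + 2 * J + T" for \<kappa>
    using AG gs bound_le fA by (auto simp: Sf_def cnt_def)
  have cen: "set (Sf \<kappa>) \<subseteq> {..<n}" if k: "\<kappa> < 1 + 2 * J + T" for \<kappa>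
  proof -
    consider "\<kappa> = 0" | "\<kappa> \<noteq> 0" "\<kappa> \<le> 2 * J" | "\<kappa> > 2 * J" by linarith
    then show ?thesis
    proof cases
      case 1
      then show ?thesis using AG fA lt[of _ 0] N0 by (auto simp: Sf_def)
    next
      case 2
      define c where "c = (\<kappa> - 1) div 2"
      have c: "c < N" using 2 by (auto simp: N_def c_def)
      define xs where "xs = (if odd \<kappa> then take (bound c) (gs c) else drop (bound c) (gs c))"
      have xs: "set xs \<subseteq> {..<G}"
        using gs(2)[of c] set_take_subset[of "bound c" "gs c"] set_drop_subset[of "bound c" "gs c"]
        by (auto simp: xs_def)
      have "Sf \<kappa> = map (\<lambda>g. 2 * (g * N + c)) xs" using 2 by (simp only: Sf_def xs_def c_def if_True if_False)
      then show ?thesis using lt[OF _ c] xs by (auto simp del: distrib_left_numeral)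
    next
      case 3
      then have "\<kappa> - 2 * J - 1 < length es" using k es by auto
      then have "es ! (\<kappa> - 2 * J - 1) \<in> set es" by simp
      then obtain g u where gu: "es ! (\<kappa> - 2 * J - 1) = (g, u)" "g < G" "u < U"
        unfolding es(2) by auto
      have "Sf \<kappa> = [2 * (g * N + (J + u))]" using 3 gu by (simp add: Sf_def)
      moreover have "J + u < N" using gu by (simp add: N_def)
      ultimately show ?thesis using lt[OF gu(2), of "J + u"] by simp
    qed
  qed
  let ?W = "cost A"
  have cov: "\<exists>\<kappa> < 1 + 2 * J + T. \<exists>p\<in>set (Sf \<kappa>). q \<in> nball ?W p (rad_exp \<kappa>)" if q: "q < n" for q
  proof -
    define i where "i = q div 2"
    define g where "g = i div N"
    define c where "c = i mod N"
    have i: "i = g * N + c" by (simp only: g_def c_def div_mult_mod_eq)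
    have "i < G * N" using q by (auto simp: n_def i_def algebra_simps)
    then have gc: "g < G" "c < N" using div_mod_less by (auto simp: g_def c_def)
    have di: "dist_exp (2 * i) q = item_exp i" by (simp add: dist_exp_def i_def)
    show ?thesis
    proof (cases "g \<in> A")
      case True
      have "dist_exp (2 * (g * N)) q \<le> L * (2 * J + 1)"
        using item_exp_le[of "g * N"] N0 by (auto simp: dist_exp_def g_def i_def)
      then have "q \<in> nball ?W (2 * (g * N)) (rad_exp 0)"
        using q by (simp add: nball_def rad_exp_def)
      then show ?thesis using True fA by (intro exI[of _ 0]) (auto simp: Sf_def)
    next
      case gA: False
      show ?thesis
      proof (cases "c < J")
        case True
        have ie: "item_exp i = L * (2 * J + 1 - (if E c g then 1 + 2 * c else 2 + 2 * c))"
          using True by (simp add: item_exp_def g_def c_def Let_def)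
        have "g \<in> set (gs c)" using gs gc gA by auto
        then have "g \<in> set (take (bound c) (gs c)) \<or> g \<in> set (drop (bound c) (gs c))"
          by (metis Un_iff append_take_drop_id set_append)
        then show ?thesis
        proof
          assume g: "g \<in> set (take (bound c) (gs c))"
          have "item_exp i \<le> rad_exp (1 + 2 * c)"
          proof -
            have "rad_exp (1 + 2 * c) = L * (2 * J + 1 - (1 + 2 * c))" using True by (simp add: rad_exp_def)
            moreover have "2 * J + 1 - (if E c g then 1 + 2 * c else 2 + 2 * c) \<le> 2 * J + 1 - (1 + 2 * c)" by auto
            ultimately show ?thesis unfolding ie by (simp only: mult_le_mono2)
          qed
          then have "q \<in> nball ?W (2 * i) (rad_exp (1 + 2 * c))" using q di by (simp add: nball_def)
          moreover have "2 * i \<in> set (Sf (1 + 2 * c))" using g True i by (auto simp: Sf_def)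
          ultimately show ?thesis using True by (intro exI[of _ "1 + 2 * c"]) auto
        next
          assume "g \<in> set (drop (bound c) (gs c))"
          moreover have "set (drop (bound c) (gs c)) \<subseteq> {g. \<not> E c g}"
            using few[OF True] set_drop_subset by (fastforce simp: gs_def)
          ultimately have g: "g \<in> set (drop (bound c) (gs c))" "\<not> E c g" by auto
          have "item_exp i \<le> rad_exp (2 + 2 * c)"
            unfolding ie rad_exp_def using True g by simp
          then have "q \<in> nball ?W (2 * i) (rad_exp (2 + 2 * c))" using q di by (simp add: nball_def)
          moreover have "2 * i \<in> set (Sf (2 + 2 * c))" using g True i by (auto simp: Sf_def)
          ultimately show ?thesis using True by (intro exI[of _ "2 + 2 * c"]) auto
        qed
      next
        case False
        let ?u = "c - J"
        have u: "?u < U" "c = J + ?u" using gc False by (auto simp: N_def)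
        have ie: "item_exp i = (if w g ?u then T + 1 else 0)"
          using False by (simp add: item_exp_def g_def c_def Let_def)
        have gu: "(g, ?u) \<in> set al" using al gc gA u by auto
        obtain b where b: "b < T" "es ! b = (g, ?u)" "w g ?u \<Longrightarrow> b < ?W"
        proof (cases "w g ?u")
          case True
          then have "(g, ?u) \<in> set (filter (\<lambda>(g, u). w g u) al)" using gu by simp
          then obtain b where "b < ?W" "filter (\<lambda>(g, u). w g u) al ! b = (g, ?u)"
            unfolding in_set_conv_nth early by blast
          then show ?thesis using that[of b] costT early by (auto simp: es_def nth_append)
        next
          case False
          have "(g, ?u) \<in> set es" using es gc gA u by auto
          then obtain b where "b < T" "es ! b = (g, ?u)" unfolding in_set_conv_nth es(1) by blast
          then show ?thesis using that False by blast
        qed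
        \<comment> \<open>Class \<open>2 * J + 1 + b\<close> has exponent \<open>T - b\<close>,
          while a marked pair needs \<open>T + 1\<close>; the shift \<open>?W\<close> makes up for
          this since \<open>b < ?W\<close>.\<close>
        have "item_exp i \<le> rad_exp (2 * J + 1 + b) + ?W"
          unfolding ie rad_exp_def using b costT by auto
        then have "q \<in> nball ?W (2 * i) (rad_exp (2 * J + 1 + b))" using q di by (simp add: nball_def)
        moreover have "2 * i \<in> set (Sf (2 * J + 1 + b))" using b i u by (auto simp: Sf_def)
        ultimately show ?thesis using b by (intro exI[of _ "2 * J + 1 + b"]) auto
      qed
    qed
  qed
  show ?thesis
    unfolding covers_def
  proof (intro exI[of _ "map Sf [0..<1 + 2 * J + T]"] conjI)
    have nth: "map Sf [0..<1 + 2 * J + T] ! \<kappa> = Sf \<kappa>" if "\<kappa> < 1 + 2 * J + T" for \<kappa>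
      using that by (simp del: upt_Suc)
    show "\<forall>\<kappa><1 + 2 * J + T. length (map Sf [0..<1 + 2 * J + T] ! \<kappa>) = cnt \<kappa> \<and>
        set (map Sf [0..<1 + 2 * J + T] ! \<kappa>) \<subseteq> {..<n}" using len cen nth by simp
    show "\<forall>q<n. \<exists>\<kappa><1 + 2 * J + T. \<exists>p\<in>set (map Sf [0..<1 + 2 * J + T] ! \<kappa>). q \<in> nball (cost A) p (rad_exp \<kappa>)"
      using cov nth by metis
  qed simp
qed

lemma cost_le: "cost A \<le> (G - card (A \<inter> {..<G})) * U"
proof -
  have "cost A \<le> card (({..<G} - A) \<times> {..<U})"
    unfolding cost_def by (intro card_mono) auto
  also have "\<dots> = (G - card (A \<inter> {..<G})) * U"
    by (simp add: card_cartesian_product card_Diff_subset_Int Int_commute)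
  finally show ?thesis .
qed

lemma cost_le_T: "hits A \<Longrightarrow> cost A \<le> T"
  using cost_le[of A] by (auto simp: hits_def T_def Int_absorb2)

text \<open>The blocks are exactly as many as the balls of all classes together, which is what makes
  the clustering unique.\<close>

lemma blocks_partition:
  assumes A: "hits A" and N0: "0 < N" and KG: "K \<le> G"
  shows "partition_on {..<n} (blocks A)" "card (blocks A) = K + (G - K) * N" "finite (blocks A)"
proof -
  have AG: "A \<subseteq> {..<G}" "card A = K" and fA: "finite A"
    using A by (auto simp: hits_def finite_subset)
  let ?g = "\<lambda>g. {p. p < n \<and> p div 2 div N = g}" and ?i = "\<lambda>i. {2 * i, 2 * i + 1}"
  let ?It = "{i. i < G * N \<and> i div N \<notin> A}"
  have gin: "2 * (g * N) \<in> ?g g" if "g \<in> A" for g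
    using that AG N0 by (auto simp: n_def)
  have half: "p < n \<longleftrightarrow> p div 2 < G * N" for p by (auto simp: n_def algebra_simps)
  have d1: "?g g \<inter> ?i i = {}" if "g \<in> A" "i \<in> ?It" for g i using that by auto
  have cross: "?g ` A \<inter> ?i ` ?It = {}"
  proof -
    have "?g g \<noteq> ?i i" if "g \<in> A" "i \<in> ?It" for g i using d1[OF that] by blast
    then show ?thesis by blast
  qed
  show "finite (blocks A)" using fA by (auto simp: blocks_def)
  have "inj_on ?g A"
  proof (rule inj_onI)
    fix g g' assume "g \<in> A" "g' \<in> A" "?g g = ?g g'"
    then have "2 * (g * N) \<in> ?g g'" using gin by blast
    then show "g = g'" using N0 by simp
  qed
  moreover have "inj_on ?i ?It" by (auto simp: inj_on_def doubleton_eq_iff)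
  moreover have "?It = {i. (i div N, i mod N) \<in> ({..<G} - A) \<times> {..<N}}"
    using N0 by (simp add: div_less_iff_less_mult set_eq_iff conj_ac)
  then have "card ?It = (G - K) * N"
    using AG fA item_card[of "({..<G} - A) \<times> {..<N}"] by (simp add: card_Diff_subset)
  ultimately show "card (blocks A) = K + (G - K) * N"
    unfolding blocks_def using fA cross AG by (subst card_Un_disjoint) (auto simp: card_image)
  show "partition_on {..<n} (blocks A)"
  proof (rule partition_onI)
    show "\<Union> (blocks A) = {..<n}"
    proof
      show "\<Union> (blocks A) \<subseteq> {..<n}" by (auto simp: blocks_def half)
      show "{..<n} \<subseteq> \<Union> (blocks A)"
      proof
        fix p assume p: "p \<in> {..<n}"
        show "p \<in> \<Union> (blocks A)"
        proof (cases "p div 2 div N \<in> A")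
          case True
          then have "?g (p div 2 div N) \<in> blocks A" unfolding blocks_def by (intro UnI1 imageI)
          moreover have "p \<in> ?g (p div 2 div N)" using p by simp
          ultimately show ?thesis by (rule UnionI)
        next
          case False
          then have "p div 2 \<in> ?It" using p half by simp
          then have "?i (p div 2) \<in> blocks A" unfolding blocks_def by (intro UnI2 imageI)
          moreover have "p \<in> ?i (p div 2)" by auto
          ultimately show ?thesis by (rule UnionI)
        qed
      qed
    qed
    have blk: "b = (if x div 2 div N \<in> A then ?g (x div 2 div N) else ?i (x div 2))"
      if "b \<in> blocks A" "x \<in> b" for b x
    proof -
      from that(1) consider g where "g \<in> A" "b = ?g g" | i where "i \<in> ?It" "b = ?i i"
        unfolding blocks_def by (elim UnE imageE)
      then show ?thesis
      proof cases
        case 1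
        then show ?thesis using that(2) by simp
      next
        case 2
        then have "x div 2 = i" using that(2) by auto
        then show ?thesis using 2 by simp
      qed
    qed
    show "disjnt p q" if "p \<in> blocks A" "q \<in> blocks A" "p \<noteq> q" for p q
    proof (rule ccontr)
      assume "\<not> disjnt p q"
      then obtain x where "x \<in> p" "x \<in> q" unfolding disjnt_def by blast
      from blk[OF that(1) this(1)] blk[OF that(2) this(2)] that(3) show False by (simp only:)
    qed
    have "p \<noteq> {}" if "p \<in> blocks A" for p
    proof -
      from that consider g where "g \<in> A" "p = ?g g" | i where "i \<in> ?It" "p = ?i i"
        unfolding blocks_def by (elim UnE imageE)
      then show ?thesis
      proof cases
        case 1
        then have "2 * (g * N) \<in> p" using gin by (simp only:)
        then show ?thesis by blast
      qed simp
    qed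
    then show "{} \<notin> blocks A" by blast
  qed
qed

section \<open>The metric instance and its resilience\<close>

definition inst :: "nat \<Rightarrow> nat nukc" where
  "inst Q = \<lparr>points = {..<n},
     metr = (\<lambda>p q. if p < n \<and> q < n then (if p = q then 0 else 2 ^ (Q * dist_exp p q)) else 0),
     radii = map (\<lambda>\<kappa>. 2 ^ (Q * rad_exp \<kappa>)) [0..<1 + 2 * J + T],
     counts = map cnt [0..<1 + 2 * J + T]\<rparr>"

lemma inst_simps [simp]:
  "points (inst Q) = {..<n}" "length (radii (inst Q)) = 1 + 2 * J + T"
  "\<kappa> < 1 + 2 * J + T \<Longrightarrow> radii (inst Q) ! \<kappa> = 2 ^ (Q * rad_exp \<kappa>)"
  "\<kappa> < 1 + 2 * J + T \<Longrightarrow> counts (inst Q) ! \<kappa> = cnt \<kappa>"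
  by (auto simp: inst_def simp del: upt_Suc)

text \<open>An ordinary triangle inequality for exponents would not survive exponentiation; the
  ultrametric one does.\<close>

lemma dist_exp_ultra: "dist_exp p r \<le> max (dist_exp p q) (dist_exp q r)"
proof -
  define a where "a = L * (2 * J + 2)"
  define b where "b = L * (2 * J + 1)"
  have "b \<le> a" by (simp add: a_def b_def)
  moreover have "item_exp i \<le> b" for i unfolding b_def by (rule item_exp_le)
  ultimately have *: "b \<le> a" "item_exp i \<le> b" "item_exp i \<le> a" for i by (auto intro: le_trans)
  have d: "dist_exp x y = (if x div 2 div N \<noteq> y div 2 div N then a
     else if x div 2 \<noteq> y div 2 then b else item_exp (x div 2))" for x y
    by (simp add: dist_exp_def a_def b_def)
  show ?thesis unfolding d le_max_iff_disj using * by (auto split del: if_split split: if_splits)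
qed

lemma dist_exp_commute: "dist_exp p q = dist_exp q p" by (auto simp: dist_exp_def)

lemma inst_metric: "Metric_space {..<n} (metr (inst Q))"
proof
  fix p q r
  show "0 \<le> metr (inst Q) p q" by (simp add: inst_def)
  show "metr (inst Q) p q = metr (inst Q) q p" by (simp add: inst_def dist_exp_commute)
  show "metr (inst Q) p q = 0 \<longleftrightarrow> p = q" if "p \<in> {..<n}" "q \<in> {..<n}" using that by (simp add: inst_def)
  show "metr (inst Q) p r \<le> metr (inst Q) p q + metr (inst Q) q r"
    if *: "p \<in> {..<n}" "q \<in> {..<n}" "r \<in> {..<n}"
  proof -
    have "(2::real) ^ (Q * dist_exp p r) \<le> 2 ^ (Q * max (dist_exp p q) (dist_exp q r))"
      using dist_exp_ultra by (intro power_increasing mult_le_mono2) auto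
    also have "\<dots> \<le> 2 ^ (Q * dist_exp p q) + 2 ^ (Q * dist_exp q r)" by (simp add: max_def)
    finally show ?thesis using * by (auto simp: inst_def)
  qed
qed

lemma rad_exp_decreasing:
  assumes "\<kappa> < \<kappa>'" "\<kappa>' < 1 + 2 * J + T" shows "rad_exp \<kappa>' < rad_exp \<kappa>"
proof -
  have L0: "0 < L" "T < L" by (auto simp: L_def)
  consider "\<kappa>' \<le> 2 * J" | "\<kappa> \<le> 2 * J" "2 * J < \<kappa>'" | "2 * J < \<kappa>" by linarith
  then show ?thesis
  proof cases
    case 1
    then have "L * (2 * J + 1 - \<kappa>') < L * (2 * J + 1 - \<kappa>)" using assms L0 by (intro mult_less_mono2) auto
    then show ?thesis using 1 assms by (simp add: rad_exp_def)
  next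
    case 2
    then have "L * 1 \<le> L * (2 * J + 1 - \<kappa>)" by (intro mult_le_mono2) auto
    then have "L \<le> rad_exp \<kappa>" using 2 by (simp add: rad_exp_def)
    moreover have "rad_exp \<kappa>' \<le> T" using 2 by (simp add: rad_exp_def)
    ultimately show ?thesis using L0 by linarith
  next
    case 3
    then show ?thesis using assms by (auto simp: rad_exp_def)
  qed
qed

lemma inst_valid:
  assumes "0 < Q" shows "nukc_instance (inst Q)"
  unfolding nukc_instance_def
proof (intro conjI)
  show "Metric_space (points (inst Q)) (metr (inst Q))" using inst_metric by simp
  show "sorted_wrt (>) (radii (inst Q))"
    unfolding sorted_wrt_iff_nth_less using assms rad_exp_decreasing by auto
qed (auto simp: inst_def)

lemma feasible_instI:
  assumes cov: "covers W S"
  shows "feasible_placement (inst Q) (2 ^ (Q * W)) S"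
proof -
  let ?P = "placement_balls (inst Q) (2 ^ (Q * W)) S"
  have "q \<in> \<Union> ?P" if q: "q < n" for q
  proof -
    obtain \<kappa> p where k: "\<kappa> < 1 + 2 * J + T" "p \<in> set (S ! \<kappa>)" "q \<in> nball W p (rad_exp \<kappa>)"
      using cov q by (auto simp: covers_def)
    have p: "p < n" using cov k by (auto simp: covers_def)
    have "(2::real) ^ (Q * dist_exp p q) \<le> 2 ^ (Q * (rad_exp \<kappa> + W))" if "dist_exp p q \<le> rad_exp \<kappa> + W"
      using that by (intro power_increasing mult_le_mono2) auto
    then have "q \<in> nukc_ball (inst Q) p (2 ^ (Q * W) * radii (inst Q) ! \<kappa>)"
      using k q p by (auto simp: nukc_ball_def inst_def nball_def power_add algebra_simps simp del: upt_Suc)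
    moreover have "nukc_ball (inst Q) p (2 ^ (Q * W) * radii (inst Q) ! \<kappa>) \<in> ?P"
      unfolding placement_balls_def inst_simps(2) using k by blast
    ultimately show ?thesis by blast
  qed
  moreover have "\<Union> ?P \<subseteq> {..<n}" by (auto simp: placement_balls_def nukc_ball_def)
  ultimately show ?thesis using cov unfolding feasible_placement_def covers_def by auto
qed

end

context hitting begin

lemma sum_list_cnt: "K \<le> G \<Longrightarrow> sum_list (counts (inst Q)) = K + (G - K) * N"
proof -
  have "sum_list (counts (inst Q)) = (\<Sum>\<kappa>=0..<1 + 2 * J + T. cnt \<kappa>)"
    by (simp add: inst_def interv_sum_list_conv_sum_set_nat del: upt_Suc)
  also have "\<dots> = cnt 0 + (\<Sum>\<kappa>=1..<1 + 2 * J + T. cnt \<kappa>)"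
    by (simp add: sum.atLeast_Suc_lessThan)
  also have "(\<Sum>\<kappa>=1..<1 + 2 * J + T. cnt \<kappa>) = J * (G - K) + T" by (rule cnt_sum_iso) simp
  also have "J * (G - K) + T = (G - K) * N" by (simp add: N_def T_def algebra_simps)
  finally show ?thesis by (simp add: cnt_def)
qed

text \<open>Distances and radii are powers of \<open>2 ^ Q\<close>, so a strict bound at level
  \<open>W + 1\<close> is already a bound at level \<open>W\<close>; the loss by \<gamma> is
  absorbed by the strictness.\<close>

lemma perturbed_ball:
  assumes pt: "metric_perturbation \<gamma> {..<n} (metr (inst Q)) d1" and \<gamma>: "0 < \<gamma>" and Q: "0 < Q"
    and \<alpha>: "\<gamma> * \<alpha> < 2 ^ (Q * (W + 1))" and \<kappa>: "\<kappa> < 1 + 2 * J + T" and p: "p < n"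
  shows "nukc_ball (inst Q\<lparr>metr := d1\<rparr>) p (\<alpha> * radii (inst Q) ! \<kappa>) \<subseteq> nball W p (rad_exp \<kappa>)"
proof
  fix q assume "q \<in> nukc_ball (inst Q\<lparr>metr := d1\<rparr>) p (\<alpha> * radii (inst Q) ! \<kappa>)"
  then have q: "q < n" "d1 p q \<le> \<alpha> * 2 ^ (Q * rad_exp \<kappa>)" using \<kappa> by (auto simp: nukc_ball_def)
  show "q \<in> nball W p (rad_exp \<kappa>)"
  proof (cases "q = p")
    case False
    have "metr (inst Q) p q / \<gamma> \<le> d1 p q"
      using pt p q(1) by (simp add: metric_perturbation_def)
    then have "2 ^ (Q * dist_exp p q) / \<gamma> \<le> d1 p q"
      using p q(1) False by (simp add: inst_def)
    then have "(2::real) ^ (Q * dist_exp p q) \<le> \<gamma> * d1 p q" using \<gamma> by (simp add: divide_simps mult.commute)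
    also have "\<dots> \<le> \<gamma> * (\<alpha> * 2 ^ (Q * rad_exp \<kappa>))" using q(2) \<gamma> by (intro mult_left_mono) auto
    also have "\<dots> = \<gamma> * \<alpha> * 2 ^ (Q * rad_exp \<kappa>)" by simp
    also have "\<dots> < 2 ^ (Q * (W + 1)) * 2 ^ (Q * rad_exp \<kappa>)" using \<alpha> by (intro mult_strict_right_mono) auto
    also have "\<dots> = 2 ^ (Q * (W + 1 + rad_exp \<kappa>))" by (simp add: power_add[symmetric] algebra_simps)
    finally have "Q * dist_exp p q < Q * (W + 1 + rad_exp \<kappa>)" by (rule power_less_imp_less_exp[rotated]) simp
    then have "dist_exp p q < W + 1 + rad_exp \<kappa>" by (meson mult_le_mono2 not_le)
    then show ?thesis using q(1) by (simp add: nball_def)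
  qed (use q in \<open>simp add: nball_def\<close>)
qed

lemma perturbed_covers:
  assumes pt: "metric_perturbation \<gamma> {..<n} (metr (inst Q)) d1" and \<gamma>: "0 < \<gamma>" and Q: "0 < Q"
    and \<alpha>: "\<gamma> * \<alpha> < 2 ^ (Q * (W + 1))" and f: "feasible_placement (inst Q\<lparr>metr := d1\<rparr>) \<alpha> S"
  shows "covers W S"
proof -
  have S: "length S = 1 + 2 * J + T" "\<And>\<kappa>. \<kappa> < 1 + 2 * J + T \<Longrightarrow> length (S ! \<kappa>) = cnt \<kappa> \<and> set (S ! \<kappa>) \<subseteq> {..<n}"
    and U: "\<Union> (placement_balls (inst Q\<lparr>metr := d1\<rparr>) \<alpha> S) = {..<n}"
    using f by (auto simp: feasible_placement_def)
  have "\<exists>\<kappa> < 1 + 2 * J + T. \<exists>p\<in>set (S ! \<kappa>). q \<in> nball W p (rad_exp \<kappa>)" if "q < n" for q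
  proof -
    from that U have "q \<in> \<Union> (placement_balls (inst Q\<lparr>metr := d1\<rparr>) \<alpha> S)" by simp
    then obtain \<kappa> p where kp: "\<kappa> < 1 + 2 * J + T" "p \<in> set (S ! \<kappa>)"
      "q \<in> nukc_ball (inst Q\<lparr>metr := d1\<rparr>) p (\<alpha> * radii (inst Q) ! \<kappa>)"
      unfolding placement_balls_def by auto
    then have "p < n" using S(2) by auto
    from perturbed_ball[OF pt \<gamma> Q \<alpha> kp(1) this] kp show ?thesis by blast
  qed
  then show ?thesis unfolding covers_def using S by blast
qed

text \<open>Let \<open>W\<close> be the minimum cost. Perturbations only shrink distances, so the
  optimal dilation stays at most \<open>2 ^ (Q * W)\<close>; multiplied by \<gamma> it is still
  below the next level, and every optimal placement selects \<open>A\<close>. Its balls lie inside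
  the blocks of \<open>A\<close>, and the number of clusters leaves no other clustering. The same
  estimate applies to an approximate placement of the unperturbed instance.\<close>

theorem inst_resilient:
  assumes \<gamma>: "1 \<le> \<gamma>" "\<gamma> < 2 ^ Q" and KG: "K \<le> G" and N0: "0 < N" and A: "hits A"
    and uniq: "\<And>B. hits B \<Longrightarrow> cost B \<le> cost A \<Longrightarrow> B = A"
  shows "perturbation_resilient \<gamma> (inst Q)"
    and "\<And>S \<alpha> \<beta>. feasible_placement (inst Q) \<alpha> S \<Longrightarrow> optimal_dilation (inst Q) \<beta> \<Longrightarrow> \<alpha> \<le> \<gamma> * \<beta> \<Longrightarrow>
           groups S = A"
proof -
  have Q: "0 < Q" using \<gamma> by (cases Q) auto
  let ?W = "cost A"
  have WT: "?W \<le> T" by (rule cost_le_T[OF A])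
  have AG: "A \<subseteq> {..<G}" using A by (simp add: hits_def)
  have ne: "\<exists>g<G. E c g" if "c < J" for c using A that AG unfolding hits_def by (meson lessThan_iff subsetD)
  obtain S0 where S0: "covers ?W S0" using covers_exists[OF A N0 KG] by blast
  note bp = blocks_partition[OF A N0 KG]
  \<comment> \<open>Consecutive levels differ by the factor \<open>2 ^ Q\<close>, which exceeds
    \<gamma>.\<close>
  have small: "\<gamma> * \<alpha> < 2 ^ (Q * (?W + 1))" if "\<alpha> \<le> 2 ^ (Q * ?W)" for \<alpha> :: real
  proof -
    have "\<gamma> * \<alpha> \<le> \<gamma> * 2 ^ (Q * ?W)" using that \<gamma> by (intro mult_left_mono) auto
    also have "\<dots> < 2 ^ Q * 2 ^ (Q * ?W)" using \<gamma> by (intro mult_strict_right_mono) auto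
    finally show ?thesis by (simp add: power_add)
  qed
  have struct: "groups S = A" "\<And>\<kappa> p. \<kappa> < 1 + 2 * J + T \<Longrightarrow> p \<in> set (S ! \<kappa>) \<Longrightarrow> \<exists>b\<in>blocks A. nball ?W p (rad_exp \<kappa>) \<subseteq> b"
    if "covers ?W S" for S
  proof -
    note st = covers_structure[OF that WT KG N0 ne]
    have "hits (groups S)" "cost (groups S) \<le> ?W" using st(1,2) by blast+
    then show g: "groups S = A" by (rule uniq)
    show "\<exists>b\<in>blocks A. nball ?W p (rad_exp \<kappa>) \<subseteq> b" if "\<kappa> < 1 + 2 * J + T" "p \<in> set (S ! \<kappa>)" for \<kappa> p
      using st(3)[OF _ that] g by simp
  qed
  have cnts: "length (counts (inst Q)) = length (radii (inst Q))" by (simp add: inst_def)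
  have main: "{\<C>'. optimal_clustering (inst Q\<lparr>metr := d1\<rparr>) \<C>'} = {blocks A}"
    if pt: "metric_perturbation \<gamma> {..<n} (metr (inst Q)) d1" for d1
  proof -
    let ?I = "inst Q\<lparr>metr := d1\<rparr>"
    have g0: "0 < \<gamma>" using \<gamma> by simp
    have M: "Metric_space {..<n} d1" using pt by (simp add: metric_perturbation_def)
    have d1: "d1 p q \<le> metr (inst Q) p q" if "p < n" "q < n" for p q
      using pt that by (auto simp: metric_perturbation_def)
    have f0: "feasible_placement ?I (2 ^ (Q * ?W)) S0"
    proof -
      have f: "feasible_placement (inst Q) (2 ^ (Q * ?W)) S0" by (rule feasible_instI[OF S0])
      have sub: "nukc_ball (inst Q) p r \<subseteq> nukc_ball ?I p r" if "p < n" for p r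
        using d1 that by (force simp: nukc_ball_def)
      have "\<Union> (placement_balls (inst Q) (2 ^ (Q * ?W)) S0) \<subseteq> \<Union> (placement_balls ?I (2 ^ (Q * ?W)) S0)"
      proof
        fix x assume "x \<in> \<Union> (placement_balls (inst Q) (2 ^ (Q * ?W)) S0)"
        then obtain i p where ip: "i < length (radii (inst Q))" "p \<in> set (S0 ! i)"
          "x \<in> nukc_ball (inst Q) p (2 ^ (Q * ?W) * radii (inst Q) ! i)"
          unfolding placement_balls_def by blast
        then have "p < n" using f unfolding feasible_placement_def by fastforce
        then have "x \<in> nukc_ball ?I p (2 ^ (Q * ?W) * radii ?I ! i)"
          using ip(3) sub by auto
        moreover have "i < length (radii ?I)" using ip by simp
        ultimately show "x \<in> \<Union> (placement_balls ?I (2 ^ (Q * ?W)) S0)"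
          unfolding placement_balls_def using ip(2) by blast
      qed
      moreover have "\<Union> (placement_balls ?I (2 ^ (Q * ?W)) S0) \<subseteq> {..<n}" by (auto simp: placement_balls_def nukc_ball_def)
      ultimately show ?thesis using f unfolding feasible_placement_def by auto
    qed
    have "\<exists>\<beta>. optimal_dilation ?I \<beta>"
      by (rule optimal_dilation_exists[OF _ _ f0]) (auto simp: inst_def)
    then obtain \<beta> where \<beta>: "optimal_dilation ?I \<beta>" by blast
    have opt: "\<alpha> \<le> 2 ^ (Q * ?W)" if "optimal_dilation ?I \<alpha>" for \<alpha>
      using that f0 by (auto simp: optimal_dilation_def)
    have balls: "finite (placement_balls ?I \<alpha> S)" "card (placement_balls ?I \<alpha> S) \<le> card (blocks A)"
        "\<And>B. B \<in> placement_balls ?I \<alpha> S \<Longrightarrow> \<exists>b\<in>blocks A. B \<subseteq> b"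
      if o: "optimal_dilation ?I \<alpha>" and f: "feasible_placement ?I \<alpha> S" for \<alpha> S
    proof -
      note cv = perturbed_covers[OF pt g0 Q small[OF opt[OF o]] f]
      show "finite (placement_balls ?I \<alpha> S)"
        by (rule card_placement_balls) (use f cnts in \<open>auto simp: feasible_placement_def\<close>)
      have "card (placement_balls ?I \<alpha> S) \<le> sum_list (counts ?I)"
        by (rule card_placement_balls) (use f cnts in \<open>auto simp: feasible_placement_def\<close>)
      then show "card (placement_balls ?I \<alpha> S) \<le> card (blocks A)"
        using sum_list_cnt[OF KG] bp(2) by simp
      fix B assume "B \<in> placement_balls ?I \<alpha> S"
      then obtain \<kappa> p where kp: "\<kappa> < 1 + 2 * J + T" "p \<in> set (S ! \<kappa>)"
        and B: "B = nukc_ball ?I p (\<alpha> * radii (inst Q) ! \<kappa>)"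
        unfolding placement_balls_def by auto
      then have "p < n" using f by (auto simp: feasible_placement_def)
      from perturbed_ball[OF pt g0 Q small[OF opt[OF o]] kp(1) this] struct(2)[OF cv kp]
      show "\<exists>b\<in>blocks A. B \<subseteq> b" unfolding B by blast
    qed
    show ?thesis
    proof (intro equalityI subsetI CollectI)
      fix \<C>' assume "\<C>' \<in> {\<C>'. optimal_clustering ?I \<C>'}"
      then obtain \<alpha> S where o: "optimal_dilation ?I \<alpha>" "feasible_placement ?I \<alpha> S"
        and c: "partition_on {..<n} \<C>'" "card \<C>' = card (blocks A)" "\<And>C. C \<in> \<C>' \<Longrightarrow> \<exists>B\<in>placement_balls ?I \<alpha> S. C \<subseteq> B"
        using sum_list_cnt[OF KG] bp(2) by (auto simp: optimal_clustering_def induced_clustering_def)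
      have fC: "finite \<C>'" using finite_elements[OF _ c(1)] by simp
      have in_b: "\<exists>b\<in>blocks A. C \<subseteq> b" if "C \<in> \<C>'" for C
      proof -
        obtain B where "B \<in> placement_balls ?I \<alpha> S" "C \<subseteq> B" using c(3)[OF \<open>C \<in> \<C>'\<close>] by blast
        moreover from balls(3)[OF o this(1)] obtain b where "b \<in> blocks A" "B \<subseteq> b" by (elim bexE)
        ultimately show ?thesis by (meson subset_trans)
      qed
      \<comment> \<open>The clusters refine the blocks and are equally many, so every block is
        itself a cluster.\<close>
      have "b \<in> \<C>'" if b: "b \<in> blocks A" for b
      proof -
        have "\<exists>C\<in>\<C>'. b \<subseteq> C"
        proof (rule partition_cover_eq[OF bp(1,3) in_b _ fC _ b])
          show "{..<n} \<subseteq> \<Union> \<C>'" using partition_onD1[OF c(1)] by simp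
        qed (simp_all add: c(2))
        then obtain C where C: "C \<in> \<C>'" "b \<subseteq> C" by blast
        obtain b' where b': "b' \<in> blocks A" "C \<subseteq> b'" using in_b[OF C(1)] by blast
        have "b \<noteq> {}" using partition_onD3[OF bp(1)] b by (metis)
        then have "b \<inter> b' \<noteq> {}" using C(2) b'(2) by (simp add: Int_absorb2 subset_trans)
        then have "b = b'" using partition_onD2[OF bp(1)] b b'(1) unfolding disjoint_def by metis
        then show ?thesis using C b' by (metis subset_antisym)
      qed
      then have "blocks A \<subseteq> \<C>'" by (rule subsetI)
      then have "blocks A = \<C>'" by (rule card_subset_eq[OF fC]) (simp add: c(2))
      then show "\<C>' \<in> {blocks A}" by simp
    next
      fix \<C>' assume "\<C>' \<in> {blocks A}"
      then have C: "\<C>' = blocks A" by simp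
      obtain S where S: "feasible_placement ?I \<beta> S" using \<beta> by (auto simp: optimal_dilation_def)
      note bl = balls[OF \<beta> S]
      \<comment> \<open>Conversely, a block spread over several balls would leave too few balls for
        the other blocks.\<close>
      have "\<exists>B\<in>placement_balls ?I \<beta> S. b \<subseteq> B" if b: "b \<in> blocks A" for b
      proof (rule partition_cover_eq[OF bp(1,3) bl(3) _ bl(1,2) b])
        show "{..<n} \<subseteq> \<Union> (placement_balls ?I \<beta> S)" using S by (simp add: feasible_placement_def)
      qed
      moreover have "card (blocks A) = sum_list (counts ?I)" using bp(2) sum_list_cnt[OF KG] by simp
      ultimately have "induced_clustering ?I \<beta> S \<C>'"
        unfolding induced_clustering_def C using bp(1) by simp
      then show "optimal_clustering ?I \<C>'" unfolding optimal_clustering_def using \<beta> S by (intro exI conjI)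
    qed
  qed
  have self: "metric_perturbation \<gamma> {..<n} (metr (inst Q)) (metr (inst Q))"
  proof -
    have "x / \<gamma> \<le> x" if "0 \<le> x" for x
      using that \<gamma> mult_right_mono[of 1 \<gamma> x] by (simp add: divide_le_eq mult.commute)
    then show ?thesis using inst_metric unfolding metric_perturbation_def
      by (simp add: Metric_space.nonneg[OF inst_metric])
  qed
  have I: "inst Q\<lparr>metr := metr (inst Q)\<rparr> = inst Q" by simp
  show "perturbation_resilient \<gamma> (inst Q)"
    unfolding perturbation_resilient_def
  proof (intro exI conjI allI impI)
    show "{\<C>'. optimal_clustering (inst Q) \<C>'} = {blocks A}" using main[OF self] unfolding I .
    fix d1 assume "metric_perturbation \<gamma> (points (inst Q)) (metr (inst Q)) d1"
    then show "{\<C>'. optimal_clustering (inst Q\<lparr>metr := d1\<rparr>) \<C>'} = {blocks A}" by (intro main) simp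
  qed
  fix S \<alpha> \<beta> assume f: "feasible_placement (inst Q) \<alpha> S" and o: "optimal_dilation (inst Q) \<beta>" and le: "\<alpha> \<le> \<gamma> * \<beta>"
  have "\<beta> \<le> 2 ^ (Q * ?W)" using o feasible_instI[OF S0] by (auto simp: optimal_dilation_def)
  from le_less_trans[OF le small[OF this]] have \<alpha>: "1 * \<alpha> < 2 ^ (Q * (?W + 1))" by simp
  \<comment> \<open>The metric is left unperturbed here; the factor \<gamma> has been spent on the
    dilation instead.\<close>
  have "metric_perturbation 1 {..<n} (metr (inst Q)) (metr (inst Q))"
    using inst_metric by (simp add: metric_perturbation_def)
  from perturbed_covers[OF this _ Q \<alpha>, unfolded I] f have "covers ?W S" by simp
  then show "groups S = A" by (rule struct(1))
qed

end

section \<open>The isolating lemma\<close>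

lemma central_binomial_Suc: "Suc m * (2 * Suc m choose Suc m) = 2 * (2 * m + 1) * (2 * m choose m)"
proof -
  define a where "a = (Suc (2 * m) choose m)"
  have "Suc (2 * m) - m = Suc m" by simp
  then have "a = (Suc (2 * m) choose Suc m)"
    unfolding a_def using binomial_symmetric[of m "Suc (2 * m)"] by (simp only:)
  then have 1: "Suc (2 * m) * (2 * m choose m) = a * Suc m"
    by (simp only: Suc_times_binomial_eq)
  have "2 * Suc m = Suc (Suc (2 * m))" by simp
  then have 2: "Suc m * (2 * Suc m choose Suc m) = 2 * Suc m * a"
    using Suc_times_binomial_eq[of "Suc (2 * m)" m] unfolding a_def by (simp only: mult.commute)
  have "2 * Suc m * a = 2 * (Suc (2 * m) * (2 * m choose m))" unfolding 1 by (simp only: mult_ac)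
  then show ?thesis unfolding 2 by (simp only: mult.assoc Suc_eq_plus1)
qed

text \<open>The factor \<open>2 * m + 1\<close> is what the induction can carry: its step amounts to
  (2m + 1)(2m + 3) \<le> (2m + 2)^2.\<close>

lemma central_binomial_sqr_le: "(2 * m choose m)\<^sup>2 * (2 * m + 1) \<le> 16 ^ m"
proof (induction m)
  case (Suc m)
  define C where "C = (2 * m choose m)"
  define D where "D = (2 * Suc m choose Suc m)"
  have D: "Suc m * D = 2 * (2 * m + 1) * C" unfolding C_def D_def by (rule central_binomial_Suc)
  have "(Suc m)\<^sup>2 * (D\<^sup>2 * (2 * Suc m + 1)) = (Suc m * D)\<^sup>2 * (2 * m + 3)"
  proof -
    have "2 * Suc m + 1 = 2 * m + 3" by simp
    then show ?thesis by (simp only: power_mult_distrib mult.assoc)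
  qed
  also have "\<dots> = (C\<^sup>2 * (2 * m + 1)) * (4 * (2 * m + 1) * (2 * m + 3))"
    unfolding D by (simp add: power2_eq_square algebra_simps)
  also have "\<dots> \<le> 16 ^ m * (16 * (Suc m)\<^sup>2)"
    by (rule mult_mono[OF Suc[folded C_def]]) (simp_all add: power2_eq_square algebra_simps)
  finally have "(Suc m)\<^sup>2 * (D\<^sup>2 * (2 * Suc m + 1)) \<le> (Suc m)\<^sup>2 * 16 ^ Suc m" by (simp add: mult_ac)
  then show ?case unfolding D_def by (metis mult_le_cancel1 zero_less_Suc zero_less_power)
qed simp

text \<open>The number of ones among \<open>4 * G\<^sup>2\<close> fair bits takes each value with
  probability at most 1/(2G). In contrast to a uniformly distributed weight it is read directly from
  the random string as a number of marks. With \<open>m = 2 * G\<^sup>2\<close> the factor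
  \<open>(2 * G)\<^sup>2\<close> equals \<open>2 * m\<close>.\<close>

lemma binomial_isolation_bound: "2 * G * (4 * G\<^sup>2 choose k) \<le> 2 ^ (4 * G\<^sup>2)"
proof -
  define m where "m = 2 * G\<^sup>2"
  have m: "4 * G\<^sup>2 = 2 * m" by (simp add: m_def)
  have "(2 * m choose k) \<le> (2 * m choose m)" by (rule binomial_maximum')
  then have "(2 * G * (2 * m choose k))\<^sup>2 \<le> (2 * G * (2 * m choose m))\<^sup>2" by (intro power_mono mult_le_mono2) auto
  also have "\<dots> = (2 * m choose m)\<^sup>2 * (2 * m)" by (simp add: m_def power2_eq_square)
  also have "\<dots> \<le> (2 * m choose m)\<^sup>2 * (2 * m + 1)" by simp
  also have "\<dots> \<le> 16 ^ m" by (rule central_binomial_sqr_le)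
  also have "(16::nat) ^ m = (2 ^ (2 * m))\<^sup>2" by (simp add: power_mult power2_eq_square power_mult_distrib[symmetric])
  finally show ?thesis unfolding m by (rule power2_le_imp_le) simp
qed

definition ones :: "bool list \<Rightarrow> nat" where "ones xs = length (filter id xs)"

lemma card_ones_le: "card {xs. length xs = U \<and> ones xs = k} \<le> U choose k"
proof -
  have "card {xs. length xs = U \<and> ones xs = k} \<le> card {S. S \<subseteq> {..<U} \<and> card S = k}"
  proof (rule card_inj_on_le)
    show "inj_on (\<lambda>xs. {i. i < U \<and> xs ! i}) {xs. length xs = U \<and> ones xs = k}"
    proof (rule inj_onI)
      fix xs ys assume "xs \<in> {xs. length xs = U \<and> ones xs = k}" "ys \<in> {xs. length xs = U \<and> ones xs = k}"
        and eq: "{i. i < U \<and> xs ! i} = {i. i < U \<and> ys ! i}"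
      then have "length xs = U" "length ys = U" by auto
      moreover have "xs ! i = ys ! i" if "i < U" for i using eq that by blast
      ultimately show "xs = ys" by (intro nth_equalityI) auto
    qed
    show "(\<lambda>xs. {i. i < U \<and> xs ! i}) ` {xs. length xs = U \<and> ones xs = k} \<subseteq> {S. S \<subseteq> {..<U} \<and> card S = k}"
      by (auto simp: ones_def length_filter_conv_card)
    show "finite {S. S \<subseteq> {..<U} \<and> card S = k}" by simp
  qed
  then show ?thesis by (simp add: n_subsets)
qed

lemma card_bool_lists: "card {xs :: bool list. length xs = n} = 2 ^ n" "finite {xs :: bool list. length xs = n}"
  using card_lists_length_eq[of "UNIV :: bool set" n] finite_lists_length_eq[of "UNIV :: bool set" n] by auto

definition wt :: "nat \<Rightarrow> bool list \<Rightarrow> nat \<Rightarrow> nat" where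
  "wt U r g = ones (take U (drop (g * U) r))"

text \<open>If all bits outside block \<open>g\<close> are fixed, so is the threshold, and
  prescribing the number of ones leaves at most \<open>C\<close> choices for the block.\<close>

lemma card_weight_eq_le:
  assumes g: "g < G"
    and indep: "\<And>r r'. length r = G * U \<Longrightarrow> length r' = G * U \<Longrightarrow>
      take (g * U) r = take (g * U) r' \<Longrightarrow> drop (Suc g * U) r = drop (Suc g * U) r' \<Longrightarrow> \<theta> r = \<theta> r'"
    and C: "\<And>k. U choose k \<le> C"
  shows "card {r. length r = G * U \<and> wt U r g = \<theta> r} \<le> 2 ^ ((G - 1) * U) * C"
proof -
  let ?P = "{xs :: bool list. length xs = g * U}" and ?S = "{xs :: bool list. length xs = (G - Suc g) * U}"
  \<comment> \<open>A dummy block replaces block \<open>g\<close>, on which the threshold does not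
    depend.\<close>
  let ?\<theta> = "\<lambda>(p, s). \<theta> (p @ replicate U False @ s)"
  let ?X = "SIGMA ps:?P \<times> ?S. {xs. length xs = U \<and> ones xs = ?\<theta> ps}"
  let ?f = "\<lambda>r. ((take (g * U) r, drop (Suc g * U) r), take U (drop (g * U) r))"
  have le: "Suc g * U \<le> G * U" using g by (intro mult_le_mono1) simp
  have sp: "G * U = g * U + U + (G - Suc g) * U"
  proof -
    have "G = g + 1 + (G - Suc g)" using g by simp
    then have "G * U = (g + 1 + (G - Suc g)) * U" by simp
    then show ?thesis by (simp add: add_mult_distrib)
  qed
  have fin: "finite {xs. length xs = U \<and> ones xs = k}" for k
    by (rule finite_subset[OF _ card_bool_lists(2)[of U]]) auto
  have "card {r. length r = G * U \<and> wt U r g = \<theta> r} \<le> card ?X"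
  proof (rule card_inj_on_le)
    show "inj_on ?f {r. length r = G * U \<and> wt U r g = \<theta> r}"
    proof (rule inj_onI)
      fix r r' assume "?f r = ?f r'"
      then have eq: "take (g * U) r = take (g * U) r'" "take U (drop (g * U) r) = take U (drop (g * U) r')"
        "drop U (drop (g * U) r) = drop U (drop (g * U) r')" by simp_all
      have "drop (g * U) r = drop (g * U) r'" using eq(2,3) by (metis append_take_drop_id)
      then show "r = r'" using eq(1) by (metis append_take_drop_id)
    qed
    show "?f ` {r. length r = G * U \<and> wt U r g = \<theta> r} \<subseteq> ?X"
    proof
      fix x assume "x \<in> ?f ` {r. length r = G * U \<and> wt U r g = \<theta> r}"
      then obtain r where r: "length r = G * U" "wt U r g = \<theta> r" "x = ?f r" by blast
      have l: "length (take (g * U) r) = g * U" "length (drop (Suc g * U) r) = (G - Suc g) * U"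
        "length (take U (drop (g * U) r)) = U" using r(1) sp by auto
      have "\<theta> (take (g * U) r @ replicate U False @ drop (Suc g * U) r) = \<theta> r"
        using r(1) l sp le by (intro indep) auto
      then show "x \<in> ?X" using r l by (simp add: wt_def)
    qed
    show "finite ?X" using card_bool_lists(2) fin by (intro finite_SigmaI finite_cartesian_product) (auto split: prod.splits)
  qed
  also have "card ?X = (\<Sum>ps\<in>?P \<times> ?S. card {xs. length xs = U \<and> ones xs = ?\<theta> ps})"
    using card_bool_lists(2) fin by (intro card_SigmaI finite_cartesian_product) (auto split: prod.splits)
  also have "\<dots> \<le> of_nat (card (?P \<times> ?S)) * C"
    by (intro sum_bounded_above order_trans[OF card_ones_le C])
  also have "card (?P \<times> ?S) = 2 ^ ((G - 1) * U)"
  proof -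
    have "g * U + (G - Suc g) * U = (G - 1) * U" using g by (simp add: add_mult_distrib[symmetric])
    then show ?thesis by (simp add: card_cartesian_product card_bool_lists power_add[symmetric])
  qed
  finally show ?thesis by simp
qed

definition cost_of :: "nat \<Rightarrow> nat \<Rightarrow> bool list \<Rightarrow> nat set \<Rightarrow> nat" where
  "cost_of G U r A = (\<Sum>g\<in>{..<G} - A. wt U r g)"

text \<open>
  The argument of Mulmuley, Vazirani and Vazirani: if two sets of minimum cost differ in \<open>g\<close>,
  then the weight of \<open>g\<close> is the difference of the minimum costs of the sets with and without
  \<open>g\<close>, computed without the weight of \<open>g\<close>, and hence determined by the other weights.
\<close>

lemma isolation:
  assumes F: "F \<noteq> {}" "\<And>A. A \<in> F \<Longrightarrow> A \<subseteq> {..<G}" and C: "\<And>k. U choose k \<le> C" "2 * G * C \<le> 2 ^ U"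
  shows "2 ^ (G * U) \<le> 2 * card {r. length r = G * U \<and>
    (\<exists>A\<in>F. \<forall>B\<in>F. cost_of G U r B \<le> cost_of G U r A \<longrightarrow> B = A)}"
proof -
  let ?R = "{r :: bool list. length r = G * U}"
  let ?good = "{r. length r = G * U \<and> (\<exists>A\<in>F. \<forall>B\<in>F. cost_of G U r B \<le> cost_of G U r A \<longrightarrow> B = A)}"
  have fF: "finite F" by (rule finite_subset[of _ "Pow {..<G}"]) (use F in auto)
  define cg where "cg = (\<lambda>g r A. \<Sum>h\<in>{..<G} - A - {g}. wt U r h)"
  \<comment> \<open>The cost counts the elements left out, so it is the sets without
    \<open>g\<close> that carry the weight of \<open>g\<close>. If one of the families is empty, its
    minimum is unspecified, but the threshold still depends on the other weights only.\<close>
  define \<theta> where "\<theta> = (\<lambda>g r. Min (cg g r ` {A\<in>F. g \<in> A}) - Min (cg g r ` {A\<in>F. g \<notin> A}))"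
  let ?bad = "\<lambda>g. {r. length r = G * U \<and> wt U r g = \<theta> g r}"
  have c_in: "cost_of G U r A = cg g r A" if "g \<in> A" for g r A
    using that unfolding cost_of_def cg_def by (intro sum.cong) auto
  have c_out: "cost_of G U r A = cg g r A + wt U r g" if "g \<notin> A" "g < G" for g r A
    using that unfolding cost_of_def cg_def by (subst sum.remove[of _ g]) auto
  have "r \<in> ?good \<union> (\<Union>g<G. ?bad g)" if r: "length r = G * U" for r
  proof (cases "r \<in> ?good")
    case False
    obtain A where A: "A \<in> F" "\<And>B. B \<in> F \<Longrightarrow> cost_of G U r A \<le> cost_of G U r B"
    proof (rule that)
      show "arg_min_on (cost_of G U r) F \<in> F" by (rule arg_min_if_finite[OF fF F(1)])
      show "cost_of G U r (arg_min_on (cost_of G U r) F) \<le> cost_of G U r B" if "B \<in> F" for B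
        by (rule arg_min_least[OF fF F(1) that])
    qed
    obtain B where B: "B \<in> F" "cost_of G U r B \<le> cost_of G U r A" "B \<noteq> A"
    proof -
      have "\<not> (\<exists>A\<in>F. \<forall>B\<in>F. cost_of G U r B \<le> cost_of G U r A \<longrightarrow> B = A)" using False r by simp
      then show ?thesis using A(1) that by metis
    qed
    have Bm: "cost_of G U r B \<le> cost_of G U r D" if "D \<in> F" for D by (rule le_trans[OF B(2) A(2)[OF that]])
    have key: "wt U r g = \<theta> g r" if X: "X \<in> F" "\<And>D. D \<in> F \<Longrightarrow> cost_of G U r X \<le> cost_of G U r D"
        and Y: "Y \<in> F" "\<And>D. D \<in> F \<Longrightarrow> cost_of G U r Y \<le> cost_of G U r D" and g: "g \<in> X" "g \<notin> Y" for X Y g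
    proof -
      have gG: "g < G" using F(2)[OF X(1)] g by auto
      have 1: "Min (cg g r ` {A\<in>F. g \<in> A}) = cg g r X"
      proof (rule Min_eqI)
        show "cg g r X \<le> y" if "y \<in> cg g r ` {A\<in>F. g \<in> A}" for y
        proof -
          obtain D where D: "D \<in> F" "g \<in> D" "y = cg g r D" using \<open>y \<in> _\<close> by blast
          from X(2)[OF D(1)] show ?thesis using c_in[OF D(2), of r] c_in[OF g(1), of r] D(3) by simp
        qed
        show "finite (cg g r ` {A\<in>F. g \<in> A})" using fF by simp
        show "cg g r X \<in> cg g r ` {A\<in>F. g \<in> A}" using X(1) g(1) by (intro imageI CollectI conjI)
      qed
      have 2: "Min (cg g r ` {A\<in>F. g \<notin> A}) = cg g r Y"
      proof (rule Min_eqI)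
        show "cg g r Y \<le> y" if y: "y \<in> cg g r ` {A\<in>F. g \<notin> A}" for y
        proof -
          obtain D where D: "D \<in> F" "g \<notin> D" "y = cg g r D" using y by blast
          from Y(2)[OF D(1)] show ?thesis using c_out[OF D(2) gG, of r] c_out[OF g(2) gG, of r] D(3) by simp
        qed
        show "finite (cg g r ` {A\<in>F. g \<notin> A})" using fF by simp
        show "cg g r Y \<in> cg g r ` {A\<in>F. g \<notin> A}" using Y(1) g(2) by (intro imageI CollectI conjI)
      qed
      have "cost_of G U r X = cost_of G U r Y" by (rule le_antisym[OF X(2)[OF Y(1)] Y(2)[OF X(1)]])
      then show ?thesis using c_in[OF g(1), of r] c_out[OF g(2) gG, of r] unfolding \<theta>_def 1 2 by simp
    qed
    obtain g where "g \<in> A \<and> g \<notin> B \<or> g \<in> B \<and> g \<notin> A" using B(3) by blast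
    then have "wt U r g = \<theta> g r \<and> g < G"
    proof (elim disjE conjE)
      assume "g \<in> A" "g \<notin> B"
      then show ?thesis using key[OF A B(1) Bm] F(2)[OF A(1)] by auto
    next
      assume "g \<in> B" "g \<notin> A"
      then show ?thesis using key[OF B(1) Bm A] F(2)[OF B(1)] by auto
    qed
    then have "r \<in> (\<Union>g<G. ?bad g)" using r by (intro UN_I[of g]) simp_all
    then show ?thesis by (rule UnI2)
  qed (rule UnI1)
  note cases = this
  have sub: "?R \<subseteq> ?good \<union> (\<Union>g<G. ?bad g)"
  proof
    fix r assume "r \<in> ?R"
    then show "r \<in> ?good \<union> (\<Union>g<G. ?bad g)" by (intro cases) simp
  qed
  have fin: "finite ?good" "\<And>g. finite (?bad g)"
    by (rule finite_subset[OF _ card_bool_lists(2)[of "G * U"]], rule subsetI, simp)+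
  have bad: "card (?bad g) \<le> 2 ^ ((G - 1) * U) * C" if g: "g < G" for g
  proof (rule card_weight_eq_le[OF g _ C(1)])
    fix r r' :: "bool list" assume l: "length r = G * U" "length r' = G * U"
      and eq: "take (g * U) r = take (g * U) r'" "drop (Suc g * U) r = drop (Suc g * U) r'"
    have "wt U r h = wt U r' h" if "h \<noteq> g" for h
    proof (cases "h < g")
      case True
      then have "h * U + U \<le> g * U" by (metis Suc_leI add.commute mult_Suc mult_le_mono1)
      have "take U (drop (h * U) r) = take U (drop (h * U) (take (g * U) r))" for r :: "bool list"
        using \<open>h * U + U \<le> g * U\<close> by (simp add: drop_take min_def)
      then show ?thesis unfolding wt_def using eq(1) by metis
    next
      case False
      then have "Suc g * U \<le> h * U" using that by (intro mult_le_mono1) simp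
      then have "drop (h * U) r = drop (h * U - Suc g * U) (drop (Suc g * U) r)" for r :: "bool list" by simp
      then show ?thesis unfolding wt_def using eq(2) by metis
    qed
    then have "cg g r = cg g r'" unfolding cg_def by (intro ext sum.cong) auto
    then show "\<theta> g r = \<theta> g r'" by (simp add: \<theta>_def)
  qed
  have "2 ^ (G * U) = card ?R" by (simp add: card_bool_lists)
  also have "\<dots> \<le> card (?good \<union> (\<Union>g<G. ?bad g))" using fin by (intro card_mono sub) auto
  also have "\<dots> \<le> card ?good + (\<Sum>g<G. card (?bad g))"
    by (intro order_trans[OF card_Un_le] add_mono order_refl card_UN_le) simp
  also have "(\<Sum>g<G. card (?bad g)) \<le> G * (2 ^ ((G - 1) * U) * C)"
    using sum_bounded_above[of "{..<G}" "\<lambda>g. card (?bad g)" "2 ^ ((G - 1) * U) * C"] bad by simp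
  finally have 1: "2 ^ (G * U) \<le> card ?good + G * (2 ^ ((G - 1) * U) * C)" by simp
  have "2 * (G * (2 ^ ((G - 1) * U) * C)) \<le> 2 ^ (G * U)"
  proof (cases G)
    case (Suc n)
    have "2 * (G * (2 ^ ((G - 1) * U) * C)) = 2 ^ ((G - 1) * U) * (2 * G * C)" by (simp only: mult_ac)
    also have "\<dots> \<le> 2 ^ ((G - 1) * U) * 2 ^ U" by (rule mult_le_mono2[OF C(2)])
    also have "\<dots> = 2 ^ ((G - 1) * U + U)" by (simp only: power_add)
    also have "(G - 1) * U + U = G * U" using Suc by simp
    finally show ?thesis .
  qed simp
  with 1 show ?thesis by linarith
qed

section \<open>Tableaux of accepting computations\<close>

context tableau begin

lemma rule_graph:
  assumes p: "proper val" and k0: "0 < k" and t: "t \<le> B" and j: "j < k" and i: "i < Wd"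
  shows "(\<exists>g\<in>graph val. rule f t j i a b g) \<longleftrightarrow>
    (if f = 0 then t < B \<longrightarrow> val (Xc t) = a \<longrightarrow> a < NV \<and> val (Xc (t + 1)) < NV \<and> cst (val (Xc (t + 1))) = nst a
     else if f = 1 then val (Xh t j) = i \<longrightarrow> val (Xs t j i) = a \<longrightarrow> val (Xc t) < NV \<and> a < S \<and> csc (val (Xc t)) j = a
     else if f = 2 then t < B \<longrightarrow> val (Xc t) = a \<longrightarrow> val (Xh t j) = i \<longrightarrow>
        a < NV \<and> val (Xh (t + 1) j) = move_head (cdir a j) i
     else if f = 3 then t < B \<longrightarrow> val (Xc t) = a \<longrightarrow> val (Xh t j) = i \<longrightarrow>
        a < NV \<and> val (Xs (t + 1) j i) < S \<and> cwr a j = val (Xs (t + 1) j i)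
     else if f = 4 then t < B \<longrightarrow> b \<noteq> i \<longrightarrow> val (Xh t j) = b \<longrightarrow> val (Xs t j i) = a \<longrightarrow> val (Xs (t + 1) j i) = a
     else if f = 5 then val (Xh 0 j) = 0
     else if f = 6 then (if j = 0 \<and> i < length s0 then val (Xs 0 j i) = str_tape s0 i
        else if j = 0 \<and> i < length s0 + P then val (Xs 0 j i) < 3 else val (Xs 0 j i) = 0)
     else if f = 7 then length s0 \<le> i \<longrightarrow> i + 1 < Wd \<longrightarrow> val (Xs 0 0 i) = 0 \<longrightarrow> val (Xs 0 0 (i + 1)) = 0
     else if f = 8 then val (Xc 0) < NV \<and> cst (val (Xc 0)) = 0
     else if f = 9 then val (Xc B) < NV \<and> cst (val (Xc B)) = num_states M
     else if f = 10 then val (Xs B 0 0) = 2 else val (Xs B 0 1) = 0)"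
proof -
  have W: "0 < Wd" "1 < Wd" by (auto simp: Wd_def)
  have ne: "\<exists>g. g \<in> graph val" using X_less(1)[of 0] by (auto simp: graph_def)
  have X': "t < B \<Longrightarrow> Xc (t + 1) < Mv" "t < B \<Longrightarrow> Xh (t + 1) j < Mv" "t < B \<Longrightarrow> Xs (t + 1) j i < Mv"
    using X_less[of "t + 1"] j i by auto
  \<comment> \<open>Side conditions do not mention the pair, and the graph is not empty.\<close>
  have pull: "(\<exists>g\<in>graph val. Q \<longrightarrow> R g) \<longleftrightarrow> (Q \<longrightarrow> (\<exists>g\<in>graph val. R g))" for Q R
    using ne by blast
  note X0 = X_less(1)[of 0] X_less(2)[of 0, OF _ j] X_less(3)[of 0, OF _ j i]
    X_less(3)[of 0 0, OF _ k0] X_less(1)[of B] X_less(3)[of B 0, OF _ k0]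
  note Xt = X_less(1)[OF t] X_less(2)[OF t j] X_less(3)[OF t j i]
  note gr = una_graph[OF p] imp_graph[OF p]
  consider "f = 0" | "f = 1" | "f = 2" | "f = 3" | "f = 4" | "f = 5" | "f = 6" | "f = 7" | "f = 8" | "f = 9"
    | "f = 10" | "10 < f" by atomize_elim presburger
  then show ?thesis
  proof cases
    case 1
    then show ?thesis using X' Xt by (simp add: rule_def pull gr cong: imp_cong)
  next
    case 2
    then show ?thesis using Xt j by (simp add: rule_def gr, blast?)
  next
    case 3
    have "(\<lambda>v. a < NV \<and> j < k \<and> cdir a j = Go_Left \<and> v = i - 1 \<or>
             a < NV \<and> j < k \<and> cdir a j = Stay \<and> v = i \<or>
             a < NV \<and> j < k \<and> cdir a j = Go_Right \<and> v = i + 1) =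
          (\<lambda>v. a < NV \<and> v = move_head (cdir a j) i)"
      using j by (cases "cdir a j") auto
    then show ?thesis using 3 X' Xt by (simp add: rule_def pull gr cong: imp_cong)
  next
    case 4
    then show ?thesis using X' Xt j by (simp add: rule_def pull gr cong: imp_cong)
  next
    case 5
    then show ?thesis using X' Xt by (simp add: rule_def pull gr cong: imp_cong) blast
  next
    case 6
    then show ?thesis using X0 by (simp add: rule_def gr)
  next
    case 7
    then show ?thesis using X0 by (simp add: rule_def gr)
  next
    case 8
    have "i + 1 < Wd \<Longrightarrow> Xs 0 0 (i + 1) < Mv" "Xs 0 0 i < Mv" using X0(4) i by auto
    then show ?thesis using 8 by (simp add: rule_def pull gr cong: imp_cong) blast
  next
    case 9
    then show ?thesis using X0 by (simp add: rule_def gr)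
  next
    case 10
    then show ?thesis using X0 by (simp add: rule_def gr)
  next
    case 11
    then show ?thesis using X0 W by (simp add: rule_def gr)
  next
    case 12
    then show ?thesis using X0 W by (simp add: rule_def gr)
  qed
qed

text \<open>The parameters \<open>a\<close> and \<open>b\<close> of a rule are instantiated with the
  actual values of the cells in question; properness puts these in range.\<close>

lemma hits_sem:
  assumes p: "proper val" and k0: "0 < k" and h: "\<forall>c<J. \<exists>g\<in>graph val. E c g"
  shows "sem val"
proof -
  from h have r: "\<exists>g\<in>graph val. rule f t j i a b g"
    if "f < 12" "t \<le> B" "j < k" "i < Wd" "a < q" "b < q" for f t j i a b
    unfolding all_E using that by auto
  have q0: "val x < q" if "x < Mv" for x using p that by (simp add: proper_def)
  have W: "0 < Wd" by (simp add: Wd_def)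
  have vc: "val (Xc t) < q" if "t \<le> B" for t using q0 X_less(1) that by blast
  have vs: "val (Xs t j i) < q" "val (Xh t j) < q" if "t \<le> B" "j < k" "i < Wd" for t j i
    using q0 X_less(2,3) that by blast+
  note g = rule_graph[OF p k0, THEN iffD1]
  have qp: "0 < q" using vc[of 0] by simp
  show ?thesis
    unfolding sem_def
  proof (intro conjI allI impI)
    fix t a assume t: "t < B" and a: "a < NV" "val (Xc t) = a"
    have "a < q" using a vc[of t] t by simp
    from g[OF _ k0 W r[of 0 t 0 0 a 0]] t a this k0 W qp
    show "val (Xc (t + 1)) < NV" "cst (val (Xc (t + 1))) = nst a" by auto
  next
    fix t j i assume *: "t \<le> B" "j < k" "i < Wd" "val (Xh t j) = i"
    from g[OF *(1,2,3) r[of 1 t j i "val (Xs t j i)" 0]] * vs[OF *(1-3)] qp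
    show "val (Xc t) < NV" "val (Xs t j i) < S" "csc (val (Xc t)) j = val (Xs t j i)" by auto
  next
    fix t j i assume *: "t < B" "j < k" "i < Wd" "val (Xc t) < NV" "val (Xh t j) = i"
    then have t: "t \<le> B" by simp
    from g[OF t *(2,3) r[of 2 t j i "val (Xc t)" 0]] * vc[OF t] qp
    show "val (Xh (t + 1) j) = move_head (cdir (val (Xc t)) j) i" by auto
    from g[OF t *(2,3) r[of 3 t j i "val (Xc t)" 0]] * vc[OF t] qp
    show "val (Xs (t + 1) j i) < S" "val (Xs (t + 1) j i) = cwr (val (Xc t)) j" by auto
  next
    fix t j i assume *: "t < B" "j < k" "i < Wd" "val (Xh t j) \<noteq> i"
    then have t: "t \<le> B" by simp
    from g[OF t *(2,3) r[of 4 t j i "val (Xs t j i)" "val (Xh t j)"]] * vs[OF t *(2,3)]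
    show "val (Xs (t + 1) j i) = val (Xs t j i)" by auto
  next
    fix j assume *: "j < k"
    from g[OF _ * W r[of 5 0 j 0 0 0]] * W qp show "val (Xh 0 j) = 0" by auto
  next
    fix j i assume *: "j < k" "i < Wd"
    from g[OF _ * r[of 6 0 j i 0 0]] * qp
    show "if j = 0 \<and> i < length s0 then val (Xs 0 j i) = str_tape s0 i
        else if j = 0 \<and> i < length s0 + P then val (Xs 0 j i) < 3 else val (Xs 0 j i) = 0" by auto
  next
    fix i assume *: "length s0 \<le> i" "i + 1 < Wd" "val (Xs 0 0 i) = 0"
    have i: "i < Wd" using * by simp
    from g[OF _ k0 i r[of 7 0 0 i 0 0]] * k0 i qp show "val (Xs 0 0 (i + 1)) = 0" by auto
  next
    from g[OF _ k0 W r[of 8 0 0 0 0 0]] k0 W qp show "val (Xc 0) < NV" "cst (val (Xc 0)) = 0" by auto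
    from g[OF _ k0 W r[of 9 0 0 0 0 0]] k0 W qp
    show "val (Xc B) < NV" "cst (val (Xc B)) = num_states M" by auto
    from g[OF _ k0 W r[of 10 0 0 0 0 0]] k0 W qp show "val (Xs B 0 0) = 2" by auto
    from g[OF _ k0 W r[of 11 0 0 0 0 0]] k0 W qp show "val (Xs B 0 1) = 0" by auto
  qed
qed

lemma semD:
  assumes "sem val"
  shows "t < B \<Longrightarrow> val (Xc t) < NV \<Longrightarrow> val (Xc (t + 1)) < NV \<and> cst (val (Xc (t + 1))) = nst (val (Xc t))"
    "t \<le> B \<Longrightarrow> j < k \<Longrightarrow> i < Wd \<Longrightarrow> val (Xh t j) = i \<Longrightarrow> val (Xs t j i) < S \<and> csc (val (Xc t)) j = val (Xs t j i)"
    "t < B \<Longrightarrow> j < k \<Longrightarrow> i < Wd \<Longrightarrow> val (Xc t) < NV \<Longrightarrow> val (Xh t j) = i \<Longrightarrow>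
       val (Xh (t + 1) j) = move_head (cdir (val (Xc t)) j) i \<and>
       val (Xs (t + 1) j i) < S \<and> val (Xs (t + 1) j i) = cwr (val (Xc t)) j"
    "t < B \<Longrightarrow> j < k \<Longrightarrow> i < Wd \<Longrightarrow> val (Xh t j) \<noteq> i \<Longrightarrow> val (Xs (t + 1) j i) = val (Xs t j i)"
    "j < k \<Longrightarrow> val (Xh 0 j) = 0"
    "j < k \<Longrightarrow> i < Wd \<Longrightarrow> if j = 0 \<and> i < length s0 then val (Xs 0 j i) = str_tape s0 i
        else if j = 0 \<and> i < length s0 + P then val (Xs 0 j i) < 3 else val (Xs 0 j i) = 0"
    "length s0 \<le> i \<Longrightarrow> i + 1 < Wd \<Longrightarrow> val (Xs 0 0 i) = 0 \<Longrightarrow> val (Xs 0 0 (i + 1)) = 0"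
    "val (Xc 0) < NV" "cst (val (Xc 0)) = 0" "val (Xc B) < NV" "cst (val (Xc B)) = num_states M"
    "val (Xs B 0 0) = 2" "val (Xs B 0 1) = 0"
proof -
  note r0 = assms[unfolded sem_def]
  note r1 = conjunct2[OF r0] note r2 = conjunct2[OF r1] note r3 = conjunct2[OF r2] note r4 = conjunct2[OF r3]
  note r5 = conjunct2[OF r4] note r6 = conjunct2[OF r5] note r7 = conjunct2[OF r6]
  show "t < B \<Longrightarrow> val (Xc t) < NV \<Longrightarrow> val (Xc (t + 1)) < NV \<and> cst (val (Xc (t + 1))) = nst (val (Xc t))"
    using conjunct1[OF r0] by blast
  show "t \<le> B \<Longrightarrow> j < k \<Longrightarrow> i < Wd \<Longrightarrow> val (Xh t j) = i \<Longrightarrow> val (Xs t j i) < S \<and> csc (val (Xc t)) j = val (Xs t j i)"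
    using conjunct1[OF r1] by blast
  show "t < B \<Longrightarrow> j < k \<Longrightarrow> i < Wd \<Longrightarrow> val (Xc t) < NV \<Longrightarrow> val (Xh t j) = i \<Longrightarrow>
       val (Xh (t + 1) j) = move_head (cdir (val (Xc t)) j) i \<and>
       val (Xs (t + 1) j i) < S \<and> val (Xs (t + 1) j i) = cwr (val (Xc t)) j"
    using conjunct1[OF r2] by blast
  show "t < B \<Longrightarrow> j < k \<Longrightarrow> i < Wd \<Longrightarrow> val (Xh t j) \<noteq> i \<Longrightarrow> val (Xs (t + 1) j i) = val (Xs t j i)"
    using conjunct1[OF r3] by blast
  show "j < k \<Longrightarrow> val (Xh 0 j) = 0" using conjunct1[OF r4] by blast
  show "j < k \<Longrightarrow> i < Wd \<Longrightarrow> if j = 0 \<and> i < length s0 then val (Xs 0 j i) = str_tape s0 i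
        else if j = 0 \<and> i < length s0 + P then val (Xs 0 j i) < 3 else val (Xs 0 j i) = 0"
    using conjunct1[OF r5] by blast
  show "length s0 \<le> i \<Longrightarrow> i + 1 < Wd \<Longrightarrow> val (Xs 0 0 i) = 0 \<Longrightarrow> val (Xs 0 0 (i + 1)) = 0"
    using conjunct1[OF r6] by blast
  show "val (Xc 0) < NV" "cst (val (Xc 0)) = 0" "val (Xc B) < NV" "cst (val (Xc B)) = num_states M"
    "val (Xs B 0 0) = 2" "val (Xs B 0 1) = 0" using r7 by blast+
qed

lemma sem_hits:
  assumes p: "proper val" and k0: "0 < k" and s: "sem val" and NV: "\<And>t. t \<le> B \<Longrightarrow> val (Xc t) < NV"
  shows "\<forall>c<J. \<exists>g\<in>graph val. E c g"
  unfolding all_E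
proof (intro conjI graph_props(3)[OF p] allI impI)
  fix f t j i a b :: nat
  assume b: "f < 12" "t < B + 1" "j < k" "i < Wd" "a < q" "b < q"
  then have t: "t \<le> B" by simp
  have n1: "t < B \<Longrightarrow> val (Xc (t + 1)) < NV" using NV[of "t + 1"] by simp
  note d = semD[OF s]
  consider "f = 0" | "f = 1" | "f = 2" | "f = 3" | "f = 4" | "f = 5" | "f = 6" | "f = 7" | "f = 8" | "f = 9"
    | "f = 10" | "10 < f" by atomize_elim presburger
  then show "\<exists>g\<in>graph val. rule f t j i a b g"
  proof cases
    case 1
    then show ?thesis unfolding rule_graph[OF p k0 t b(3,4)] using d(1)[of t] n1 NV[OF t] by simp
  next
    case 2
    then show ?thesis unfolding rule_graph[OF p k0 t b(3,4)] using d(2)[OF t b(3,4)] NV[OF t] b(3) by auto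
  next
    case 3
    then show ?thesis unfolding rule_graph[OF p k0 t b(3,4)] using d(3)[OF _ b(3,4) NV[OF t]] NV[OF t] by auto
  next
    case 4
    then show ?thesis unfolding rule_graph[OF p k0 t b(3,4)] using d(3)[OF _ b(3,4) NV[OF t]] NV[OF t] by auto
  next
    case 5
    then show ?thesis unfolding rule_graph[OF p k0 t b(3,4)] using d(4)[OF _ b(3,4)] by auto
  next
    case 6
    then show ?thesis unfolding rule_graph[OF p k0 t b(3,4)] using d(5)[OF b(3)] by simp
  next
    case 7
    then show ?thesis unfolding rule_graph[OF p k0 t b(3,4)] using d(6)[OF b(3,4)] by simp
  next
    case 8
    then show ?thesis unfolding rule_graph[OF p k0 t b(3,4)] using d(7)[of i] by simp
  qed (use d in \<open>simp_all add: rule_graph[OF p k0 t b(3,4)]\<close>)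
qed

section \<open>Soundness and completeness of the tableau\<close>

lemma step_act:
  assumes st: "step M (s, h, T) = (s', h', T')" and wf: "wf_tm M"
    and v: "ctrls M ! v = (s, map (\<lambda>j. T j (h j)) [0..<k])"
  shows "s' = nst v" "\<And>j. j < k \<Longrightarrow> h' j = move_head (cdir v j) (h j)"
    "\<And>j. j < k \<Longrightarrow> T' j = (T j)(h j := cwr v j)"
proof -
  have "s' = nst v \<and> (\<forall>j<k. h' j = move_head (cdir v j) (h j) \<and> T' j = (T j)(h j := cwr v j))"
  proof (cases "s \<ge> num_states M")
    case True
    then show ?thesis using st by (simp add: nst_def cdir_def cwr_def v act_def)
  next
    case False
    obtain p acts where tr: "trans M s (map (\<lambda>j. T j (h j)) [0..<k]) = (p, acts)" by fastforce
    show ?thesis using st False tr by (simp add: nst_def cdir_def cwr_def v act_def) auto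
  qed
  then show "s' = nst v" "\<And>j. j < k \<Longrightarrow> h' j = move_head (cdir v j) (h j)"
    "\<And>j. j < k \<Longrightarrow> T' j = (T j)(h j := cwr v j)" by auto
qed

text \<open>Blanks are skipped wherever they occur instead of ending the word; this matches the loop
  in \<open>wit_code\<close>.\<close>

definition word :: "(nat \<Rightarrow> nat) \<Rightarrow> bool list" where
  "word f = concat (map (\<lambda>i. if f i = 2 then [True] else if f i = 1 then [False] else []) [0..<P])"

text \<open>By \<open>cl\<close> a blank is followed by blanks only, so skipping blanks merely cuts
  off a suffix.\<close>

lemma word_props:
  assumes f: "\<And>i. i < P \<Longrightarrow> f i < 3" and cl: "\<And>i. i + 1 < P \<Longrightarrow> f i = 0 \<Longrightarrow> f (i + 1) = 0"
  shows "length (word f) \<le> P" "\<And>i. i < P \<Longrightarrow> str_tape (word f) i = f i"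
proof -
  let ?w = "\<lambda>n. concat (map (\<lambda>i. if f i = 2 then [True] else if f i = 1 then [False] else []) [0..<n])"
  have "\<exists>l\<le>n. ?w n = map (\<lambda>i. f i = 2) [0..<l] \<and> (\<forall>i<l. f i \<noteq> 0) \<and> (\<forall>i. l \<le> i \<longrightarrow> i < n \<longrightarrow> f i = 0)"
    if "n \<le> P" for n
    using that
  proof (induction n)
    case (Suc n)
    then obtain l where l: "l \<le> n" "?w n = map (\<lambda>i. f i = 2) [0..<l]" "\<forall>i<l. f i \<noteq> 0"
      "\<forall>i. l \<le> i \<longrightarrow> i < n \<longrightarrow> f i = 0" by auto
    show ?case
    proof (cases "f n = 0")
      case True
      have "f i = 0" if "l \<le> i" "i < Suc n" for i using that l(4) True by (cases "i = n") auto
      then show ?thesis using l True by (intro exI[of _ l]) auto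
    next
      case False
      have "l = n"
      proof (rule ccontr)
        assume "l \<noteq> n"
        then have "f (n - 1) = 0" "n - 1 + 1 = n" using l(1,4) by auto
        then show False using cl[of "n - 1"] False Suc.prems by simp
      qed
      moreover have "f n = 1 \<or> f n = 2" using f[of n] False Suc.prems by auto
      ultimately have "?w (Suc n) = map (\<lambda>i. f i = 2) [0..<Suc n]" using l(2) by auto
      moreover have "\<forall>i<Suc n. f i \<noteq> 0" using l(3) \<open>l = n\<close> False by (auto simp: less_Suc_eq)
      ultimately show ?thesis by (intro exI[of _ "Suc n"]) auto
    qed
  qed simp
  from this[of P] obtain l where l: "l \<le> P" "word f = map (\<lambda>i. f i = 2) [0..<l]" "\<forall>i<l. f i \<noteq> 0"
      "\<forall>i. l \<le> i \<longrightarrow> i < P \<longrightarrow> f i = 0" by (auto simp: word_def)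
  show "length (word f) \<le> P" using l by simp
  fix i assume i: "i < P"
  show "str_tape (word f) i = f i"
  proof (cases "i < l")
    case True
    have "f i = 1 \<or> f i = 2" using f[OF i] l(3) True by fastforce
    then show ?thesis using True l(2) by (auto simp: str_tape_def sym_of_bit_def)
  next
    case False
    then show ?thesis using l i by (simp add: str_tape_def)
  qed
qed

lemma ctrls_length:
  assumes "v < NV" shows "length (snd (ctrls M ! v)) = k"
proof -
  have "ctrls M ! v \<in> set (ctrls M)" using assms by (simp add: NV_def)
  then show ?thesis by (auto simp: set_ctrls)
qed

text \<open>By induction on the time, each row describes the configuration of the run on
  \<open>s0\<close> and the decoded word. The finite width is no restriction, because heads stay
  within the first \<open>B + 1\<close> cells.\<close>

theorem sem_sound:
  assumes wf: "wf_tm M" and s: "sem val"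
  defines "w \<equiv> word (\<lambda>i. val (Xs 0 0 (length s0 + i)))"
  shows "length w \<le> P" "halted_with M ((step M ^^ B) (init_config (s0 @ w))) [True]"
proof -
  note d = semD[OF s]
  have k0: "0 < k" using wf by (simp add: wf_tm_def)
  let ?f = "\<lambda>i. val (Xs 0 0 (length s0 + i))"
  have cells: "if j = 0 \<and> i < length s0 then val (Xs 0 j i) = str_tape s0 i
        else if j = 0 \<and> i < length s0 + P then val (Xs 0 j i) < 3 else val (Xs 0 j i) = 0"
    if "j < k" "i < Wd" for j i by (rule d(6)[OF that])
  have f: "?f i < 3" if "i < P" for i using cells[of 0 "length s0 + i"] that k0 by (simp add: Wd_def)
  have cl: "?f (i + 1) = 0" if "i + 1 < P" "?f i = 0" for i
  proof -
    have "length s0 + i + 1 < Wd" using that by (simp add: Wd_def)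
    then have "val (Xs 0 0 (length s0 + i + 1)) = 0" using d(7)[of "length s0 + i"] that by simp
    then show ?thesis by (simp add: add.assoc)
  qed
  show lw: "length w \<le> P" unfolding w_def by (rule word_props(1)[where f = ?f, OF f cl])
  have tw: "str_tape w i = ?f i" if "i < P" for i unfolding w_def by (rule word_props(2)[where f = ?f, OF f cl that])
  have init: "val (Xs 0 0 i) = str_tape (s0 @ w) i" if i: "i < Wd" for i
  proof -
    consider "i < length s0" | "length s0 \<le> i" "i < length s0 + P" | "length s0 + P \<le> i" by linarith
    then show ?thesis
    proof cases
      case 1
      then show ?thesis using cells[OF k0 i] by (simp add: str_tape_def nth_append)
    next
      case 2
      then have "str_tape (s0 @ w) i = str_tape w (i - length s0)"
        by (auto simp: str_tape_def nth_append)
      also have "\<dots> = val (Xs 0 0 i)" using tw[of "i - length s0"] 2 by simp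
      finally show ?thesis by simp
    next
      case 3
      then show ?thesis using cells[OF k0 i] lw by (simp add: str_tape_def)
    qed
  qed
  let ?cf = "\<lambda>t. (step M ^^ t) (init_config (s0 @ w))"
  have "row val t (?cf t)" if "t \<le> B" for t
    using that
  proof (induction t)
    case 0
    let ?c = "ctrls M ! val (Xc 0)"
    have T: "val (Xs 0 j i) = (if j = 0 then str_tape (s0 @ w) else (\<lambda>i. 0)) i" if "j < k" "i < Wd" for j i
      using init[OF that(2)] cells[OF that] by auto
    have h: "val (Xh 0 j) = 0" if "j < k" for j by (rule d(5)[OF that])
    have n: "val (Xc 0) < NV" "fst ?c = 0" using d(8,9) by (simp_all add: cst_def)
    have W: "0 < Wd" by (simp add: Wd_def)
    have "csc (val (Xc 0)) j = val (Xs 0 j 0)" if "j < k" for j using d(2)[OF _ that W h[OF that]] by simp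
    then have "snd ?c = map (\<lambda>j. (if j = 0 then str_tape (s0 @ w) else (\<lambda>i. 0)) 0) [0..<k]"
      using ctrls_length[OF n(1)] T[OF _ W] by (intro nth_equalityI) (auto simp: csc_def)
    then have "?c = (0, map (\<lambda>j. (if j = 0 then str_tape (s0 @ w) else (\<lambda>i. 0)) 0) [0..<k])"
      using n(2) by (simp add: prod_eq_iff)
    then show ?case unfolding row_def using n(1) h T by (simp add: init_config_str)
  next
    case (Suc t)
    obtain st h T where cf: "?cf t = (st, h, T)" by (metis surj_pair)
    obtain st' h' T' where cf': "?cf (Suc t) = (st', h', T')" by (metis surj_pair)
    have stp: "step M (st, h, T) = (st', h', T')" using cf cf' by simp
    have t: "t \<le> B" "t < B" using Suc.prems by auto
    let ?v = "val (Xc t)" and ?v' = "val (Xc (t + 1))"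
    have r: "?v < NV" "ctrls M ! ?v = (st, map (\<lambda>j. T j (h j)) [0..<k])"
      "\<And>j. j < k \<Longrightarrow> val (Xh t j) = h j" "\<And>j i. j < k \<Longrightarrow> i < Wd \<Longrightarrow> val (Xs t j i) = T j i"
      using Suc.IH[OF t(1)] unfolding cf row_def by auto
    note a = step_act[OF stp wf r(2)]
    have hW: "h j < Wd" "h' j < Wd" for j
      using steps_reach(1)[OF cf] steps_reach(1)[OF cf'] t Suc.prems by (auto simp: Wd_def intro: le_less_trans)
    have v': "?v' < NV" "cst ?v' = nst ?v" using d(1)[OF t(2) r(1)] by simp_all
    have h: "val (Xh (t + 1) j) = h' j" if "j < k" for j
      using d(3)[OF t(2) that hW(1) r(1) r(3)[OF that]] a(2)[OF that] by simp
    have T: "val (Xs (t + 1) j i) = T' j i" if "j < k" "i < Wd" for j i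
    proof (cases "i = h j")
      case True
      have "val (Xs (t + 1) j i) = cwr ?v j" using d(3)[OF t(2) that(1) hW(1) r(1) r(3)[OF that(1)]] True by simp
      then show ?thesis using a(3)[OF that(1)] True by simp
    next
      case False
      then have "val (Xs (t + 1) j i) = val (Xs t j i)" using d(4)[OF t(2) that] r(3)[OF that(1)] by simp
      then show ?thesis using a(3)[OF that(1)] False r(4)[OF that] by simp
    qed
    have "csc ?v' j = T' j (h' j)" if "j < k" for j
    proof -
      have "t + 1 \<le> B" using t(2) by simp
      then have "csc ?v' j = val (Xs (t + 1) j (h' j))" using d(2)[OF _ that hW(2) h[OF that]] by simp
      then show ?thesis using T[OF that hW(2)] by simp
    qed
    then have "snd (ctrls M ! ?v') = map (\<lambda>j. T' j (h' j)) [0..<k]"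
      using ctrls_length[OF v'(1)] by (intro nth_equalityI) (auto simp: csc_def)
    then have "ctrls M ! ?v' = (st', map (\<lambda>j. T' j (h' j)) [0..<k])"
      using v'(2) a(1) by (simp add: prod_eq_iff cst_def)
    then show ?case unfolding cf' row_def using v'(1) h T by simp
  qed
  from this[of B] have r: "row val B (?cf B)" by simp
  obtain st h T where cf: "?cf B = (st, h, T)" by (metis surj_pair)
  have W: "0 < Wd" "1 < Wd" by (auto simp: Wd_def)
  have "st = num_states M" "T 0 0 = 2" "T 0 1 = 0"
    using r[unfolded row_def cf] d(11,12,13) k0 W by (auto simp: cst_def)
  then show "halted_with M (?cf B) [True]" unfolding cf by (simp add: halted_with_def sym_of_bit_def)
qed

text \<open>The list \<open>ctrls\<close> may contain repetitions, hence a choice of the index; the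
  other cells are recognized by their offset in the row.\<close>

definition run_val :: "bool list \<Rightarrow> nat \<Rightarrow> nat" where
  "run_val w x = (case (step M ^^ (x div Rw)) (init_config (s0 @ w)) of (s, h, T) \<Rightarrow>
     let o' = x mod Rw in
     if o' = 0 then (SOME v. v < NV \<and> ctrls M ! v = (s, map (\<lambda>j. T j (h j)) [0..<k]))
     else if o' \<le> k then h (o' - 1) else T ((o' - 1 - k) div Wd) ((o' - 1 - k) mod Wd))"

text \<open>Acceptance at time exactly \<open>B\<close> is a fair demand, since an earlier halting
  configuration persists.\<close>

theorem sem_complete:
  assumes wf: "wf_tm M" and w: "length w \<le> P"
    and acc: "halted_with M ((step M ^^ B) (init_config (s0 @ w))) [True]"
  shows "proper (run_val w)" "sem (run_val w)" "\<And>t. t \<le> B \<Longrightarrow> run_val w (Xc t) < NV"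
proof -
  let ?val = "run_val w"
  let ?cf = "\<lambda>t. (step M ^^ t) (init_config (s0 @ w))"
  have k0: "0 < k" and S3: "3 \<le> S" using wf by (auto simp: wf_tm_def)
  have W: "0 < Wd" "1 < Wd" "B < Wd" by (auto simp: Wd_def)
  have inv: "s \<le> num_states M \<and> (\<forall>j<k. \<forall>i. T j i < S)" if "?cf t = (s, h, T)" for t s h T
    using that
  proof (induction t arbitrary: s h T)
    case 0
    have "str_tape x i < S" for x i using str_tape_le[of x i] S3 by linarith
    then show ?case using 0 S3 by (auto simp: init_config_str)
  next
    case (Suc t)
    obtain s1 h1 T1 where 1: "?cf t = (s1, h1, T1)" by (metis surj_pair)
    have st: "step M (s1, h1, T1) = (s, h, T)" using Suc.prems 1 by simp
    have IH: "s1 \<le> num_states M" "\<forall>j<k. \<forall>i. T1 j i < S" using Suc.IH[OF 1] by auto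
    have "s \<le> num_states M"
    proof (cases "s1 < num_states M")
      case True
      have "length (map (\<lambda>j. T1 j (h1 j)) [0..<k]) = k" "set (map (\<lambda>j. T1 j (h1 j)) [0..<k]) \<subseteq> {..<S}"
        using IH(2) by auto
      then have "fst (trans M s1 (map (\<lambda>j. T1 j (h1 j)) [0..<k])) \<le> num_states M"
        using wf True unfolding wf_tm_def by blast
      then show ?thesis using st True by (auto split: prod.splits)
    qed (use st IH in auto)
    then show ?case using step_syms[OF wf IH(2) st] by simp
  qed
  have Rw0: "0 < Rw" by (simp add: Rw_def)
  have Xdm: "Xc t div Rw = t" "Xc t mod Rw = 0" for t using Rw0 by (simp_all add: Xc_def)
  have hdm: "Xh t j div Rw = t" "Xh t j mod Rw = 1 + j" if "j < k" for t j
  proof -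
    have "1 + j < Rw" using that by (simp add: Rw_def)
    then show "Xh t j div Rw = t" "Xh t j mod Rw = 1 + j"
      using mult_add_div_mod[of "1 + j" Rw t] unfolding Xh_def by (simp_all add: add.assoc)
  qed
  have sdm: "Xs t j i div Rw = t" "Xs t j i mod Rw = 1 + k + (j * Wd + i)" if "j < k" "i < Wd" for t j i
  proof -
    have "j * Wd + i < Suc j * Wd" using that by simp
    also have "\<dots> \<le> k * Wd" using that by (intro mult_le_mono1) simp
    finally have "1 + k + (j * Wd + i) < Rw" by (simp add: Rw_def)
    then show "Xs t j i div Rw = t" "Xs t j i mod Rw = 1 + k + (j * Wd + i)"
      using mult_add_div_mod[of "1 + k + (j * Wd + i)" Rw t] unfolding Xs_def by (simp_all only: add.assoc)
  qed
  have rows: "row ?val t (?cf t)" for t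
  proof -
    obtain s h T where cf: "?cf t = (s, h, T)" by (metis surj_pair)
    note i = inv[OF cf]
    have "(s, map (\<lambda>j. T j (h j)) [0..<k]) \<in> set (ctrls M)" using i by (auto simp: set_ctrls)
    then have "\<exists>v. v < NV \<and> ctrls M ! v = (s, map (\<lambda>j. T j (h j)) [0..<k])"
      by (simp add: in_set_conv_nth NV_def)
    then have "?val (Xc t) < NV \<and> ctrls M ! ?val (Xc t) = (s, map (\<lambda>j. T j (h j)) [0..<k])"
      unfolding run_val_def Xdm cf by (simp, rule someI_ex)
    moreover have "?val (Xh t j) = h j" if "j < k" for j
      unfolding run_val_def hdm[OF that] cf using that by simp
    moreover have "?val (Xs t j i) = T j i" if "j < k" "i < Wd" for j i
    proof -
      have "(1 + k + (j * Wd + i) - 1 - k) div Wd = j" "(1 + k + (j * Wd + i) - 1 - k) mod Wd = i"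
        using mult_add_div_mod[OF that(2), of j] by simp_all
      then show ?thesis unfolding run_val_def sdm[OF that] cf by (simp del: diff_diff_left)
    qed
    ultimately show ?thesis unfolding cf row_def by simp
  qed
  show NV: "?val (Xc t) < NV" for t using rows[of t] by (auto simp: row_def split: prod.splits)
  have rowD: "ctrls M ! ?val (Xc t) = (s, map (\<lambda>j. T j (h j)) [0..<k])"
      "\<And>j. j < k \<Longrightarrow> ?val (Xh t j) = h j" "\<And>j i. j < k \<Longrightarrow> i < Wd \<Longrightarrow> ?val (Xs t j i) = T j i"
    if "?cf t = (s, h, T)" for t s h T
    using rows[of t] unfolding that row_def by auto
  have sc: "csc (?val (Xc t)) j = T j (h j)" if "?cf t = (s, h, T)" "j < k" for t s h T j
    using rowD(1)[OF that(1)] that(2) by (simp add: csc_def)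
  show "proper ?val"
    unfolding proper_def
  proof (intro allI impI)
    fix x assume x: "x < Mv"
    define t where "t = x div Rw"
    define o' where "o' = x mod Rw"
    have "t < B + 1" using x Rw0 by (simp add: t_def Mv_def div_less_iff_less_mult)
    then have t: "t \<le> B" by simp
    have ol: "o' < Rw" using Rw0 by (simp add: o'_def)
    have xt: "x = t * Rw + o'" by (simp add: t_def o'_def)
    obtain s h T where cf: "?cf t = (s, h, T)" by (metis surj_pair)
    consider "o' = 0" | "1 \<le> o'" "o' \<le> k" | "k < o'" by linarith
    then show "?val x < q"
    proof cases
      case 1
      then have "x = Xc t" using xt by (simp add: Xc_def)
      then show ?thesis using NV[of t] by (simp add: q_def)
    next
      case 2
      then have "x = Xh t (o' - 1)" using xt by (simp add: Xh_def)
      moreover have "?val (Xh t (o' - 1)) = h (o' - 1)" using 2 by (intro rowD(2)[OF cf]) simp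
      moreover have "h (o' - 1) < Wd" using steps_reach(1)[OF cf] t W(3) by (meson le_less_trans)
      ultimately show ?thesis by (simp add: q_def)
    next
      case 3
      define j where "j = (o' - 1 - k) div Wd"
      define i where "i = (o' - 1 - k) mod Wd"
      have "o' - 1 - k < k * Wd" using ol 3 by (auto simp: Rw_def)
      then have ji: "j < k" "i < Wd" using W by (simp_all add: j_def i_def div_less_iff_less_mult)
      have "j * Wd + i = o' - 1 - k" by (simp add: j_def i_def)
      then have "x = Xs t j i" using xt 3 by (simp add: Xs_def)
      moreover have "T j i < S" using inv[OF cf] ji by simp
      ultimately show ?thesis using rowD(3)[OF cf ji] by (simp add: q_def)
    qed
  qed
  have init: "?cf 0 = (0, \<lambda>j. 0, \<lambda>j. if j = 0 then str_tape (s0 @ w) else (\<lambda>i. 0))"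
    by (simp add: init_config_str)
  have stp: "\<exists>s h T s' h' T'. ?cf t = (s, h, T) \<and> ?cf (t + 1) = (s', h', T') \<and> s' = nst (?val (Xc t)) \<and>
      (\<forall>j<k. h' j = move_head (cdir (?val (Xc t)) j) (h j) \<and> T' j = (T j)(h j := cwr (?val (Xc t)) j))" for t
  proof -
    obtain s h T where cf: "?cf t = (s, h, T)" by (metis surj_pair)
    obtain s' h' T' where cf': "?cf (t + 1) = (s', h', T')" by (metis surj_pair)
    have "step M (s, h, T) = (s', h', T')" using cf cf' by simp
    from step_act[OF this wf rowD(1)[OF cf]] show ?thesis using cf cf' by blast
  qed
  obtain sB hB TB where cfB: "?cf B = (sB, hB, TB)" by (metis surj_pair)
  have fin: "sB = num_states M" "TB 0 0 = 2" "TB 0 1 = 0"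
    using acc by (auto simp: cfB halted_with_def sym_of_bit_def)
  show "sem ?val"
    unfolding sem_def
  proof (intro conjI allI impI)
    fix t a assume "?val (Xc t) = a"
    moreover obtain s h T s' h' T' where c: "?cf (t + 1) = (s', h', T')" "s' = nst (?val (Xc t))"
      using stp[of t] by blast
    ultimately show "cst (?val (Xc (t + 1))) = nst a" using rowD(1)[OF c(1)] by (simp add: cst_def)
  next
    fix t j i assume *: "j < k" "i < Wd" "?val (Xh t j) = i"
    obtain s h T where cf: "?cf t = (s, h, T)" by (metis surj_pair)
    show "?val (Xs t j i) < S" using rowD(3)[OF cf *(1,2)] inv[OF cf] * by simp
    show "csc (?val (Xc t)) j = ?val (Xs t j i)"
      using sc[OF cf *(1)] rowD(2)[OF cf *(1)] rowD(3)[OF cf *(1,2)] * by simp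
  next
    fix t j i assume *: "j < k" "i < Wd" "?val (Xh t j) = i"
    obtain s h T s' h' T' where c: "?cf t = (s, h, T)" "?cf (t + 1) = (s', h', T')"
      "\<forall>j<k. h' j = move_head (cdir (?val (Xc t)) j) (h j) \<and> T' j = (T j)(h j := cwr (?val (Xc t)) j)"
      using stp[of t] by blast
    have hj: "h j = i" using rowD(2)[OF c(1) *(1)] * by simp
    show "?val (Xh (t + 1) j) = move_head (cdir (?val (Xc t)) j) i"
      using rowD(2)[OF c(2) *(1)] c(3) * hj by simp
    show "?val (Xs (t + 1) j i) < S" using rowD(3)[OF c(2) *(1,2)] inv[OF c(2)] * by simp
    show "?val (Xs (t + 1) j i) = cwr (?val (Xc t)) j" using rowD(3)[OF c(2) *(1,2)] c(3) * hj by simp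
  next
    fix t j i assume *: "j < k" "i < Wd" "?val (Xh t j) \<noteq> i"
    obtain s h T s' h' T' where c: "?cf t = (s, h, T)" "?cf (t + 1) = (s', h', T')"
      "\<forall>j<k. h' j = move_head (cdir (?val (Xc t)) j) (h j) \<and> T' j = (T j)(h j := cwr (?val (Xc t)) j)"
      using stp[of t] by blast
    show "?val (Xs (t + 1) j i) = ?val (Xs t j i)"
      using rowD(3)[OF c(2) *(1,2)] rowD(3)[OF c(1) *(1,2)] rowD(2)[OF c(1) *(1)] c(3) * by auto
  next
    fix j assume "j < k"
    then show "?val (Xh 0 j) = 0" using rowD(2)[OF init] by simp
  next
    fix j i assume ji: "j < k" "i < Wd"
    show "if j = 0 \<and> i < length s0 then ?val (Xs 0 j i) = str_tape s0 i
        else if j = 0 \<and> i < length s0 + P then ?val (Xs 0 j i) < 3 else ?val (Xs 0 j i) = 0"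
      using rowD(3)[OF init ji] w str_tape_le[of "s0 @ w" i]
      by (auto simp: str_tape_def nth_append)
  next
    fix i assume i: "i + 1 < Wd" "?val (Xs 0 0 i) = 0"
    then show "?val (Xs 0 0 (i + 1)) = 0" using rowD(3)[OF init k0, of i] rowD(3)[OF init k0 i(1)] by simp
  next
    show "cst (?val (Xc 0)) = 0" using rowD(1)[OF init] by (simp add: cst_def)
    show "cst (?val (Xc B)) = num_states M" using rowD(1)[OF cfB] fin by (simp add: cst_def)
    show "?val (Xs B 0 0) = 2" "?val (Xs B 0 1) = 0"
      using rowD(3)[OF cfB k0] W fin by simp_all
  qed (rule NV)+
qed

end

section \<open>Computability of the reduction\<close>

lemma pfb_table3:
  assumes "pf \<Gamma> a" "pf \<Gamma> b" "pf \<Gamma> d"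
  shows "pfb \<Gamma> (\<lambda>c. a c < k \<and> b c < l \<and> d c < m \<and> P (a c) (b c) (d c))"
proof (induction k)
  case 0
  show ?case by (rule pfb_cong[OF pfb_const[of _ False]]) simp
next
  case (Suc k)
  have "pfb \<Gamma> (\<lambda>c. a c = k \<and> b c < l \<and> d c < m \<and> P k (b c) (d c) \<or>
      a c < k \<and> b c < l \<and> d c < m \<and> P (a c) (b c) (d c))"
    by (intro pfb_disj Suc pfb_conj pfb_eq pfb_table2[where P = "P k"] assms pf_const)
  then show ?case by (rule pfb_cong) (auto simp: less_Suc_eq)
qed

lemma pf_min: "pf \<Gamma> a \<Longrightarrow> pf \<Gamma> b \<Longrightarrow> pf \<Gamma> (\<lambda>c. min (a c) (b c))"
  unfolding min_def by (intro pf_ifb pfb_le)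

lemmas pf_arith = pf_add pf_mult pf_sub pf_div pf_mod pf_Suc pf_const pf_ifb pf_power_const pf_min
lemmas pf_logic = pfb_conj pfb_disj pfb_not pfb_imp pfb_ifb pfb_le pfb_less pfb_eq pfb_const

section \<open>Computability of the tableau\<close>

context
  fixes \<Gamma> :: "'c ctx" and M :: tm and B P :: "'c \<Rightarrow> nat" and s :: "'c \<Rightarrow> bool list"
  assumes B: "pf \<Gamma> B" and P: "pf \<Gamma> P" and len: "pf \<Gamma> (\<lambda>c. length (s c))"
    and str: "\<And>i. pf \<Gamma> i \<Longrightarrow> pf \<Gamma> (\<lambda>c. str_tape (s c) (i c))"
begin

lemma pf_Wd: "pf \<Gamma> (\<lambda>c. tableau.Wd (B c) (P c) (s c))"
  unfolding tableau.Wd_def by (intro pf_arith B P len)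

lemma pf_q: "pf \<Gamma> (\<lambda>c. tableau.q M (B c) (P c) (s c))"
  unfolding tableau.q_def by (intro pf_arith pf_Wd)

lemma pf_Rw: "pf \<Gamma> (\<lambda>c. tableau.Rw M (B c) (P c) (s c))"
  unfolding tableau.Rw_def by (intro pf_arith pf_Wd)

lemma pf_Mv: "pf \<Gamma> (\<lambda>c. tableau.Mv M (B c) (P c) (s c))"
  unfolding tableau.Mv_def by (intro pf_arith pf_Rw B)

lemma pf_J: "pf \<Gamma> (\<lambda>c. tableau.J M (B c) (P c) (s c))"
  unfolding tableau.J_def by (intro pf_arith pf_Mv pf_Wd pf_q B)

lemma pf_Xc: "pf \<Gamma> t \<Longrightarrow> pf \<Gamma> (\<lambda>c. tableau.Xc M (B c) (P c) (s c) (t c))"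
  unfolding tableau.Xc_def by (intro pf_arith pf_Rw)

lemma pf_Xh: "pf \<Gamma> t \<Longrightarrow> pf \<Gamma> j \<Longrightarrow> pf \<Gamma> (\<lambda>c. tableau.Xh M (B c) (P c) (s c) (t c) (j c))"
  unfolding tableau.Xh_def by (intro pf_arith pf_Rw)

lemma pf_Xs: "pf \<Gamma> t \<Longrightarrow> pf \<Gamma> j \<Longrightarrow> pf \<Gamma> i \<Longrightarrow>
    pf \<Gamma> (\<lambda>c. tableau.Xs M (B c) (P c) (s c) (t c) (j c) (i c))"
  unfolding tableau.Xs_def by (intro pf_arith pf_Rw pf_Wd)

lemma pfb_una:
  assumes "pf \<Gamma> g" "pf \<Gamma> X"
    "pfb \<Gamma> (\<lambda>c. R c (g c mod tableau.q M (B c) (P c) (s c)))"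
  shows "pfb \<Gamma> (\<lambda>c. tableau.una M (B c) (P c) (s c) (X c) (R c) (g c))"
  unfolding tableau.una_def by (intro pf_logic pf_arith pf_q assms)

lemma pfb_imp_clause:
  assumes "pf \<Gamma> g" "pf \<Gamma> X1" "pf \<Gamma> X2" "pf \<Gamma> X3" "pf \<Gamma> a" "pf \<Gamma> b"
    "pfb \<Gamma> (\<lambda>c. R c (g c mod tableau.q M (B c) (P c) (s c)))"
  shows "pfb \<Gamma> (\<lambda>c. tableau.imp M (B c) (P c) (s c) (X1 c) (a c) (X2 c) (b c) (X3 c) (R c) (g c))"
  unfolding tableau.imp_def by (intro pf_logic pf_arith pf_q assms)

text \<open>The machine is fixed, so each lookup in its table is a finite case distinction; all the
  rest is arithmetic on cell numbers.\<close>

lemma pfb_rule: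
  assumes f: "pf \<Gamma> f" and t: "pf \<Gamma> t" and j: "pf \<Gamma> j" and i: "pf \<Gamma> i" and a: "pf \<Gamma> a" and b: "pf \<Gamma> b" and g: "pf \<Gamma> g"
  shows "pfb \<Gamma> (\<lambda>c. tableau.rule M (B c) (P c) (s c) (f c) (t c) (j c) (i c) (a c) (b c) (g c))"
proof -
  let ?v = "\<lambda>c. g c mod tableau.q M (B c) (P c) (s c)"
  have v: "pf \<Gamma> ?v" by (rule pf_mod[OF g pf_q])
  have dir: "pfb \<Gamma> (\<lambda>c. a c < tableau.NV M \<and> j c < num_tapes M \<and> tableau.cdir M (a c) (j c) = m \<and> ?v c = r c)"
    if "pf \<Gamma> r" for m r
    by (rule pfb_cong[OF pfb_conj[OF pfb_table2[OF a j, where P = "\<lambda>a j. tableau.cdir M a j = m"] pfb_eq[OF v that]]]) simp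
  note X = pf_Xc pf_Xh pf_Xs
  note R = pfb_table2[OF a v, where P = "\<lambda>a v. tableau.cst M v = tableau.nst M a"]
    pfb_table3[OF v j a, where P = "\<lambda>v j a. tableau.csc M v j = a"] dir[OF pf_sub[OF i pf_const]] dir[OF i]
    dir[OF pf_add[OF i pf_const]] pfb_table3[OF a j v, where P = "\<lambda>a j v. tableau.cwr M a j = v"]
    pfb_table2[OF v pf_const[of \<Gamma> 0], where P = "\<lambda>v _. tableau.cst M v = 0"]
    pfb_table2[OF v pf_const[of \<Gamma> 0], where P = "\<lambda>v _. tableau.cst M v = num_states M"]
  show ?thesis
    unfolding tableau.rule_def
    by (intro R pfb_ifb pfb_imp_clause pfb_una X pfb_imp pfb_conj pfb_disj pfb_not pfb_eq pfb_less pfb_le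
        v f t B b i g a j len P str pf_Wd pf_add pf_const)
qed

lemma pfb_E:
  assumes d: "pf \<Gamma> d" and g: "pf \<Gamma> g"
  shows "pfb \<Gamma> (\<lambda>c. tableau.E M (B c) (P c) (s c) (d c) (g c))"
  unfolding tableau.E_def
  by (intro pfb_ifb pfb_rule pf_logic pf_arith pf_Mv pf_q pf_Wd B d g)

end

section \<open>Computability of distances and counts\<close>

context
  fixes \<Gamma> :: "'c ctx" and G K J U :: "'c \<Rightarrow> nat" and e w :: "'c \<Rightarrow> nat \<Rightarrow> nat \<Rightarrow> bool"
  assumes G: "pf \<Gamma> G" and K: "pf \<Gamma> K" and J: "pf \<Gamma> J" and U: "pf \<Gamma> U"
    and e: "\<And>a b. pf \<Gamma> a \<Longrightarrow> pf \<Gamma> b \<Longrightarrow> pfb \<Gamma> (\<lambda>c. e c (a c) (b c))"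
    and e': "\<And>a b. pf (ext \<Gamma>) a \<Longrightarrow> pf (ext \<Gamma>) b \<Longrightarrow> pfb (ext \<Gamma>) (\<lambda>p. e (fst p) (a p) (b p))"
    and w: "\<And>a b. pf \<Gamma> a \<Longrightarrow> pf \<Gamma> b \<Longrightarrow> pfb \<Gamma> (\<lambda>c. w c (a c) (b c))"
begin

lemma pf_hN: "pf \<Gamma> (\<lambda>c. hitting.N (J c) (U c))"
  unfolding hitting.N_def by (intro pf_arith J U)

lemma pf_hT: "pf \<Gamma> (\<lambda>c. hitting.T (G c) (K c) (U c))"
  unfolding hitting.T_def by (intro pf_arith G K U)

lemma pf_hL: "pf \<Gamma> (\<lambda>c. hitting.L (G c) (K c) (U c))"
  unfolding hitting.L_def by (intro pf_arith pf_hT)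

lemma pf_item_exp:
  assumes "pf \<Gamma> i"
  shows "pf \<Gamma> (\<lambda>c. hitting.item_exp (G c) (K c) (J c) (U c) (e c) (w c) (i c))"
  unfolding hitting.item_exp_def Let_def
  by (intro pf_arith pfb_less e w pf_hN pf_hL pf_hT J assms)

lemma pf_dist_exp:
  assumes "pf \<Gamma> a" "pf \<Gamma> b"
  shows "pf \<Gamma> (\<lambda>c. hitting.dist_exp (G c) (K c) (J c) (U c) (e c) (w c) (a c) (b c))"
  unfolding hitting.dist_exp_def
  by (intro pf_ifb pfb_not pfb_eq pf_item_exp pf_div pf_mult pf_add pf_const pf_hN pf_hL J assms)

text \<open>The cardinality becomes a sum over the groups. As the summand has one more variable, the
  relation must also be decidable in the extended context, which is the assumption
  \<open>e'\<close>.\<close>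

lemma pf_bound_cnt:
  assumes "pf \<Gamma> x"
  shows "pf \<Gamma> (\<lambda>c. hitting.bound (G c) (K c) (e c) (x c))"
proof -
  have "pf \<Gamma> (\<lambda>c. min ((\<Sum>g<G c. if e c (x c) g then 1 else 0) - 1) (G c - K c))"
    by (intro pf_min pf_sub G K pf_const pf_sum pf_ifb e' pf_weak[OF assms] pf_snd)
  moreover have "(\<Sum>g<n. if Q g then 1 else 0) = card {g. g < n \<and> Q g}" for n :: nat and Q
    by (simp add: sum.If_cases Int_def lessThan_def)
  ultimately show ?thesis unfolding hitting.bound_def by simp
qed

lemma pf_cnt:
  assumes "pf \<Gamma> x"
  shows "pf \<Gamma> (\<lambda>c. hitting.cnt (G c) (K c) (J c) (e c) (x c))"
proof -
  have odd: "pfb \<Gamma> (\<lambda>c. odd (x c))"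
    unfolding odd_iff_mod_2_eq_one by (intro pfb_eq pf_mod assms pf_const)
  show ?thesis
    unfolding hitting.cnt_def
    by (intro pf_ifb pfb_eq pfb_le odd pf_bound_cnt pf_sub pf_div pf_mult pf_const G K J assms)
qed

end

section \<open>Writing the instance in binary\<close>

lemma length_binary: "v \<le> N \<Longrightarrow> length (binary v) = (\<Sum>i<N. if v div 2 ^ i \<noteq> 0 then 1 else 0)"
  and binary_eq_map: "binary v = map (\<lambda>i. odd (v div 2 ^ i)) [0..<length (binary v)]"
proof -
  \<comment> \<open>The length is the number of shifts \<open>v div 2 ^ i\<close> that do not
    vanish; any \<open>N \<ge> v\<close> is large enough as a range for \<open>i\<close>.\<close>
  have "length (binary v) = (\<Sum>i<N. if v div 2 ^ i \<noteq> 0 then 1 else 0) \<and>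
      binary v = map (\<lambda>i. odd (v div 2 ^ i)) [0..<length (binary v)]" if "v \<le> N" for N
    using that
  proof (induction v arbitrary: N rule: less_induct)
    case (less v)
    show ?case
    proof (cases "v = 0")
      case True
      then show ?thesis by (simp add: binary.simps[of 0])
    next
      case False
      obtain N' where N: "N = Suc N'" using less.prems False by (cases N) auto
      have b: "binary v = odd v # binary (v div 2)" using False by (simp add: binary.simps[of v])
      have lt: "v div 2 < v" "v div 2 \<le> N'" using less.prems False N by auto
      have IH: "length (binary (v div 2)) = (\<Sum>i<N'. if v div 2 div 2 ^ i \<noteq> 0 then 1 else 0)"
        "binary (v div 2) = map (\<lambda>i. odd (v div 2 div 2 ^ i)) [0..<length (binary (v div 2))]"
        using conjunct1[OF less.IH[OF lt]] conjunct2[OF less.IH[OF lt]] by (simp_all only:)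
      have d: "v div 2 div 2 ^ i = v div 2 ^ Suc i" for i by (simp add: div_mult2_eq)
      have "length (binary v) = Suc (\<Sum>i<N'. if v div 2 ^ Suc i \<noteq> 0 then 1 else 0)"
        unfolding b using IH(1) unfolding d by simp
      also have "\<dots> = (\<Sum>i<N. if v div 2 ^ i \<noteq> 0 then 1 else 0)"
        unfolding N sum.lessThan_Suc_shift using False by simp
      finally have 1: "length (binary v) = (\<Sum>i<N. if v div 2 ^ i \<noteq> 0 then 1 else 0)" .
      have "map (\<lambda>i. odd (v div 2 ^ i)) [0..<length (binary v)] =
          odd v # map (\<lambda>i. odd (v div 2 ^ Suc i)) [0..<length (binary (v div 2))]"
        unfolding b by (simp only: list.size add_Suc_right add_0_right upt_conv_Cons zero_less_Suc map_Suc_upt[symmetric]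
            list.map map_map comp_def power_0 div_by_1 Suc_eq_plus1[symmetric])
      also have "\<dots> = binary v" unfolding b using IH(2) unfolding d by simp
      finally show ?thesis using 1 by simp
    qed
  qed
  then show "v \<le> N \<Longrightarrow> length (binary v) = (\<Sum>i<N. if v div 2 ^ i \<noteq> 0 then 1 else 0)"
    "binary v = map (\<lambda>i. odd (v div 2 ^ i)) [0..<length (binary v)]" by blast+
qed

lemma pf_length_binary:
  assumes "pf \<Gamma> a" shows "pf \<Gamma> (\<lambda>c. length (binary (a c)))"
  unfolding length_binary[OF order_refl]
  by (intro pf_sum assms pf_ifb pfb_nonzero pf_halve pf_snd pf_weak[OF assms] pf_const)

lemma pfb_odd: "pf \<Gamma> a \<Longrightarrow> pfb \<Gamma> (\<lambda>c. odd (a c))"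
  unfolding odd_iff_mod_2_eq_one by (intro pfb_eq pf_mod pf_const)

lemma tr_enc_nat:
  assumes "pf \<Gamma> a" shows "tr \<Gamma> (\<lambda>c. enc_nat (a c))"
proof -
  have "tr \<Gamma> (\<lambda>c. concat (map (\<lambda>i. [True] @ [odd (a c div 2 ^ i)]) [0..<length (binary (a c))]) @ [False])"
    by (intro tr_append tr_for tr_emit tr_bit pfb_odd pf_halve pf_snd pf_weak[OF assms] pf_length_binary assms)
  moreover have "enc_nat v = concat (map (\<lambda>i. [True] @ [odd (v div 2 ^ i)]) [0..<length (binary v)]) @ [False]" for v
    unfolding enc_nat_def enc_bits_def by (subst binary_eq_map) (simp add: comp_def)
  ultimately show ?thesis by simp
qed

lemma binary_0: "binary 0 = []" and binary_1: "binary (Suc 0) = [True]"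
  using binary.simps[of "Suc 0"] by (simp_all add: binary.simps[of 0])

lemma binary_power2: "binary (2 ^ k) = replicate k False @ [True]"
proof (induction k)
  case 0
  show ?case by (simp add: binary_0 binary_1)
next
  case (Suc k)
  have "binary (2 ^ Suc k) = False # binary (2 ^ k)" by (subst binary.simps) simp
  then show ?case by (simp add: Suc)
qed

lemma enc_rat_0: "enc_rat 0 = [False, True, True, False]"
  by (simp add: enc_rat_def enc_nat_def enc_bits_def binary_0 binary_1)

lemma quotient_of_power2: "quotient_of (2 ^ k) = (2 ^ k, 1)"
  using quotient_of_int[of "2 ^ k"] by (simp add: Rat.of_int_def)

text \<open>The number may be too large for a register, but its exponent is not: the code is a run
  of zero digits, as long as the exponent, followed by a constant string for the leading digit and
  the denominator 1.\<close>

lemma enc_rat_power2: "enc_rat (2 ^ k) = concat (map (\<lambda>i. [True, False]) [0..<k]) @ [True, True, False, True, True, False]"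
proof -
  have n: "nat (2 ^ k) = 2 ^ k" by (simp add: nat_power_eq)
  have c: "concat (map (\<lambda>b. [True, b]) (replicate k False)) = concat (map (\<lambda>i. [True, False]) [0..<k])"
    by (simp add: map_replicate_const)
  have "enc_rat (2 ^ k) = enc_nat (nat (2 ^ k)) @ enc_nat (nat 1)" by (simp add: enc_rat_def quotient_of_power2)
  also have "\<dots> = enc_bits (replicate k False @ [True]) @ enc_bits [True]"
    unfolding n enc_nat_def binary_power2 by (simp add: binary_1)
  also have "\<dots> = concat (map (\<lambda>i. [True, False]) [0..<k]) @ [True, True, False, True, True, False]"
    unfolding enc_bits_def map_append concat_append c by simp
  finally show ?thesis .
qed

lemma tr_list: "tr \<Gamma> (\<lambda>c. bs)"
proof (induction bs)
  case (Cons b bs)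
  show ?case by (rule tr_cong[OF tr_append[OF tr_emit[of _ b] Cons]]) simp
qed (rule tr_nil)

lemma tr_enc_rat_power2:
  assumes "pf \<Gamma> a" shows "tr \<Gamma> (\<lambda>c. enc_rat (2 ^ a c))"
  unfolding enc_rat_power2 by (intro tr_append tr_for tr_list assms)

lemma enc_list_map: "enc_list f (map g [0..<n]) = concat (map (\<lambda>i. [True] @ f (g i)) [0..<n]) @ [False]"
  by (simp add: enc_list_def comp_def)

lemma tr_enc_list:
  assumes "pf \<Gamma> n" "tr (ext \<Gamma>) (\<lambda>p. f (g (fst p) (snd p)))"
  shows "tr \<Gamma> (\<lambda>c. enc_list f (map (g c) [0..<n c]))"
  unfolding enc_list_map by (intro tr_append tr_for tr_emit assms)

text \<open>
  An automaton for the first row of an encoded placement: in state 1 the flag of the next center is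
  read, in states 2 and 3 the flags and bits of its binary code; state 4 is a sink.
\<close>

fun delta :: "nat \<Rightarrow> bool \<Rightarrow> nat" where
  "delta s b = (if s = 0 then (if b then 1 else 4) else if s = 1 then (if b then 2 else 4)
     else if s = 2 then (if b then 3 else 1) else if s = 3 then 2 else 4)"

declare delta.simps [simp del]

definition is_prefix :: "bool list \<Rightarrow> bool list \<Rightarrow> bool" where
  "is_prefix u t \<longleftrightarrow> length u \<le> length t \<and> (\<forall>i<length u. t ! i = u ! i)"

text \<open>A True flag read in state 1 is what announces the code of a center.\<close>

definition found :: "nat \<Rightarrow> bool list \<Rightarrow> nat \<Rightarrow> bool" where
  "found s t v \<longleftrightarrow> (\<exists>p<length t. foldl delta s (take p t) = 1 \<and> t ! p \<and> is_prefix (enc_nat v) (drop (Suc p) t))"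

lemma is_prefix_iff: "is_prefix u t \<longleftrightarrow> (\<exists>r. t = u @ r)"
proof
  assume "is_prefix u t"
  then have "take (length u) t = u" unfolding is_prefix_def by (intro nth_equalityI) auto
  then show "\<exists>r. t = u @ r" by (metis append_take_drop_id)
qed (auto simp: is_prefix_def nth_append)

lemma found_Nil: "\<not> found s [] v" by (simp add: found_def)

lemma found_Cons:
  "found s (b # t) v \<longleftrightarrow> s = 1 \<and> b \<and> is_prefix (enc_nat v) t \<or> found (delta s b) t v"
proof -
  have "found s (b # t) v \<longleftrightarrow> (\<exists>p<Suc (length t). foldl delta s (take p (b # t)) = 1 \<and> (b # t) ! p \<and>
      is_prefix (enc_nat v) (drop (Suc p) (b # t)))" by (simp add: found_def)
  also have "\<dots> \<longleftrightarrow> s = 1 \<and> b \<and> is_prefix (enc_nat v) t \<or> found (delta s b) t v"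
    unfolding Ex_less_Suc2 by (simp add: found_def)
  finally show ?thesis .
qed

text \<open>The end of the first row leads into the sink, so the centers of later classes are not
  seen.\<close>

lemma found_4: "\<not> found 4 t v"
  by (induction t) (auto simp: found_Nil found_Cons delta.simps)

lemma found_2_enc_bits: "found 2 (enc_bits u @ t) v \<longleftrightarrow> found 1 t v"
  by (induction u) (auto simp: enc_bits_def found_Cons delta.simps)

text \<open>Thanks to this, comparing a position with one given code is conclusive without knowing
  where the code standing there ends.\<close>

lemma enc_bits_prefix_free: "enc_bits u @ r = enc_bits v @ r' \<Longrightarrow> u = v"
proof (induction u arbitrary: v)
  case Nil
  then show ?case by (cases v) (auto simp: enc_bits_def)
next
  case (Cons b u)
  then show ?case by (cases v) (auto simp: enc_bits_def)
qed

lemma binary_inj: "binary a = binary b \<Longrightarrow> a = b"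
proof (induction a arbitrary: b rule: less_induct)
  case (less a)
  show ?case
  proof (cases "a = 0 \<or> b = 0")
    case True
    then show ?thesis using less.prems by (auto simp: binary.simps[of a] binary.simps[of b] split: if_splits)
  next
    case False
    then have "odd a = odd b" "binary (a div 2) = binary (b div 2)"
      using less.prems by (simp_all add: binary.simps[of a] binary.simps[of b])
    moreover from this have "a div 2 = b div 2" using less.IH[of "a div 2"] False by simp
    ultimately show ?thesis by (metis div_mult_mod_eq parity_cases)
  qed
qed

lemma found_1_list:
  "found 1 (concat (map (\<lambda>x. True # enc_nat x) xs) @ [False] @ t) v \<longleftrightarrow> v \<in> set xs"
proof (induction xs)
  case Nil
  show ?case by (simp add: found_Cons delta.simps found_4)
next
  case (Cons x xs)
  let ?t = "concat (map (\<lambda>x. True # enc_nat x) xs) @ [False] @ t"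
  have "is_prefix (enc_nat v) (enc_nat x @ ?t) \<longleftrightarrow> v = x"
    unfolding is_prefix_iff enc_nat_def by (metis enc_bits_prefix_free binary_inj)
  moreover have "found 2 (enc_nat x @ ?t) v \<longleftrightarrow> found 1 ?t v"
    unfolding enc_nat_def by (rule found_2_enc_bits)
  ultimately show ?case using Cons by (simp add: found_Cons delta.simps)
qed

lemma found_placement: "found 0 (enc_placement (xs # S)) v \<longleftrightarrow> v \<in> set xs"
proof -
  have "enc_placement (xs # S) = True # concat (map (\<lambda>x. True # enc_nat x) xs) @ [False] @
      (concat (map (\<lambda>x. True # enc_list enc_nat x) S) @ [False])"
    by (simp add: enc_placement_def enc_list_def)
  then show ?thesis using found_1_list by (simp add: found_Cons delta.simps)
qed

lemma enc_nat_nth: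
  shows "length (enc_nat v) = 2 * length (binary v) + 1"
    "i < length (enc_nat v) \<Longrightarrow> enc_nat v ! i \<longleftrightarrow> i < 2 * length (binary v) \<and> (even i \<or> odd (v div 2 ^ (i div 2)))"
proof -
  have e: "length (enc_bits u) = 2 * length u + 1 \<and>
     (\<forall>i<2 * length u + 1. enc_bits u ! i \<longleftrightarrow> i < 2 * length u \<and> (even i \<or> u ! (i div 2)))" for u
  proof (induction u)
    case (Cons b u)
    have "enc_bits (b # u) = True # b # enc_bits u" by (simp add: enc_bits_def)
    moreover have "(True # b # enc_bits u) ! i \<longleftrightarrow> i < 2 * length (b # u) \<and> (even i \<or> (b # u) ! (i div 2))"
      if "i < 2 * length (b # u) + 1" for i
    proof -
      consider "i = 0" | "i = 1" | i' where "i = Suc (Suc i')" by (metis One_nat_def not0_implies_Suc)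
      then show ?thesis using Cons that by cases auto
    qed
    ultimately show ?case using Cons by simp
  qed (simp add: enc_bits_def)
  show l: "length (enc_nat v) = 2 * length (binary v) + 1" using e[of "binary v"] by (simp add: enc_nat_def)
  have "binary v ! (i div 2) = odd (v div 2 ^ (i div 2))" if "i < 2 * length (binary v)"
  proof -
    have "i div 2 < length (binary v)" using that by linarith
    then show ?thesis by (subst binary_eq_map) (simp del: upt_Suc)
  qed
  then show "enc_nat v ! i \<longleftrightarrow> i < 2 * length (binary v) \<and> (even i \<or> odd (v div 2 ^ (i div 2)))"
    if "i < length (enc_nat v)"
    using e[of "binary v"] that l by (auto simp: enc_nat_def)
qed

text \<open>The run of the automaton is a recursion with values at most 4, hence trivially bounded.
  The code of the sought number is never built; its bits come from
  \<open>enc_nat_nth\<close>.\<close>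

lemma pfb_found:
  assumes Y: "\<And>c. Y c = fst (snd \<Gamma>) c" and v: "pf \<Gamma> v"
  shows "pfb \<Gamma> (\<lambda>c. found 0 (Y c) (v c))"
proof -
  define st where "st = (\<lambda>y. rec_nat (0::nat) (\<lambda>i s. delta s (str_tape y i = 2)))"
  have st: "st y p = foldl delta 0 (take p y)" if "p \<le> length y" for y p
    using that
  proof (induction p)
    case (Suc p)
    then have "str_tape y p = 2 \<longleftrightarrow> y ! p" by (simp add: str_tape_def sym_of_bit_def)
    then show ?case using Suc by (simp add: st_def take_Suc_conv_app_nth)
  qed (simp add: st_def)
  have st4: "st y p \<le> 4" for y p by (cases p) (simp_all add: st_def delta.simps)
  have len: "pf \<Gamma> (\<lambda>c. length (Y c))" by (rule pf_len[where j = 1]) (simp_all add: Y)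
  have Y1: "\<And>p. Y (fst p) = fst (snd (ext \<Gamma>)) p" by (simp add: Y ext_def)
  have Y2: "\<And>p. Y (fst (fst p)) = fst (snd (ext (ext \<Gamma>))) p" by (simp add: Y ext_def)
  have Y3: "\<And>p. Y (fst (fst (fst p))) = fst (snd (ext (ext (ext \<Gamma>)))) p" by (simp add: Y ext_def)
  have bit: "pfb \<Gamma>' (\<lambda>c. Y' c ! i c = True)" if "\<And>c. Y' c = fst (snd \<Gamma>') c" "pf \<Gamma>' i" "\<And>c. i c < length (Y' c)"
    for \<Gamma>' :: "'d ctx" and Y' i
  proof -
    have "pfb \<Gamma>' (\<lambda>c. str_tape (Y' c) (i c) = 2)"
      by (intro pfb_eq pf_read[where j = 1] that(2) pf_const) (simp_all add: that(1))
    then show ?thesis by (rule pfb_cong) (use that(3) in \<open>simp add: str_tape_def sym_of_bit_def\<close>)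
  qed
  note v1 = pf_weak[OF v] note v2 = pf_weak[OF v1]
  have "pf (ext \<Gamma>) (\<lambda>p. rec_nat 0 ((\<lambda>p i s. delta s (str_tape (Y (fst p)) i = 2)) p) (snd p))"
  proof (rule pf_rec[OF pf_snd pf_zero, where q = "[:4:]"])
    have s: "pf (ext (ext (ext \<Gamma>))) (\<lambda>p. str_tape (Y (fst (fst (fst p)))) (snd (fst p)))"
      by (rule pf_read[where j = 1]) (simp_all add: Y3 pf_weak[OF pf_snd])
    show "pf (ext (ext (ext \<Gamma>))) (\<lambda>p. delta (snd p) (str_tape (Y (fst (fst (fst p)))) (snd (fst p)) = 2))"
      unfolding delta.simps by (intro pf_ifb pfb_eq pf_snd pf_const s)
    show "rec_nat 0 (\<lambda>i s. delta s (str_tape (Y (fst c)) i = 2)) i \<le> poly [:4:] (csize (ext \<Gamma>) c)" for c i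
      using st4[of "Y (fst c)" i] by (simp add: st_def)
  qed
  then have pst: "pf (ext \<Gamma>) (\<lambda>p. st (Y (fst p)) (snd p))" by (simp add: st_def)
  have rd1: "pf (ext \<Gamma>) (\<lambda>p. str_tape (Y (fst p)) (snd p))"
    by (rule pf_read[where j = 1]) (simp_all add: Y1 pf_snd)
  have rd2: "pf (ext (ext \<Gamma>)) (\<lambda>p. str_tape (Y (fst (fst p))) (Suc (snd (fst p)) + snd p))"
    by (rule pf_read[where j = 1]) (simp_all add: Y2 pf_snd pf_weak[OF pf_snd] pf_add pf_Suc)
  have "pfb \<Gamma> (\<lambda>c. \<exists>p<length (Y c). st (Y c) p = 1 \<and> str_tape (Y c) p = 2 \<and>
     (\<forall>i<2 * length (binary (v c)) + 1. str_tape (Y c) (Suc p + i) =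
        (if i < 2 * length (binary (v c)) \<and> (\<not> odd i \<or> odd (v c div 2 ^ (i div 2))) then 2 else 1)))"
    by (intro pfb_ex len pfb_conj pfb_eq pst rd1 pf_const pfb_all pf_add pf_mult pf_length_binary v1 rd2
        pf_ifb pfb_less pfb_disj pfb_not pfb_odd pf_halve v2 pf_div pf_snd)
  then show ?thesis
  proof (rule pfb_cong, goal_cases)
    case (1 c)
    let ?y = "Y c" and ?v = "v c"
    have "(\<forall>i<2 * length (binary ?v) + 1. str_tape ?y (Suc p + i) =
        (if i < 2 * length (binary ?v) \<and> (\<not> odd i \<or> odd (?v div 2 ^ (i div 2))) then 2 else 1))
      \<longleftrightarrow> is_prefix (enc_nat ?v) (drop (Suc p) ?y)" for p
    proof -
      have l: "length (enc_nat ?v) = 2 * length (binary ?v) + 1"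
        by (rule enc_nat_nth(1))
      have i: "str_tape ?y (Suc p + i) = (if B then 2 else 1) \<longleftrightarrow> Suc p + i < length ?y \<and> ?y ! (Suc p + i) = B" for i B
        by (auto simp: str_tape_def sym_of_bit_def)
      have "(\<forall>i<2 * length (binary ?v) + 1. str_tape ?y (Suc p + i) =
        (if i < 2 * length (binary ?v) \<and> (\<not> odd i \<or> odd (?v div 2 ^ (i div 2))) then 2 else 1)) \<longleftrightarrow>
        (\<forall>i<length (enc_nat ?v). Suc p + i < length ?y \<and> ?y ! (Suc p + i) = enc_nat ?v ! i)"
        unfolding l[symmetric] i using enc_nat_nth(2)[of _ ?v] by auto
      also have "\<dots> \<longleftrightarrow> is_prefix (enc_nat ?v) (drop (Suc p) ?y)"
      proof
        assume *: "\<forall>i<length (enc_nat ?v). Suc p + i < length ?y \<and> ?y ! (Suc p + i) = enc_nat ?v ! i"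
        have "Suc p + 2 * length (binary ?v) < length ?y" using * l by simp
        then show "is_prefix (enc_nat ?v) (drop (Suc p) ?y)" unfolding is_prefix_def using * l by auto
      next
        assume *: "is_prefix (enc_nat ?v) (drop (Suc p) ?y)"
        show "\<forall>i<length (enc_nat ?v). Suc p + i < length ?y \<and> ?y ! (Suc p + i) = enc_nat ?v ! i"
          using * unfolding is_prefix_def by auto
      qed
      finally show ?thesis .
    qed
    moreover have "str_tape ?y p = 2 \<longleftrightarrow> ?y ! p" if "p < length ?y" for p
      using that by (simp add: str_tape_def sym_of_bit_def)
    ultimately show ?case unfolding found_def using st[of _ ?y] by (metis less_imp_le)
  qed
qed

section \<open>The instance as a finite input\<close>

context hitting
begin

definition input_of :: "nat \<Rightarrow> nukc_input" where
  "input_of Q = \<lparr>in_dist = map (\<lambda>i. map (\<lambda>j. if i = j then 0 else 2 ^ (Q * dist_exp i j)) [0..<n]) [0..<n],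
     in_radii = map (\<lambda>\<kappa>. 2 ^ (Q * rad_exp \<kappa>)) [0..<1 + 2 * J + T],
     in_counts = map cnt [0..<1 + 2 * J + T]\<rparr>"

lemma input_size_input_of: "input_size (input_of Q) = n"
  by (simp add: input_size_def input_of_def)

lemma instance_of_input_of: "instance_of (input_of Q) = inst Q"
proof -
  have "(if i < n \<and> j < n then real_of_rat (in_dist (input_of Q) ! i ! j) else 0) =
      (if i < n \<and> j < n then (if i = j then 0 else 2 ^ (Q * dist_exp i j)) else 0)" for i j
    by (simp add: input_of_def of_rat_power)
  then show ?thesis
    unfolding instance_of_def Let_def input_size_input_of
    by (simp add: inst_def del: upt_Suc) (simp add: input_of_def of_rat_power comp_def del: upt_Suc)
qed

lemma valid_input_of: "0 < Q \<Longrightarrow> valid_input (input_of Q)"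
  unfolding valid_input_def instance_of_input_of input_size_input_of
  using inst_valid by (intro conjI) (auto simp: input_of_def)

end

section \<open>Decoding pairs of bit strings\<close>

definition lenx :: "bool list \<Rightarrow> nat" where
  "lenx z = (\<Sum>l<length z. if \<forall>i<Suc l. str_tape z (2 * i) = 2 then 1 else 0)"

definition head_code :: "bool list \<Rightarrow> bool list" where
  "head_code z = take (2 * lenx z + 1) z"

lemma enc_bits_nth: "i < length x \<Longrightarrow> enc_bits x ! (2 * i) = True" "enc_bits x ! (2 * length x) = False"
  "length (enc_bits x) = 2 * length x + 1"
proof -
  have "length (enc_bits x) = 2 * length x + 1 \<and> (\<forall>i<length x. enc_bits x ! (2 * i)) \<and> \<not> enc_bits x ! (2 * length x)"
  proof (induction x)
    case (Cons b x)
    have e: "enc_bits (b # x) = True # b # enc_bits x" by (simp add: enc_bits_def)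
    have "(True # b # enc_bits x) ! (2 * i)" if "i < Suc (length x)" for i
      using Cons that by (cases i) auto
    then show ?case using Cons by (simp add: e)
  qed (simp add: enc_bits_def)
  then show "i < length x \<Longrightarrow> enc_bits x ! (2 * i) = True" "enc_bits x ! (2 * length x) = False"
    "length (enc_bits x) = 2 * length x + 1" by auto
qed

text \<open>The flags are the bits at even positions. They are True up to the terminating flag at
  \<open>2 * length x\<close>, so exactly \<open>length x\<close> indices are counted.\<close>

lemma lenx_pair_code: "lenx (pair_code x r) = length x"
proof -
  let ?z = "pair_code x r"
  have lz: "length x < length ?z" by (simp add: pair_code_def enc_bits_nth(3))
  have flag: "str_tape ?z (2 * i) = 2" if "i < length x" for i
    using that enc_bits_nth(1)[OF that] by (simp add: str_tape_def pair_code_def nth_append enc_bits_nth(3) sym_of_bit_def)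
  have stop: "str_tape ?z (2 * length x) = 1"
    by (simp add: str_tape_def pair_code_def nth_append enc_bits_nth sym_of_bit_def)
  have "(\<forall>i<Suc l. str_tape ?z (2 * i) = 2) \<longleftrightarrow> l < length x" for l
  proof
    assume *: "\<forall>i<Suc l. str_tape ?z (2 * i) = 2"
    show "l < length x"
    proof (rule ccontr)
      assume "\<not> l < length x"
      then have "str_tape ?z (2 * length x) = 2" using * by simp
      then show False using stop by simp
    qed
  next
    assume "l < length x"
    then show "\<forall>i<Suc l. str_tape ?z (2 * i) = 2" using flag by simp
  qed
  then have "lenx ?z = (\<Sum>l<length ?z. if l < length x then 1 else 0)" by (simp add: lenx_def)
  also have "\<dots> = (\<Sum>l<length x. 1)" using lz by (intro sum.mono_neutral_cong_right) auto
  finally show ?thesis by simp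
qed

lemma head_code_pair_code: "head_code (pair_code x r) = enc_bits x"
  unfolding head_code_def lenx_pair_code by (simp add: pair_code_def enc_bits_nth(3))

lemma pf_lenx:
  assumes Z: "\<And>c. Z c = fst \<Gamma> c" shows "pf \<Gamma> (\<lambda>c. lenx (Z c))"
  unfolding lenx_def
  by (intro pf_sum pf_len[where j = 0] pf_ifb pfb_all pf_Suc pf_snd pfb_eq pf_read[where j = 0] pf_mult pf_const)
    (simp_all add: Z ext_def)

lemma pf_length_head_code:
  assumes Z: "\<And>c. Z c = fst \<Gamma> c" shows "pf \<Gamma> (\<lambda>c. length (head_code (Z c)))"
proof -
  have "pf \<Gamma> (\<lambda>c. min (length (Z c)) (2 * lenx (Z c) + 1))"
    by (intro pf_min pf_add pf_mult pf_const pf_lenx pf_len[where j = 0]) (simp_all add: Z)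
  then show ?thesis by (simp add: head_code_def)
qed

lemma str_tape_head_code: "str_tape (head_code z) i = (if i < 2 * lenx z + 1 then str_tape z i else 0)"
  by (simp add: str_tape_def head_code_def)

lemma pf_str_tape_head_code:
  assumes Z: "\<And>c. Z c = fst \<Gamma> c" and i: "pf \<Gamma> i" shows "pf \<Gamma> (\<lambda>c. str_tape (head_code (Z c)) (i c))"
  unfolding str_tape_head_code
  by (intro pf_ifb pfb_less i pf_add pf_mult pf_const pf_lenx pf_read[where j = 0]) (simp_all add: Z)

lemma tr_head_code:
  assumes Z: "\<And>c. Z c = fst \<Gamma> c" shows "tr \<Gamma> (\<lambda>c. head_code (Z c))"
proof -
  have "tr \<Gamma> (\<lambda>c. concat (map (\<lambda>i. [str_tape (Z c) i = 2]) [0..<length (head_code (Z c))]))"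
    by (intro tr_for pf_length_head_code tr_bit pfb_eq pf_read[where j = 0] pf_snd pf_const) (simp_all add: Z ext_def)
  then show ?thesis
  proof (rule tr_cong)
    fix c
    have "map (\<lambda>i. str_tape (Z c) i = 2) [0..<length (head_code (Z c))] = head_code (Z c)"
      by (intro nth_equalityI) (auto simp: head_code_def str_tape_def sym_of_bit_def)
    then show "concat (map (\<lambda>i. [str_tape (Z c) i = 2]) [0..<length (head_code (Z c))]) = head_code (Z c)"
      by simp
  qed
qed

section \<open>The reduction as a polynomial-time function\<close>

locale reduction =
  fixes M :: tm and p qV :: "nat poly" and C :: nat
begin

definition PP where "PP z = poly p (lenx z)"
text \<open>The verifier is run on codes of length at most \<open>2 * lenx z + 1 + PP z\<close>, so
  this one time bound serves all admissible witnesses.\<close>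

definition BB where "BB z = poly qV (2 * lenx z + 1 + PP z)"
definition KK where "KK z = tableau.Mv M (BB z) (PP z) (head_code z)"
definition qq where "qq z = tableau.q M (BB z) (PP z) (head_code z)"
definition GG where "GG z = KK z * qq z"
definition JJ where "JJ z = tableau.J M (BB z) (PP z) (head_code z)"
definition UU where "UU z = 4 * (GG z)\<^sup>2"
definition EE where "EE z = tableau.E M (BB z) (PP z) (head_code z)"
text \<open>The random string follows the code of the input and is divided into blocks of
  \<open>UU z\<close> bits, one block per group.\<close>

definition ww where "ww z g u \<longleftrightarrow> str_tape z (2 * lenx z + 1 + (g * UU z + u)) = 2"
text \<open>This makes \<open>2 ^ QQ z\<close> exceed the factor belonging to the number of points
  of the very same instance. There is no circularity, as the number of points does not depend on
  \<open>Q\<close>.\<close>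

definition QQ where "QQ z = C * hitting.n (GG z) (JJ z) (UU z) ^ C + 1"

definition inst_code where
  "inst_code z = enc_input (hitting.input_of (GG z) (KK z) (JJ z) (UU z) (EE z) (ww z) (QQ z))"

text \<open>Group \<open>g\<close> consists of the points \<open>2 * (g * N) + u\<close> with
  \<open>u < 2 * N\<close>; a pair of cell and value is selected if some center of class 0 lies in
  its group.\<close>

definition sel where
  "sel z y x a \<longleftrightarrow> (\<exists>u < 2 * hitting.N (JJ z) (UU z).
     found 0 y (2 * ((x * qq z + a) * hitting.N (JJ z) (UU z)) + u))"

definition cellx where
  "cellx z i = tableau.Xs M (BB z) (PP z) (head_code z) 0 0 (length (head_code z) + i)"

definition wit_code where
  "wit_code z y = head_code z @ concat (map (\<lambda>i. if sel z y (cellx z i) 2 then [True]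
     else if sel z y (cellx z i) 1 then [False] else []) [0..<PP z])"

lemma pf_PP: "(\<And>c. Z c = fst \<Gamma> c) \<Longrightarrow> pf \<Gamma> (\<lambda>c. PP (Z c))"
  unfolding PP_def by (intro pf_poly pf_lenx)

lemma pf_BB: "(\<And>c. Z c = fst \<Gamma> c) \<Longrightarrow> pf \<Gamma> (\<lambda>c. BB (Z c))"
  unfolding BB_def by (intro pf_poly pf_add pf_mult pf_const pf_lenx pf_PP)

lemma pf_KK: "(\<And>c. Z c = fst \<Gamma> c) \<Longrightarrow> pf \<Gamma> (\<lambda>c. KK (Z c))"
  unfolding KK_def by (intro pf_Mv pf_BB pf_PP pf_length_head_code pf_str_tape_head_code)

lemma pf_qq: "(\<And>c. Z c = fst \<Gamma> c) \<Longrightarrow> pf \<Gamma> (\<lambda>c. qq (Z c))"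
  unfolding qq_def by (intro pf_q pf_BB pf_PP pf_length_head_code pf_str_tape_head_code)

lemma pf_GG: "(\<And>c. Z c = fst \<Gamma> c) \<Longrightarrow> pf \<Gamma> (\<lambda>c. GG (Z c))"
  unfolding GG_def by (intro pf_mult pf_KK pf_qq)

lemma pf_JJ: "(\<And>c. Z c = fst \<Gamma> c) \<Longrightarrow> pf \<Gamma> (\<lambda>c. JJ (Z c))"
  unfolding JJ_def by (intro pf_J pf_BB pf_PP pf_length_head_code pf_str_tape_head_code)

lemma pf_UU: "(\<And>c. Z c = fst \<Gamma> c) \<Longrightarrow> pf \<Gamma> (\<lambda>c. UU (Z c))"
  unfolding UU_def by (intro pf_mult pf_power_const pf_GG pf_const)

lemma pfb_EE: "(\<And>c. Z c = fst \<Gamma> c) \<Longrightarrow> pf \<Gamma> a \<Longrightarrow> pf \<Gamma> b \<Longrightarrow> pfb \<Gamma> (\<lambda>c. EE (Z c) (a c) (b c))"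
  unfolding EE_def by (intro pfb_E pf_BB pf_PP pf_length_head_code pf_str_tape_head_code)

lemma pfb_ww: "(\<And>c. Z c = fst \<Gamma> c) \<Longrightarrow> pf \<Gamma> a \<Longrightarrow> pf \<Gamma> b \<Longrightarrow> pfb \<Gamma> (\<lambda>c. ww (Z c) (a c) (b c))"
  unfolding ww_def
  by (intro pfb_eq pf_read[where j = 0] pf_add pf_mult pf_const pf_lenx pf_UU) simp_all

lemma pf_NN: "(\<And>c. Z c = fst \<Gamma> c) \<Longrightarrow> pf \<Gamma> (\<lambda>c. hitting.N (JJ (Z c)) (UU (Z c)))"
  unfolding hitting.N_def by (intro pf_add pf_JJ pf_UU)

lemma pf_nn: "(\<And>c. Z c = fst \<Gamma> c) \<Longrightarrow> pf \<Gamma> (\<lambda>c. hitting.n (GG (Z c)) (JJ (Z c)) (UU (Z c)))"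
  unfolding hitting.n_def by (intro pf_mult pf_const pf_NN pf_GG)

lemma pf_QQ: "(\<And>c. Z c = fst \<Gamma> c) \<Longrightarrow> pf \<Gamma> (\<lambda>c. QQ (Z c))"
  unfolding QQ_def by (intro pf_add pf_mult pf_power_const pf_const pf_nn)

lemma ext_ctx: "(\<And>c. Z c = fst \<Gamma> c) \<Longrightarrow> Z (fst d) = fst (ext \<Gamma>) d"
  by (simp add: ext_def)

lemma pf_dist:
  assumes Z: "\<And>c. Z c = fst \<Gamma> c" and "pf \<Gamma> a" "pf \<Gamma> b"
  shows "pf \<Gamma> (\<lambda>c. hitting.dist_exp (GG (Z c)) (KK (Z c)) (JJ (Z c)) (UU (Z c)) (EE (Z c)) (ww (Z c)) (a c) (b c))"
  using assms
  by (intro pf_dist_exp pf_GG pf_KK pf_JJ pf_UU pfb_EE pfb_ww ext_ctx[of Z \<Gamma>])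

lemma pf_rad:
  assumes Z: "\<And>c. Z c = fst \<Gamma> c" and "pf \<Gamma> a"
  shows "pf \<Gamma> (\<lambda>c. hitting.rad_exp (GG (Z c)) (KK (Z c)) (JJ (Z c)) (UU (Z c)) (a c))"
  unfolding hitting.rad_exp_def hitting.L_def hitting.T_def using assms
  by (intro pf_arith pfb_le pf_GG pf_KK pf_JJ pf_UU)

lemma pf_count:
  assumes Z: "\<And>c. Z c = fst \<Gamma> c" and "pf \<Gamma> a"
  shows "pf \<Gamma> (\<lambda>c. hitting.cnt (GG (Z c)) (KK (Z c)) (JJ (Z c)) (EE (Z c)) (a c))"
  using assms
  by (intro pf_cnt[where U = "\<lambda>_. 0" and w = "\<lambda>_ _ _. True"] pf_GG pf_KK pf_JJ pf_const pfb_const pfb_EE ext_ctx[of Z \<Gamma>])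

lemma pf_classes:
  assumes Z: "\<And>c. Z c = fst \<Gamma> c"
  shows "pf \<Gamma> (\<lambda>c. 1 + 2 * JJ (Z c) + hitting.T (GG (Z c)) (KK (Z c)) (UU (Z c)))"
  unfolding hitting.T_def using Z by (intro pf_arith pf_GG pf_KK pf_JJ pf_UU)

lemma tr_inst_code:
  assumes Z: "\<And>c. Z c = fst \<Gamma> c"
  shows "tr \<Gamma> (\<lambda>c. inst_code (Z c))"
proof -
  note Z1 = ext_ctx[of Z \<Gamma>, OF Z]
  note Z2 = ext_ctx[of "\<lambda>p. Z (fst p)" "ext \<Gamma>", OF Z1]
  have r: "enc_rat (if b then 0 else 2 ^ k) = (if b then [False, True, True, False] else enc_rat (2 ^ k))" for b k
    by (simp add: enc_rat_0)
  show ?thesis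
    unfolding inst_code_def enc_input_def hitting.input_of_def nukc_input.simps
  proof (intro tr_append tr_enc_list pf_nn pf_classes Z Z1)
    show "tr (ext (ext \<Gamma>)) (\<lambda>p. enc_rat (if snd (fst p) = snd p then 0 else
       2 ^ (QQ (Z (fst (fst p))) * hitting.dist_exp (GG (Z (fst (fst p)))) (KK (Z (fst (fst p)))) (JJ (Z (fst (fst p))))
          (UU (Z (fst (fst p)))) (EE (Z (fst (fst p)))) (ww (Z (fst (fst p)))) (snd (fst p)) (snd p))))"
      unfolding r
      by (intro tr_ifb pfb_eq pf_weak[OF pf_snd] pf_snd tr_list tr_enc_rat_power2 pf_mult pf_QQ pf_dist Z2)
    show "tr (ext \<Gamma>) (\<lambda>p. enc_rat (2 ^ (QQ (Z (fst p)) * hitting.rad_exp (GG (Z (fst p))) (KK (Z (fst p)))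
        (JJ (Z (fst p))) (UU (Z (fst p))) (snd p))))"
      by (intro tr_enc_rat_power2 pf_mult pf_QQ pf_rad pf_snd Z1)
    show "tr (ext \<Gamma>) (\<lambda>p. enc_nat (hitting.cnt (GG (Z (fst p))) (KK (Z (fst p))) (JJ (Z (fst p))) (EE (Z (fst p))) (snd p)))"
      by (intro tr_enc_nat pf_count pf_snd Z1)
  qed
qed

lemma pfb_sel:
  assumes Z: "\<And>c. Z c = fst \<Gamma> c" and Y: "\<And>c. Y c = fst (snd \<Gamma>) c" and x: "pf \<Gamma> x" and a: "pf \<Gamma> a"
  shows "pfb \<Gamma> (\<lambda>c. sel (Z c) (Y c) (x c) (a c))"
proof -
  note Z1 = ext_ctx[of Z \<Gamma>, OF Z]
  have Y1: "Y (fst p) = fst (snd (ext \<Gamma>)) p" for p by (simp add: Y ext_def)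
  show ?thesis
    unfolding sel_def
    by (intro pfb_ex pf_mult pf_const pf_NN Z pfb_found Y1 pf_add pf_qq Z1 pf_weak[OF x] pf_weak[OF a] pf_snd)
qed

lemma pf_cellx:
  assumes Z: "\<And>c. Z c = fst \<Gamma> c" and i: "pf \<Gamma> i"
  shows "pf \<Gamma> (\<lambda>c. cellx (Z c) (i c))"
  unfolding cellx_def
  by (intro pf_Xs pf_BB pf_PP pf_length_head_code pf_str_tape_head_code pf_const pf_add i Z)

lemma tr_wit_code:
  assumes Z: "\<And>c. Z c = fst \<Gamma> c" and Y: "\<And>c. Y c = fst (snd \<Gamma>) c"
  shows "tr \<Gamma> (\<lambda>c. wit_code (Z c) (Y c))"
proof -
  note Z1 = ext_ctx[of Z \<Gamma>, OF Z]
  have Y1: "Y (fst p) = fst (snd (ext \<Gamma>)) p" for p by (simp add: Y ext_def)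
  show ?thesis
    unfolding wit_code_def
    by (intro tr_append tr_head_code tr_for pf_PP tr_ifb pfb_sel pf_cellx pf_snd pf_const tr_emit tr_nil Z Z1 Y1)
qed

text \<open>In \<open>RP\<close> the number of random bits is exactly a polynomial in the length of
  the input. One per weight bit is such a number, because the dimensions of the tableau depend on
  \<open>x\<close> only through its length.\<close>

definition size_poly :: "nat poly" where
  "size_poly = (let pB = pcompose qV ([:1, 2:] + p); pW = pB + [:1, 2:] + p + 2;
     pG = (pB + 1) * ([:1 + num_tapes M:] + [:num_tapes M:] * pW) * ([:tableau.NV M + num_syms M:] + pW)
   in pG * (4 * pG ^ 2))"

lemma poly_size_poly: "poly size_poly (length x) = GG (pair_code x r) * UU (pair_code x r)"
proof -
  let ?z = "pair_code x r"
  have P: "PP ?z = poly p (length x)" by (simp add: PP_def lenx_pair_code)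
  have B: "BB ?z = poly qV (1 + 2 * length x + poly p (length x))"
    by (simp add: BB_def P lenx_pair_code)
  have G: "GG ?z = (BB ?z + 1) * ((1 + num_tapes M) + num_tapes M * (BB ?z + (1 + 2 * length x) + PP ?z + 2)) *
      (tableau.NV M + num_syms M + (BB ?z + (1 + 2 * length x) + PP ?z + 2))"
    unfolding GG_def KK_def qq_def tableau.Mv_def tableau.q_def tableau.Rw_def
      tableau.Wd_def head_code_pair_code enc_bits_nth(3)
    by simp
  show ?thesis
    unfolding UU_def G unfolding B P size_poly_def Let_def
    by (simp add: poly_pcompose mult.commute[of _ 2])
qed

end

section \<open>NP and RP\<close>

lemma steps_halted: "num_states M \<le> fst cf \<Longrightarrow> (step M ^^ t) cf = cf"
  by (induction t) (cases cf; simp)+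

lemma halted_with_unique:
  assumes "halted_with M cf y" "halted_with M cf y'" shows "y = y'"
proof -
  obtain s h T where cf: "cf = (s, h, T)" by (cases cf) auto
  have a: "\<forall>i<length y. T 0 i = sym_of_bit (y ! i)" "T 0 (length y) = 0"
    "\<forall>i<length y'. T 0 i = sym_of_bit (y' ! i)" "T 0 (length y') = 0"
    using assms by (auto simp: halted_with_def cf)
  have nz: "sym_of_bit b \<noteq> 0" for b by (simp add: sym_of_bit_def)
  have "\<not> length y < length y'" "\<not> length y' < length y" using a nz by metis+
  then have l: "length y = length y'" by simp
  show ?thesis
  proof (rule nth_equalityI[OF l])
    fix i assume i: "i < length y"
    then have "sym_of_bit (y ! i) = sym_of_bit (y' ! i)" using a l by metis
    then show "y ! i = y' ! i" by (simp add: sym_of_bit_def split: if_splits)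
  qed
qed

text \<open>A halted machine stays put, so any bound above the running time can replace it;
  witnesses of different lengths can then share one \<open>B\<close>.\<close>

lemma halted_with_iff:
  assumes h: "halted_with M ((step M ^^ t) cf) y" and t: "t \<le> B"
  shows "halted_with M ((step M ^^ B) cf) y' \<longleftrightarrow> y = y'"
proof -
  have "num_states M \<le> fst ((step M ^^ t) cf)" using h by (auto simp: halted_with_def split: prod.splits)
  then have "(step M ^^ (B - t)) ((step M ^^ t) cf) = (step M ^^ t) cf" by (rule steps_halted)
  moreover have "(step M ^^ B) cf = (step M ^^ (B - t)) ((step M ^^ t) cf)"
    using t by (simp flip: funpow_add[THEN fun_cong, unfolded comp_apply])
  ultimately show ?thesis using h halted_with_unique by metis
qed

text \<open>Since c \<le> C < 2^C, the base can be raised to \<open>2 ^ C\<close>, which turns the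
  double exponent into a polynomial exponent of 2.\<close>

lemma growth_bound:
  fixes c :: real
  assumes "c > 0" "1 \<le> n" "c \<le> real C"
  shows "c powr (real n powr c) < 2 ^ (C * n ^ C + 1)"
proof -
  have "real C < 2 ^ C" by (rule of_nat_less_two_power)
  moreover have "(2::real) powr real C = 2 ^ C" by (rule powr_realpow) simp
  ultimately have c: "c \<le> 2 powr real C" using assms(3) by linarith
  have "real n powr c \<le> real n powr real C" using assms by (intro powr_mono) auto
  then have n: "real n powr c \<le> real n ^ C" using assms(2) by (simp add: powr_realpow)
  have "c powr (real n powr c) \<le> (2 powr real C) powr (real n powr c)"
    using c assms(1) by (intro powr_mono2) auto
  also have "\<dots> = 2 powr (real C * real n powr c)" by (simp add: powr_powr)
  also have "\<dots> \<le> 2 powr (real C * real n ^ C)" using n by (intro powr_mono mult_left_mono) auto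
  also have "\<dots> = 2 powr real (C * n ^ C)" by simp
  also have "\<dots> = 2 ^ (C * n ^ C)" by (rule powr_realpow) simp
  also have "\<dots> < 2 ^ (C * n ^ C + 1)" by simp
  finally show ?thesis .
qed

section \<open>Excluding factors below 1\<close>

lemma single_class_clustering:
  fixes n :: nat
  assumes M: "Metric_space {..<n} d" and n: "0 < n"
  defines "I \<equiv> \<lparr>points = {..<n}, metr = d, radii = [1], counts = [1]\<rparr>"
  shows "{\<C>. optimal_clustering I \<C>} = {{{..<n}}}" "\<exists>\<beta>. optimal_dilation I \<beta>"
proof -
  interpret Metric_space "{..<n}" d by (rule M)
  have single: "\<exists>p<n. S = [[p]]" if "feasible_placement I \<alpha> S" for \<alpha> S
    using that by (auto simp: feasible_placement_def I_def length_Suc_conv)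
  have balls: "placement_balls I \<alpha> [[p]] = {nukc_ball I p \<alpha>}" for \<alpha> p
    by (auto simp: placement_balls_def I_def)
  have le: "d 0 q \<le> (\<Sum>q<n. d 0 q)" if "q < n" for q using that by (intro member_le_sum) auto
  have "nukc_ball I 0 (\<Sum>q<n. d 0 q) = {..<n}" using le by (auto simp: nukc_ball_def I_def)
  then have "feasible_placement I (\<Sum>q<n. d 0 q) [[0]]"
    using n balls[of "\<Sum>q<n. d 0 q" 0] by (simp add: feasible_placement_def sum_nonneg) (simp add: I_def)
  then show ex: "\<exists>\<beta>. optimal_dilation I \<beta>" by (rule optimal_dilation_exists[rotated 2]) (auto simp: I_def)
  then obtain \<beta> S where \<beta>: "optimal_dilation I \<beta>" and S: "feasible_placement I \<beta> S"
    unfolding optimal_dilation_def by blast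
  obtain p where p: "S = [[p]]" using single[OF S] by blast
  have "\<Union> (placement_balls I \<beta> S) = {..<n}" using S by (simp add: feasible_placement_def I_def)
  then have "nukc_ball I p \<beta> = {..<n}" unfolding p balls by simp
  then have "induced_clustering I \<beta> S {{..<n}}"
    unfolding induced_clustering_def p balls using n by (simp add: I_def partition_on_space) (auto simp: partition_on_def)
  then have "optimal_clustering I {{..<n}}" unfolding optimal_clustering_def using \<beta> S by blast
  moreover have "\<C> = {{..<n}}" if "optimal_clustering I \<C>" for \<C>
  proof -
    have "partition_on {..<n} \<C>" "card \<C> = 1"
      using that by (auto simp: optimal_clustering_def induced_clustering_def I_def)
    then show ?thesis by (auto simp: card_1_singleton_iff partition_on_def)
  qed
  ultimately show "{\<C>. optimal_clustering I \<C>} = {{{..<n}}}" by blast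
qed

text \<open>
  No factor below 1 can be guaranteed on the uniform metric with a single ball, which is
  resilient for every parameter.
\<close>

lemma approximation_factor_ge_1:
  assumes f: "approximates_resilient_nukc \<gamma> f" and n: "2 \<le> n"
  shows "1 \<le> \<gamma> n"
proof (rule ccontr)
  assume g: "\<not> 1 \<le> \<gamma> n"
  define X where "X = \<lparr>in_dist = map (\<lambda>i. map (\<lambda>j. if i = j then 0 else 1) [0..<n]) [0..<n],
     in_radii = [1], in_counts = [1]\<rparr>"
  define d where "d = (\<lambda>i j. if i < n \<and> j < n \<and> i \<noteq> j then 1 else 0 :: real)"
  define I where "I = \<lparr>points = {..<n}, metr = d, radii = [1], counts = [1]\<rparr>"
  have sz: "input_size X = n" by (simp add: input_size_def X_def)
  have "(if i < n \<and> j < n then real_of_rat (in_dist X ! i ! j) else 0) = d i j" for i j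
    by (simp add: X_def d_def)
  then have inst: "instance_of X = I" unfolding instance_of_def Let_def sz by (simp add: I_def) (simp add: X_def)
  have M: "Metric_space {..<n} d" by unfold_locales (auto simp: d_def)
  have "valid_input X"
    unfolding valid_input_def inst sz nukc_instance_def using M by (auto simp: X_def I_def)
  moreover have "perturbation_resilient (\<gamma> n) I"
    unfolding perturbation_resilient_def
  proof (intro exI[of _ "{{..<n}}"] conjI allI impI)
    show "{\<C>'. optimal_clustering I \<C>'} = {{{..<n}}}"
      unfolding I_def using n by (intro single_class_clustering M) simp
    fix d1 assume "metric_perturbation (\<gamma> n) (points I) (metr I) d1"
    then have "Metric_space {..<n} d1" by (simp add: metric_perturbation_def I_def)
    moreover have "I\<lparr>metr := d1\<rparr> = \<lparr>points = {..<n}, metr = d1, radii = [1], counts = [1]\<rparr>" by (simp add: I_def)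
    ultimately show "{\<C>'. optimal_clustering (I\<lparr>metr := d1\<rparr>) \<C>'} = {{{..<n}}}"
      using n single_class_clustering(1)[of n d1] by auto
  qed
  ultimately obtain S \<alpha> where S: "feasible_placement I \<alpha> S"
    and le: "\<And>\<beta>. optimal_dilation I \<beta> \<Longrightarrow> \<alpha> \<le> \<gamma> n * \<beta>"
    using f unfolding approximates_resilient_nukc_def by (metis inst sz)
  obtain \<beta> where \<beta>: "optimal_dilation I \<beta>"
    using single_class_clustering(2)[OF M] n unfolding I_def by auto
  \<comment> \<open>Reaching any second point takes dilation 1. So the optimum is positive, and a
    factor below 1 would undercut it.\<close>
  have ge1: "1 \<le> \<delta>" if fp: "feasible_placement I \<delta> S'" for \<delta> S'
  proof -
    obtain p where p: "S' = [[p]]" "p < n"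
      using fp by (auto simp: feasible_placement_def I_def length_Suc_conv)
    define r where "r = (if p = 0 then 1 else 0 :: nat)"
    have r: "r < n" "r \<noteq> p" using n by (auto simp: r_def)
    have "r \<in> \<Union> (placement_balls I \<delta> S')" using fp r by (simp add: feasible_placement_def I_def)
    then have "d p r \<le> \<delta>" by (auto simp: placement_balls_def nukc_ball_def I_def p)
    then show ?thesis using r p by (simp add: d_def)
  qed
  obtain S' where "feasible_placement I \<beta> S'" using \<beta> by (auto simp: optimal_dilation_def)
  then have "1 \<le> \<beta>" by (rule ge1)
  then have "\<gamma> n * \<beta> < \<beta>" using g by simp
  moreover have "\<beta> \<le> \<alpha>" using \<beta> S by (auto simp: optimal_dilation_def)
  ultimately show False using le[OF \<beta>] by simp
qed

text \<open>An accepting random string is a witness. Since \<open>NP\<close> only bounds the length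
  of a witness while \<open>RP\<close> prescribes it, the verifier pads the witness with False, or
  cuts it, to the prescribed length.\<close>

lemma RP_subset_NP: "RP \<subseteq> NP"
proof
  fix L assume "L \<in> RP"
  then obtain V p where V: "poly_time V" and
    L: "\<And>x. let W = {w :: bool list. length w = poly p (length x)};
                    A = {w \<in> W. V (pair_code x w) = [True]}
                in (x \<in> L \<longrightarrow> real (card A) / real (card W) \<ge> 1 / 2) \<and> (x \<notin> L \<longrightarrow> A = {})"
    unfolding RP_def by blast
  let ?pad = "\<lambda>z. map (\<lambda>i. str_tape z (2 * lenx z + 1 + i) = 2) [0..<poly p (lenx z)]"
  let ?V = "\<lambda>z. V (head_code z @ ?pad z)"
  have "tr zy_ctx (\<lambda>c. head_code (fst c) @ concat (map (\<lambda>i. [str_tape (fst c) (2 * lenx (fst c) + 1 + i) = 2]) [0..<poly p (lenx (fst c))]))"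
    by (intro tr_append tr_head_code tr_for pf_poly pf_lenx tr_bit pfb_eq pf_read[where j = 0] pf_add pf_mult pf_const pf_snd)
      (simp_all add: zy_ctx_def ext_def)
  then have G: "tr zy_ctx (\<lambda>c. head_code (fst c) @ ?pad (fst c))" by simp
  \<comment> \<open>The composition theorem is applied with an idle question: the first stage
    evaluates \<open>V\<close> on the empty string, and \<open>G\<close> looks only at the
    input.\<close>
  have pt: "poly_time ?V" using poly_time_compose[OF V V tr_nil G] by simp
  have pc: "?V (pair_code x w) = V (pair_code x (?pad (pair_code x w)))" for x w
    by (simp only: head_code_pair_code) (simp add: pair_code_def)
  have nz: "k \<noteq> 0" if "1 / 2 \<le> real k / m" for k m
    using that by (intro notI) simp
  have "x \<in> L \<longleftrightarrow> (\<exists>w. length w \<le> poly p (length x) \<and> ?V (pair_code x w) = [True])" for x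
  proof
    assume "x \<in> L"
    then have "real (card {w \<in> {w :: bool list. length w = poly p (length x)}. V (pair_code x w) = [True]}) /
      real (card {w :: bool list. length w = poly p (length x)}) \<ge> 1 / 2" using L[of x] by (simp add: Let_def)
    then have "card {w \<in> {w :: bool list. length w = poly p (length x)}. V (pair_code x w) = [True]} \<noteq> 0"
      by (rule nz)
    then have "{w \<in> {w :: bool list. length w = poly p (length x)}. V (pair_code x w) = [True]} \<noteq> {}"
      by (intro notI) (simp only: card.empty)
    then obtain w where w: "length w = poly p (length x)" "V (pair_code x w) = [True]" by blast
    have pad: "?pad (pair_code x w) = w"
      unfolding lenx_pair_code
      by (rule nth_equalityI) (auto simp: w(1) str_tape_def pair_code_def nth_append enc_bits_nth(3) sym_of_bit_def)
    have "?V (pair_code x w) = [True]" unfolding pc unfolding pad by (rule w(2))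
    then show "\<exists>w. length w \<le> poly p (length x) \<and> ?V (pair_code x w) = [True]" using w(1) by (intro exI[of _ w]) simp
  next
    assume "\<exists>w. length w \<le> poly p (length x) \<and> ?V (pair_code x w) = [True]"
    then obtain w where "V (pair_code x (?pad (pair_code x w))) = [True]" using pc by metis
    moreover have "length (?pad (pair_code x w)) = poly p (length x)" by (simp add: lenx_pair_code)
    ultimately show "x \<in> L" using L[of x] by (auto simp: Let_def)
  qed
  then show "L \<in> NP" unfolding NP_def using pt by blast
qed

section \<open>Correctness of the randomized reduction\<close>

context reduction
begin

definition fam :: "bool list \<Rightarrow> nat set set" where
  "fam z = {A. A \<subseteq> {..<GG z} \<and> card A = KK z \<and> (\<forall>c<JJ z. \<exists>g\<in>A. EE z c g)}"

text \<open>The random string enters only through the marks. The family is therefore fixed before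
  the weights are drawn, as isolation requires.\<close>

lemma fam_pair_code: "fam (pair_code x r) = fam (pair_code x r')"
  by (simp add: fam_def GG_def KK_def qq_def JJ_def EE_def PP_def BB_def lenx_pair_code head_code_pair_code)

lemma accepts_iff:
  assumes V: "\<And>x. halted_with M ((step M ^^ poly qV (length x)) (init_config x)) (V x)"
    and w: "length w \<le> poly p (length x)"
  shows "V (pair_code x w) = [True] \<longleftrightarrow>
    halted_with M ((step M ^^ BB (pair_code x r)) (init_config (enc_bits x @ w))) [True]"
proof -
  have "poly qV (length (enc_bits x @ w)) \<le> BB (pair_code x r)"
    unfolding BB_def PP_def lenx_pair_code using w by (intro poly_mono_nat) (simp add: enc_bits_nth(3))
  from halted_with_iff[OF V this, of "[True]"] show ?thesis by (simp add: pair_code_def)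
qed

lemma fam_nonempty:
  assumes wf: "wf_tm M" and V: "\<And>x. halted_with M ((step M ^^ poly qV (length x)) (init_config x)) (V x)"
    and w: "length w \<le> poly p (length x)" "V (pair_code x w) = [True]"
  shows "fam (pair_code x r) \<noteq> {}"
proof -
  let ?z = "pair_code x r"
  interpret tb: tableau M "BB ?z" "PP ?z" "head_code ?z" .
  have k0: "0 < num_tapes M" using wf by (simp add: wf_tm_def)
  have "length w \<le> PP ?z" using w by (simp add: PP_def lenx_pair_code)
  moreover have "halted_with M ((step M ^^ BB ?z) (init_config (head_code ?z @ w))) [True]"
    using accepts_iff[OF V w(1)] w(2) by (simp add: head_code_pair_code)
  ultimately have c: "tb.proper (tb.run_val w)" "tb.sem (tb.run_val w)"
    "\<And>t. t \<le> BB ?z \<Longrightarrow> tb.run_val w (tb.Xc t) < tb.NV"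
    using tb.sem_complete[OF wf] by blast+
  have "tb.graph (tb.run_val w) \<in> fam ?z"
    unfolding fam_def GG_def KK_def qq_def JJ_def EE_def
    using tb.graph_props(1,2)[OF c(1)] tb.sem_hits[OF c(1) k0 c(2,3)] by simp
  then show ?thesis by blast
qed

lemma sel_iff:
  assumes S: "\<And>v. v \<in> set xs \<Longrightarrow> v div 2 div hitting.N (JJ z) (UU z) \<in> A"
    "\<And>g. g \<in> A \<Longrightarrow> \<exists>v\<in>set xs. v div 2 div hitting.N (JJ z) (UU z) = g"
    and N: "0 < hitting.N (JJ z) (UU z)"
  shows "sel z (enc_placement (xs # S)) x a \<longleftrightarrow> x * qq z + a \<in> A"
proof
  let ?N = "hitting.N (JJ z) (UU z)"
  let ?g = "x * qq z + a"
  have dm: "v div 2 div ?N = v div (2 * ?N)" for v by (simp add: div_mult2_eq)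
  assume "sel z (enc_placement (xs # S)) x a"
  then obtain u where u: "u < 2 * ?N" "2 * (?g * ?N) + u \<in> set xs"
    unfolding sel_def found_placement by blast
  have "2 * (?g * ?N) + u = ?g * (2 * ?N) + u" by simp
  then have "(2 * (?g * ?N) + u) div 2 div ?N = ?g" unfolding dm using u(1) N by (simp only: mult_add_div_mod)
  then show "?g \<in> A" using S(1)[OF u(2)] by simp
next
  let ?N = "hitting.N (JJ z) (UU z)"
  let ?g = "x * qq z + a"
  have dm: "v div 2 div ?N = v div (2 * ?N)" for v by (simp add: div_mult2_eq)
  assume "?g \<in> A"
  then obtain v where v: "v \<in> set xs" "v div (2 * ?N) = ?g" using S(2) dm by metis
  have "2 * (?g * ?N) + v mod (2 * ?N) = v" using div_mult_mod_eq[of v "2 * ?N"] v(2) by simp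
  moreover have "v mod (2 * ?N) < 2 * ?N" using N by simp
  ultimately show "sel z (enc_placement (xs # S)) x a"
    unfolding sel_def found_placement using v(1) by metis
qed

text \<open>Marks of the gadget are ones of the random string, so the cost measured by the dilation
  is the cost of the isolating lemma.\<close>

lemma card_marks:
  assumes "length r = GG z * UU z" and z: "z = pair_code x r"
  shows "hitting.cost (GG z) (UU z) (ww z) A = cost_of (GG z) (UU z) r A"
proof -
  let ?G = "GG z" and ?U = "UU z"
  have lt: "g * ?U + u < length r" if "g < ?G" "u < ?U" for g u
  proof -
    have "g * ?U + u < Suc g * ?U" using that by simp
    also have "\<dots> \<le> ?G * ?U" using that by (intro mult_le_mono1) simp
    finally show ?thesis using assms by simp
  qed
  have ww: "ww z g u \<longleftrightarrow> r ! (g * ?U + u)" if "g < ?G" "u < ?U" for g u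
  proof -
    have "str_tape z (2 * length x + 1 + i) = sym_of_bit (r ! i)" if "i < length r" for i
      using that by (simp add: z str_tape_def pair_code_def nth_append enc_bits_nth(3))
    moreover have "lenx z = length x" by (simp add: z lenx_pair_code)
    ultimately show ?thesis unfolding ww_def using lt[OF that] by (simp add: sym_of_bit_def)
  qed
  have wt: "wt ?U r g = card {u. u < ?U \<and> ww z g u}" if g: "g < ?G" for g
  proof -
    have le: "u < length (take ?U (drop (g * ?U) r)) \<longleftrightarrow> u < ?U" for u
      using lt[OF g, of "?U - 1"] by auto
    have "drop (g * ?U) r ! u = r ! (g * ?U + u)" if "u < ?U" for u
      using lt[OF g that] by (intro nth_drop) simp
    then have "{u. u < length (take ?U (drop (g * ?U) r)) \<and> id (take ?U (drop (g * ?U) r) ! u)} = {u. u < ?U \<and> ww z g u}"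
      unfolding le using ww[OF g] lt[OF g] by auto
    then show ?thesis unfolding wt_def ones_def length_filter_conv_card by simp
  qed
  have "{(g, u). g < ?G \<and> g \<notin> A \<and> u < ?U \<and> ww z g u} = (SIGMA g:{..<?G} - A. {u. u < ?U \<and> ww z g u})" by auto
  then have "hitting.cost ?G ?U (ww z) A = (\<Sum>g\<in>{..<?G} - A. card {u. u < ?U \<and> ww z g u})"
    unfolding hitting.cost_def by simp
  also have "\<dots> = cost_of ?G ?U r A" unfolding cost_of_def by (intro sum.cong) (auto simp: wt)
  finally show ?thesis .
qed

text \<open>If the random string isolates \<open>A\<close>, any placement within the factor has
  \<open>A\<close> as its chosen groups. This set is the graph of an accepting tableau, and asking
  for the values 2 and 1 in the witness cells recovers an accepted word.\<close>

lemma wit_code_correct: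
  assumes wf: "wf_tm M" and V: "\<And>x. halted_with M ((step M ^^ poly qV (length x)) (init_config x)) (V x)"
    and f: "approximates_resilient_nukc \<gamma> f"
    and \<gamma>: "\<And>n. 2 \<le> n \<Longrightarrow> 1 \<le> \<gamma> n" "\<And>n. 2 \<le> n \<Longrightarrow> \<gamma> n < 2 ^ (C * n ^ C + 1)"
    and r: "length r = GG z * UU z" and z: "z = pair_code x r"
    and A: "A \<in> fam z" and uniq: "\<And>B. B \<in> fam z \<Longrightarrow> cost_of (GG z) (UU z) r B \<le> cost_of (GG z) (UU z) r A \<Longrightarrow> B = A"
  shows "V (wit_code z (f (inst_code z))) = [True]"
proof -
  interpret tb: tableau M "BB z" "PP z" "head_code z" .
  interpret H: hitting "GG z" "KK z" "JJ z" "UU z" "EE z" "ww z" .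
  have k0: "0 < num_tapes M" and S3: "3 \<le> num_syms M" using wf by (auto simp: wf_tm_def)
  have q: "3 \<le> qq z" unfolding qq_def tb.q_def using S3 by simp
  have Mv: "0 < KK z" unfolding KK_def tb.Mv_def tb.Rw_def by simp
  have KG: "KK z \<le> GG z" unfolding GG_def using q by simp
  have JM: "KK z \<le> JJ z" unfolding KK_def JJ_def tb.J_def by simp
  have N0: "0 < H.N" unfolding H.N_def using Mv JM by simp
  have n2: "2 \<le> H.n" unfolding H.n_def using N0 KG Mv by simp
  have hits: "H.hits B \<longleftrightarrow> B \<in> fam z" for B by (simp add: H.hits_def fam_def)
  have cost: "H.cost B = cost_of (GG z) (UU z) r B" for B by (rule card_marks[OF r z])
  let ?I = "H.input_of (QQ z)"
  have g: "1 \<le> \<gamma> H.n" "\<gamma> H.n < 2 ^ QQ z" using \<gamma> n2 by (auto simp: QQ_def)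
  have un: "B = A" if "H.hits B" "H.cost B \<le> H.cost A" for B using that uniq unfolding hits cost by blast
  have hA: "H.hits A" using A hits by simp
  have res: "perturbation_resilient (\<gamma> H.n) (H.inst (QQ z))"
    by (rule H.inst_resilient(1)[OF g KG N0 hA]) (rule un)
  have "0 < QQ z" by (simp add: QQ_def)
  then have "valid_input ?I" by (rule H.valid_input_of)
  then obtain S \<alpha> where S: "f (inst_code z) = enc_placement S" "feasible_placement (H.inst (QQ z)) \<alpha> S"
    and le: "\<And>\<beta>. optimal_dilation (H.inst (QQ z)) \<beta> \<Longrightarrow> \<alpha> \<le> \<gamma> H.n * \<beta>"
    using f res unfolding approximates_resilient_nukc_def inst_code_def
    by (metis H.input_size_input_of H.instance_of_input_of)
  have "\<exists>\<beta>. optimal_dilation (H.inst (QQ z)) \<beta>"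
    by (rule optimal_dilation_exists[OF _ _ S(2)]) (auto simp: H.inst_def)
  then obtain \<beta> where \<beta>: "optimal_dilation (H.inst (QQ z)) \<beta>" by blast
  have gr: "H.groups S = A" by (rule H.inst_resilient(2)[OF g KG N0 hA _ S(2) \<beta> le[OF \<beta>]]) (rule un)
  have "length S = length (radii (H.inst (QQ z)))" using S(2) by (simp add: feasible_placement_def)
  then have "S \<noteq> []" by (auto simp: H.inst_def)
  then obtain xs S' where S': "S = xs # S'" by (cases S) auto
  have gx: "A = (\<lambda>p. p div 2 div H.N) ` set xs" using gr by (simp add: H.groups_def S')
  have sel: "sel z (f (inst_code z)) y a \<longleftrightarrow> y * qq z + a \<in> A" for y a
    unfolding S(1) S' by (rule sel_iff[OF _ _ N0]) (auto simp: gx)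
  have A1: "A \<subseteq> {..<tb.Mv * tb.q}" "card A = tb.Mv" and A2: "\<forall>c<tb.J. \<exists>g\<in>A. tb.E c g"
    using A unfolding fam_def GG_def KK_def qq_def JJ_def EE_def by auto
  obtain val where val: "tb.proper val" "A = tb.graph val"
    using tb.hits_graph[OF A1] A2 unfolding tb.all_E by blast
  have sem: "tb.sem val" using tb.hits_sem[OF val(1) k0] A2 val(2) by blast
  have graph: "y * qq z + a \<in> A \<longleftrightarrow> val y = a" if "y < tb.Mv" "a < qq z" for y a
  proof
    assume "y * qq z + a \<in> A"
    then obtain y' where y': "y' < tb.Mv" "y * tb.q + a = y' * tb.q + val y'"
      using val(2) by (auto simp: tb.graph_def qq_def)
    have v: "val y' < tb.q" using val(1) y'(1) by (simp add: tb.proper_def)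
    have "(y * tb.q + a) div tb.q = y" "(y * tb.q + a) mod tb.q = a"
      using that by (simp_all only: mult_add_div_mod qq_def)
    moreover have "(y' * tb.q + val y') div tb.q = y'" "(y' * tb.q + val y') mod tb.q = val y'"
      using v by (simp_all only: mult_add_div_mod)
    ultimately show "val y = a" using y'(2) by metis
  next
    assume "val y = a"
    then show "y * qq z + a \<in> A" unfolding val(2) tb.graph_def qq_def using that(1) by auto
  qed
  let ?w = "tb.word (\<lambda>i. val (tb.Xs 0 0 (length (head_code z) + i)))"
  have cell: "sel z (f (inst_code z)) (cellx z i) a \<longleftrightarrow> val (tb.Xs 0 0 (length (head_code z) + i)) = a"
    if "i < PP z" "a < 3" for i a
  proof -
    have "length (head_code z) + i < tb.Wd" using that by (simp add: tb.Wd_def)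
    then have "cellx z i < tb.Mv" unfolding cellx_def by (intro tb.X_less k0) simp_all
    then show ?thesis unfolding sel using graph that q by (simp add: cellx_def)
  qed
  have hd: "head_code z = enc_bits x" unfolding z by (rule head_code_pair_code)
  have "wit_code z (f (inst_code z)) = head_code z @ ?w"
    unfolding wit_code_def tb.word_def
    by (intro arg_cong2[where f = append] refl arg_cong[where f = concat] map_cong) (simp_all add: cell)
  then have wit: "wit_code z (f (inst_code z)) = pair_code x ?w" by (simp only: hd pair_code_def)
  have "PP z = poly p (length x)" by (simp add: PP_def z lenx_pair_code)
  with tb.sem_sound[OF wf sem] have w: "length ?w \<le> poly p (length x)"
    "halted_with M ((step M ^^ BB z) (init_config (enc_bits x @ ?w))) [True]"
    by (simp_all only: hd)
  show ?thesis unfolding wit using accepts_iff[OF V w(1), of r] w(2) unfolding z by blast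
qed

text \<open>The answer \<open>y\<close> is arbitrary here. Even if the queried instance is not
  resilient, the verifier is applied to an admissible candidate for the same \<open>x\<close>, so it
  cannot accept a nonmember.\<close>

lemma wit_code_pair_code:
  "\<exists>w. length w \<le> poly p (length x) \<and> wit_code (pair_code x r) y = pair_code x w"
proof -
  define h where "h = (\<lambda>i. if sel (pair_code x r) y (cellx (pair_code x r) i) 2 then [True]
     else if sel (pair_code x r) y (cellx (pair_code x r) i) 1 then [False] else [])"
  have "length (concat (map h [0..<m])) \<le> m" for m
  proof (induction m)
    case (Suc m)
    moreover have "length (h m) \<le> 1" by (simp add: h_def)
    ultimately show ?case by simp
  qed simp
  moreover have "PP (pair_code x r) = poly p (length x)" by (simp add: PP_def lenx_pair_code)
  moreover have "wit_code (pair_code x r) y = pair_code x (concat (map h [0..<PP (pair_code x r)]))"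
    by (simp only: wit_code_def head_code_pair_code h_def) (simp add: pair_code_def)
  ultimately show ?thesis by metis
qed

end

section \<open>From an approximation algorithm to the collapse of classes\<close>

lemma NP_subset_RP:
  assumes f: "poly_time f" "approximates_resilient_nukc \<gamma> f"
    and \<gamma>: "\<And>n. 2 \<le> n \<Longrightarrow> 1 \<le> \<gamma> n" "\<And>n. 2 \<le> n \<Longrightarrow> \<gamma> n < 2 ^ (C * n ^ C + 1)"
  shows "NP \<subseteq> RP"
proof
  fix L assume "L \<in> NP"
  then obtain V p where V: "poly_time V" and
    L: "\<And>x. x \<in> L \<longleftrightarrow> (\<exists>w. length w \<le> poly p (length x) \<and> V (pair_code x w) = [True])"
    unfolding NP_def by blast
  obtain M qV where wf: "wf_tm M"
    and M: "\<And>x. halted_with M ((step M ^^ poly qV (length x)) (init_config x)) (V x)"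
    using V unfolding poly_time_def by blast
  interpret reduction M p qV C .
  define V' where "V' = (\<lambda>z. V (wit_code z (f (inst_code z))))"
  have "tr zy_ctx (\<lambda>c. inst_code (fst c))" by (rule tr_inst_code) (simp add: zy_ctx_def)
  moreover have "tr zy_ctx (\<lambda>c. wit_code (fst c) (snd c))" by (rule tr_wit_code) (simp_all add: zy_ctx_def)
  ultimately have "poly_time V'" unfolding V'_def using poly_time_compose[OF f(1) V] by fastforce
  moreover have "let W = {w :: bool list. length w = poly size_poly (length x)};
                    A = {w \<in> W. V' (pair_code x w) = [True]}
                in (x \<in> L \<longrightarrow> real (card A) / real (card W) \<ge> 1 / 2) \<and> (x \<notin> L \<longrightarrow> A = {})" for x
  proof -
    let ?W = "{w :: bool list. length w = poly size_poly (length x)}"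
    let ?A = "{w \<in> ?W. V' (pair_code x w) = [True]}"
    have neg: "?A = {}" if "x \<notin> L"
    proof -
      have "V' (pair_code x r) \<noteq> [True]" for r
        unfolding V'_def using wit_code_pair_code[of x r] that L by metis
      then show ?thesis by simp
    qed
    have pos: "1 / 2 \<le> real (card ?A) / real (card ?W)" if x: "x \<in> L"
    proof -
      obtain w where w: "length w \<le> poly p (length x)" "V (pair_code x w) = [True]" using x L by blast
      let ?F = "fam (pair_code x [])"
      let ?G = "GG (pair_code x [])" and ?U = "UU (pair_code x [])"
      have GU: "GG (pair_code x r) = ?G" "UU (pair_code x r) = ?U" for r
        by (simp_all add: UU_def GG_def KK_def qq_def PP_def BB_def lenx_pair_code head_code_pair_code)
      have sz: "poly size_poly (length x) = ?G * ?U" by (rule poly_size_poly)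
      let ?good = "{r. length r = ?G * ?U \<and> (\<exists>A\<in>?F. \<forall>B\<in>?F. cost_of ?G ?U r B \<le> cost_of ?G ?U r A \<longrightarrow> B = A)}"
      \<comment> \<open>The central coefficient dominates all others, and the size
        \<open>4 * G\<^sup>2\<close> of the blocks was chosen for this inequality.\<close>
      have C: "2 * ?G * (?U choose (?U div 2)) \<le> 2 ^ ?U" unfolding UU_def by (rule binomial_isolation_bound)
      have "2 ^ (?G * ?U) \<le> 2 * card ?good"
        by (rule isolation[OF fam_nonempty[OF wf M w] _ binomial_maximum C]) (simp add: fam_def)
      also have "card ?good \<le> card ?A"
      proof (rule card_mono)
        show "finite ?A" by (rule finite_subset[OF _ card_bool_lists(2)]) auto
        show "?good \<subseteq> ?A"
        proof
          fix r assume "r \<in> ?good"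
          then obtain A where r: "length r = ?G * ?U" and A: "A \<in> ?F"
            "\<And>B. B \<in> ?F \<Longrightarrow> cost_of ?G ?U r B \<le> cost_of ?G ?U r A \<Longrightarrow> B = A" by blast
          have "V' (pair_code x r) = [True]"
            unfolding V'_def
          proof (rule wit_code_correct[OF wf M f(2) \<gamma> _ refl])
            show "length r = GG (pair_code x r) * UU (pair_code x r)" unfolding GU[of r] by (rule r)
            show "A \<in> fam (pair_code x r)" using A(1) fam_pair_code by metis
            show "B = A" if "B \<in> fam (pair_code x r)"
              "cost_of (GG (pair_code x r)) (UU (pair_code x r)) r B \<le> cost_of (GG (pair_code x r)) (UU (pair_code x r)) r A" for B
              using A(2)[of B] that unfolding GU[of r] fam_pair_code[of x r "[]"] by blast
          qed
          then show "r \<in> ?A" using r sz by simp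
        qed
      qed
      finally have "2 ^ (?G * ?U) \<le> 2 * card ?A" by simp
      moreover have "card ?W = 2 ^ (?G * ?U)" unfolding sz by (rule card_bool_lists)
      ultimately have "card ?W \<le> 2 * card ?A" and pos: "0 < card ?W" by simp_all
      then have "real (card ?W) \<le> real (2 * card ?A)" by (intro of_nat_mono)
      then show ?thesis using pos by (simp add: divide_simps)
    qed
    show ?thesis unfolding Let_def using neg pos by blast
  qed
  ultimately show "L \<in> RP" unfolding RP_def by blast
qed

theorem theorem12:
  fixes c :: real and \<gamma> :: "nat \<Rightarrow> real"
  assumes "c > 0"
    and "\<And>n. \<gamma> n \<le> c powr (real n powr c)"
    and "NP \<noteq> RP"
  shows "\<not> (\<exists>f. poly_time f \<and> approximates_resilient_nukc \<gamma> f)"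
proof
  assume "\<exists>f. poly_time f \<and> approximates_resilient_nukc \<gamma> f"
  then obtain f where f: "poly_time f" "approximates_resilient_nukc \<gamma> f" by blast
  \<comment> \<open>A natural number at least \<open>c\<close>; it becomes a fixed constant of the
    reduction, in which \<open>C\<close> is the degree of a polynomial.\<close>
  define C where "C = nat \<lceil>c\<rceil>"
  have C: "c \<le> real C" unfolding C_def by linarith
  have "\<gamma> n < 2 ^ (C * n ^ C + 1)" if "2 \<le> n" for n
    using order.strict_trans1[OF assms(2) growth_bound[OF assms(1) _ C]] that by simp
  then have "NP \<subseteq> RP" using NP_subset_RP[OF f] approximation_factor_ge_1[OF f(2)] by blast
  then show False using RP_subset_NP assms(3) by blast
qed

end
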